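(* There exists a universal constant $C_1$ such that, for every entire maximal surface $S$ in $\mathrm{AdS}^3$ whose boundary at infinity is the graph of an orientation-preserving homeomorphism of $\mathbb{RP}^1$, with $\|\lambda\|_\infty<1$ and with $w$ the width of the convex hull of $\partial_\infty S$, $$\|\lambda\|_\infty\leq C_1\tan w\,.$$
   Context: Anti-de Sitter space. $\mathbb{R}^{2,2}$ is $\mathbb{R}^4$ with $\langle x,y\rangle=x^1y^1+x^2y^2-x^3y^3-x^4y^4$; $\widehat{\mathrm{AdS}^3}=\{x:\langle x,x\rangle=-1\}$ and $\mathrm{AdS}^3=\mathrm{P}(\{\langle x,x\rangle<0\})\subset\mathbb{RP}^3$, doubly covered by $\widehat{\mathrm{AdS}^3}$, with the induced time-oriented Lorentzian metric of constant curvature $-1$. A totally geodesic spacelike plane is $p^\perp$ with $\langle p,p\rangle<0$; it is isometric to $\mathbb{H}^2$. The length of a timelike curve $\gamma$ is $\int\sqrt{-\langle\dot\gamma,\dot\gamma\rangle}\,dt$. Boundary at infinity. $\partial_\infty\mathrm{AdS}^3=\mathrm{P}(\{\langle x,x\rangle=0\})$ is a doubly ruled quadric (left and right ruling). A spacelike plane $P$ meets each line of either ruling exactly once at infinity; fixing $P$ and identifying $\partial_\infty P=\partial\mathbb{H}^2=\mathbb{RP}^1$, one identifies $\partial_\infty\mathrm{AdS}^3$ with $\mathbb{RP}^1\times\mathbb{RP}^1$ by $\xi\mapsto(\pi_l(\xi),\pi_r(\xi))$, the projections to $\partial_\infty P$ along the left and right rulings. The graph $gr(\phi)$ of a homeomorphism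 $\phi$ of $\mathbb{RP}^1$ is thus a curve in $\partial_\infty\mathrm{AdS}^3$. Surfaces. A smooth embedded spacelike surface $S$ (Riemannian induced metric) with unit normal $N$ has shape operator $B=\nabla N$; it is maximal if $\mathrm{tr}\,B=0$. Its principal curvatures (eigenvalues of $B$) are then $\pm\lambda$ with $\lambda\geq0$, and $\|\lambda\|_\infty=\sup_S\lambda$. $S$ is entire if it is a topological disc whose frontier (denoted $\partial_\infty S$) is contained in $\partial_\infty\mathrm{AdS}^3$. Width. For $\Gamma=gr(\phi)$, the convex hull $\mathcal{CH}(\Gamma)$ is the intersection of the half-spaces containing $\Gamma$ bounded by planes $P$ with $\partial_\infty P\cap\Gamma=\emptyset$. The width $w$ is the supremum of the lengths of timelike geodesic segments contained in $\mathcal{CH}(\Gamma)$ ($0$ if there are none). *)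

theory Defs
  imports "HOL-Analysis.Analysis"
begin

section \<open>Real projective spaces\<close>

text \<open>The type \<open>'n projective\<close> is the space of lines of \<open>real ^ 'n\<close>, so that
  \<open>2 projective\<close> and \<open>4 projective\<close> are the real projective line and 3-space. The
  representative \<open>proj x\<close> is only meaningful for \<open>x \<noteq> 0\<close>.\<close>

typedef (overloaded) ('n::finite) projective =
  "{L :: (real ^ 'n) set. \<exists>x. x \<noteq> 0 \<and> L = span {x}}"
proof -
  have "(axis undefined 1 :: real ^ 'n) \<noteq> 0"
    by (simp add: axis_eq_0_iff)
  then show ?thesis
    by blast
qed

definition proj :: "real ^ 'n \<Rightarrow> ('n::finite) projective" where
  "proj x = Abs_projective (span {x})"

instantiation projective :: (finite) topological_space
begin

text \<open>The quotient topology from \<open>real ^ 'n - {0}\<close>.\<close>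

definition open_projective :: "'a projective set \<Rightarrow> bool" where
  "open_projective U \<longleftrightarrow> open {x. x \<noteq> 0 \<and> proj x \<in> U}"

instance
proof
  have "{x :: real ^ 'a. x \<noteq> 0 \<and> proj x \<in> UNIV} = - {0}"
    by auto
  then show "open (UNIV :: 'a projective set)"
    unfolding open_projective_def by (simp add: open_Compl)
next
  fix S T :: "'a projective set"
  assume "open S" "open T"
  moreover have "{x. x \<noteq> 0 \<and> proj x \<in> S \<inter> T} =
      {x. x \<noteq> 0 \<and> proj x \<in> S} \<inter> {x. x \<noteq> 0 \<and> proj x \<in> T}"
    by auto
  ultimately show "open (S \<inter> T)"
    unfolding open_projective_def by (simp only: open_Int)
next
  fix K :: "'a projective set set"
  assume "\<forall>S\<in>K. open S"
  moreover have "{x. x \<noteq> 0 \<and> proj x \<in> \<Union>K} = (\<Union>S\<in>K. {x. x \<noteq> 0 \<and> proj x \<in> S})"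
    by auto
  ultimately show "open (\<Union>K)"
    unfolding open_projective_def by auto
qed

end

section \<open>Anti-de Sitter space\<close>

definition form :: "real ^ 4 \<Rightarrow> real ^ 4 \<Rightarrow> real" where
  "form x y = x $ 1 * y $ 1 + x $ 2 * y $ 2 - x $ 3 * y $ 3 - x $ 4 * y $ 4"

definition AdS_hat :: "(real ^ 4) set" where
  "AdS_hat = {x. form x x = -1}"

definition AdS :: "4 projective set" where
  "AdS = {proj x | x. form x x < 0}"

definition bdry_AdS :: "4 projective set" where
  "bdry_AdS = {proj x | x. x \<noteq> 0 \<and> form x x = 0}"

text \<open>\<open>plane p\<close> is the projective plane orthogonal to \<open>p \<noteq> 0\<close>; its intersections with \<open>AdS\<close>
  and with \<open>bdry_AdS\<close> are the totally geodesic plane and its boundary at infinity. The plane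
  is spacelike iff \<open>form p p < 0\<close>.\<close>

definition plane :: "real ^ 4 \<Rightarrow> 4 projective set" where
  "plane p = {proj x | x. x \<noteq> 0 \<and> form x p = 0}"

definition bdry_plane :: "real ^ 4 \<Rightarrow> 4 projective set" where
  "bdry_plane p = plane p \<inter> bdry_AdS"

text \<open>Orthogonal projection onto the tangent space of \<open>AdS_hat\<close> at \<open>x\<close>. The Levi-Civita
  connection of \<open>AdS_hat\<close> is the flat derivative followed by this projection.\<close>

definition tangential :: "real ^ 4 \<Rightarrow> real ^ 4 \<Rightarrow> real ^ 4" where
  "tangential x y = y + form y x *\<^sub>R x"

section \<open>The boundary at infinity as a product\<close>

text \<open>Null vectors are identified with singular 2 by 2 matrices through
  \<open>- form x x = det ((x3 + x1, x2 + x4), (x2 - x4, x3 - x1))\<close>, and \<open>segre u v\<close> is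
  the matrix \<open>u v\<^sup>T\<close>. Fixing the direction of \<open>u\<close>, respectively of \<open>v\<close>, gives the
  two families of lines. Exchanging the names left and right replaces a homeomorphism by its inverse.\<close>

definition segre :: "real ^ 2 \<Rightarrow> real ^ 2 \<Rightarrow> real ^ 4" where
  "segre u v = vector
    [(u $ 1 * v $ 1 - u $ 2 * v $ 2) / 2,
     (u $ 1 * v $ 2 + u $ 2 * v $ 1) / 2,
     (u $ 1 * v $ 1 + u $ 2 * v $ 2) / 2,
     (u $ 1 * v $ 2 - u $ 2 * v $ 1) / 2]"

definition left_ruling :: "4 projective set set" where
  "left_ruling = {{proj (segre u v) | v. v \<noteq> 0} | u. u \<noteq> 0}"

definition right_ruling :: "4 projective set set" where
  "right_ruling = {{proj (segre u v) | u. u \<noteq> 0} | v. v \<noteq> 0}"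

text \<open>The fixed spacelike plane is \<open>plane base_point\<close>, that is \<open>x4 = 0\<close>. Its boundary is
  the conic \<open>x1\<^sup>2 + x2\<^sup>2 = x3\<^sup>2\<close>, identified with the projective line by
  \<open>[a : b] \<mapsto> [a\<^sup>2 - b\<^sup>2 : 2ab : a\<^sup>2 + b\<^sup>2 : 0]\<close>, which extends an isometry
  from the upper half-plane.\<close>

definition base_point :: "real ^ 4" where
  "base_point = axis 4 1"

definition conic_point :: "2 projective \<Rightarrow> 4 projective" where
  "conic_point a = (THE \<xi>. \<exists>u. u \<noteq> 0 \<and> proj u = a \<and> \<xi> = proj (segre u u))"

definition proj_left :: "4 projective \<Rightarrow> 4 projective" where
  "proj_left \<xi> = (THE \<eta>. \<eta> \<in> bdry_plane base_point \<and> (\<exists>l\<in>left_ruling. \<xi> \<in> l \<and> \<eta> \<in> l))"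

definition proj_right :: "4 projective \<Rightarrow> 4 projective" where
  "proj_right \<xi> = (THE \<eta>. \<eta> \<in> bdry_plane base_point \<and> (\<exists>l\<in>right_ruling. \<xi> \<in> l \<and> \<eta> \<in> l))"

definition gr :: "(2 projective \<Rightarrow> 2 projective) \<Rightarrow> 4 projective set" where
  "gr \<phi> = {\<xi> \<in> bdry_AdS. \<exists>a. conic_point a = proj_left \<xi> \<and> conic_point (\<phi> a) = proj_right \<xi>}"

text \<open>Orientation is read off on the universal cover \<open>t \<mapsto> [cos t : sin t]\<close> of the projective
  line: the homeomorphism preserves it iff it has an increasing lift.\<close>

definition circle_cover :: "real \<Rightarrow> 2 projective" where
  "circle_cover t = proj (vector [cos t, sin t])"

definition orientation_preserving_homeo :: "(2 projective \<Rightarrow> 2 projective) \<Rightarrow> bool" where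
  "orientation_preserving_homeo \<phi> \<longleftrightarrow>
    (\<exists>\<psi>. homeomorphism UNIV UNIV \<phi> \<psi>) \<and>
    (\<exists>F :: real \<Rightarrow> real. continuous_on UNIV F \<and> strict_mono F \<and>
      (\<forall>t. \<phi> (circle_cover t) = circle_cover (F t)))"

section \<open>Maximal surfaces\<close>

text \<open>Derivatives are taken in the full space, so these are only used on open sets.\<close>

primrec C_k_on :: "nat \<Rightarrow> ('a::real_normed_vector \<Rightarrow> 'b::real_normed_vector) \<Rightarrow> 'a set \<Rightarrow> bool" where
  "C_k_on 0 f W \<longleftrightarrow> continuous_on W f"
| "C_k_on (Suc k) f W \<longleftrightarrow> (\<forall>x\<in>W. f differentiable (at x)) \<and>
     (\<forall>v. C_k_on k (\<lambda>x. frechet_derivative f (at x) v) W)"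

definition smooth_on :: "('a::real_normed_vector \<Rightarrow> 'b::real_normed_vector) \<Rightarrow> 'a set \<Rightarrow> bool" where
  "smooth_on f W \<longleftrightarrow> (\<forall>k. C_k_on k f W)"

text \<open>Local parametrizations are lifted to \<open>AdS_hat\<close>, on which \<open>proj\<close> is a local
  isometry onto \<open>AdS\<close>.\<close>

definition local_param :: "4 projective set \<Rightarrow> (real ^ 2) set \<Rightarrow> (real ^ 2 \<Rightarrow> real ^ 4) \<Rightarrow> bool" where
  "local_param S W \<sigma> \<longleftrightarrow>
    open W \<and> smooth_on \<sigma> W \<and> \<sigma> ` W \<subseteq> AdS_hat \<and>
    (\<forall>u\<in>W. inj (frechet_derivative \<sigma> (at u))) \<and>
    openin (top_of_set S) ((proj \<circ> \<sigma>) ` W) \<and>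
    (\<exists>g. homeomorphism W ((proj \<circ> \<sigma>) ` W) (proj \<circ> \<sigma>) g)"

definition embedded_surface :: "4 projective set \<Rightarrow> bool" where
  "embedded_surface S \<longleftrightarrow> S \<subseteq> AdS \<and>
    (\<forall>p\<in>S. \<exists>W \<sigma>. local_param S W \<sigma> \<and> p \<in> (proj \<circ> \<sigma>) ` W)"

definition spacelike_surface :: "4 projective set \<Rightarrow> bool" where
  "spacelike_surface S \<longleftrightarrow> embedded_surface S \<and>
    (\<forall>W \<sigma> u v. local_param S W \<sigma> \<and> u \<in> W \<and> v \<noteq> 0 \<longrightarrow>
      form (frechet_derivative \<sigma> (at u) v) (frechet_derivative \<sigma> (at u) v) > 0)"

definition unit_normal :: "(real ^ 2) set \<Rightarrow> (real ^ 2 \<Rightarrow> real ^ 4) \<Rightarrow> (real ^ 2 \<Rightarrow> real ^ 4) \<Rightarrow> bool" where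
  "unit_normal W \<sigma> N \<longleftrightarrow> smooth_on N W \<and>
    (\<forall>u\<in>W. form (N u) (N u) = -1 \<and> form (N u) (\<sigma> u) = 0 \<and>
      (\<forall>v. form (N u) (frechet_derivative \<sigma> (at u) v) = 0))"

text \<open>The matrix of \<open>B = \<nabla>N\<close> in the basis of the tangent plane given by the parametrization.\<close>

definition shape_operator ::
  "(real ^ 2 \<Rightarrow> real ^ 4) \<Rightarrow> (real ^ 2 \<Rightarrow> real ^ 4) \<Rightarrow> real ^ 2 \<Rightarrow> real ^ 2 ^ 2" where
  "shape_operator \<sigma> N u = (THE B. \<forall>v.
     frechet_derivative \<sigma> (at u) (B *v v) = tangential (\<sigma> u) (frechet_derivative N (at u) v))"

definition maximal_surface :: "4 projective set \<Rightarrow> bool" where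
  "maximal_surface S \<longleftrightarrow> spacelike_surface S \<and>
    (\<forall>W \<sigma> N u. local_param S W \<sigma> \<and> unit_normal W \<sigma> N \<and> u \<in> W \<longrightarrow>
      trace (shape_operator \<sigma> N u) = 0)"

definition principal_curvatures :: "4 projective set \<Rightarrow> 4 projective \<Rightarrow> real set" where
  "principal_curvatures S p = {k. \<exists>W \<sigma> N u v.
     local_param S W \<sigma> \<and> unit_normal W \<sigma> N \<and> u \<in> W \<and> proj (\<sigma> u) = p \<and>
     v \<noteq> 0 \<and> shape_operator \<sigma> N u *v v = k *\<^sub>R v}"

text \<open>The function \<open>\<lambda>\<close> of a maximal surface; the supremum is taken in \<open>ereal\<close> since it may
  be infinite.\<close>

definition principal_curvature :: "4 projective set \<Rightarrow> 4 projective \<Rightarrow> real" where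
  "principal_curvature S p = (THE k. k \<ge> 0 \<and> principal_curvatures S p = {k, - k})"

definition curvature_norm :: "4 projective set \<Rightarrow> ereal" where
  "curvature_norm S = (SUP p\<in>S. ereal (principal_curvature S p))"

text \<open>The frontier of a surface is meant in the sense of manifolds: the limit points that do
  not belong to the surface (the topological frontier would contain the surface itself).\<close>

definition bdry_infinity :: "4 projective set \<Rightarrow> 4 projective set" where
  "bdry_infinity S = closure S - S"

definition entire_surface :: "4 projective set \<Rightarrow> bool" where
  "entire_surface S \<longleftrightarrow> S homeomorphic (ball 0 1 :: (real ^ 2) set) \<and> bdry_infinity S \<subseteq> bdry_AdS"

section \<open>Convex hull and width\<close>

text \<open>A single plane does not separate projective space, so half-spaces live in the affine charts:
  \<open>half_space q p\<close> is a closed half-space bounded by \<open>plane p\<close> in the complement of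
  \<open>plane q\<close> (the other one is \<open>half_space q (- p)\<close>). For a closed curve \<open>\<Gamma>\<close> contained in some chart,
  all charts containing \<open>\<Gamma>\<close> give the same hull.\<close>

definition half_space :: "real ^ 4 \<Rightarrow> real ^ 4 \<Rightarrow> 4 projective set" where
  "half_space q p = {proj x | x. form x q \<noteq> 0 \<and> form x p / form x q \<ge> 0}"

definition convex_hull_AdS :: "4 projective set \<Rightarrow> 4 projective set" where
  "convex_hull_AdS \<Gamma> = \<Inter>{half_space q p | q p.
     q \<noteq> 0 \<and> p \<noteq> 0 \<and> bdry_plane p \<inter> \<Gamma> = {} \<and> \<Gamma> \<subseteq> half_space q p}"

text \<open>Geodesics of \<open>AdS\<close> are given by their lifts to \<open>AdS_hat\<close>.\<close>

definition timelike_geodesic :: "(real \<Rightarrow> real ^ 4) \<Rightarrow> real \<Rightarrow> real \<Rightarrow> bool" where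
  "timelike_geodesic \<gamma> a b \<longleftrightarrow> a < b \<and> (\<exists>\<gamma>' \<gamma>''. \<forall>t\<in>{a..b}.
     \<gamma> t \<in> AdS_hat \<and>
     (\<gamma> has_vector_derivative \<gamma>' t) (at t within {a..b}) \<and>
     (\<gamma>' has_vector_derivative \<gamma>'' t) (at t within {a..b}) \<and>
     form (\<gamma>' t) (\<gamma>' t) < 0 \<and>
     tangential (\<gamma> t) (\<gamma>'' t) = 0)"

definition timelike_length :: "(real \<Rightarrow> real ^ 4) \<Rightarrow> real \<Rightarrow> real \<Rightarrow> real" where
  "timelike_length \<gamma> a b = integral {a..b} (\<lambda>t.
     sqrt (- form (vector_derivative \<gamma> (at t within {a..b})) (vector_derivative \<gamma> (at t within {a..b}))))"

definition width :: "4 projective set \<Rightarrow> real" where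
  "width K = Sup (insert 0 {timelike_length \<gamma> a b | \<gamma> a b.
     timelike_geodesic \<gamma> a b \<and> (\<forall>t\<in>{a..b}. proj (\<gamma> t) \<in> K)})"

end

theory Submission
  imports Defs
begin

text \<open>Lift the surface to a closed surface \<open>T\<close> in \<open>AdS_hat\<close> with unit normal \<open>N\<close>, and the curve at
  infinity to a compact set \<open>\<Gamma>\<close> of null vectors with pairwise negative products. Functions of the form
  \<open>u x = \<langle>x, p\<rangle>\<close> and \<open>n x = \<langle>N x, p\<rangle>\<close> satisfy \<open>\<Delta>u = 2u\<close> and \<open>\<Delta>n = 2\<lambda>\<^sup>2n\<close>, and \<open>\<Delta> ln \<lambda> = 2\<lambda>\<^sup>2 - 2\<close>.
  If \<open>p\<close> is positive on \<open>\<Gamma>\<close>, then \<open>u > 0\<close>, and the maximum principle applied first to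
  \<open>G = |\<nabla> ln u|\<^sup>2\<close> and then to \<open>ln (\<lambda> |n| / u) + G\<close> gives \<open>G \<le> 20\<close> and \<open>\<lambda> |n| \<le> c u\<close> with a universal
  constant \<open>c\<close>. By duality the points at distance \<open>arctan (\<lambda> / c)\<close> from \<open>x\<close> on both sides along the normal
  geodesic belong to the convex hull, so that the width is at least twice this number. That the width
  is smaller than \<open>\<pi>/2\<close>, hence \<open>tan w\<close> meaningful, follows from \<open>\<lambda> \<le> L < 1\<close>, which gives
  \<open>|\<langle>y, N x\<rangle>| \<le> L |\<langle>y, x\<rangle>|\<close> on \<open>T\<close>.\<close>

subsection \<open>The bilinear form\<close>

text \<open>Non-compactness of \<open>T\<close> is the main obstacle. For \<open>p\<close> positive
  on \<Gamma>, \<open>u\<close> tends to infinity at the ends of \<open>T\<close>, so its sublevel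
  sets are compact, and a bounded quantity attains a maximum once the penalty
  \<open>e * ln u\<close> is subtracted. Since \<Delta> ln u = 2 - G, the penalty costs only 2e and
  disappears with \<open>e\<close>. The a priori boundedness this requires comes from a comparison
  of \<open>n\<close> with \<open>u\<close> that may depend on \<open>p\<close>; the resulting
  bounds do not.

  The Laplacian of ln (\<lambda> |n| / u) alone has no term that grows with the quantity itself.
  That of \<open>G\<close> contributes half of (\<lambda> n / u)^2, which is why \<open>G\<close> is
  added, and why it must be bounded first. The constant is 11 exp 20: at a maximum the quotient is
  at most 11, and removing \<open>G\<close> costs a factor exp 20.

  Uniformity in \<open>p\<close> turns the estimate into a statement about the hull:
  \<open>x + t nor x\<close> and \<open>x - t nor x\<close> both lie in the cone over the hull iff t
  |n| \<le> u for every such \<open>p\<close>.\<close>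

lemma bilinear_form: "bilinear form"
  unfolding bilinear_def
  by (auto intro!: linearI simp: form_def algebra_simps)

lemma bounded_bilinear_form: "bounded_bilinear form"
  using bilinear_form by (simp add: bilinear_conv_bounded_bilinear)

interpretation form: bounded_bilinear form
  by (rule bounded_bilinear_form)

lemmas form_simps = form.add_left form.add_right form.diff_left form.diff_right
  form.scaleR_left form.scaleR_right form.minus_left form.minus_right form.zero_left form.zero_right

lemma form_commute: "form x y = form y x"
  by (simp add: form_def algebra_simps)

lemma form_nondegenerate:
  assumes "\<And>y. form x y = 0"
  shows "x = 0"
proof -
  have "x $ i = 0" for i
    using exhaust_4[of i] assms[of "axis i 1"]
    by (auto simp: form_def axis_def)
  then show ?thesis
    by (simp add: vec_eq_iff)
qed

lemma continuous_on_form [continuous_intros]: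
  "continuous_on S f \<Longrightarrow> continuous_on S g \<Longrightarrow> continuous_on S (\<lambda>x. form (f x) (g x))"
  by (rule form.continuous_on)

lemma norm_vec4_eq: "(norm (x::real^4))\<^sup>2 = (x$1)\<^sup>2 + (x$2)\<^sup>2 + (x$3)\<^sup>2 + (x$4)\<^sup>2"
  by (simp only: power2_norm_eq_inner) (simp add: inner_vec_def sum_4 power2_eq_square)

lemma AdS_hat_norm_ge_1:
  assumes "x \<in> AdS_hat"
  shows "norm x \<ge> 1"
proof -
  have "x$1 * x$1 + x$2 * x$2 - x$3 * x$3 - x$4 * x$4 = -1"
    using assms by (simp add: AdS_hat_def form_def)
  then have "(norm x)\<^sup>2 = 1 + 2 * (x$1)\<^sup>2 + 2 * (x$2)\<^sup>2"
    unfolding norm_vec4_eq by (simp only: power2_eq_square)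
  then have "(norm x)\<^sup>2 \<ge> 1\<^sup>2"
    by simp
  then show ?thesis
    by (rule power2_le_imp_le) simp
qed

subsection \<open>Smooth maps\<close>

lemma C_k_on_cong:
  assumes "open W" "\<And>x. x \<in> W \<Longrightarrow> f x = g x" "C_k_on k f W"
  shows "C_k_on k g W"
  using assms(2,3)
proof (induction k arbitrary: f g)
  case 0
  then show ?case
    using continuous_on_eq[of W f g] by simp
next
  case (Suc k)
  have *: "(g has_derivative frechet_derivative f (at x)) (at x)" if "x \<in> W" for x
  proof (rule has_derivative_transform_within_open[OF _ assms(1) that])
    show "(f has_derivative frechet_derivative f (at x)) (at x)"
      using Suc.prems(2) that frechet_derivative_works by auto
  qed (use Suc.prems in auto)
  then have "frechet_derivative g (at x) = frechet_derivative f (at x)" if "x \<in> W" for x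
    using frechet_derivative_at[OF *] that by metis
  then show ?case
    using Suc.prems * differentiableI[OF *] Suc.IH[of "\<lambda>x. frechet_derivative f (at x) v" "\<lambda>x. frechet_derivative g (at x) v" for v]
    by auto
qed

lemma C_k_on_subset:
  assumes "C_k_on k f W" "V \<subseteq> W"
  shows "C_k_on k f V"
  using assms by (induction k arbitrary: f) (auto intro: continuous_on_subset)

lemma C_k_on_SucD: "C_k_on (Suc k) f W \<Longrightarrow> C_k_on k f W"
proof (induction k arbitrary: f)
  case 0
  then show ?case
    by (auto intro!: continuous_at_imp_continuous_on dest: differentiable_imp_continuous_within)
next
  case (Suc k)
  have "C_k_on k (\<lambda>x. frechet_derivative f (at x) v) W" for v
    by (rule Suc.IH) (use Suc.prems in auto)
  then show ?case
    using Suc.prems by auto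
qed

text \<open>The definition speaks of \<open>frechet_derivative\<close>; this rule lets the
  derivative be supplied in any convenient form. The closure properties for sums, products and
  powers are inductions built on it.\<close>

lemma C_k_on_SucI:
  assumes "open W" "\<And>x. x \<in> W \<Longrightarrow> (f has_derivative f' x) (at x)"
    and "\<And>v. C_k_on k (\<lambda>x. f' x v) W"
  shows "C_k_on (Suc k) f W"
proof -
  have "frechet_derivative f (at x) = f' x" if "x \<in> W" for x
    using frechet_derivative_at[OF assms(2)[OF that]] by simp
  then show ?thesis
    using assms by (auto simp: differentiable_def intro: C_k_on_cong[OF assms(1) _ assms(3)])
qed

lemma C_k_on_const: "C_k_on k (\<lambda>x. c) W"
  by (induction k arbitrary: c) auto

lemma C_k_on_add:
  assumes "open W" "C_k_on k f W" "C_k_on k g W"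
  shows "C_k_on k (\<lambda>x. f x + g x) W"
  using assms(2,3)
proof (induction k arbitrary: f g)
  case (Suc k)
  show ?case
  proof (rule C_k_on_SucI[OF assms(1)])
    fix x assume "x \<in> W"
    then show "((\<lambda>x. f x + g x) has_derivative
        (\<lambda>v. frechet_derivative f (at x) v + frechet_derivative g (at x) v)) (at x)"
      using Suc.prems by (auto intro!: has_derivative_add simp: frechet_derivative_works[symmetric])
  qed (use Suc in auto)
qed (auto intro: continuous_on_add)

lemma C_k_on_linear:
  assumes "open W" "bounded_linear L" "C_k_on k f W"
  shows "C_k_on k (\<lambda>x. L (f x)) W"
  using assms(3)
proof (induction k arbitrary: f)
  case 0
  then show ?case
    using bounded_linear.continuous_on[OF assms(2)] by auto
next
  case (Suc k)
  show ?case
  proof (rule C_k_on_SucI[OF assms(1)])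
    fix x assume "x \<in> W"
    then show "((\<lambda>x. L (f x)) has_derivative
        (\<lambda>v. L (frechet_derivative f (at x) v))) (at x)"
      using Suc.prems
      by (auto intro!: bounded_linear.has_derivative[OF assms(2)] simp: frechet_derivative_works[symmetric])
  qed (use Suc in auto)
qed

lemma C_k_on_bilinear:
  assumes "open W" "bounded_bilinear B" "C_k_on k f W" "C_k_on k g W"
  shows "C_k_on k (\<lambda>x. B (f x) (g x)) W"
  using assms(3,4)
proof (induction k arbitrary: f g)
  case 0
  then show ?case
    using bounded_bilinear.continuous_on[OF assms(2)] by auto
next
  case (Suc k)
  show ?case
  proof (rule C_k_on_SucI[OF assms(1)])
    fix x assume "x \<in> W"
    then show "((\<lambda>x. B (f x) (g x)) has_derivative
        (\<lambda>v. B (f x) (frechet_derivative g (at x) v) + B (frechet_derivative f (at x) v) (g x))) (at x)"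
      using Suc.prems
      by (auto intro!: bounded_bilinear.FDERIV[OF assms(2)] simp: frechet_derivative_works[symmetric])
  next
    fix v
    have "C_k_on k f W" "C_k_on k g W"
      using Suc.prems C_k_on_SucD by blast+
    then show "C_k_on k (\<lambda>x. B (f x) (frechet_derivative g (at x) v) + B (frechet_derivative f (at x) v) (g x)) W"
      using Suc by (intro C_k_on_add[OF assms(1)] Suc.IH) auto
  qed
qed

text \<open>The induction runs over all exponents at once, because each derivative lowers the
  exponent by one. Reciprocals and normalisations of vectors are then the exponents -1 and
  -1/2.\<close>

lemma C_k_on_powr:
  fixes f :: "'a::real_normed_vector \<Rightarrow> real"
  assumes "open W" "C_k_on k f W" "\<And>x. x \<in> W \<Longrightarrow> f x > 0"
  shows "C_k_on k (\<lambda>x. f x powr a) W"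
  using assms(2)
proof (induction k arbitrary: a)
  case 0
  then show ?case
    using assms(3) by (auto intro!: continuous_intros) (metis less_irrefl)
next
  case (Suc k)
  show ?case
  proof (rule C_k_on_SucI[OF assms(1)])
    fix x assume x: "x \<in> W"
    have "(f has_derivative frechet_derivative f (at x)) (at x)"
      using Suc.prems x by (auto simp: frechet_derivative_works[symmetric])
    from has_derivative_powr[OF this has_derivative_const[of a]]
    have "((\<lambda>x. f x powr a) has_derivative
        (\<lambda>v. f x powr a * (0 * ln (f x) + frechet_derivative f (at x) v * a / f x))) (at x)"
      using assms(3)[OF x] by simp
    moreover have "f x powr a * (0 * ln (f x) + frechet_derivative f (at x) v * a / f x)
        = (a * f x powr (a - 1)) * frechet_derivative f (at x) v" for v
      using assms(3)[OF x] by (simp add: powr_diff field_simps)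
    ultimately show "((\<lambda>x. f x powr a) has_derivative
        (\<lambda>v. (a * f x powr (a - 1)) * frechet_derivative f (at x) v)) (at x)"
      by simp
  next
    fix v
    have "C_k_on k f W"
      using Suc.prems C_k_on_SucD by blast
    then show "C_k_on k (\<lambda>x. (a * f x powr (a - 1)) * frechet_derivative f (at x) v) W"
      using Suc.IH[of "a - 1"] Suc.prems
      by (intro C_k_on_bilinear[OF assms(1) bounded_bilinear_mult] C_k_on_const) auto
  qed
qed

lemma smooth_on_cong:
  assumes "smooth_on f W" "open W" "\<And>x. x \<in> W \<Longrightarrow> f x = g x"
  shows "smooth_on g W"
  using assms C_k_on_cong unfolding smooth_on_def by blast

lemma smooth_on_subset: "smooth_on f W \<Longrightarrow> V \<subseteq> W \<Longrightarrow> smooth_on f V"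
  using C_k_on_subset unfolding smooth_on_def by blast

lemma smooth_on_const: "smooth_on (\<lambda>x. c) W"
  unfolding smooth_on_def by (simp add: C_k_on_const)

lemma smooth_on_add:
  "open W \<Longrightarrow> smooth_on f W \<Longrightarrow> smooth_on g W \<Longrightarrow> smooth_on (\<lambda>x. f x + g x) W"
  unfolding smooth_on_def by (simp add: C_k_on_add)

lemma smooth_on_linear:
  "open W \<Longrightarrow> bounded_linear L \<Longrightarrow> smooth_on f W \<Longrightarrow> smooth_on (\<lambda>x. L (f x)) W"
  unfolding smooth_on_def by (simp add: C_k_on_linear)

lemma smooth_on_bilinear:
  "open W \<Longrightarrow> bounded_bilinear B \<Longrightarrow> smooth_on f W \<Longrightarrow> smooth_on g W
    \<Longrightarrow> smooth_on (\<lambda>x. B (f x) (g x)) W"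
  unfolding smooth_on_def by (simp add: C_k_on_bilinear)

lemma smooth_on_powr:
  fixes f :: "'a::real_normed_vector \<Rightarrow> real"
  shows "open W \<Longrightarrow> smooth_on f W \<Longrightarrow> (\<And>x. x \<in> W \<Longrightarrow> f x > 0) \<Longrightarrow> smooth_on (\<lambda>x. f x powr a) W"
  unfolding smooth_on_def by (simp add: C_k_on_powr)

lemma smooth_on_frechet: "smooth_on f W \<Longrightarrow> smooth_on (\<lambda>x. frechet_derivative f (at x) v) W"
  unfolding smooth_on_def
proof
  fix k assume "\<forall>k. C_k_on k f W"
  then have "C_k_on (Suc k) f W" ..
  then show "C_k_on k (\<lambda>x. frechet_derivative f (at x) v) W"
    by simp
qed

lemma smooth_on_has_derivative:
  assumes "smooth_on f W" "x \<in> W"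
  shows "(f has_derivative frechet_derivative f (at x)) (at x)"
proof -
  have "C_k_on (Suc 0) f W"
    using assms(1) smooth_on_def by blast
  then show ?thesis
    using assms(2) frechet_derivative_works by auto
qed

lemma smooth_on_continuous: "smooth_on f W \<Longrightarrow> continuous_on W f"
  unfolding smooth_on_def using C_k_on.simps(1)[of f W] by blast

lemma smooth_on_mult:
  fixes f g :: "'a::real_normed_vector \<Rightarrow> real"
  shows "open W \<Longrightarrow> smooth_on f W \<Longrightarrow> smooth_on g W \<Longrightarrow> smooth_on (\<lambda>x. f x * g x) W"
  by (rule smooth_on_bilinear[OF _ bounded_bilinear_mult])

lemma smooth_on_scaleR:
  "open W \<Longrightarrow> smooth_on f W \<Longrightarrow> smooth_on g W \<Longrightarrow> smooth_on (\<lambda>x. f x *\<^sub>R g x) W"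
  by (rule smooth_on_bilinear[OF _ bounded_bilinear_scaleR])

lemma smooth_on_form:
  "open W \<Longrightarrow> smooth_on f W \<Longrightarrow> smooth_on g W \<Longrightarrow> smooth_on (\<lambda>x. form (f x) (g x)) W"
  by (rule smooth_on_bilinear[OF _ bounded_bilinear_form])

lemma smooth_on_minus: "open W \<Longrightarrow> smooth_on f W \<Longrightarrow> smooth_on (\<lambda>x. - f x) W"
  using smooth_on_linear[OF _ bounded_linear_minus[OF bounded_linear_ident]] .

lemma smooth_on_diff:
  "open W \<Longrightarrow> smooth_on f W \<Longrightarrow> smooth_on g W \<Longrightarrow> smooth_on (\<lambda>x. f x - g x) W"
  using smooth_on_add[OF _ _ smooth_on_minus, of W f g] by simp

lemma smooth_on_inverse:
  fixes f :: "'a::real_normed_vector \<Rightarrow> real"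
  assumes "open W" "smooth_on f W" "\<And>x. x \<in> W \<Longrightarrow> f x > 0"
  shows "smooth_on (\<lambda>x. inverse (f x)) W"
proof (rule smooth_on_cong[OF smooth_on_powr[OF assms, of "-1"] assms(1)])
  show "f x powr - 1 = inverse (f x)" if "x \<in> W" for x
    using assms(3)[OF that] by (simp add: powr_minus)
qed

lemma smooth_on_divide:
  fixes f g :: "'a::real_normed_vector \<Rightarrow> real"
  assumes "open W" "smooth_on f W" "smooth_on g W" "\<And>x. x \<in> W \<Longrightarrow> g x > 0"
  shows "smooth_on (\<lambda>x. f x / g x) W"
  using smooth_on_mult[OF assms(1,2) smooth_on_inverse[OF assms(1,3,4)]] by (simp add: divide_inverse)

text \<open>The first derivative is f'/f, already known to be smooth, so a case distinction on
  \<open>k\<close> replaces an induction.\<close>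

lemma smooth_on_ln:
  fixes f :: "'a::real_normed_vector \<Rightarrow> real"
  assumes "open W" "smooth_on f W" "\<And>x. x \<in> W \<Longrightarrow> f x > 0"
  shows "smooth_on (\<lambda>x. ln (f x)) W"
  unfolding smooth_on_def
proof
  fix k
  show "C_k_on k (\<lambda>x. ln (f x)) W"
  proof (cases k)
    case 0
    then show ?thesis
      using assms(3) smooth_on_continuous[OF assms(2)] by (auto intro!: continuous_intros) (metis less_irrefl)
  next
    case (Suc j)
    have "C_k_on (Suc j) (\<lambda>x. ln (f x)) W"
    proof (rule C_k_on_SucI[OF assms(1)])
      show "((\<lambda>x. ln (f x)) has_derivative (\<lambda>v. inverse (f x) * frechet_derivative f (at x) v)) (at x)"
        if "x \<in> W" for x
        using assms(3)[OF that] smooth_on_has_derivative[OF assms(2) that]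
        by (auto intro!: derivative_eq_intros simp: field_simps)
      show "C_k_on j (\<lambda>x. inverse (f x) * frechet_derivative f (at x) v) W" for v
        using smooth_on_mult[OF assms(1) smooth_on_inverse[OF assms] smooth_on_frechet[OF assms(2)]]
        unfolding smooth_on_def by blast
    qed
    then show ?thesis
      using Suc by simp
  qed
qed

lemma smooth_on_vec:
  fixes f :: "'a::real_normed_vector \<Rightarrow> real ^ 'n"
  assumes "open W" "\<And>i. smooth_on (\<lambda>x. f x $ i) W"
  shows "smooth_on f W"
proof -
  have *: "smooth_on (\<lambda>x. \<Sum>i\<in>I. f x $ i *\<^sub>R axis i 1) W" if "finite I" for I :: "'n set"
    using that
  proof induction
    case empty
    then show ?case
      using smooth_on_const[of 0] by simp
  next
    case (insert i I)
    then show ?case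
      using smooth_on_add[OF assms(1) smooth_on_scaleR[OF assms(1) assms(2) smooth_on_const]] by simp
  qed
  have "f x = (\<Sum>i\<in>UNIV. f x $ i *\<^sub>R axis i 1)" for x
    using basis_expansion[of "f x"] by (simp add: scalar_mult_eq_scaleR)
  then show ?thesis
    using smooth_on_cong[OF *[of UNIV, OF finite] assms(1), of f] by metis
qed

lemma smooth_on_nth: "open W \<Longrightarrow> smooth_on f W \<Longrightarrow> smooth_on (\<lambda>x. f x $ i) W"
  using smooth_on_linear[OF _ bounded_linear_vec_nth] .

lemmas smooth_intros = smooth_on_const smooth_on_add smooth_on_diff smooth_on_minus smooth_on_mult
  smooth_on_scaleR smooth_on_form smooth_on_nth smooth_on_frechet

section \<open>Derivations along vector fields and the symmetry of second derivatives\<close>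

lemma vec2_eq: "(v :: real ^ 2) = v $ 1 *\<^sub>R axis 1 1 + v $ 2 *\<^sub>R axis 2 1"
  by (simp add: vec_eq_iff forall_2 axis_def)

text \<open>The derivation given by the vector field \<open>E\<close>. As \<open>E\<close> varies
  with the point, iterating it also differentiates the field, which is why commutators and
  connection terms appear.\<close>

definition deriv_along ::
  "(real ^ 2 \<Rightarrow> real ^ 2) \<Rightarrow> (real ^ 2 \<Rightarrow> 'b::real_normed_vector) \<Rightarrow> real ^ 2 \<Rightarrow> 'b" where
  "deriv_along E f x = frechet_derivative f (at x) (E x)"

lemma smooth_on_deriv_along:
  assumes "open W" "smooth_on E W" "smooth_on f W"
  shows "smooth_on (deriv_along E f) W"
proof (rule smooth_on_cong[OF _ assms(1)])
  let ?g = "\<lambda>x. E x $ 1 *\<^sub>R frechet_derivative f (at x) (axis 1 1)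
      + E x $ 2 *\<^sub>R frechet_derivative f (at x) (axis 2 1)"
  show "smooth_on ?g W"
    using assms by (intro smooth_intros)
  show "?g x = deriv_along E f x" if "x \<in> W" for x
  proof -
    have lin: "linear (frechet_derivative f (at x))"
      using smooth_on_has_derivative[OF assms(3) that] has_derivative_linear by blast
    then show ?thesis
      unfolding deriv_along_def linear_scale[OF lin, symmetric] linear_add[OF lin, symmetric]
      by (simp only: vec2_eq[symmetric])
  qed
qed

lemma has_derivative_line:
  assumes "(f has_derivative f') (at (y + r *\<^sub>R z))"
  shows "((\<lambda>r. f (y + r *\<^sub>R z)) has_vector_derivative f' z) (at r)"
proof -
  have "((\<lambda>r. y + r *\<^sub>R z) has_derivative (\<lambda>k. k *\<^sub>R z)) (at r)"
    by (auto intro!: derivative_eq_intros)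
  from has_derivative_compose[OF this assms]
  show ?thesis
    unfolding has_vector_derivative_def
    using linear_scale[OF has_derivative_linear[OF assms]] by simp
qed

text \<open>Schwarz's theorem: the second difference \<open>Q\<close> of \<open>g\<close> on the
  parallelogram spanned by \<open>s v\<close> and \<open>s w\<close> is symmetric in
  \<open>v\<close> and \<open>w\<close>, and divided by s^2 it tends to either mixed
  derivative.\<close>

lemma second_derivative_real_symmetric:
  fixes g :: "'a::real_normed_vector \<Rightarrow> real"
  assumes "open W" "smooth_on g W" "x \<in> W"
  shows "frechet_derivative (\<lambda>y. frechet_derivative g (at y) v) (at x) w =
    frechet_derivative (\<lambda>y. frechet_derivative g (at y) w) (at x) v"
proof -
  define h where "h v w y = frechet_derivative (\<lambda>y. frechet_derivative g (at y) v) (at y) w" for v w y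
  have cont: "continuous_on W (h v w)" for v w
    using smooth_on_continuous[OF smooth_on_frechet[OF smooth_on_frechet[OF assms(2)]]]
    unfolding h_def by blast
  obtain d where d: "d > 0" "ball x d \<subseteq> W"
    using assms(1,3) open_contains_ball by blast
  define Q where "Q s t v w = g (x + s *\<^sub>R v + t *\<^sub>R w) - g (x + s *\<^sub>R v) - g (x + t *\<^sub>R w) + g x" for s t :: real and v w
  text \<open>The double difference quotient is a value of either mixed derivative.\<close>
  have key: "\<exists>y. dist x y \<le> 2 * s * (norm v + norm w) \<and> Q s s v w = s * s * h v w y"
    if s: "s > 0" "2 * s * (norm v + norm w) < d" for s v w
  proof -
    have inW: "x + r *\<^sub>R v + t *\<^sub>R w \<in> W" and le: "dist x (x + r *\<^sub>R v + t *\<^sub>R w) \<le> 2 * s * (norm v + norm w)"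
      if "0 \<le> r" "r \<le> s" "0 \<le> t" "t \<le> s" for r t
    proof -
      have "norm (r *\<^sub>R v + t *\<^sub>R w) \<le> r * norm v + t * norm w"
        using norm_triangle_ineq[of "r *\<^sub>R v" "t *\<^sub>R w"] that by simp
      also have "\<dots> \<le> s * norm v + s * norm w"
        using that by (intro add_mono mult_right_mono) auto
      also have "\<dots> \<le> 2 * s * (norm v + norm w)"
        using s by (simp add: algebra_simps)
      finally show "dist x (x + r *\<^sub>R v + t *\<^sub>R w) \<le> 2 * s * (norm v + norm w)"
        using norm_minus_cancel[of "r *\<^sub>R v + t *\<^sub>R w"] by (simp add: dist_norm algebra_simps)
      then have "x + r *\<^sub>R v + t *\<^sub>R w \<in> ball x d"
        using s by (simp only: mem_ball)
      then show "x + r *\<^sub>R v + t *\<^sub>R w \<in> W"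
        using d by blast
    qed
    have gd: "((\<lambda>r. g (y + r *\<^sub>R z)) has_real_derivative frechet_derivative g (at (y + r *\<^sub>R z)) z) (at r)"
      if "y + r *\<^sub>R z \<in> W" for y z r
      using has_derivative_line[OF smooth_on_has_derivative[OF assms(2) that]]
      by (simp add: has_real_derivative_iff_has_vector_derivative)
    have hd: "((\<lambda>t. frechet_derivative g (at (y + t *\<^sub>R z)) v) has_real_derivative h v z (y + t *\<^sub>R z)) (at t)"
      if "y + t *\<^sub>R z \<in> W" for y z t
      using has_derivative_line[OF smooth_on_has_derivative[OF smooth_on_frechet[OF assms(2)] that], of v]
      by (simp add: has_real_derivative_iff_has_vector_derivative h_def)
    define f where "f r = g (x + s *\<^sub>R w + r *\<^sub>R v) - g (x + r *\<^sub>R v)" for r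
    have "\<exists>r. 0 < r \<and> r < s \<and> f s - f 0 = (s - 0) *
        (frechet_derivative g (at (x + s *\<^sub>R w + r *\<^sub>R v)) v - frechet_derivative g (at (x + r *\<^sub>R v)) v)"
      unfolding f_def
    proof (rule MVT2)
      fix r assume r: "0 \<le> r" "r \<le> s"
      have "x + s *\<^sub>R w + r *\<^sub>R v \<in> W" "x + r *\<^sub>R v \<in> W"
        using inW[OF r, of s] inW[OF r, of 0] s(1) by (simp_all add: add_ac)
      then show "((\<lambda>r. g (x + s *\<^sub>R w + r *\<^sub>R v) - g (x + r *\<^sub>R v)) has_real_derivative
          frechet_derivative g (at (x + s *\<^sub>R w + r *\<^sub>R v)) v - frechet_derivative g (at (x + r *\<^sub>R v)) v) (at r)"
        by (intro DERIV_diff gd)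
    qed (use s in auto)
    then obtain r where r: "0 < r" "r < s" "f s - f 0 = s *
        (frechet_derivative g (at (x + s *\<^sub>R w + r *\<^sub>R v)) v - frechet_derivative g (at (x + r *\<^sub>R v)) v)"
      by auto
    have "\<exists>t. 0 < t \<and> t < s \<and> frechet_derivative g (at ((x + r *\<^sub>R v) + s *\<^sub>R w)) v
        - frechet_derivative g (at ((x + r *\<^sub>R v) + 0 *\<^sub>R w)) v = (s - 0) * h v w ((x + r *\<^sub>R v) + t *\<^sub>R w)"
    proof (rule MVT2)
      show "((\<lambda>t. frechet_derivative g (at (x + r *\<^sub>R v + t *\<^sub>R w)) v) has_real_derivative
          h v w (x + r *\<^sub>R v + t *\<^sub>R w)) (at t)" if "0 \<le> t" "t \<le> s" for t
        using inW[of r t] that r by (intro hd) auto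
    qed (use s in auto)
    then obtain t where t: "0 < t" "t < s" "frechet_derivative g (at (x + r *\<^sub>R v + s *\<^sub>R w)) v
        - frechet_derivative g (at (x + r *\<^sub>R v)) v = s * h v w (x + r *\<^sub>R v + t *\<^sub>R w)"
      by auto
    have comm: "x + s *\<^sub>R w + r *\<^sub>R v = x + r *\<^sub>R v + s *\<^sub>R w"
      by simp
    have "Q s s v w = f s - f 0"
      by (simp add: Q_def f_def add.commute add.left_commute)
    then have "Q s s v w = s * s * h v w (x + r *\<^sub>R v + t *\<^sub>R w)"
      using r(3) t(3) unfolding comm by (simp only: mult.assoc)
    then show ?thesis
      using le[of r t] r t by force
  qed
  have lim: "\<exists>s0>0. \<forall>s. 0 < s \<and> s < s0 \<longrightarrow> \<bar>Q s s v w / (s * s) - h v w x\<bar> < e" if e: "e > 0" for e v w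
  proof -
    obtain d' where d': "d' > 0" "\<And>y. y \<in> W \<Longrightarrow> dist y x < d' \<Longrightarrow> dist (h v w y) (h v w x) < e"
      using cont[of v w] assms(3) e unfolding continuous_on_iff by blast
    define s0 where "s0 = min d d' / (2 * (norm v + norm w + 1))"
    have pos: "norm v + norm w + 1 > 0"
      by (smt (verit) norm_ge_zero)
    have "\<bar>Q s s v w / (s * s) - h v w x\<bar> < e" if s: "0 < s" "s < s0" for s
    proof -
      have "2 * s * (norm v + norm w + 1) < min d d'"
        using s pos unfolding s0_def by (simp add: pos_less_divide_eq mult_ac)
      then have "2 * s * (norm v + norm w) < min d d'"
        using s(1) by (simp add: algebra_simps)
      with key[of s v w] s obtain y where y: "dist x y < min d d'" "Q s s v w = s * s * h v w y"
        by force
      have "y \<in> W"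
        using y(1) d(2) by auto
      then have "dist (h v w y) (h v w x) < e"
        using d'(2)[of y] y(1) by (simp add: dist_commute)
      then show ?thesis
        using y s by (simp add: dist_real_def)
    qed
    moreover have "s0 > 0"
      using d d' pos by (simp add: s0_def)
    ultimately show ?thesis
      by blast
  qed
  have Qsym: "Q s s v w = Q s s w v" for s
    by (simp add: Q_def add_ac)
  have "\<bar>h v w x - h w v x\<bar> \<le> e" if e: "e > 0" for e
  proof -
    obtain s0 where s0: "s0 > 0"
      "\<And>s. 0 < s \<Longrightarrow> s < s0 \<Longrightarrow> \<bar>Q s s v w / (s * s) - h v w x\<bar> < e / 2"
      using lim[of "e / 2" v w] e by auto
    obtain s1 where s1: "s1 > 0"
      "\<And>s. 0 < s \<Longrightarrow> s < s1 \<Longrightarrow> \<bar>Q s s w v / (s * s) - h w v x\<bar> < e / 2"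
      using lim[of "e / 2" w v] e by auto
    define s where "s = min s0 s1 / 2"
    have sp: "0 < s" "s < s0" "s < s1"
      using s0(1) s1(1) by (auto simp: s_def min_def)
    then show ?thesis
      using s0(2)[OF sp(1,2)] s1(2)[OF sp(1,3), folded Qsym] by linarith
  qed
  then have "h v w x = h w v x"
    using field_le_epsilon[of "\<bar>h v w x - h w v x\<bar>" 0] by simp
  then show ?thesis
    by (simp add: h_def)
qed

lemma second_derivative_symmetric:
  fixes g :: "'a::real_normed_vector \<Rightarrow> real ^ 'n"
  assumes "open W" "smooth_on g W" "x \<in> W"
  shows "frechet_derivative (\<lambda>y. frechet_derivative g (at y) v) (at x) w =
    frechet_derivative (\<lambda>y. frechet_derivative g (at y) w) (at x) v"
proof -
  have nth: "frechet_derivative (\<lambda>y. f y $ i) (at y) v = frechet_derivative f (at y) v $ i"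
    if "smooth_on f W" "y \<in> W" for f :: "'a \<Rightarrow> real ^ 'n" and i y v
  proof -
    have "((\<lambda>y. f y $ i) has_derivative (\<lambda>v. frechet_derivative f (at y) v $ i)) (at y)"
      using bounded_linear.has_derivative[OF bounded_linear_vec_nth smooth_on_has_derivative[OF that]] .
    from frechet_derivative_at[OF this] show ?thesis
      by metis
  qed
  have second: "frechet_derivative (\<lambda>y. frechet_derivative g (at y) v) (at x) w $ i =
      frechet_derivative (\<lambda>y. frechet_derivative (\<lambda>y. g y $ i) (at y) v) (at x) w" for i v w
  proof -
    have "frechet_derivative (\<lambda>y. frechet_derivative g (at y) v) (at x) w $ i =
        frechet_derivative (\<lambda>y. frechet_derivative g (at y) v $ i) (at x) w"
      using nth[OF smooth_on_frechet[OF assms(2)] assms(3)] by metis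
    also have "\<dots> = frechet_derivative (\<lambda>y. frechet_derivative (\<lambda>y. g y $ i) (at y) v) (at x) w"
    proof -
      have "frechet_derivative (\<lambda>y. frechet_derivative g (at y) v $ i) (at x) =
          frechet_derivative (\<lambda>y. frechet_derivative (\<lambda>y. g y $ i) (at y) v) (at x)"
        using smooth_on_nth[OF assms(1) smooth_on_frechet[OF assms(2)]]
          smooth_on_has_derivative[OF _ assms(3)] nth[OF assms(2)]
        by (intro frechet_derivative_transform_within_open[OF _ assms(1,3)])
          (auto simp: differentiable_def)
      then show ?thesis
        by simp
    qed
    finally show ?thesis .
  qed
  show ?thesis
    unfolding vec_eq_iff
    using second second_derivative_real_symmetric[OF assms(1) smooth_on_nth[OF assms(1,2)] assms(3)] by metis
qed

subsection \<open>Frames adapted to the form\<close>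

text \<open>An orthonormal basis of the ambient space of signature (2,2): a point of
  \<open>AdS_hat\<close>, an orthonormal pair tangent to a spacelike surface there, and a timelike
  unit normal of the surface.\<close>

definition orthoframe :: "real ^ 4 \<Rightarrow> real ^ 4 \<Rightarrow> real ^ 4 \<Rightarrow> real ^ 4 \<Rightarrow> bool" where
  "orthoframe x e f n \<longleftrightarrow> form x x = -1 \<and> form e e = 1 \<and> form f f = 1 \<and> form n n = -1 \<and>
     form x e = 0 \<and> form x f = 0 \<and> form x n = 0 \<and> form e f = 0 \<and> form e n = 0 \<and> form f n = 0"

text \<open>Pairing with the four vectors recovers the coordinates, so the coordinate map is
  injective, hence onto in dimension 4.\<close>

lemma orthoframe_expand:
  assumes "orthoframe x e f n"
  shows "z = form z e *\<^sub>R e + form z f *\<^sub>R f - form z x *\<^sub>R x - form z n *\<^sub>R n"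
proof -
  define L :: "real ^ 4 \<Rightarrow> real ^ 4" where
    "L v = v $ 1 *\<^sub>R e + v $ 2 *\<^sub>R f + v $ 3 *\<^sub>R x + v $ 4 *\<^sub>R n" for v
  have coeffs: "form (L v) e = v $ 1" "form (L v) f = v $ 2" "form (L v) x = - v $ 3"
    "form (L v) n = - v $ 4" for v
    using assms by (auto simp: L_def orthoframe_def form_simps form_commute[of e x] form_commute[of f x]
        form_commute[of n x] form_commute[of f e] form_commute[of n e] form_commute[of n f])
  have lin: "linear L"
    by (rule linearI) (simp_all add: L_def algebra_simps)
  moreover have "inj L"
    unfolding linear_injective_0[OF lin]
  proof (intro allI impI)
    fix v assume "L v = 0"
    then show "v = 0"
      using coeffs[of v] by (simp add: vec_eq_iff[of v] forall_4 form.zero_left)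
  qed
  ultimately have "surj L"
    by (simp add: linear_injective_imp_surjective[OF lin])
  then obtain v where "z = L v"
    by auto
  then show ?thesis
    using coeffs[of v] by (simp add: L_def)
qed

lemma orthoframe_form:
  assumes "orthoframe x e f n"
  shows "form z w = form z e * form w e + form z f * form w f - form z x * form w x - form z n * form w n"
proof -
  have "form w z = form w (form z e *\<^sub>R e + form z f *\<^sub>R f - form z x *\<^sub>R x - form z n *\<^sub>R n)"
    using orthoframe_expand[OF assms, of z] by simp
  then show ?thesis
    by (simp add: form_simps form_commute)
qed

text \<open>Does not vanish on pairs spanning a negative definite plane, so that its sign selects one of the
  two unit normals continuously.\<close>

definition orient :: "real ^ 4 \<Rightarrow> real ^ 4 \<Rightarrow> real" where
  "orient x n = x $ 3 * n $ 4 - x $ 4 * n $ 3"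

text \<open>\<open>x\<close> and \<open>n\<close> span a negative definite plane, whereas a vector
  with vanishing third and fourth coordinates has nonnegative square. Hence the projection of that
  plane to these two coordinates is injective and its determinant does not vanish.\<close>

lemma orient_nonzero:
  assumes "form x x < 0" "form n n < 0" "form x n = 0"
  shows "orient x n \<noteq> 0"
proof
  assume o: "orient x n = 0"
  have nn: "(c *\<^sub>R x - d *\<^sub>R n) $ 3 = 0 \<Longrightarrow> (c *\<^sub>R x - d *\<^sub>R n) $ 4 = 0 \<Longrightarrow> c = 0 \<and> d = 0" for c d
  proof -
    let ?z = "c *\<^sub>R x - d *\<^sub>R n"
    assume "?z $ 3 = 0" "?z $ 4 = 0"
    then have "form ?z ?z = (?z $ 1)\<^sup>2 + (?z $ 2)\<^sup>2"
      unfolding form_def[of ?z] by (simp only: power2_eq_square mult_zero_left diff_0_right)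
    then have "form ?z ?z \<ge> 0"
      by simp
    moreover have "form ?z ?z = c\<^sup>2 * form x x + d\<^sup>2 * form n n"
      using assms(3) by (simp add: form_simps form_commute[of n x] power2_eq_square algebra_simps)
    moreover have "c\<^sup>2 * form x x \<le> 0" "d\<^sup>2 * form n n \<le> 0"
      using assms by (simp_all add: mult_nonneg_nonpos)
    ultimately have "c\<^sup>2 * form x x = 0" "d\<^sup>2 * form n n = 0"
      by linarith+
    then show ?thesis
      using assms by auto
  qed
  \<comment> \<open>If the determinant vanishes, the combinations with coefficients
    \<open>(n $ 3, x $ 3)\<close> and \<open>(n $ 4, x $ 4)\<close> have third and fourth coordinate
    zero, so all four coefficients vanish.\<close>
  have "x $ 3 = 0" "x $ 4 = 0"
    using nn[of "n $ 3" "x $ 3"] nn[of "n $ 4" "x $ 4"] o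
    by (auto simp: orient_def algebra_simps)
  then have "form x x = (x $ 1)\<^sup>2 + (x $ 2)\<^sup>2"
    by (simp add: form_def power2_eq_square)
  then show False
    using assms(1) by (smt (verit) zero_le_power2)
qed

lemma unit_normal_unique:
  assumes F: "orthoframe x e f n" and n': "form n' n' = -1" "form n' x = 0" "form n' e = 0" "form n' f = 0"
  shows "n' = n \<or> n' = - n"
proof -
  have eq: "n' = (- form n' n) *\<^sub>R n"
    using orthoframe_expand[OF F, of n'] n' by simp
  then have "form n' n' = (form n' n)\<^sup>2 * form n n"
    by (metis form.scaleR_left form.scaleR_right mult.assoc mult_minus_left mult_minus_right minus_minus power2_eq_square real_scaleR_def)
  moreover have "form n n = - 1"
    using F by (simp add: orthoframe_def)
  ultimately have "(form n' n)\<^sup>2 = 1"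
    using n'(1) by simp
  then have "form n' n = 1 \<or> form n' n = -1"
    by (simp add: power2_eq_1_iff)
  then show ?thesis
    using eq by (metis minus_minus scaleR_minus_left scaleR_one)
qed

text \<open>Generalised cross product: the 3 by 3 minors of \<open>a\<close>, \<open>b\<close>,
  \<open>c\<close> with indices raised by the form, so that \<open>form (cross4 a b c) z\<close> is
  the determinant of \<open>a\<close>, \<open>b\<close>, \<open>c\<close>, \<open>z\<close>. Applied
  to a parametrisation and its partial derivatives it gives a normal that is polynomial in them,
  hence smooth.\<close>

definition cross4 :: "real ^ 4 \<Rightarrow> real ^ 4 \<Rightarrow> real ^ 4 \<Rightarrow> real ^ 4" where
  "cross4 a b c = (let d = (\<lambda>i j k. a $ i * (b $ j * c $ k - b $ k * c $ j)
       - a $ j * (b $ i * c $ k - b $ k * c $ i) + a $ k * (b $ i * c $ j - b $ j * c $ i))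
     in (\<chi> i. if i = 1 then - d 2 3 4 else if i = 2 then d 1 3 4 else if i = 3 then d 1 2 4 else - d 1 2 3))"

lemma cross4_nth:
  "cross4 a b c $ 1 = - (a $ 2 * (b $ 3 * c $ 4 - b $ 4 * c $ 3)
       - a $ 3 * (b $ 2 * c $ 4 - b $ 4 * c $ 2) + a $ 4 * (b $ 2 * c $ 3 - b $ 3 * c $ 2))"
  "cross4 a b c $ 2 = a $ 1 * (b $ 3 * c $ 4 - b $ 4 * c $ 3)
       - a $ 3 * (b $ 1 * c $ 4 - b $ 4 * c $ 1) + a $ 4 * (b $ 1 * c $ 3 - b $ 3 * c $ 1)"
  "cross4 a b c $ 3 = a $ 1 * (b $ 2 * c $ 4 - b $ 4 * c $ 2)
       - a $ 2 * (b $ 1 * c $ 4 - b $ 4 * c $ 1) + a $ 4 * (b $ 1 * c $ 2 - b $ 2 * c $ 1)"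
  "cross4 a b c $ 4 = - (a $ 1 * (b $ 2 * c $ 3 - b $ 3 * c $ 2)
       - a $ 2 * (b $ 1 * c $ 3 - b $ 3 * c $ 1) + a $ 3 * (b $ 1 * c $ 2 - b $ 2 * c $ 1))"
  by (simp_all add: cross4_def Let_def)

lemma form_cross4:
  "form (cross4 a b c) a = 0" "form (cross4 a b c) b = 0" "form (cross4 a b c) c = 0"
  unfolding form_def cross4_nth by algebra+

text \<open>The right side is the Gram determinant of \<open>a\<close>, \<open>b\<close>,
  \<open>c\<close>; it appears with sign +1 because the form has determinant 1.\<close>

lemma form_cross4_self:
  "form (cross4 a b c) (cross4 a b c) =
     form a a * (form b b * form c c - form b c * form b c)
     - form a b * (form a b * form c c - form b c * form a c)
     + form a c * (form a b * form b c - form b b * form a c)"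
  unfolding form_def cross4_nth by (simp add: algebra_simps)

lemma smooth_on_cross4:
  assumes "open W" "smooth_on f W" "smooth_on g W" "smooth_on h W"
  shows "smooth_on (\<lambda>x. cross4 (f x) (g x) (h x)) W"
proof (rule smooth_on_vec[OF assms(1)])
  fix i :: 4
  show "smooth_on (\<lambda>x. cross4 (f x) (g x) (h x) $ i) W"
    using exhaust_4[of i] assms
    by (elim disjE) (simp only: cross4_nth; intro smooth_intros; assumption)+
qed

lemma smooth_on_orient:
  assumes "open W" "smooth_on f W" "smooth_on g W"
  shows "smooth_on (\<lambda>x. orient (f x) (g x)) W"
  unfolding orient_def using assms by (intro smooth_intros)

text \<open>The reflection in \<open>x - y\<close> maps the frame at \<open>x\<close> to one at \<open>y\<close>; two spacelike planes of
  \<open>y\<^sup>\<bottom>\<close> admit orthonormal bases whose pairing has trace at least 2.\<close>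

lemma two_frames:
  assumes F: "orthoframe x e1 e2 n" and G: "orthoframe y f1 f2 m" and a: "form x y > -1"
  defines "M \<equiv> \<lambda>e f. form e f - form e y * form f x / (1 + form x y)"
  shows "\<exists>p q r s. p\<^sup>2 + q\<^sup>2 = 1 \<and> r\<^sup>2 + s\<^sup>2 = 1 \<and> p * r + q * s = 0 \<and>
    M (p *\<^sub>R e1 + q *\<^sub>R e2) f1 + M (r *\<^sub>R e1 + s *\<^sub>R e2) f2 \<ge> 2"
proof -
  define a where "a = form x y"
  have a1: "1 + a > 0"
    using assms(3) by (simp add: a_def)
  \<comment> \<open>Since \<open>x - y\<close> has square \<open>-2 * (1 + a)\<close>, this is the
    usual formula for the reflection.\<close>
  define R where "R z = z + (form z (x - y) / (1 + a)) *\<^sub>R (x - y)" for z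
  have xx: "form x x = -1" "form y y = -1"
    using F G by (auto simp: orthoframe_def)
  have xy: "form (x - y) (x - y) = - 2 * (1 + a)"
    by (simp add: form_simps xx a_def form_commute[of y x])
  have iso: "form (R z) (R w) = form z w" for z w
  proof -
    have "form (R z) (R w) = form z w + 2 * (form z (x - y) * form w (x - y) / (1 + a))
        + form z (x - y) / (1 + a) * (form w (x - y) / (1 + a)) * form (x - y) (x - y)"
      unfolding R_def
      by (simp only: form.add_left form.add_right form.scaleR_left form.scaleR_right
          form_commute[of "x - y" w]) (simp add: algebra_simps)
    also have "\<dots> = form z w"
    proof -
      have "Z / d * (W / d) * (- 2 * d) = - 2 * (Z * W / d)" if "d \<noteq> 0" for Z W d :: real
        using that by (simp add: field_simps)
      from this[of "1 + a" "form z (x - y)" "form w (x - y)"]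
      have "form z (x - y) / (1 + a) * (form w (x - y) / (1 + a)) * (- 2 * (1 + a))
          = - 2 * (form z (x - y) * form w (x - y) / (1 + a))"
        using a1 by simp
      then show ?thesis
        unfolding xy by linarith
    qed
    finally show ?thesis .
  qed
  have Rx: "R x = y"
  proof -
    have "form x (x - y) = - (1 + a)"
      by (simp add: form_simps xx a_def)
    then have "form x (x - y) / (1 + a) = - 1"
      using a1 by (simp add: field_simps)
    then show ?thesis
      by (simp add: R_def)
  qed
  have F': "orthoframe y (R e1) (R e2) (R n)"
    using F unfolding orthoframe_def Rx[symmetric] iso by simp
  have M: "form (R e) f = M e f" if "form e x = 0" "form f y = 0" for e f
  proof -
    have "form (R e) f = form e f + form e (x - y) * form (x - y) f / (1 + a)"
      by (simp add: R_def form.add_left form.scaleR_left)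
    also have "\<dots> = M e f"
      using that by (simp add: M_def form_simps form_commute[of x f] form_commute[of y f] a_def)
    finally show ?thesis .
  qed
  have ex: "form e1 x = 0" "form e2 x = 0" "form f1 y = 0" "form f2 y = 0"
    using F G by (auto simp: orthoframe_def form_commute)
  define A B C D where "A = M e1 f1" "B = M e1 f2" "C = M e2 f1" "D = M e2 f2"
  define u v where "u = form f1 (R n)" "v = form f2 (R n)"
  \<comment> \<open>Expand \<open>f1\<close> and \<open>f2\<close> in the transported frame. For the
    matrix K = ((A, B), (C, D)) this says that K^T K is the identity plus the rank one matrix of
    \<open>(u, v)\<close>, so that (det K)^2 = 1 + u^2 + v^2.\<close>
  have "1 = A * A + C * C - u * u" "1 = B * B + D * D - v * v" "0 = A * B + C * D - u * v"
    using orthoframe_form[OF F', of f1 f1] orthoframe_form[OF F', of f2 f2] orthoframe_form[OF F', of f1 f2]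
      M[OF ex(1,3)] M[OF ex(1,4)] M[OF ex(2,3)] M[OF ex(2,4)] G ex
    by (auto simp: orthoframe_def A_B_C_D_def u_v_def form_commute)
  then have "A * A + C * C = 1 + u * u" "B * B + D * D = 1 + v * v" "A * B + C * D = u * v"
    by linarith+
  moreover have "(A * D - B * C)\<^sup>2 = (A * A + C * C) * (B * B + D * D) - (A * B + C * D)\<^sup>2"
    by algebra
  ultimately have "(A * D - B * C)\<^sup>2 = 1 + u\<^sup>2 + v\<^sup>2"
    by (simp add: power2_eq_square algebra_simps)
  then have det: "(A * D - B * C)\<^sup>2 \<ge> 1"
    by simp
  have lin: "M (p *\<^sub>R e1 + q *\<^sub>R e2) f = p * M e1 f + q * M e2 f" for p q f
    by (simp add: M_def form_simps algebra_simps add_divide_distrib)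
  show ?thesis
  proof (cases "A * D - B * C > 0")
    case True
    then have d: "A * D - B * C \<ge> 1"
      using det power2_le_imp_le[of 1 "A * D - B * C"] by (simp add: power2_commute)
    \<comment> \<open>\<open>h\<close> is the largest trace of K obtainable by rotating
      \<open>(e1, e2)\<close>, attained for the angle with cosine \<open>(A + D) / h\<close> and
      sine \<open>(C - B) / h\<close>. It is at least 2 because h^2 = (A - D)^2 + (B + C)^2 + 4 det
      K.\<close>
    define h where "h = sqrt ((A + D)\<^sup>2 + (C - B)\<^sup>2)"
    have "(A + D)\<^sup>2 + (C - B)\<^sup>2 = (A - D)\<^sup>2 + (B + C)\<^sup>2 + 4 * (A * D - B * C)"
      by algebra
    moreover have "0 + 4 * 1 \<le> (A - D)\<^sup>2 + (B + C)\<^sup>2 + 4 * (A * D - B * C)"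
      using d by (intro add_mono mult_left_mono) auto
    ultimately have h2: "(A + D)\<^sup>2 + (C - B)\<^sup>2 \<ge> 2\<^sup>2"
      by simp
    then have h: "h \<ge> 2" "h * h = (A + D)\<^sup>2 + (C - B)\<^sup>2"
      unfolding h_def by (auto intro: real_le_rsqrt)
    let ?p = "(A + D) / h" and ?q = "(C - B) / h"
    have "?p\<^sup>2 + ?q\<^sup>2 = ((A + D)\<^sup>2 + (C - B)\<^sup>2) / (h * h)"
      by (simp only: power_divide power2_eq_square[of h] add_divide_distrib[of _ _ "h * h"])
    then have pq: "?p\<^sup>2 + ?q\<^sup>2 = 1"
      using h(1) unfolding h(2)[symmetric] by simp
    have "M (?p *\<^sub>R e1 + ?q *\<^sub>R e2) f1 + M ((- ?q) *\<^sub>R e1 + ?p *\<^sub>R e2) f2 = h * h / h"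
      unfolding lin A_B_C_D_def[symmetric] h(2) power2_eq_square
      by (simp only: times_divide_eq_left minus_divide_left flip: add_divide_distrib) (simp add: algebra_simps)
    moreover have "h * h / h = h"
      using h(1) by simp
    ultimately have "M (?p *\<^sub>R e1 + ?q *\<^sub>R e2) f1 + M ((- ?q) *\<^sub>R e1 + ?p *\<^sub>R e2) f2 \<ge> 2"
      using h(1) by linarith
    then show ?thesis
      using pq by (intro exI[of _ ?p] exI[of _ ?q] exI[of _ "- ?q"]) (auto simp: add.commute)
  next
    case False
    then have d: "B * C - A * D \<ge> 1"
      using det power2_le_imp_le[of 1 "B * C - A * D"] by (simp add: power2_commute)
    \<comment> \<open>For negative determinant the frame is reflected instead of rotated, which
      exchanges sums and differences.\<close>
    define h where "h = sqrt ((A - D)\<^sup>2 + (C + B)\<^sup>2)"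
    have "(A - D)\<^sup>2 + (C + B)\<^sup>2 = (A + D)\<^sup>2 + (B - C)\<^sup>2 + 4 * (B * C - A * D)"
      by algebra
    moreover have "0 + 4 * 1 \<le> (A + D)\<^sup>2 + (B - C)\<^sup>2 + 4 * (B * C - A * D)"
      using d by (intro add_mono mult_left_mono) auto
    ultimately have h2: "(A - D)\<^sup>2 + (C + B)\<^sup>2 \<ge> 2\<^sup>2"
      by simp
    then have h: "h \<ge> 2" "h * h = (A - D)\<^sup>2 + (C + B)\<^sup>2"
      unfolding h_def by (auto intro: real_le_rsqrt)
    let ?p = "(A - D) / h" and ?q = "(C + B) / h"
    have "?p\<^sup>2 + ?q\<^sup>2 = ((A - D)\<^sup>2 + (C + B)\<^sup>2) / (h * h)"
      by (simp only: power_divide power2_eq_square[of h] add_divide_distrib[of _ _ "h * h"])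
    then have pq: "?p\<^sup>2 + ?q\<^sup>2 = 1"
      using h(1) unfolding h(2)[symmetric] by simp
    have "M (?p *\<^sub>R e1 + ?q *\<^sub>R e2) f1 + M (?q *\<^sub>R e1 + (- ?p) *\<^sub>R e2) f2 = h * h / h"
      unfolding lin A_B_C_D_def[symmetric] h(2) power2_eq_square
      by (simp only: times_divide_eq_left minus_divide_left flip: add_divide_distrib) (simp add: algebra_simps)
    moreover have "h * h / h = h"
      using h(1) by simp
    ultimately have "M (?p *\<^sub>R e1 + ?q *\<^sub>R e2) f1 + M (?q *\<^sub>R e1 + (- ?p) *\<^sub>R e2) f2 \<ge> 2"
      using h(1) by linarith
    then show ?thesis
      using pq by (intro exI[of _ ?p] exI[of _ ?q] exI[of _ "- ?p"]) (auto simp: add.commute)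
  qed
qed

subsection \<open>Projective space\<close>

lemma proj_eq_iff:
  assumes "x \<noteq> 0" "y \<noteq> 0"
  shows "proj x = proj y \<longleftrightarrow> (\<exists>c. c \<noteq> 0 \<and> y = c *\<^sub>R x)"
proof -
  have "proj x = proj y \<longleftrightarrow> span {x} = span {y}"
    unfolding proj_def using assms by (subst Abs_projective_inject) auto
  also have "\<dots> \<longleftrightarrow> (\<exists>c. c \<noteq> 0 \<and> y = c *\<^sub>R x)"
  proof
    assume "span {x} = span {y}"
    then have "y \<in> span {x}"
      using span_base[of y "{y}"] by simp
    then show "\<exists>c. c \<noteq> 0 \<and> y = c *\<^sub>R x"
      using assms by (auto simp: span_singleton)
  next
    assume "\<exists>c. c \<noteq> 0 \<and> y = c *\<^sub>R x"
    then obtain c where c: "c \<noteq> 0" "y = c *\<^sub>R x"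
      by blast
    have "range (\<lambda>k. k *\<^sub>R x) \<subseteq> range (\<lambda>k. k *\<^sub>R c *\<^sub>R x)"
    proof safe
      fix k
      show "k *\<^sub>R x \<in> range (\<lambda>k. k *\<^sub>R c *\<^sub>R x)"
        using c(1) by (intro image_eqI[of _ _ "k / c"]) auto
    qed
    then show "span {x} = span {y}"
      unfolding span_singleton c(2) by auto
  qed
  finally show ?thesis .
qed

lemma proj_scaleR: "c \<noteq> 0 \<Longrightarrow> x \<noteq> 0 \<Longrightarrow> proj (c *\<^sub>R x) = proj x"
  by (subst eq_commute, subst proj_eq_iff) auto

lemma proj_minus: "proj (- x) = proj x"
  using proj_scaleR[of "-1" x] by (cases "x = 0") auto

lemma continuous_on_proj: "continuous_on (- {0}) (proj :: real ^ 'n \<Rightarrow> _)"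
proof -
  have "open (proj -` U \<inter> - {0 :: real ^ 'n})" if "open U" for U
  proof -
    have "proj -` U \<inter> - {0 :: real ^ 'n} = {x. x \<noteq> 0 \<and> proj x \<in> U}"
      by auto
    then show ?thesis
      using that unfolding open_projective_def by simp
  qed
  then show ?thesis
    using continuous_on_open_vimage[of "- {0 :: real ^ 'n}" proj] by (simp add: open_Compl)
qed

lemma ex_proj: "\<exists>x. x \<noteq> 0 \<and> p = proj x"
proof -
  obtain x where "x \<noteq> 0" "Rep_projective p = span {x}"
    using Rep_projective[of p] by auto
  then have "p = proj x"
    unfolding proj_def by (simp only: Rep_projective_inverse flip: \<open>Rep_projective p = span {x}\<close>)
  then show ?thesis
    using \<open>x \<noteq> 0\<close> by (intro exI[of _ x] conjI)
qed

lemma AdS_hat_nonzero: "x \<in> AdS_hat \<Longrightarrow> x \<noteq> 0"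
  using AdS_hat_norm_ge_1[of x] by auto

lemma AdS_hat_proj_eq:
  assumes "x \<in> AdS_hat" "y \<in> AdS_hat" "proj x = proj y"
  shows "y = x \<or> y = - x"
proof -
  obtain c where c: "y = c *\<^sub>R x"
    using proj_eq_iff[of x y] AdS_hat_nonzero assms by auto
  then have "c * c = 1"
    using assms(1,2) by (simp add: AdS_hat_def form_simps)
  then have "c = 1 \<or> c = -1"
    by (simp add: square_eq_1_iff)
  then show ?thesis
    using c by auto
qed

lemma proj_in_AdS_iff:
  assumes x: "x \<noteq> 0"
  shows "proj x \<in> AdS \<longleftrightarrow> form x x < 0"
proof
  assume "proj x \<in> AdS"
  then obtain y where y: "proj x = proj y" "form y y < 0"
    unfolding AdS_def by auto
  then have "y \<noteq> 0"
    by (auto simp: form.zero_left)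
  then obtain c where "y = c *\<^sub>R x"
    using proj_eq_iff[of x y] x y(1) by auto
  then have "form y y = c\<^sup>2 * form x x"
    by (simp add: form_simps power2_eq_square)
  moreover have "0 \<le> c\<^sup>2 * form x x" if "\<not> form x x < 0"
    using that by (intro mult_nonneg_nonneg) auto
  ultimately show "form x x < 0"
    using y(2) by fastforce
next
  assume "form x x < 0"
  then show "proj x \<in> AdS"
    unfolding AdS_def by auto
qed

lemma proj_in_bdry_iff:
  assumes x: "x \<noteq> 0"
  shows "proj x \<in> bdry_AdS \<longleftrightarrow> form x x = 0"
proof
  assume "proj x \<in> bdry_AdS"
  then obtain y where y: "proj x = proj y" "y \<noteq> 0" "form y y = 0"
    unfolding bdry_AdS_def by auto
  then obtain c where "c \<noteq> 0" "y = c *\<^sub>R x"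
    using proj_eq_iff[of x y] x by auto
  then show "form x x = 0"
    using y(3) by (simp add: form_simps)
next
  assume "form x x = 0"
  then show "proj x \<in> bdry_AdS"
    unfolding bdry_AdS_def using x by auto
qed

subsection \<open>Charts and moving frames\<close>

lemma local_param_restrict:
  assumes "local_param S W \<sigma>" "open V" "V \<subseteq> W"
  shows "local_param S V \<sigma>"
proof -
  let ?P = "proj \<circ> \<sigma>"
  obtain g where g: "homeomorphism W (?P ` W) ?P g"
    using assms(1) unfolding local_param_def by auto
  have "openin (top_of_set W) V"
    using assms by (simp add: open_subset)
  then have "openin (top_of_set (?P ` W)) (?P ` V)"
    by (rule homeomorphism_imp_open_map[OF g])
  moreover have "openin (top_of_set S) (?P ` W)"
    using assms(1) unfolding local_param_def by auto
  ultimately have "openin (top_of_set S) (?P ` V)"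
    by (rule openin_trans)
  moreover have "homeomorphism V (?P ` V) ?P g"
    using assms(3) by (intro homeomorphism_of_subsets[OF g]) auto
  moreover have "smooth_on \<sigma> V"
    using assms smooth_on_subset[of \<sigma> W V] unfolding local_param_def by auto
  ultimately show ?thesis
    using assms unfolding local_param_def by (auto simp: image_subset_iff subset_iff)
qed

text \<open>Both lifts of a parametrisation are admissible, so a chart with values in a prescribed
  sheet over \<open>S\<close> can be obtained by a change of sign.\<close>

lemma local_param_uminus:
  assumes "local_param S W \<sigma>"
  shows "local_param S W (\<lambda>u. - \<sigma> u)"
proof -
  have "open W" "smooth_on \<sigma> W"
    using assms unfolding local_param_def by auto
  then have "smooth_on (\<lambda>u. - \<sigma> u) W"
    by (rule smooth_on_minus)
  moreover have "inj (frechet_derivative (\<lambda>u. - \<sigma> u) (at u))" if "u \<in> W" for u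
  proof -
    have "((\<lambda>u. - \<sigma> u) has_derivative (\<lambda>v. - frechet_derivative \<sigma> (at u) v)) (at u)"
      using smooth_on_has_derivative[OF \<open>smooth_on \<sigma> W\<close> that] by (rule has_derivative_minus)
    then have "frechet_derivative (\<lambda>u. - \<sigma> u) (at u) = (\<lambda>v. - frechet_derivative \<sigma> (at u) v)"
      using frechet_derivative_at by metis
    moreover have "inj (frechet_derivative \<sigma> (at u))"
      using assms that unfolding local_param_def by auto
    ultimately show ?thesis
      by (simp add: inj_def)
  qed
  moreover have "proj \<circ> (\<lambda>u. - \<sigma> u) = proj \<circ> \<sigma>"
    by (simp add: fun_eq_iff proj_minus)
  moreover have "- x \<in> AdS_hat" if "x \<in> AdS_hat" for x
    using that by (simp add: AdS_hat_def form_simps)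
  ultimately show ?thesis
    using assms unfolding local_param_def by (auto simp: image_subset_iff)
qed

lemma deriv_along_eqI:
  assumes "(f has_derivative f') (at u)"
  shows "deriv_along E f u = f' (E u)"
  unfolding deriv_along_def using frechet_derivative_at[OF assms] by simp

lemma deriv_along_cong:
  assumes "open W" "u \<in> W" "\<And>x. x \<in> W \<Longrightarrow> f x = g x" "smooth_on f W"
  shows "deriv_along E g u = deriv_along E f u"
proof -
  have "(g has_derivative frechet_derivative f (at u)) (at u)"
    by (rule has_derivative_transform_within_open[OF smooth_on_has_derivative[OF assms(4,2)] assms(1,2)])
      (use assms(3) in auto)
  then show ?thesis
    by (simp add: deriv_along_eqI) (simp add: deriv_along_def)
qed

lemma deriv_along_bilinear:
  assumes "bounded_bilinear B" "smooth_on f W" "smooth_on g W" "u \<in> W"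
  shows "deriv_along E (\<lambda>x. B (f x) (g x)) u = B (f u) (deriv_along E g u) + B (deriv_along E f u) (g u)"
  by (subst deriv_along_eqI[OF bounded_bilinear.FDERIV[OF assms(1)]])
    (use assms smooth_on_has_derivative in \<open>auto simp: deriv_along_def\<close>)

lemma deriv_along_add:
  assumes "smooth_on f W" "smooth_on g W" "u \<in> W"
  shows "deriv_along E (\<lambda>x. f x + g x) u = deriv_along E f u + deriv_along E g u"
  by (subst deriv_along_eqI[OF has_derivative_add])
    (use assms smooth_on_has_derivative in \<open>auto simp: deriv_along_def\<close>)

lemma deriv_along_diff:
  assumes "smooth_on f W" "smooth_on g W" "u \<in> W"
  shows "deriv_along E (\<lambda>x. f x - g x) u = deriv_along E f u - deriv_along E g u"
  by (subst deriv_along_eqI[OF has_derivative_diff])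
    (use assms smooth_on_has_derivative in \<open>auto simp: deriv_along_def\<close>)

lemma deriv_along_const: "deriv_along E (\<lambda>x. c) u = 0"
  by (simp add: deriv_along_eqI[OF has_derivative_const])

lemma deriv_along_comb:
  fixes f :: "real ^ 2 \<Rightarrow> 'b::real_normed_vector"
  assumes "smooth_on f W" "u \<in> W"
  shows "frechet_derivative f (at u) (a *\<^sub>R E u + b *\<^sub>R F u) = a *\<^sub>R deriv_along E f u + b *\<^sub>R deriv_along F f u"
proof -
  have lin: "linear (frechet_derivative f (at u))"
    using smooth_on_has_derivative[OF assms] has_derivative_linear by auto
  show ?thesis
    by (simp add: deriv_along_def linear_add[OF lin] linear_scale[OF lin])
qed

lemma deriv_along_coords:
  assumes "smooth_on f W" "u \<in> W"
  shows "deriv_along E f u = E u $ 1 *\<^sub>R frechet_derivative f (at u) (axis 1 1)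
    + E u $ 2 *\<^sub>R frechet_derivative f (at u) (axis 2 1)"
proof -
  have lin: "linear (frechet_derivative f (at u))"
    using smooth_on_has_derivative[OF assms] has_derivative_linear by auto
  show ?thesis
    unfolding deriv_along_def linear_scale[OF lin, symmetric] linear_add[OF lin, symmetric]
    by (simp only: vec2_eq[symmetric])
qed

text \<open>The commutator of two derivations is the derivation along the bracket of the fields.
  Symmetry of the second derivative is a hypothesis so that one proof serves vector-valued and real
  functions.\<close>

lemma deriv_along_commute_aux:
  fixes f :: "real ^ 2 \<Rightarrow> 'b::real_normed_vector"
  assumes W: "open W" "u \<in> W" and f: "smooth_on f W" and E: "smooth_on E W" and F: "smooth_on F W"
    and symmetric: "frechet_derivative (\<lambda>y. frechet_derivative f (at y) (axis 1 1)) (at u) (axis 2 1) =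
      frechet_derivative (\<lambda>y. frechet_derivative f (at y) (axis 2 1)) (at u) (axis 1 1)"
  shows "deriv_along E (deriv_along F f) u - deriv_along F (deriv_along E f) u =
    frechet_derivative f (at u) (deriv_along E F u - deriv_along F E u)"
proof -
  define f1 f2 where "f1 x = frechet_derivative f (at x) (axis 1 1)"
    and "f2 x = frechet_derivative f (at x) (axis 2 1)" for x
  have sm: "smooth_on f1 W" "smooth_on f2 W"
    unfolding f1_def f2_def by (rule smooth_on_frechet[OF f])+
  have step: "deriv_along E (deriv_along F f) u = F u $ 1 *\<^sub>R deriv_along E f1 u + deriv_along E F u $ 1 *\<^sub>R f1 u
      + (F u $ 2 *\<^sub>R deriv_along E f2 u + deriv_along E F u $ 2 *\<^sub>R f2 u)"
    if E: "smooth_on E W" and F: "smooth_on F W" for E F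
  proof -
    have nth: "deriv_along E (\<lambda>x. F x $ i) u = deriv_along E F u $ i" for i
      by (simp add: deriv_along_eqI[OF bounded_linear.has_derivative[OF bounded_linear_vec_nth
              smooth_on_has_derivative[OF F W(2)]]]) (simp add: deriv_along_def)
    note Fi = smooth_on_nth[OF W(1) F]
    have "deriv_along E (deriv_along F f) u = deriv_along E (\<lambda>x. F x $ 1 *\<^sub>R f1 x + F x $ 2 *\<^sub>R f2 x) u"
      by (intro deriv_along_cong[OF W])
        (auto intro!: smooth_on_deriv_along W F f smooth_on_add smooth_on_scaleR Fi smooth_on_frechet[OF f] simp: deriv_along_coords[OF f] f1_def f2_def)
    also have "\<dots> = deriv_along E (\<lambda>x. F x $ 1 *\<^sub>R f1 x) u + deriv_along E (\<lambda>x. F x $ 2 *\<^sub>R f2 x) u"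
      by (intro deriv_along_add[OF _ _ W(2)] smooth_on_scaleR W Fi sm)
    also have "\<dots> = F u $ 1 *\<^sub>R deriv_along E f1 u + deriv_along E F u $ 1 *\<^sub>R f1 u
      + (F u $ 2 *\<^sub>R deriv_along E f2 u + deriv_along E F u $ 2 *\<^sub>R f2 u)"
      by (simp add: deriv_along_bilinear[OF bounded_bilinear_scaleR Fi sm(1) W(2)]
          deriv_along_bilinear[OF bounded_bilinear_scaleR Fi sm(2) W(2)] nth)
    finally show ?thesis .
  qed
  have sym: "frechet_derivative f1 (at u) (axis 2 1) = frechet_derivative f2 (at u) (axis 1 1)"
    unfolding f1_def f2_def by (rule symmetric)
  have lin: "linear (frechet_derivative f (at u))"
    using smooth_on_has_derivative[OF f W(2)] has_derivative_linear by auto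
  let ?v = "deriv_along E F u - deriv_along F E u"
  have "frechet_derivative f (at u) ?v = ?v $ 1 *\<^sub>R f1 u + ?v $ 2 *\<^sub>R f2 u"
    unfolding f1_def f2_def linear_scale[OF lin, symmetric] linear_add[OF lin, symmetric]
    by (simp only: vec2_eq[symmetric])
  then show ?thesis
    unfolding step[OF E F] step[OF F E] deriv_along_coords[OF sm(1) W(2)] deriv_along_coords[OF sm(2) W(2)] sym
    by (simp add: algebra_simps)
qed

lemma deriv_along_commute:
  fixes f :: "real ^ 2 \<Rightarrow> real ^ 'n"
  assumes "open W" "u \<in> W" "smooth_on f W" "smooth_on E W" "smooth_on F W"
  shows "deriv_along E (deriv_along F f) u - deriv_along F (deriv_along E f) u =
    frechet_derivative f (at u) (deriv_along E F u - deriv_along F E u)"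
  using deriv_along_commute_aux[OF assms second_derivative_symmetric[OF assms(1,3,2)]] .

lemma deriv_along_commute_real:
  fixes f :: "real ^ 2 \<Rightarrow> real"
  assumes "open W" "u \<in> W" "smooth_on f W" "smooth_on E W" "smooth_on F W"
  shows "deriv_along E (deriv_along F f) u - deriv_along F (deriv_along E f) u =
    frechet_derivative f (at u) (deriv_along E F u - deriv_along F E u)"
  using deriv_along_commute_aux[OF assms second_derivative_real_symmetric[OF assms(1,3,2)]] .

section \<open>Structure equations of a maximal surface in a moving frame\<close>

locale moving_frame =
  fixes W :: "(real ^ 2) set" and \<sigma> e1 e2 N :: "real ^ 2 \<Rightarrow> real ^ 4" and E1 E2 :: "real ^ 2 \<Rightarrow> real ^ 2"
  assumes open_W: "open W"
    and smooth_\<sigma>: "smooth_on \<sigma> W" and smooth_N: "smooth_on N W"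
    and smooth_E1: "smooth_on E1 W" and smooth_E2: "smooth_on E2 W"
    and frame: "u \<in> W \<Longrightarrow> orthoframe (\<sigma> u) (e1 u) (e2 u) (N u)"
    and e1: "e1 = deriv_along E1 \<sigma>" and e2: "e2 = deriv_along E2 \<sigma>"
    and trace_free: "u \<in> W \<Longrightarrow> form (deriv_along E1 N u) (e1 u) + form (deriv_along E2 N u) (e2 u) = 0"
begin

abbreviation "D1 \<equiv> deriv_along E1"
abbreviation "D2 \<equiv> deriv_along E2"

text \<open>\<open>\<omega>1\<close> and \<open>\<omega>2\<close> are the coefficients of the
  Levi-Civita connection in the frame. \<open>\<alpha>\<close> and \<open>\<beta>\<close> are the
  entries of the shape operator, whose matrix will be ((\<alpha>, \<beta>), (\<beta>, -\<alpha>)),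
  so that \<lambda>^2 = \<alpha>^2 + \<beta>^2.\<close>

definition "\<omega>1 u = form (D1 e1 u) (e2 u)"
definition "\<omega>2 u = form (D2 e1 u) (e2 u)"
definition "\<alpha> u = form (D1 N u) (e1 u)"
definition "\<beta> u = form (D1 N u) (e2 u)"

lemma smooth_e1: "smooth_on e1 W" and smooth_e2: "smooth_on e2 W"
  unfolding e1 e2 by (intro smooth_on_deriv_along open_W smooth_E1 smooth_E2 smooth_\<sigma>)+

lemma smooth_coeffs: "smooth_on \<omega>1 W" "smooth_on \<omega>2 W" "smooth_on \<alpha> W" "smooth_on \<beta> W"
  unfolding \<omega>1_def[abs_def] \<omega>2_def[abs_def] \<alpha>_def[abs_def] \<beta>_def[abs_def]
  by (intro smooth_on_form smooth_on_deriv_along open_W smooth_E1 smooth_E2 smooth_e1 smooth_e2 smooth_N)+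

lemma gram:
  assumes "u \<in> W"
  shows "form (\<sigma> u) (\<sigma> u) = -1" "form (e1 u) (e1 u) = 1" "form (e2 u) (e2 u) = 1" "form (N u) (N u) = -1"
    "form (\<sigma> u) (e1 u) = 0" "form (\<sigma> u) (e2 u) = 0" "form (\<sigma> u) (N u) = 0"
    "form (e1 u) (\<sigma> u) = 0" "form (e2 u) (\<sigma> u) = 0" "form (N u) (\<sigma> u) = 0"
    "form (e1 u) (e2 u) = 0" "form (e1 u) (N u) = 0" "form (e2 u) (N u) = 0"
    "form (e2 u) (e1 u) = 0" "form (N u) (e1 u) = 0" "form (N u) (e2 u) = 0"
  using frame[OF assms] unfolding orthoframe_def by (simp_all add: form_commute)

lemma deriv_form_const:
  assumes "smooth_on f W" "smooth_on g W" "u \<in> W" "\<And>x. x \<in> W \<Longrightarrow> form (f x) (g x) = c"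
  shows "form (deriv_along E f u) (g u) = - form (f u) (deriv_along E g u)"
proof -
  have "deriv_along E (\<lambda>x. form (f x) (g x)) u = deriv_along E (\<lambda>x. c) u"
    by (rule deriv_along_cong[OF open_W assms(3) _ smooth_on_const]) (use assms(4) in auto)
  then show ?thesis
    using deriv_along_bilinear[OF bounded_bilinear_form assms(1,2,3), of E]
    by (simp add: deriv_along_const)
qed

lemma basis_E:
  assumes "u \<in> W"
  shows "\<exists>a b. v = a *\<^sub>R E1 u + b *\<^sub>R E2 u"
proof -
  define d where "d = E1 u $ 1 * E2 u $ 2 - E1 u $ 2 * E2 u $ 1"
  have lin: "linear (frechet_derivative \<sigma> (at u))"
    using smooth_on_has_derivative[OF smooth_\<sigma> assms] has_derivative_linear by auto
  have ind: "a = 0 \<and> b = 0" if "a *\<^sub>R E1 u + b *\<^sub>R E2 u = 0" for a b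
  proof -
    have "a *\<^sub>R e1 u + b *\<^sub>R e2 u = 0"
      using deriv_along_comb[OF smooth_\<sigma> assms, of a E1 b E2] that
      by (simp add: e1 e2 linear_0[OF lin])
    then have "form (a *\<^sub>R e1 u + b *\<^sub>R e2 u) (e1 u) = 0" "form (a *\<^sub>R e1 u + b *\<^sub>R e2 u) (e2 u) = 0"
      by (simp_all add: form.zero_left)
    then show ?thesis
      using gram[OF assms] by (simp add: form_simps)
  qed
  have "d \<noteq> 0"
  proof
    assume d: "d = 0"
    have "E1 u $ 1 = 0" "E1 u $ 2 = 0"
      using ind[of "E2 u $ 1" "- E1 u $ 1"] ind[of "E2 u $ 2" "- E1 u $ 2"] d
      by (auto simp: vec_eq_iff forall_2 d_def algebra_simps)
    then have "E1 u = 0"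
      by (simp add: vec_eq_iff forall_2)
    then show False
      using ind[of 1 0] by simp
  qed
  then have "v = ((v $ 1 * E2 u $ 2 - v $ 2 * E2 u $ 1) / d) *\<^sub>R E1 u + ((E1 u $ 1 * v $ 2 - E1 u $ 2 * v $ 1) / d) *\<^sub>R E2 u"
    by (simp add: vec_eq_iff forall_2 add_divide_distrib[symmetric] eq_divide_eq) (simp add: d_def algebra_simps)
  then show ?thesis
    by blast
qed

lemma expand: "u \<in> W \<Longrightarrow> z = form z (e1 u) *\<^sub>R e1 u + form z (e2 u) *\<^sub>R e2 u - form z (\<sigma> u) *\<^sub>R \<sigma> u - form z (N u) *\<^sub>R N u"
  using orthoframe_expand[OF frame] .

lemma expandI:
  assumes "u \<in> W" "form z (e1 u) = a" "form z (e2 u) = b" "form z (\<sigma> u) = c" "form z (N u) = d"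
  shows "z = a *\<^sub>R e1 u + b *\<^sub>R e2 u - c *\<^sub>R \<sigma> u - d *\<^sub>R N u"
  using expand[OF assms(1)] assms by metis

text \<open>Both parts come from \<open>D1 e2 - D2 e1\<close>, the commutator of the two derivations
  on \<open>\<sigma>\<close>. Its tangential part expresses that the connection has no torsion; the
  absence of a normal part is the symmetry of the shape operator.\<close>

lemma bracket:
  assumes "u \<in> W"
  shows "D1 E2 u - D2 E1 u = - (\<omega>1 u *\<^sub>R E1 u) - \<omega>2 u *\<^sub>R E2 u"
    and "form (D2 N u) (e1 u) = \<beta> u"
proof -
  note c = deriv_form_const[OF _ _ assms]
  note g = gram
  obtain a b where ab: "D1 E2 u - D2 E1 u = a *\<^sub>R E1 u + b *\<^sub>R E2 u"
    using basis_E[OF assms] by blast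
  have "D1 e2 u - D2 e1 u = a *\<^sub>R e1 u + b *\<^sub>R e2 u"
    using deriv_along_commute[OF open_W assms smooth_\<sigma> smooth_E1 smooth_E2]
    unfolding ab deriv_along_comb[OF smooth_\<sigma> assms] e1[symmetric] e2[symmetric] .
  then have f: "form (D1 e2 u) z - form (D2 e1 u) z = a * form (e1 u) z + b * form (e2 u) z" for z
    by (metis form.add_left form.diff_left form.scaleR_left real_scaleR_def)
  have "form (D1 e2 u) (e1 u) = - \<omega>1 u"
    using c[OF smooth_e2 smooth_e1 g(14), of E1] by (simp add: \<omega>1_def form_commute)
  moreover have "form (D2 e1 u) (e1 u) = 0" "form (D1 e2 u) (e2 u) = 0"
    using c[OF smooth_e1 smooth_e1 g(2), of E2] c[OF smooth_e2 smooth_e2 g(3), of E1]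
    by (simp_all add: form_commute)
  ultimately have "a = - \<omega>1 u" "b = - \<omega>2 u"
    using f[of "e1 u"] f[of "e2 u"] gram[OF assms] by (simp_all add: \<omega>2_def)
  then show "D1 E2 u - D2 E1 u = - (\<omega>1 u *\<^sub>R E1 u) - \<omega>2 u *\<^sub>R E2 u"
    using ab by simp
  have "form (D1 e2 u) (N u) = - \<beta> u" "form (D2 e1 u) (N u) = - form (D2 N u) (e1 u)"
    using c[OF smooth_e2 smooth_N g(13), of E1] c[OF smooth_e1 smooth_N g(12), of E2]
    by (simp_all add: \<beta>_def form_commute)
  then show "form (D2 N u) (e1 u) = \<beta> u"
    using f[of "N u"] gram[OF assms] by simp
qed

text \<open>The Gauss-Weingarten equations. Each coefficient is found by differentiating one of the
  constant products of the frame. The term \<open>\<sigma> u\<close> is the second fundamental form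
  of \<open>AdS_hat\<close> in the flat space, and \<open>trace_free\<close> makes the second
  diagonal entry of the shape operator -\<alpha>.\<close>

lemma frame_equations:
  assumes "u \<in> W"
  shows "D1 e1 u = \<sigma> u + \<omega>1 u *\<^sub>R e2 u + \<alpha> u *\<^sub>R N u"
    and "D1 e2 u = - (\<omega>1 u *\<^sub>R e1 u) + \<beta> u *\<^sub>R N u"
    and "D2 e1 u = \<omega>2 u *\<^sub>R e2 u + \<beta> u *\<^sub>R N u"
    and "D2 e2 u = \<sigma> u - \<omega>2 u *\<^sub>R e1 u - \<alpha> u *\<^sub>R N u"
    and "D1 N u = \<alpha> u *\<^sub>R e1 u + \<beta> u *\<^sub>R e2 u"
    and "D2 N u = \<beta> u *\<^sub>R e1 u - \<alpha> u *\<^sub>R e2 u"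
proof -
  note c = deriv_form_const[OF _ _ assms]
  note g = gram
  have D\<sigma>: "D1 \<sigma> u = e1 u" "D2 \<sigma> u = e2 u"
    by (simp_all add: e1 e2)
  have N2: "form (D2 N u) (e2 u) = - \<alpha> u"
    using trace_free[OF assms] by (simp add: \<alpha>_def)
  have a: "form (D1 N u) (e1 u) = \<alpha> u" "form (D1 N u) (e2 u) = \<beta> u"
    by (simp_all add: \<alpha>_def \<beta>_def)
  have o: "form (D1 e1 u) (e2 u) = \<omega>1 u" "form (D2 e1 u) (e2 u) = \<omega>2 u"
    by (simp_all add: \<omega>1_def \<omega>2_def)
  show "D1 e1 u = \<sigma> u + \<omega>1 u *\<^sub>R e2 u + \<alpha> u *\<^sub>R N u"
  proof -
    have "form (D1 e1 u) (e1 u) = 0"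
      "form (D1 e1 u) (e2 u) = \<omega>1 u"
      "form (D1 e1 u) (\<sigma> u) = -1"
      "form (D1 e1 u) (N u) = - \<alpha> u"
      using c[OF smooth_e1 smooth_\<sigma> g(8), of E1]
      c[OF smooth_e1 smooth_e1 g(2), of E1] c[OF smooth_e1 smooth_N g(12), of E1]
      by (simp_all add: D\<sigma> gram[OF assms] a o form_commute[of "e1 u" "deriv_along E f u" for E f])
    from expandI[OF assms this] show ?thesis
      by simp
  qed
  show "D1 e2 u = - (\<omega>1 u *\<^sub>R e1 u) + \<beta> u *\<^sub>R N u"
  proof -
    have "form (D1 e2 u) (e1 u) = - \<omega>1 u"
      "form (D1 e2 u) (e2 u) = 0"
      "form (D1 e2 u) (\<sigma> u) = 0"
      "form (D1 e2 u) (N u) = - \<beta> u"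
      using c[OF smooth_e2 smooth_\<sigma> g(9), of E1]
      c[OF smooth_e2 smooth_e2 g(3), of E1] c[OF smooth_e2 smooth_N g(13), of E1]
      c[OF smooth_e2 smooth_e1 g(14), of E1]
      by (simp_all add: D\<sigma> gram[OF assms] a o form_commute[of "e2 u" "deriv_along E f u" for E f])
    from expandI[OF assms this] show ?thesis
      by simp
  qed
  show "D2 e1 u = \<omega>2 u *\<^sub>R e2 u + \<beta> u *\<^sub>R N u"
  proof -
    have "form (D2 e1 u) (e1 u) = 0"
      "form (D2 e1 u) (e2 u) = \<omega>2 u"
      "form (D2 e1 u) (\<sigma> u) = 0"
      "form (D2 e1 u) (N u) = - \<beta> u"
      using c[OF smooth_e1 smooth_\<sigma> g(8), of E2]
      c[OF smooth_e1 smooth_e1 g(2), of E2] c[OF smooth_e1 smooth_N g(12), of E2] bracket(2)[OF assms]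
      by (simp_all add: D\<sigma> gram[OF assms] a o form_commute[of "e1 u" "deriv_along E f u" for E f])
    from expandI[OF assms this] show ?thesis
      by simp
  qed
  show "D2 e2 u = \<sigma> u - \<omega>2 u *\<^sub>R e1 u - \<alpha> u *\<^sub>R N u"
  proof -
    have "form (D2 e2 u) (e1 u) = - \<omega>2 u"
      "form (D2 e2 u) (e2 u) = 0"
      "form (D2 e2 u) (\<sigma> u) = -1"
      "form (D2 e2 u) (N u) = \<alpha> u"
      using c[OF smooth_e2 smooth_\<sigma> g(9), of E2]
      c[OF smooth_e2 smooth_e2 g(3), of E2] c[OF smooth_e2 smooth_N g(13), of E2]
      c[OF smooth_e2 smooth_e1 g(14), of E2]
      by (simp_all add: D\<sigma> gram[OF assms] N2 o form_commute[of "e2 u" "deriv_along E f u" for E f])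
    from expandI[OF assms this] show ?thesis
      by simp
  qed
  show "D1 N u = \<alpha> u *\<^sub>R e1 u + \<beta> u *\<^sub>R e2 u"
  proof -
    have "form (D1 N u) (e1 u) = \<alpha> u"
      "form (D1 N u) (e2 u) = \<beta> u"
      "form (D1 N u) (\<sigma> u) = 0"
      "form (D1 N u) (N u) = 0"
      using c[OF smooth_N smooth_\<sigma> g(10), of E1]
      c[OF smooth_N smooth_N g(4), of E1]
      by (simp_all add: D\<sigma> gram[OF assms] a form_commute[of "N u" "deriv_along E f u" for E f])
    from expandI[OF assms this] show ?thesis
      by simp
  qed
  show "D2 N u = \<beta> u *\<^sub>R e1 u - \<alpha> u *\<^sub>R e2 u"
  proof -
    have "form (D2 N u) (e1 u) = \<beta> u"
      "form (D2 N u) (e2 u) = - \<alpha> u"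
      "form (D2 N u) (\<sigma> u) = 0"
      "form (D2 N u) (N u) = 0"
      using c[OF smooth_N smooth_\<sigma> g(10), of E2]
      c[OF smooth_N smooth_N g(4), of E2] bracket(2)[OF assms]
      by (simp_all add: D\<sigma> gram[OF assms] N2 form_commute[of "N u" "deriv_along E f u" for E f])
    from expandI[OF assms this] show ?thesis
      by simp
  qed
qed

lemma commutator:
  fixes f :: "real ^ 2 \<Rightarrow> real ^ 'n"
  assumes "u \<in> W" "smooth_on f W"
  shows "D1 (D2 f) u - D2 (D1 f) u = - (\<omega>1 u *\<^sub>R D1 f u) - \<omega>2 u *\<^sub>R D2 f u"
  unfolding deriv_along_commute[OF open_W assms smooth_E1 smooth_E2] bracket(1)[OF assms(1)]
  using deriv_along_comb[OF assms(2,1), of "- \<omega>1 u" E1 "- \<omega>2 u" E2] by simp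

lemma commutator_real:
  fixes f :: "real ^ 2 \<Rightarrow> real"
  assumes "u \<in> W" "smooth_on f W"
  shows "D1 (D2 f) u - D2 (D1 f) u = - \<omega>1 u * D1 f u - \<omega>2 u * D2 f u"
  unfolding deriv_along_commute_real[OF open_W assms smooth_E1 smooth_E2] bracket(1)[OF assms(1)]
  using deriv_along_comb[OF assms(2,1), of "- \<omega>1 u" E1 "- \<omega>2 u" E2] by simp

text \<open>The Codazzi equations are the \<open>e1\<close> and \<open>e2\<close> components of the
  commutator formula applied to \<open>N\<close>.\<close>

lemma codazzi:
  assumes u: "u \<in> W"
  shows "D2 \<alpha> u - D1 \<beta> u = 2 * (\<alpha> u * \<omega>1 u + \<beta> u * \<omega>2 u)"
    and "D1 \<alpha> u + D2 \<beta> u = 2 * (\<beta> u * \<omega>1 u - \<alpha> u * \<omega>2 u)"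
proof -
  note sc = smooth_on_scaleR[OF open_W]
  have 1: "D1 (D2 N) u = \<beta> u *\<^sub>R D1 e1 u + D1 \<beta> u *\<^sub>R e1 u - (\<alpha> u *\<^sub>R D1 e2 u + D1 \<alpha> u *\<^sub>R e2 u)"
    by (subst deriv_along_cong[OF open_W u frame_equations(6)[symmetric]])
      (auto simp: deriv_along_diff[OF sc sc u] smooth_coeffs smooth_e1 smooth_e2
        deriv_along_bilinear[OF bounded_bilinear_scaleR _ _ u] intro!: sc smooth_on_diff open_W)
  have 2: "D2 (D1 N) u = \<alpha> u *\<^sub>R D2 e1 u + D2 \<alpha> u *\<^sub>R e1 u + (\<beta> u *\<^sub>R D2 e2 u + D2 \<beta> u *\<^sub>R e2 u)"
    by (subst deriv_along_cong[OF open_W u frame_equations(5)[symmetric]])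
      (auto simp: deriv_along_add[OF sc sc u] smooth_coeffs smooth_e1 smooth_e2
        deriv_along_bilinear[OF bounded_bilinear_scaleR _ _ u] intro!: sc smooth_on_add open_W)
  note C = commutator[OF u smooth_N, unfolded 1 2 frame_equations[OF u]]
  show "D2 \<alpha> u - D1 \<beta> u = 2 * (\<alpha> u * \<omega>1 u + \<beta> u * \<omega>2 u)"
    using arg_cong[OF C, of "\<lambda>z. form z (e1 u)"] gram[OF u] by (simp add: form_simps algebra_simps)
  show "D1 \<alpha> u + D2 \<beta> u = 2 * (\<beta> u * \<omega>1 u - \<alpha> u * \<omega>2 u)"
    using arg_cong[OF C, of "\<lambda>z. form z (e2 u)"] gram[OF u] by (simp add: form_simps algebra_simps)
qed

text \<open>The Gauss equation, for a surface of curvature \<lambda>^2 - 1, is the \<open>e2\<close>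
  component of the commutator formula applied to \<open>e1\<close>.\<close>

lemma gauss:
  assumes u: "u \<in> W"
  shows "D1 \<omega>2 u - D2 \<omega>1 u = 1 - (\<alpha> u)\<^sup>2 - (\<beta> u)\<^sup>2 - (\<omega>1 u)\<^sup>2 - (\<omega>2 u)\<^sup>2"
proof -
  note sc = smooth_on_scaleR[OF open_W]
  have 1: "D1 (D2 e1) u = \<omega>2 u *\<^sub>R D1 e2 u + D1 \<omega>2 u *\<^sub>R e2 u + (\<beta> u *\<^sub>R D1 N u + D1 \<beta> u *\<^sub>R N u)"
    by (subst deriv_along_cong[OF open_W u frame_equations(3)[symmetric]])
      (auto simp: deriv_along_add[OF sc sc u] smooth_coeffs smooth_e1 smooth_e2 smooth_N
        deriv_along_bilinear[OF bounded_bilinear_scaleR _ _ u] intro!: sc smooth_on_add open_W)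
  have 2: "D2 (D1 e1) u = e2 u + (\<omega>1 u *\<^sub>R D2 e2 u + D2 \<omega>1 u *\<^sub>R e2 u) + (\<alpha> u *\<^sub>R D2 N u + D2 \<alpha> u *\<^sub>R N u)"
    by (subst deriv_along_cong[OF open_W u frame_equations(1)[symmetric]])
      (auto simp: deriv_along_add[OF smooth_on_add[OF open_W smooth_\<sigma> sc] sc u] deriv_along_add[OF smooth_\<sigma> sc u]
        smooth_coeffs smooth_e1 smooth_e2 smooth_N smooth_\<sigma> e2[symmetric]
        deriv_along_bilinear[OF bounded_bilinear_scaleR _ _ u] intro!: sc smooth_on_add open_W)
  note C = commutator[OF u smooth_e1, unfolded 1 2 frame_equations[OF u]]
  show ?thesis
    using arg_cong[OF C, of "\<lambda>z. form z (e2 u)"] gram[OF u]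
    by (simp add: form_simps power2_eq_square algebra_simps)
qed

end

section \<open>Frames, unit normals and shape operators of local parametrisations\<close>

lemma local_paramD:
  assumes "local_param S W \<sigma>"
  shows "open W" "smooth_on \<sigma> W" "u \<in> W \<Longrightarrow> form (\<sigma> u) (\<sigma> u) = -1"
    "u \<in> W \<Longrightarrow> inj (frechet_derivative \<sigma> (at u))"
    "u \<in> W \<Longrightarrow> form (\<sigma> u) (frechet_derivative \<sigma> (at u) v) = 0"
    "u \<in> W \<Longrightarrow> linear (frechet_derivative \<sigma> (at u))"
proof -
  show W: "open W" and s: "smooth_on \<sigma> W"
    using assms unfolding local_param_def by auto
  show n: "form (\<sigma> u) (\<sigma> u) = -1" if "u \<in> W" for u
    using assms that unfolding local_param_def AdS_hat_def by auto
  show "inj (frechet_derivative \<sigma> (at u))" if "u \<in> W"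
    using assms that unfolding local_param_def by auto
  show "linear (frechet_derivative \<sigma> (at u))" if "u \<in> W"
    using smooth_on_has_derivative[OF s that] has_derivative_linear by auto
  show "form (\<sigma> u) (frechet_derivative \<sigma> (at u) v) = 0" if u: "u \<in> W"
  proof -
    have "deriv_along (\<lambda>_. v) (\<lambda>x. form (\<sigma> x) (\<sigma> x)) u = deriv_along (\<lambda>_. v) (\<lambda>x. -1) u"
      by (rule deriv_along_cong[OF W u _ smooth_on_const]) (use n in auto)
    then have "form (\<sigma> u) (deriv_along (\<lambda>_. v) \<sigma> u) + form (deriv_along (\<lambda>_. v) \<sigma> u) (\<sigma> u) = 0"
      using deriv_along_bilinear[OF bounded_bilinear_form s s u, of "\<lambda>_. v"] by (simp add: deriv_along_const)
    then show ?thesis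
      using form_commute[of "deriv_along (\<lambda>_. v) \<sigma> u" "\<sigma> u"] by (simp add: deriv_along_def)
  qed
qed

text \<open>Gram-Schmidt applied to the coordinate fields. The normalising factors are powers with
  exponent -1/2 of the squared lengths \<open>g11\<close> and \<open>g11 * d\<close>, hence
  smooth.\<close>

lemma ex_orthonormal_fields:
  assumes lp: "local_param S W \<sigma>"
    and sp: "\<And>u v. u \<in> W \<Longrightarrow> v \<noteq> 0 \<Longrightarrow> form (frechet_derivative \<sigma> (at u) v) (frechet_derivative \<sigma> (at u) v) > 0"
  obtains E1 E2 where "smooth_on E1 W" "smooth_on E2 W"
    "\<And>u. u \<in> W \<Longrightarrow> form (deriv_along E1 \<sigma> u) (deriv_along E1 \<sigma> u) = 1"
    "\<And>u. u \<in> W \<Longrightarrow> form (deriv_along E2 \<sigma> u) (deriv_along E2 \<sigma> u) = 1"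
    "\<And>u. u \<in> W \<Longrightarrow> form (deriv_along E1 \<sigma> u) (deriv_along E2 \<sigma> u) = 0"
proof -
  note W = local_paramD(1)[OF lp] and s = local_paramD(2)[OF lp] and lin = local_paramD(6)[OF lp]
  define s1 s2 where "s1 u = frechet_derivative \<sigma> (at u) (axis 1 1)"
    and "s2 u = frechet_derivative \<sigma> (at u) (axis 2 1)" for u
  define g11 g12 g22 where "g11 u = form (s1 u) (s1 u)" and "g12 u = form (s1 u) (s2 u)"
    and "g22 u = form (s2 u) (s2 u)" for u
  define d where "d u = g11 u * g22 u - g12 u * g12 u" for u
  define E1 E2 :: "real ^ 2 \<Rightarrow> real ^ 2" where "E1 u = (g11 u powr (-1/2)) *\<^sub>R axis 1 1"
    and "E2 u = ((g11 u * d u) powr (-1/2)) *\<^sub>R (g11 u *\<^sub>R axis 2 1 - g12 u *\<^sub>R axis 1 1)" for u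
  have sms: "smooth_on s1 W" "smooth_on s2 W"
    unfolding s1_def[abs_def] s2_def[abs_def] by (rule smooth_on_frechet[OF s])+
  have smg: "smooth_on g11 W" "smooth_on g12 W" "smooth_on g22 W"
    unfolding g11_def[abs_def] g12_def[abs_def] g22_def[abs_def] by (intro smooth_on_form W sms)+
  have smd: "smooth_on d W"
    unfolding d_def[abs_def] by (intro smooth_on_diff smooth_on_mult W smg)
  have p1: "g11 u > 0" if "u \<in> W" for u
    using sp[OF that, of "axis 1 1"] by (simp add: g11_def s1_def axis_eq_0_iff)
  have gd: "form (g11 u *\<^sub>R s2 u - g12 u *\<^sub>R s1 u) (g11 u *\<^sub>R s2 u - g12 u *\<^sub>R s1 u) = g11 u * d u" for u
    by (simp add: form_simps g11_def g12_def g22_def d_def form_commute[of "s2 u" "s1 u"] algebra_simps)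
  have image: "frechet_derivative \<sigma> (at u) (g11 u *\<^sub>R axis 2 1 - g12 u *\<^sub>R axis 1 1) = g11 u *\<^sub>R s2 u - g12 u *\<^sub>R s1 u"
    if "u \<in> W" for u
    by (simp add: s1_def s2_def linear_diff[OF lin[OF that]] linear_scale[OF lin[OF that]])
  have pd: "g11 u * d u > 0" if "u \<in> W" for u
  proof -
    have "(g11 u *\<^sub>R axis 2 1 - g12 u *\<^sub>R axis 1 1 :: real ^ 2) $ 2 \<noteq> 0"
      using p1[OF that] by (simp add: axis_def)
    then have "(g11 u *\<^sub>R axis 2 1 - g12 u *\<^sub>R axis 1 1 :: real ^ 2) \<noteq> 0"
      by (metis zero_index)
    from sp[OF that this] show ?thesis
      unfolding image[OF that] gd .
  qed
  have e1: "deriv_along E1 \<sigma> u = (g11 u powr (-1/2)) *\<^sub>R s1 u" if "u \<in> W" for u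
    by (simp add: deriv_along_def E1_def s1_def linear_scale[OF lin[OF that]])
  have e2: "deriv_along E2 \<sigma> u = ((g11 u * d u) powr (-1/2)) *\<^sub>R (g11 u *\<^sub>R s2 u - g12 u *\<^sub>R s1 u)" if "u \<in> W" for u
    by (simp add: deriv_along_def E2_def linear_scale[OF lin[OF that]] image[OF that])
  have pw: "x powr (-1/2) * (x powr (-1/2) * x) = 1" if "x > 0" for x :: real
  proof -
    have "x powr (-1/2) * (x powr (-1/2) * x) = x powr (-1/2) * (x powr (-1/2) * x powr 1)"
      using that by simp
    also have "\<dots> = x powr 0"
      by (simp only: powr_add[symmetric]) simp
    finally show ?thesis
      using that by simp
  qed
  show thesis
  proof
    show "smooth_on E1 W"
      unfolding E1_def[abs_def]
      by (intro smooth_on_scaleR smooth_on_powr smooth_on_const W smg p1)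
    show "smooth_on E2 W"
      unfolding E2_def[abs_def]
      by (intro smooth_on_scaleR smooth_on_powr smooth_on_const smooth_on_diff smooth_on_mult W smg smd pd)
    show "form (deriv_along E1 \<sigma> u) (deriv_along E1 \<sigma> u) = 1" if "u \<in> W" for u
      using pw[OF p1[OF that]] by (simp add: e1[OF that] form.scaleR_left form.scaleR_right g11_def)
    show "form (deriv_along E2 \<sigma> u) (deriv_along E2 \<sigma> u) = 1" if "u \<in> W" for u
      using pw[OF pd[OF that]] by (simp add: e2[OF that] form.scaleR_left form.scaleR_right gd)
    show "form (deriv_along E1 \<sigma> u) (deriv_along E2 \<sigma> u) = 0" if "u \<in> W" for u
      by (simp add: e1[OF that] e2[OF that] form_simps g11_def g12_def)
  qed
qed

text \<open>The spacelike condition for the tangent vector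
  \<open>form a a *\<^sub>R b - form a b *\<^sub>R a\<close> makes the Gram determinant of
  \<open>a\<close> and \<open>b\<close> positive; the vector \<open>\<sigma> u\<close> of square -1,
  orthogonal to both, reverses the sign.\<close>

lemma spacelike_gram_det_pos:
  assumes lp: "local_param S W \<sigma>" and u: "u \<in> W"
    and sp: "\<And>v. v \<noteq> 0 \<Longrightarrow> form (frechet_derivative \<sigma> (at u) v) (frechet_derivative \<sigma> (at u) v) > 0"
  defines "a \<equiv> frechet_derivative \<sigma> (at u) (axis 1 1)" and "b \<equiv> frechet_derivative \<sigma> (at u) (axis 2 1)"
  shows "form (cross4 (\<sigma> u) a b) (cross4 (\<sigma> u) a b) < 0"
proof -
  note lin = local_paramD(6)[OF lp u]
  have a0: "form a a > 0"
    using sp[of "axis 1 1"] by (simp add: a_def axis_eq_0_iff)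
  let ?v = "form a a *\<^sub>R axis 2 1 - form a b *\<^sub>R axis 1 1 :: real ^ 2"
  have "?v $ 2 \<noteq> 0"
    using a0 by (simp add: axis_def)
  then have "?v \<noteq> 0"
    by (metis zero_index)
  moreover have "frechet_derivative \<sigma> (at u) ?v = form a a *\<^sub>R b - form a b *\<^sub>R a"
    by (simp add: linear_diff[OF lin] linear_scale[OF lin] a_def b_def)
  ultimately have "form (form a a *\<^sub>R b - form a b *\<^sub>R a) (form a a *\<^sub>R b - form a b *\<^sub>R a) > 0"
    using sp[of ?v] by simp
  then have "form a a * (form a a * form b b - form a b * form a b) > 0"
    by (simp add: form_simps form_commute[of b a] algebra_simps)
  then have "form a a * form b b - form a b * form a b > 0"
    using a0 by (simp add: zero_less_mult_iff)
  moreover have "form (\<sigma> u) a = 0" "form (\<sigma> u) b = 0"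
    using local_paramD(5)[OF lp u] by (simp_all add: a_def b_def)
  ultimately show ?thesis
    using local_paramD(3)[OF lp u] by (simp add: form_cross4_self)
qed

text \<open>The cross product of \<open>\<sigma>\<close> with the coordinate tangent vectors is
  normal; it remains to normalise it and to adjust its sign by \<open>orient\<close>, both
  smoothly.\<close>

lemma ex_unit_normal:
  assumes lp: "local_param S W \<sigma>"
    and sp: "\<And>u v. u \<in> W \<Longrightarrow> v \<noteq> 0 \<Longrightarrow> form (frechet_derivative \<sigma> (at u) v) (frechet_derivative \<sigma> (at u) v) > 0"
  obtains N where "unit_normal W \<sigma> N" "\<And>u. u \<in> W \<Longrightarrow> orient (\<sigma> u) (N u) > 0"
proof -
  note W = local_paramD(1)[OF lp] and s = local_paramD(2)[OF lp] and lin = local_paramD(6)[OF lp]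
  define s1 s2 where "s1 u = frechet_derivative \<sigma> (at u) (axis 1 1)"
    and "s2 u = frechet_derivative \<sigma> (at u) (axis 2 1)" for u
  define n where "n u = cross4 (\<sigma> u) (s1 u) (s2 u)" for u
  define o' where "o' u = orient (\<sigma> u) (n u)" for u
  have sms: "smooth_on s1 W" "smooth_on s2 W"
    unfolding s1_def[abs_def] s2_def[abs_def] by (rule smooth_on_frechet[OF s])+
  have smn: "smooth_on n W"
    unfolding n_def[abs_def] by (intro smooth_on_cross4 W s sms)
  have smo: "smooth_on o' W"
    unfolding o'_def[abs_def] by (intro smooth_on_orient W s smn)
  have neg: "- form (n u) (n u) > 0" if "u \<in> W" for u
    using spacelike_gram_det_pos[OF lp that sp[OF that]] by (simp add: n_def s1_def s2_def)
  have nort: "form (n u) (\<sigma> u) = 0" "form (n u) (s1 u) = 0" "form (n u) (s2 u) = 0" for u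
    by (simp_all add: n_def form_cross4)
  have o0: "o' u \<noteq> 0" if "u \<in> W" for u
    unfolding o'_def
    by (rule orient_nonzero) (use local_paramD(3)[OF lp that] neg[OF that] nort(1)[of u] in \<open>auto simp: form_commute[of "\<sigma> u" "n u"]\<close>)
  then have o2: "o' u * o' u > 0" if "u \<in> W" for u
    using that by (simp add: zero_less_mult_iff) (metis linorder_neqE_linordered_idom)
  \<comment> \<open>The product of \<open>o' u\<close> with \<open>(o' u * o' u) powr (-1/2)\<close>
    is the sign of \<open>o' u\<close>, written in a form whose smoothness is known.\<close>
  define c where "c u = o' u * ((o' u * o' u) powr (-1/2) * (- form (n u) (n u)) powr (-1/2))" for u
  define N where "N u = c u *\<^sub>R n u" for u
  have smc: "smooth_on c W"
    unfolding c_def[abs_def]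
    by (intro smooth_on_mult smooth_on_powr smooth_on_minus smooth_on_form W smo smn o2 neg)
  have pw: "x powr (-1/2) * x powr (-1/2) = 1 / x" if "x > 0" for x :: real
    by (simp only: powr_add[symmetric]) (use that in \<open>simp add: powr_minus field_simps\<close>)
  have c2: "c u * c u * form (n u) (n u) = -1" if "u \<in> W" for u
  proof -
    have "c u * c u = (o' u * o' u) * ((o' u * o' u) powr (-1/2) * (o' u * o' u) powr (-1/2))
        * ((- form (n u) (n u)) powr (-1/2) * (- form (n u) (n u)) powr (-1/2))"
      by (simp only: c_def mult_ac)
    also have "\<dots> = 1 / (- form (n u) (n u))"
      unfolding pw[OF o2[OF that]] pw[OF neg[OF that]] using o0[OF that] by simp
    finally show ?thesis
      using neg[OF that] by simp
  qed
  have co: "c u * o' u > 0" if "u \<in> W" for u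
  proof -
    have "c u * o' u = (o' u * o' u) * ((o' u * o' u) powr (-1/2) * (- form (n u) (n u)) powr (-1/2))"
      by (simp only: c_def mult_ac)
    also have "\<dots> > 0"
      by (intro mult_pos_pos[OF o2[OF that] mult_pos_pos]) (use o0[OF that] neg[OF that] in auto)
    finally show ?thesis .
  qed
  show thesis
  proof
    show "orient (\<sigma> u) (N u) > 0" if "u \<in> W" for u
      using co[OF that] by (simp add: N_def o'_def orient_def algebra_simps)
    have "form (n u) (frechet_derivative \<sigma> (at u) v) = 0" if "u \<in> W" for u v
    proof -
      have "frechet_derivative \<sigma> (at u) v = v $ 1 *\<^sub>R s1 u + v $ 2 *\<^sub>R s2 u"
        unfolding s1_def s2_def linear_scale[OF lin[OF that], symmetric] linear_add[OF lin[OF that], symmetric]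
        by (simp only: vec2_eq[symmetric])
      then show ?thesis
        using nort[of u] by (simp add: form_simps)
    qed
    moreover have "smooth_on N W"
      unfolding N_def[abs_def] by (intro smooth_on_scaleR W smc smn)
    ultimately show "unit_normal W \<sigma> N"
      unfolding unit_normal_def using c2[unfolded mult.assoc] nort by (auto simp: N_def form.scaleR_left form.scaleR_right)
  qed
qed

text \<open>The derivative of \<open>N\<close> is already tangent to the surface, so its expansion
  in the orthonormal fields solves the defining equation of the shape operator; injectivity of the
  derivative of \<open>\<sigma>\<close> makes this solution the only one.\<close>

lemma shape_operator_eq:
  assumes lp: "local_param S W \<sigma>" and N: "unit_normal W \<sigma> N" and u: "u \<in> W"
    and e: "orthoframe (\<sigma> u) (deriv_along E1 \<sigma> u) (deriv_along E2 \<sigma> u) (N u)"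
  shows "shape_operator \<sigma> N u = matrix (\<lambda>v. form (frechet_derivative N (at u) v) (deriv_along E1 \<sigma> u) *\<^sub>R E1 u
    + form (frechet_derivative N (at u) v) (deriv_along E2 \<sigma> u) *\<^sub>R E2 u)" (is "_ = matrix ?K")
    and "shape_operator \<sigma> N u *v v = form (frechet_derivative N (at u) v) (deriv_along E1 \<sigma> u) *\<^sub>R E1 u
    + form (frechet_derivative N (at u) v) (deriv_along E2 \<sigma> u) *\<^sub>R E2 u"
proof -
  note W = local_paramD(1)[OF lp] and s = local_paramD(2)[OF lp] and lin = local_paramD(6)[OF lp u]
  have sN: "smooth_on N W" and Ns: "\<And>u. u \<in> W \<Longrightarrow> form (N u) (\<sigma> u) = 0"
    "\<And>u v. u \<in> W \<Longrightarrow> form (N u) (frechet_derivative \<sigma> (at u) v) = 0" "\<And>u. u \<in> W \<Longrightarrow> form (N u) (N u) = -1"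
    using N unfolding unit_normal_def by auto
  let ?DN = "frechet_derivative N (at u)" and ?Ds = "frechet_derivative \<sigma> (at u)"
  have linN: "linear ?DN"
    using smooth_on_has_derivative[OF sN u] has_derivative_linear by auto
  have DNs: "form (?DN v) (\<sigma> u) = 0" and DNN: "form (?DN v) (N u) = 0" for v
  proof -
    have "deriv_along (\<lambda>_. v) (\<lambda>x. form (N x) (\<sigma> x)) u = deriv_along (\<lambda>_. v) (\<lambda>x. 0) u"
      "deriv_along (\<lambda>_. v) (\<lambda>x. form (N x) (N x)) u = deriv_along (\<lambda>_. v) (\<lambda>x. -1) u"
      by (rule deriv_along_cong[OF W u _ smooth_on_const], use Ns in auto)+
    then have "form (N u) (?Ds v) + form (?DN v) (\<sigma> u) = 0" "form (N u) (?DN v) + form (?DN v) (N u) = 0"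
      using deriv_along_bilinear[OF bounded_bilinear_form sN s u, of "\<lambda>_. v"]
        deriv_along_bilinear[OF bounded_bilinear_form sN sN u, of "\<lambda>_. v"]
      by (simp_all add: deriv_along_const) (simp_all add: deriv_along_def)
    then show "form (?DN v) (\<sigma> u) = 0" "form (?DN v) (N u) = 0"
      using Ns(2)[OF u] form_commute[of "N u" "?DN v"] by simp_all
  qed
  have K: "?Ds (?K v) = tangential (\<sigma> u) (?DN v)" for v
  proof -
    have "?Ds (?K v) = form (?DN v) (deriv_along E1 \<sigma> u) *\<^sub>R deriv_along E1 \<sigma> u
        + form (?DN v) (deriv_along E2 \<sigma> u) *\<^sub>R deriv_along E2 \<sigma> u"
      by (rule deriv_along_comb[OF s u])
    also have "\<dots> = ?DN v"
      using orthoframe_expand[OF e, of "?DN v"] DNs DNN by simp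
    finally show ?thesis
      using DNs by (simp add: tangential_def)
  qed
  have "linear ?K"
    by (rule linearI) (simp_all add: linear_add[OF linN] linear_scale[OF linN] form_simps algebra_simps)
  then have "(*v) (matrix ?K) = ?K"
    by (rule matrix_vector_mul(2))
  then have mK: "matrix ?K *v v = ?K v" for v
    by (rule fun_cong)
  show eq: "shape_operator \<sigma> N u = matrix ?K"
    unfolding shape_operator_def
  proof (rule the_equality)
    show "\<forall>v. ?Ds (matrix ?K *v v) = tangential (\<sigma> u) (?DN v)"
      using K mK by simp
    fix B assume "\<forall>v. ?Ds (B *v v) = tangential (\<sigma> u) (?DN v)"
    then have "?Ds (B *v v) = ?Ds (matrix ?K *v v)" for v
      using K mK by simp
    then have "B *v v = matrix ?K *v v" for v
      using injD[OF local_paramD(4)[OF lp u]] by auto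
    then show "B = matrix ?K"
      by (simp add: matrix_eq)
  qed
  show "shape_operator \<sigma> N u *v v = ?K v"
    unfolding eq mK ..
qed

text \<open>Maximality is stated through the trace of a matrix in the coordinate basis; it equals
  the trace computed in the orthonormal frame.\<close>

lemma maximal_moving_frame:
  assumes max: "maximal_surface S" and lp: "local_param S W \<sigma>" and N: "unit_normal W \<sigma> N"
  obtains e1 e2 E1 E2 where "moving_frame W \<sigma> e1 e2 N E1 E2"
proof -
  note W = local_paramD(1)[OF lp] and s = local_paramD(2)[OF lp]
  have sp: "form (frechet_derivative \<sigma> (at u) v) (frechet_derivative \<sigma> (at u) v) > 0" if "u \<in> W" "v \<noteq> 0" for u v
    using max lp that unfolding maximal_surface_def spacelike_surface_def by auto
  obtain E1 E2 where E: "smooth_on E1 W" "smooth_on E2 W"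
    "\<And>u. u \<in> W \<Longrightarrow> form (deriv_along E1 \<sigma> u) (deriv_along E1 \<sigma> u) = 1"
    "\<And>u. u \<in> W \<Longrightarrow> form (deriv_along E2 \<sigma> u) (deriv_along E2 \<sigma> u) = 1"
    "\<And>u. u \<in> W \<Longrightarrow> form (deriv_along E1 \<sigma> u) (deriv_along E2 \<sigma> u) = 0"
    using ex_orthonormal_fields[OF lp sp] by auto
  have N': "smooth_on N W" "\<And>u. u \<in> W \<Longrightarrow> form (\<sigma> u) (N u) = 0"
    "\<And>u v. u \<in> W \<Longrightarrow> form (frechet_derivative \<sigma> (at u) v) (N u) = 0" "\<And>u. u \<in> W \<Longrightarrow> form (N u) (N u) = -1"
    using N unfolding unit_normal_def by (auto simp: form_commute)
  have fr: "orthoframe (\<sigma> u) (deriv_along E1 \<sigma> u) (deriv_along E2 \<sigma> u) (N u)" if "u \<in> W" for u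
    unfolding orthoframe_def using E(3-5)[OF that] N'(2-4)[OF that] local_paramD(3,5)[OF lp that]
    by (simp add: deriv_along_def)
  have "moving_frame W \<sigma> (deriv_along E1 \<sigma>) (deriv_along E2 \<sigma>) N E1 E2"
  proof
    fix u assume u: "u \<in> W"
    let ?DN = "frechet_derivative N (at u)"
    have linN: "linear ?DN"
      using smooth_on_has_derivative[OF N'(1) u] has_derivative_linear by auto
    have "form (?DN v) z = v $ 1 * form (?DN (axis 1 1)) z + v $ 2 * form (?DN (axis 2 1)) z" for v z
    proof -
      have "?DN v = v $ 1 *\<^sub>R ?DN (axis 1 1) + v $ 2 *\<^sub>R ?DN (axis 2 1)"
        unfolding linear_scale[OF linN, symmetric] linear_add[OF linN, symmetric]
        by (simp only: vec2_eq[symmetric])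
      then show ?thesis
        by (metis form.add_left form.scaleR_left real_scaleR_def)
    qed
    from this[of "E1 u" "deriv_along E1 \<sigma> u"] this[of "E2 u" "deriv_along E2 \<sigma> u"]
    have "form (?DN (E1 u)) (deriv_along E1 \<sigma> u) + form (?DN (E2 u)) (deriv_along E2 \<sigma> u) = trace (shape_operator \<sigma> N u)"
      unfolding shape_operator_eq(1)[OF lp N u fr[OF u]] trace_def matrix_def
      by (simp add: sum_2 algebra_simps)
    also have "\<dots> = 0"
      using max lp N u unfolding maximal_surface_def by auto
    finally show "form (deriv_along E1 N u) (deriv_along E1 \<sigma> u) + form (deriv_along E2 N u) (deriv_along E2 \<sigma> u) = 0"
      by (simp only: deriv_along_def[of _ N])
  qed (use W s E N' fr in auto)
  then show thesis
    by (rule that)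
qed

text \<open>Of the map \<open>\<theta>\<close> only continuity and the relation of
  \<open>\<sigma>\<close>, \<open>\<theta>\<close> and \<open>\<tau>\<close> are known. A linear
  left inverse \<open>L\<close> of \<open>A\<close> gives \<open>L (\<sigma> x)\<close> the identity
  as derivative, and inverting this first-order expansion makes \<open>\<theta>\<close>
  differentiable with derivative \<open>L (A' v)\<close>.\<close>

lemma immersion_lift_has_derivative:
  fixes \<sigma> :: "'a::euclidean_space \<Rightarrow> 'b::euclidean_space" and \<tau> :: "'c::euclidean_space \<Rightarrow> 'b"
  assumes \<sigma>: "(\<sigma> has_derivative A) (at (\<theta> y0))" "inj A" and \<tau>: "(\<tau> has_derivative A') (at y0)"
    and V: "open V" "y0 \<in> V" "\<And>y. y \<in> V \<Longrightarrow> \<sigma> (\<theta> y) = \<tau> y" and cont: "continuous (at y0) \<theta>"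
  obtains C where "(\<theta> has_derivative C) (at y0)" "\<And>v. A (C v) = A' v"
proof -
  have linA: "linear A"
    using \<sigma> has_derivative_linear by auto
  obtain L where L: "linear L" "L \<circ> A = id"
    using linear_injective_left_inverse[OF linA \<sigma>(2)] by auto
  have bL: "bounded_linear L"
    using L(1) linear_conv_bounded_linear by auto
  have f: "((\<lambda>x. L (\<sigma> x)) has_derivative (\<lambda>h. h)) (at (\<theta> y0))"
    using bounded_linear.has_derivative[OF bL \<sigma>(1)] L(2) by (simp add: o_def fun_eq_iff id_def)
  have t: "((\<lambda>y. L (\<tau> y)) has_derivative (\<lambda>v. L (A' v))) (at y0)"
    using bounded_linear.has_derivative[OF bL \<tau>] .
  define C where "C v = L (A' v)" for v
  have bC: "bounded_linear C"
    using t has_derivative_bounded_linear unfolding C_def by auto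
  obtain K where K: "K > 0" "\<And>v. norm (C v) \<le> norm v * K"
    using bounded_linear.pos_bounded[OF bC] by auto
  obtain dV where dV: "dV > 0" "\<And>y. norm (y - y0) < dV \<Longrightarrow> y \<in> V"
    using V(1,2) unfolding open_dist dist_norm by auto
  have key: "\<exists>d>0. \<forall>y. norm (y - y0) < d \<longrightarrow> norm (\<theta> y - \<theta> y0 - C (y - y0)) \<le> e * norm (y - y0)" if e: "e > 0" for e
  proof -
    \<comment> \<open>\<open>e1 \<le> 1/2\<close> absorbs the error proportional to the increment of
      \<open>\<theta>\<close> and yields a Lipschitz bound with constant \<open>2 * (K + 1)\<close>;
      the other bound on \<open>e1\<close> then keeps the total error below
      \<open>e\<close>.\<close>
    define e1 where "e1 = min (1/2) (e / (4 * (K + 1)))"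
    define e2 where "e2 = min 1 (e / 2)"
    have e1: "e1 > 0" "e1 \<le> 1 / 2" "e1 * (2 * (K + 1)) \<le> e / 2"
    proof -
      show "e1 > 0"
        using e K by (auto simp: e1_def)
      show "e1 \<le> 1 / 2"
        unfolding e1_def by (rule min.cobounded1)
      have "e1 * (2 * (K + 1)) \<le> e / (4 * (K + 1)) * (2 * (K + 1))"
        using K by (intro mult_right_mono) (auto simp: e1_def)
      also have "\<dots> = e / 2"
        using K by (simp add: field_simps)
      finally show "e1 * (2 * (K + 1)) \<le> e / 2" .
    qed
    obtain d1 where d1: "d1 > 0" "\<And>x. norm (x - \<theta> y0) < d1 \<Longrightarrow>
        norm (L (\<sigma> x) - L (\<sigma> (\<theta> y0)) - (x - \<theta> y0)) \<le> e1 * norm (x - \<theta> y0)"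
      using f e1(1) unfolding has_derivative_at_alt by blast
    obtain d2 where d2: "d2 > 0" "\<And>y. norm (y - y0) < d2 \<Longrightarrow>
        norm (L (\<tau> y) - L (\<tau> y0) - C (y - y0)) \<le> e2 * norm (y - y0)"
      using t e unfolding has_derivative_at_alt C_def e2_def by (metis half_gt_zero min_less_iff_conj zero_less_one)
    obtain d3 where d3: "d3 > 0" "\<And>y. norm (y - y0) < d3 \<Longrightarrow> norm (\<theta> y - \<theta> y0) < d1"
      using cont d1(1) unfolding continuous_at_eps_delta dist_norm by blast
    have "norm (\<theta> y - \<theta> y0 - C (y - y0)) \<le> e * norm (y - y0)" if y: "norm (y - y0) < min dV (min d2 d3)" for y
    proof -
      let ?h = "\<theta> y - \<theta> y0" and ?k = "L (\<tau> y) - L (\<tau> y0)"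
      have eq: "L (\<sigma> (\<theta> y)) = L (\<tau> y)" "L (\<sigma> (\<theta> y0)) = L (\<tau> y0)"
        using V(3)[of y] V(3)[of y0] dV(2)[of y] V(2) y by auto
      have a: "norm (?k - ?h) \<le> e1 * norm ?h"
        using d1(2)[of "\<theta> y"] d3(2)[of y] y unfolding eq by auto
      have b: "norm (?k - C (y - y0)) \<le> e2 * norm (y - y0)"
        using d2(2)[of y] y by auto
      have "norm ?k \<le> norm (?k - C (y - y0)) + norm (C (y - y0))"
        using norm_triangle_ineq[of "?k - C (y - y0)" "C (y - y0)"] by simp
      also have "\<dots> \<le> 1 * norm (y - y0) + norm (y - y0) * K"
        using b K(2)[of "y - y0"] mult_right_mono[of e2 1 "norm (y - y0)"] by (simp add: e2_def)
      finally have k: "norm ?k \<le> (K + 1) * norm (y - y0)"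
        by (simp add: algebra_simps)
      have "norm ?h \<le> norm (?k - ?h) + norm ?k"
        using norm_triangle_ineq4[of ?k "?k - ?h"] by simp
      moreover have "e1 * norm ?h \<le> (1/2) * norm ?h"
        using e1 by (intro mult_right_mono) auto
      ultimately have h: "norm ?h \<le> 2 * (K + 1) * norm (y - y0)"
        using a k unfolding mult.assoc by linarith
      have "norm (?h - C (y - y0)) \<le> norm (?k - C (y - y0)) + norm (?k - ?h)"
        using norm_triangle_ineq4[of "?k - C (y - y0)" "?k - ?h"] by (simp add: algebra_simps)
      also have "\<dots> \<le> (e / 2) * norm (y - y0) + e1 * (2 * (K + 1) * norm (y - y0))"
      proof (rule add_mono)
        have "e2 * norm (y - y0) \<le> (e / 2) * norm (y - y0)"
          by (intro mult_right_mono) (auto simp: e2_def)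
        then show "norm (?k - C (y - y0)) \<le> (e / 2) * norm (y - y0)"
          using b by simp
        have "e1 * norm ?h \<le> e1 * (2 * (K + 1) * norm (y - y0))"
          using h e1 by (intro mult_left_mono) auto
        then show "norm (?k - ?h) \<le> e1 * (2 * (K + 1) * norm (y - y0))"
          using a by simp
      qed
      also have "e1 * (2 * (K + 1) * norm (y - y0)) \<le> (e / 2) * norm (y - y0)"
        using mult_right_mono[OF e1(3), of "norm (y - y0)"] by (simp add: mult.assoc)
      finally show ?thesis
        by (simp add: field_simps)
    qed
    moreover have "min dV (min d2 d3) > 0"
      using dV(1) d2(1) d3(1) by auto
    ultimately show ?thesis
      by blast
  qed
  have D: "(\<theta> has_derivative C) (at y0)"
    unfolding has_derivative_at_alt using bC key by auto
  have "((\<lambda>y. \<sigma> (\<theta> y)) has_derivative (\<lambda>v. A (C v))) (at y0)"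
    using has_derivative_compose[OF D \<sigma>(1)] .
  moreover have "((\<lambda>y. \<sigma> (\<theta> y)) has_derivative A') (at y0)"
    by (rule has_derivative_transform_within_open[OF \<tau> V(1,2)]) (use V(3) in auto)
  ultimately have "(\<lambda>v. A (C v)) = A'"
    by (rule has_derivative_unique)
  then show thesis
    using that[OF D] by (metis (no_types))
qed

context moving_frame
begin

text \<open>A symmetric trace-free operator in dimension 2 squares to \<lambda>^2 times the
  identity. Hence every unit tangent vector gives the same value, which will make \<lambda>
  independent of the chart.\<close>

lemma lam_sq_unit:
  assumes "u \<in> W" "form (frechet_derivative \<sigma> (at u) w) (frechet_derivative \<sigma> (at u) w) = 1"
  shows "form (frechet_derivative N (at u) w) (frechet_derivative N (at u) w) = (\<alpha> u)\<^sup>2 + (\<beta> u)\<^sup>2"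
proof -
  obtain a b where w: "w = a *\<^sub>R E1 u + b *\<^sub>R E2 u"
    using basis_E[OF assms(1)] by blast
  have "a\<^sup>2 + b\<^sup>2 = 1"
    using assms(2) gram[OF assms(1)]
    unfolding w deriv_along_comb[OF smooth_\<sigma> assms(1)] e1[symmetric] e2[symmetric]
    by (simp add: form_simps power2_eq_square)
  moreover have "form (frechet_derivative N (at u) w) (frechet_derivative N (at u) w) = (a\<^sup>2 + b\<^sup>2) * ((\<alpha> u)\<^sup>2 + (\<beta> u)\<^sup>2)"
    unfolding w deriv_along_comb[OF smooth_N assms(1)] frame_equations[OF assms(1)]
    using gram[OF assms(1)] by (simp add: form_simps power2_eq_square algebra_simps)
  ultimately show ?thesis
    by simp
qed

lemma shape_operator_comb:
  assumes lp: "local_param S W \<sigma>" and N: "unit_normal W \<sigma> N" and u: "u \<in> W"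
  shows "shape_operator \<sigma> N u *v (a *\<^sub>R E1 u + b *\<^sub>R E2 u) =
    (a * \<alpha> u + b * \<beta> u) *\<^sub>R E1 u + (a * \<beta> u - b * \<alpha> u) *\<^sub>R E2 u"
  unfolding shape_operator_eq(2)[OF lp N u frame[OF u, unfolded e1 e2]] deriv_along_comb[OF smooth_N u]
    frame_equations[OF u] e1[symmetric] e2[symmetric]
  using gram[OF u] by (simp add: form_simps algebra_simps)

lemma indep_E:
  assumes "u \<in> W" "a *\<^sub>R E1 u + b *\<^sub>R E2 u = c *\<^sub>R E1 u + d *\<^sub>R E2 u"
  shows "a = c" "b = d"
proof -
  have "a *\<^sub>R e1 u + b *\<^sub>R e2 u = c *\<^sub>R e1 u + d *\<^sub>R e2 u"
    using arg_cong[OF assms(2), of "frechet_derivative \<sigma> (at u)"]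
    unfolding deriv_along_comb[OF smooth_\<sigma> assms(1)] e1[symmetric] e2[symmetric] .
  from arg_cong[OF this, of "\<lambda>z. form z (e1 u)"] arg_cong[OF this, of "\<lambda>z. form z (e2 u)"]
  show "a = c" "b = d"
    using gram[OF assms(1)] by (simp_all add: form_simps)
qed

lemma shape_operator_eigenvalue:
  assumes lp: "local_param S W \<sigma>" and N: "unit_normal W \<sigma> N" and u: "u \<in> W"
  shows "(\<exists>v. v \<noteq> 0 \<and> shape_operator \<sigma> N u *v v = k *\<^sub>R v) \<longleftrightarrow> k\<^sup>2 = (\<alpha> u)\<^sup>2 + (\<beta> u)\<^sup>2"
proof
  assume "\<exists>v. v \<noteq> 0 \<and> shape_operator \<sigma> N u *v v = k *\<^sub>R v"
  then obtain v where v: "v \<noteq> 0" "shape_operator \<sigma> N u *v v = k *\<^sub>R v"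
    by auto
  obtain a b where ab: "v = a *\<^sub>R E1 u + b *\<^sub>R E2 u"
    using basis_E[OF u] by blast
  have "(a * \<alpha> u + b * \<beta> u) *\<^sub>R E1 u + (a * \<beta> u - b * \<alpha> u) *\<^sub>R E2 u = (k * a) *\<^sub>R E1 u + (k * b) *\<^sub>R E2 u"
    using v(2) unfolding ab shape_operator_comb[OF lp N u] by (simp add: scaleR_add_right)
  note eq = indep_E[OF u this]
  have "(a\<^sup>2 + b\<^sup>2) * k\<^sup>2 = (k * a)\<^sup>2 + (k * b)\<^sup>2"
    by (simp add: power2_eq_square algebra_simps)
  also have "\<dots> = (a\<^sup>2 + b\<^sup>2) * ((\<alpha> u)\<^sup>2 + (\<beta> u)\<^sup>2)"
    unfolding eq[symmetric] by (simp add: power2_eq_square algebra_simps)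
  finally have "(a\<^sup>2 + b\<^sup>2) * k\<^sup>2 = (a\<^sup>2 + b\<^sup>2) * ((\<alpha> u)\<^sup>2 + (\<beta> u)\<^sup>2)" .
  moreover have "a\<^sup>2 + b\<^sup>2 \<noteq> 0"
    using v(1) ab by (auto simp: sum_power2_eq_zero_iff)
  ultimately show "k\<^sup>2 = (\<alpha> u)\<^sup>2 + (\<beta> u)\<^sup>2"
    using mult_left_cancel by blast
next
  assume k: "k\<^sup>2 = (\<alpha> u)\<^sup>2 + (\<beta> u)\<^sup>2"
  \<comment> \<open>\<open>(k + \<alpha>, \<beta>)\<close> is an eigenvector for \<open>k\<close>
    unless it vanishes, which happens only for \<open>\<beta> = 0\<close> and
    \<open>k = - \<alpha>\<close>; in that case the second basis vector is one.\<close>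
  define a b where "a = (if \<beta> u = 0 \<and> k = - \<alpha> u then 0 else k + \<alpha> u)"
    and "b = (if \<beta> u = 0 \<and> k = - \<alpha> u then 1 else \<beta> u)"
  have "a * \<alpha> u + b * \<beta> u = k * a" "a * \<beta> u - b * \<alpha> u = k * b"
    using k by (auto simp: a_def b_def power2_eq_square algebra_simps)
  then have "shape_operator \<sigma> N u *v (a *\<^sub>R E1 u + b *\<^sub>R E2 u) = k *\<^sub>R (a *\<^sub>R E1 u + b *\<^sub>R E2 u)"
    unfolding shape_operator_comb[OF lp N u] by (simp add: scaleR_add_right)
  moreover have "a *\<^sub>R E1 u + b *\<^sub>R E2 u \<noteq> 0"
  proof
    assume "a *\<^sub>R E1 u + b *\<^sub>R E2 u = 0"
    then have "a = 0" "b = 0"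
      using indep_E[OF u, of a b 0 0] by auto
    then show False
      by (auto simp: a_def b_def split: if_splits)
  qed
  ultimately show "\<exists>v. v \<noteq> 0 \<and> shape_operator \<sigma> N u *v v = k *\<^sub>R v"
    by blast
qed

end

section \<open>The lifted surface, its unit normal and its principal curvature\<close>

locale lifted_surface =
  fixes S :: "4 projective set" and T :: "(real ^ 4) set"
  assumes maximal: "maximal_surface S"
    and T_sub: "T \<subseteq> {x \<in> AdS_hat. proj x \<in> S}"
    and T_open: "openin (top_of_set {x \<in> AdS_hat. proj x \<in> S}) T"
    and T_closed: "closed T"
    and T_anti: "x \<in> T \<Longrightarrow> - x \<notin> T"
begin

definition "chart W \<sigma> \<longleftrightarrow> local_param S W \<sigma> \<and> \<sigma> ` W \<subseteq> T"

lemma T_form: "x \<in> T \<Longrightarrow> form x x = -1"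
  using T_sub by (auto simp: AdS_hat_def)

lemma T_AdS: "x \<in> T \<Longrightarrow> x \<in> AdS_hat"
  using T_sub by auto

lemma T_nonzero: "x \<in> T \<Longrightarrow> x \<noteq> 0"
  using AdS_hat_nonzero[OF T_AdS] .

lemma spacelike:
  assumes "local_param S W \<sigma>" "u \<in> W" "v \<noteq> 0"
  shows "form (frechet_derivative \<sigma> (at u) v) (frechet_derivative \<sigma> (at u) v) > 0"
  using maximal assms unfolding maximal_surface_def spacelike_surface_def by auto

lemma chart_restrict:
  assumes lp: "local_param S W \<sigma>" and u: "u \<in> W" "\<sigma> u \<in> T"
  shows "\<exists>V. chart V \<sigma> \<and> u \<in> V \<and> V \<subseteq> W"
proof -
  let ?P = "{x \<in> AdS_hat. proj x \<in> S}"
  have W: "open W" "continuous_on W \<sigma>"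
    using local_paramD[OF lp] smooth_on_continuous by auto
  have "openin (top_of_set S) ((proj \<circ> \<sigma>) ` W)" "\<sigma> ` W \<subseteq> AdS_hat"
    using lp unfolding local_param_def by auto
  with openin_imp_subset[OF this(1)] have "\<sigma> \<in> W \<rightarrow> ?P"
    by auto
  from continuous_openin_preimage[OF W(2) this T_open]
  have "open (W \<inter> \<sigma> -` T)"
    using W(1) openin_open_trans by auto
  moreover have "u \<in> W \<inter> \<sigma> -` T"
    using u by auto
  ultimately show ?thesis
    using local_param_restrict[OF lp, of "W \<inter> \<sigma> -` T"] by (intro exI[of _ "W \<inter> \<sigma> -` T"]) (auto simp: chart_def)
qed

lemma local_param_sign:
  assumes lp: "local_param S W \<sigma>" and u: "u \<in> W" and x: "x \<in> T" "proj (\<sigma> u) = proj x"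
  shows "\<sigma> u = x \<or> - \<sigma> u = x"
proof -
  have "\<sigma> u \<in> AdS_hat"
    using lp u unfolding local_param_def by auto
  then show ?thesis
    using AdS_hat_proj_eq[OF _ T_AdS[OF x(1)] x(2)] by auto
qed

lemma ex_chart:
  assumes "x \<in> T"
  obtains W \<sigma> u where "chart W \<sigma>" "u \<in> W" "\<sigma> u = x"
proof -
  have "proj x \<in> S" "embedded_surface S"
    using assms T_sub maximal unfolding maximal_surface_def spacelike_surface_def by auto
  then obtain W \<sigma> where lp: "local_param S W \<sigma>" "proj x \<in> (proj \<circ> \<sigma>) ` W"
    unfolding embedded_surface_def by metis
  then obtain u where u: "u \<in> W" "proj (\<sigma> u) = proj x"
    by auto
  from local_param_sign[OF lp(1) u(1) assms u(2)]
  consider "\<sigma> u = x" | "- \<sigma> u = x"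
    by auto
  then show thesis
  proof cases
    case 1
    then show thesis
      using chart_restrict[OF lp(1) u(1)] assms that by auto
  next
    case 2
    then show thesis
      using chart_restrict[OF local_param_uminus[OF lp(1)] u(1)] assms that by auto
  qed
qed

text \<open>Parametrisations are homeomorphisms onto open subsets of \<open>S\<close>. This is
  carried over to \<open>T\<close> through \<open>proj\<close>, which is injective on
  \<open>T\<close> by \<open>T_anti\<close>.\<close>

lemma chart_inverse:
  assumes "chart W \<sigma>"
  obtains \<psi> where "openin (top_of_set T) (\<sigma> ` W)" "continuous_on (\<sigma> ` W) \<psi>" "\<And>u. u \<in> W \<Longrightarrow> \<psi> (\<sigma> u) = u"
proof -
  have lp: "local_param S W \<sigma>" and ST: "\<sigma> ` W \<subseteq> T"
    using assms unfolding chart_def by auto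
  obtain g where g: "homeomorphism W ((proj \<circ> \<sigma>) ` W) (proj \<circ> \<sigma>) g"
    using lp unfolding local_param_def by auto
  have op: "openin (top_of_set S) ((proj \<circ> \<sigma>) ` W)"
    using lp unfolding local_param_def by auto
  have cp: "continuous_on T proj"
    using continuous_on_subset[OF continuous_on_proj, of T] T_nonzero by auto
  have eq: "T \<inter> proj -` ((proj \<circ> \<sigma>) ` W) = \<sigma> ` W"
  proof
    show "T \<inter> proj -` ((proj \<circ> \<sigma>) ` W) \<subseteq> \<sigma> ` W"
    proof
      fix y assume "y \<in> T \<inter> proj -` ((proj \<circ> \<sigma>) ` W)"
      then obtain u where u: "u \<in> W" "y \<in> T" "proj (\<sigma> u) = proj y"
        by auto
      moreover have "\<sigma> u \<in> T"
        using u(1) ST by auto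
      ultimately show "y \<in> \<sigma> ` W"
        using local_param_sign[OF lp u] T_anti by auto
    qed
  qed (use ST in auto)
  have "proj \<in> T \<rightarrow> S"
    using T_sub by auto
  from continuous_openin_preimage[OF cp this op] have "openin (top_of_set T) (\<sigma> ` W)"
    unfolding eq .
  moreover have "continuous_on (\<sigma> ` W) (\<lambda>y. g (proj y))"
  proof (rule continuous_on_compose2[of _ g])
    show "continuous_on ((proj \<circ> \<sigma>) ` W) g"
      using g unfolding homeomorphism_def by auto
    show "continuous_on (\<sigma> ` W) proj"
      using cp ST continuous_on_subset by auto
  qed (auto simp: image_comp)
  moreover have "g (proj (\<sigma> u)) = u" if "u \<in> W" for u
    using g that unfolding homeomorphism_def by auto
  ultimately show thesis
    using that by auto
qed

lemma continuous_on_T: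
  assumes "\<And>W \<sigma>. chart W \<sigma> \<Longrightarrow> continuous_on W (\<lambda>u. f (\<sigma> u))"
  shows "continuous_on T f"
  unfolding continuous_on_eq_continuous_within
proof
  fix x assume "x \<in> T"
  then obtain W \<sigma> u where c: "chart W \<sigma>" "u \<in> W" "\<sigma> u = x"
    using ex_chart by metis
  obtain \<psi> where psi: "openin (top_of_set T) (\<sigma> ` W)" "continuous_on (\<sigma> ` W) \<psi>" "\<And>u. u \<in> W \<Longrightarrow> \<psi> (\<sigma> u) = u"
    using chart_inverse[OF c(1)] by metis
  have "continuous_on (\<sigma> ` W) (\<lambda>y. f (\<sigma> (\<psi> y)))"
    by (rule continuous_on_compose2[OF assms[OF c(1)] psi(2)]) (use psi(3) in auto)
  then have "continuous_on (\<sigma> ` W) f"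
    by (rule continuous_on_eq) (use psi(3) in auto)
  then have cont: "continuous (at x within \<sigma> ` W) f"
    using c unfolding continuous_on_eq_continuous_within by auto
  obtain U where U: "open U" "\<sigma> ` W = T \<inter> U"
    using psi(1) openin_open by metis
  have "at x within T = at x within \<sigma> ` W"
    by (rule at_within_nhd[of x U]) (use U c in auto)
  then show "continuous (at x within T) f"
    using cont by simp
qed

text \<open>Inverses of charts are only known to be continuous, so the differentiability of a
  transition map is extracted from the immersion property by
  \<open>immersion_lift_has_derivative\<close>.\<close>

lemma transition:
  assumes c: "chart W \<sigma>" "u \<in> W" and c': "chart W' \<sigma>'" "u' \<in> W'" and eq: "\<sigma> u = \<sigma>' u'"
  obtains V \<theta> where "open V" "u' \<in> V" "V \<subseteq> W'" "continuous_on V \<theta>" "\<theta> u' = u"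
    "\<And>y. y \<in> V \<Longrightarrow> \<theta> y \<in> W" "\<And>y. y \<in> V \<Longrightarrow> \<sigma> (\<theta> y) = \<sigma>' y"
    "\<And>y. y \<in> V \<Longrightarrow> \<exists>C. (\<theta> has_derivative C) (at y) \<and>
      (\<forall>v. frechet_derivative \<sigma> (at (\<theta> y)) (C v) = frechet_derivative \<sigma>' (at y) v)"
proof -
  have lp: "local_param S W \<sigma>" "local_param S W' \<sigma>'" and ST: "\<sigma>' ` W' \<subseteq> T"
    using c c' unfolding chart_def by auto
  obtain \<psi> where psi: "openin (top_of_set T) (\<sigma> ` W)" "continuous_on (\<sigma> ` W) \<psi>" "\<And>u. u \<in> W \<Longrightarrow> \<psi> (\<sigma> u) = u"
    using chart_inverse[OF c(1)] by metis
  have W': "open W'" "continuous_on W' \<sigma>'"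
    using local_paramD[OF lp(2)] smooth_on_continuous by auto
  define V where "V = W' \<inter> \<sigma>' -` (\<sigma> ` W)"
  have "\<sigma>' \<in> W' \<rightarrow> T"
    using ST by auto
  from continuous_openin_preimage[OF W'(2) this psi(1)]
  have V: "open V"
    unfolding V_def using W'(1) openin_open_trans by auto
  have VW: "V \<subseteq> W'" "u' \<in> V"
    using c c' eq unfolding V_def by (auto simp: image_iff) metis
  define \<theta> where "\<theta> y = \<psi> (\<sigma>' y)" for y
  have cont: "continuous_on V \<theta>"
    unfolding \<theta>_def by (rule continuous_on_compose2[OF psi(2) continuous_on_subset[OF W'(2)]]) (auto simp: V_def)
  have th: "\<theta> y \<in> W \<and> \<sigma> (\<theta> y) = \<sigma>' y" if "y \<in> V" for y
  proof -
    have "\<sigma>' y \<in> \<sigma> ` W"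
      using that unfolding V_def by simp
    then obtain w where "w \<in> W" "\<sigma>' y = \<sigma> w"
      by (rule imageE)
    then show ?thesis
      using psi(3) by (simp add: \<theta>_def)
  qed
  have "\<exists>C. (\<theta> has_derivative C) (at y) \<and>
      (\<forall>v. frechet_derivative \<sigma> (at (\<theta> y)) (C v) = frechet_derivative \<sigma>' (at y) v)" if y: "y \<in> V" for y
  proof -
    have "(\<sigma> has_derivative frechet_derivative \<sigma> (at (\<theta> y))) (at (\<theta> y))"
      "inj (frechet_derivative \<sigma> (at (\<theta> y)))"
      "(\<sigma>' has_derivative frechet_derivative \<sigma>' (at y)) (at y)"
      using th[OF y] y VW local_paramD(4)[OF lp(1)] smooth_on_has_derivative[OF local_paramD(2)[OF lp(1)]]
        smooth_on_has_derivative[OF local_paramD(2)[OF lp(2)]] by auto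
    moreover have "continuous (at y) \<theta>"
      using cont y V continuous_on_eq_continuous_at by auto
    ultimately obtain C where "(\<theta> has_derivative C) (at y)"
      "\<And>v. frechet_derivative \<sigma> (at (\<theta> y)) (C v) = frechet_derivative \<sigma>' (at y) v"
      using immersion_lift_has_derivative[of \<sigma> _ \<theta> y \<sigma>' _ V] V y th by metis
    then show ?thesis
      by auto
  qed
  moreover have "\<theta> u' = u"
    using eq c psi(3) by (metis \<theta>_def)
  ultimately show thesis
    using that[OF V VW(2,1) cont] th by auto
qed

lemma normal_transition:
  assumes c: "chart W \<sigma>" "u \<in> W" and c': "chart W' \<sigma>'" "u' \<in> W'" and eq: "\<sigma> u = \<sigma>' u'"
    and N: "unit_normal W \<sigma> N" and N': "unit_normal W' \<sigma>' N'"
  shows "N' u' = N u \<or> N' u' = - N u"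
proof -
  obtain V \<theta> where V: "open V" "u' \<in> V" "\<theta> u' = u" "\<And>y. y \<in> V \<Longrightarrow> \<exists>C. (\<theta> has_derivative C) (at y) \<and>
      (\<forall>v. frechet_derivative \<sigma> (at (\<theta> y)) (C v) = frechet_derivative \<sigma>' (at y) v)"
    using transition[OF c c' eq] by metis
  obtain C where C: "(\<theta> has_derivative C) (at u')" "\<And>v. frechet_derivative \<sigma> (at u) (C v) = frechet_derivative \<sigma>' (at u') v"
    using V(4)[OF V(2)] V(3) by auto
  have lp: "local_param S W \<sigma>" "local_param S W' \<sigma>'"
    using c c' unfolding chart_def by auto
  obtain e1 e2 E1 E2 where "moving_frame W' \<sigma>' e1 e2 N' E1 E2"
    using maximal_moving_frame[OF maximal lp(2) N'] by metis
  then interpret M: moving_frame W' \<sigma>' e1 e2 N' E1 E2 .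
  have "form (N u) (\<sigma>' u') = 0" "form (N u) (N u) = -1" "\<And>v. form (N u) (frechet_derivative \<sigma> (at u) v) = 0"
    using N c eq[symmetric] unfolding unit_normal_def by auto
  then have "N u = N' u' \<or> N u = - N' u'"
    by (intro unit_normal_unique[OF M.frame[OF c'(2)]])
      (auto simp: M.e1 M.e2 deriv_along_def C(2)[symmetric])
  then show ?thesis
    by auto
qed

text \<open>The sign between the two normals is continuous, hence locally constant, so the
  derivatives of the normals agree up to sign. The unit vectors \<open>w\<close> and
  \<open>w'\<close> may be unrelated, because \<open>lam_sq_unit\<close> gives the same value for
  all of them.\<close>

lemma lam_transition:
  assumes c: "chart W \<sigma>" "u \<in> W" and c': "chart W' \<sigma>'" "u' \<in> W'" and eq: "\<sigma> u = \<sigma>' u'"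
    and N: "unit_normal W \<sigma> N" and N': "unit_normal W' \<sigma>' N'"
    and w: "form (frechet_derivative \<sigma> (at u) w) (frechet_derivative \<sigma> (at u) w) = 1"
    and w': "form (frechet_derivative \<sigma>' (at u') w') (frechet_derivative \<sigma>' (at u') w') = 1"
  shows "form (frechet_derivative N (at u) w) (frechet_derivative N (at u) w) =
    form (frechet_derivative N' (at u') w') (frechet_derivative N' (at u') w')"
proof -
  obtain V \<theta> where V: "open V" "u' \<in> V" "V \<subseteq> W'" "continuous_on V \<theta>" "\<theta> u' = u"
    "\<And>y. y \<in> V \<Longrightarrow> \<theta> y \<in> W" "\<And>y. y \<in> V \<Longrightarrow> \<sigma> (\<theta> y) = \<sigma>' y"
    "\<And>y. y \<in> V \<Longrightarrow> \<exists>C. (\<theta> has_derivative C) (at y) \<and>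
      (\<forall>v. frechet_derivative \<sigma> (at (\<theta> y)) (C v) = frechet_derivative \<sigma>' (at y) v)"
    using transition[OF c c' eq] by metis
  obtain C where C: "(\<theta> has_derivative C) (at u')" "\<And>v. frechet_derivative \<sigma> (at u) (C v) = frechet_derivative \<sigma>' (at u') v"
    using V(8)[OF V(2)] V(5) by auto
  have lp: "local_param S W \<sigma>" "local_param S W' \<sigma>'"
    using c c' unfolding chart_def by auto
  have sm: "smooth_on N W" "smooth_on N' W'"
    using N N' unfolding unit_normal_def by auto
  define t where "t y = - form (N' y) (N (\<theta> y))" for y
  have pm: "N (\<theta> y) = t y *\<^sub>R N' y \<and> (t y = 1 \<or> t y = -1)" if y: "y \<in> V" for y
  proof -
    have "form (N' y) (N' y) = -1"
      using N' y V(3) unfolding unit_normal_def by auto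
    moreover have "N' y = N (\<theta> y) \<or> N' y = - N (\<theta> y)"
      using normal_transition[OF c(1) V(6)[OF y] c'(1) _ V(7)[OF y] N N'] y V(3) by auto
    ultimately show ?thesis
      by (auto simp: t_def form_simps)
  qed
  have "continuous_on V t"
    unfolding t_def
    by (intro continuous_intros continuous_on_subset[OF smooth_on_continuous[OF sm(2)] V(3)]
        continuous_on_compose2[OF smooth_on_continuous[OF sm(1)] V(4)]) (use V(6) in auto)
  then obtain d where d: "d > 0" "\<And>y. y \<in> V \<Longrightarrow> dist y u' < d \<Longrightarrow> dist (t y) (t u') < 1"
    using V(2) unfolding continuous_on_iff by (metis zero_less_one)
  have tc: "t y = t u'" if "y \<in> V \<inter> ball u' d" for y
    using d(2)[of y] that pm[of y] pm[OF V(2)] by (auto simp: dist_real_def dist_commute)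
  have "((\<lambda>y. N (\<theta> y)) has_derivative (\<lambda>v. frechet_derivative N (at u) (C v))) (at u')"
    by (rule has_derivative_compose[OF C(1)]) (use smooth_on_has_derivative[OF sm(1) c(2)] V(5) in auto)
  moreover have "((\<lambda>y. N (\<theta> y)) has_derivative (\<lambda>v. t u' *\<^sub>R frechet_derivative N' (at u') v)) (at u')"
  proof (rule has_derivative_transform_within_open)
    show "((\<lambda>y. t u' *\<^sub>R N' y) has_derivative (\<lambda>v. t u' *\<^sub>R frechet_derivative N' (at u') v)) (at u')"
      by (rule has_derivative_scaleR_right[OF smooth_on_has_derivative[OF sm(2) c'(2)]])
    show "open (V \<inter> ball u' d)" "u' \<in> V \<inter> ball u' d"
      using V d by auto
    show "t u' *\<^sub>R N' y = N (\<theta> y)" if "y \<in> V \<inter> ball u' d" for y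
      using tc[OF that] pm[of y] that by auto
  qed
  ultimately have eqD: "(\<lambda>v. frechet_derivative N (at u) (C v)) = (\<lambda>v. t u' *\<^sub>R frechet_derivative N' (at u') v)"
    by (rule has_derivative_unique)
  have "form (frechet_derivative N (at u) (C w')) (frechet_derivative N (at u) (C w')) =
      form (frechet_derivative N' (at u') w') (frechet_derivative N' (at u') w')"
    using fun_cong[OF eqD, of w'] pm[OF V(2)] by (auto simp: form_simps)
  moreover obtain e1 e2 E1 E2 where "moving_frame W \<sigma> e1 e2 N E1 E2"
    using maximal_moving_frame[OF maximal lp(1) N] by metis
  then interpret M: moving_frame W \<sigma> e1 e2 N E1 E2 .
  have "form (frechet_derivative N (at u) w) (frechet_derivative N (at u) w) =
      form (frechet_derivative N (at u) (C w')) (frechet_derivative N (at u) (C w'))"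
    using M.lam_sq_unit[OF c(2) w] M.lam_sq_unit[OF c(2), of "C w'"] w' C(2) by auto
  ultimately show ?thesis
    by simp
qed

text \<open>Two charts determine the normal up to sign only; the condition on \<open>orient\<close>
  removes this ambiguity, so the description is unique, as \<open>nor_eq\<close> shows.\<close>

definition "nor x = (THE n. \<exists>W \<sigma> N u. chart W \<sigma> \<and> unit_normal W \<sigma> N \<and> u \<in> W \<and> \<sigma> u = x
    \<and> orient x (N u) > 0 \<and> n = N u)"

lemma nor_eq:
  assumes "chart W \<sigma>" "unit_normal W \<sigma> N" "u \<in> W" "orient (\<sigma> u) (N u) > 0"
  shows "N u = nor (\<sigma> u)"
  unfolding nor_def
proof (rule the_equality[symmetric])
  show "\<exists>W' \<sigma>' N' u'. chart W' \<sigma>' \<and> unit_normal W' \<sigma>' N' \<and> u' \<in> W' \<and> \<sigma>' u' = \<sigma> u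
      \<and> orient (\<sigma> u) (N' u') > 0 \<and> N u = N' u'"
    using assms by blast
  fix n assume "\<exists>W' \<sigma>' N' u'. chart W' \<sigma>' \<and> unit_normal W' \<sigma>' N' \<and> u' \<in> W' \<and> \<sigma>' u' = \<sigma> u
      \<and> orient (\<sigma> u) (N' u') > 0 \<and> n = N' u'"
  then obtain W' \<sigma>' N' u' where *: "chart W' \<sigma>'" "unit_normal W' \<sigma>' N'" "u' \<in> W'" "\<sigma>' u' = \<sigma> u"
    "orient (\<sigma> u) (N' u') > 0" "n = N' u'"
    by auto
  from normal_transition[OF assms(1,3) *(1,3) *(4)[symmetric] assms(2) *(2)]
  show "n = N u"
    using assms(4) *(5,6) by (auto simp: orient_def)
qed

definition "lam x = principal_curvature S (proj x)"

text \<open>The set \<open>principal_curvatures\<close> ranges over all local parametrisations of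
  \<open>S\<close>, including lifts to the opposite sheet. Changing the sign of the lift while
  keeping the normal changes the sign of the shape operator, which does not affect the symmetric set
  of eigenvalues.\<close>

lemma lam_chart:
  assumes c: "chart W \<sigma>" "u \<in> W" and N: "unit_normal W \<sigma> N" and mf: "moving_frame W \<sigma> e1 e2 N E1 E2"
  shows "lam (\<sigma> u) \<ge> 0"
    and "(lam (\<sigma> u))\<^sup>2 = (form (deriv_along E1 N u) (e1 u))\<^sup>2 + (form (deriv_along E1 N u) (e2 u))\<^sup>2"
proof -
  interpret M: moving_frame W \<sigma> e1 e2 N E1 E2
    by (rule mf)
  have lp: "local_param S W \<sigma>"
    using c unfolding chart_def by auto
  let ?x = "\<sigma> u"
  define l where "l = sqrt ((M.\<alpha> u)\<^sup>2 + (M.\<beta> u)\<^sup>2)"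
  have l: "l \<ge> 0" "l\<^sup>2 = (M.\<alpha> u)\<^sup>2 + (M.\<beta> u)\<^sup>2"
    unfolding l_def by simp_all
  have xT: "?x \<in> T"
    using c unfolding chart_def by auto
  have unit: "form (frechet_derivative \<sigma> (at u) (E1 u)) (frechet_derivative \<sigma> (at u) (E1 u)) = 1"
    using M.gram(2)[OF c(2)] by (simp add: M.e1 deriv_along_def)
  have all: "k\<^sup>2 = l\<^sup>2" if k: "local_param S W' \<sigma>'" "unit_normal W' \<sigma>' N'" "u' \<in> W'" "proj (\<sigma>' u') = proj ?x"
    "v \<noteq> 0" "shape_operator \<sigma>' N' u' *v v = k *\<^sub>R v" for k W' \<sigma>' N' u' v
  proof -
    have main: "k'\<^sup>2 = l\<^sup>2" if k': "local_param S W' \<tau>" "unit_normal W' \<tau> N'" "\<tau> u' = ?x"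
      "shape_operator \<tau> N' u' *v v = k' *\<^sub>R v" for \<tau> k'
    proof -
      obtain V where V: "chart V \<tau>" "u' \<in> V" "V \<subseteq> W'"
        using chart_restrict[OF k'(1) k(3)] k'(3) xT by auto
      then have un: "unit_normal V \<tau> N'" and lpV: "local_param S V \<tau>"
        using k'(2) smooth_on_subset[of N' W' V] unfolding unit_normal_def chart_def by auto
      obtain f1 f2 F1 F2 where "moving_frame V \<tau> f1 f2 N' F1 F2"
        using maximal_moving_frame[OF maximal lpV un] by metis
      then interpret M': moving_frame V \<tau> f1 f2 N' F1 F2 .
      have unit': "form (frechet_derivative \<tau> (at u') (F1 u')) (frechet_derivative \<tau> (at u') (F1 u')) = 1"
        using M'.gram(2)[OF V(2)] by (simp add: M'.e1 deriv_along_def)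
      have "k'\<^sup>2 = (M'.\<alpha> u')\<^sup>2 + (M'.\<beta> u')\<^sup>2"
        using M'.shape_operator_eigenvalue[OF lpV un V(2)] k(5) k'(4) by auto
      also have "\<dots> = l\<^sup>2"
        using lam_transition[OF c V(1,2) k'(3)[symmetric] N un unit unit']
          M'.lam_sq_unit[OF V(2) unit'] M.lam_sq_unit[OF c(2) unit] l(2) by simp
      finally show ?thesis .
    qed
    from local_param_sign[OF k(1,3) xT k(4)] show ?thesis
    proof
      assume "\<sigma>' u' = ?x"
      then show ?thesis
        using main[OF k(1,2)] k(6) by auto
    next
      assume neg: "- \<sigma>' u' = ?x"
      let ?\<tau> = "\<lambda>u. - \<sigma>' u"
      have lp': "local_param S W' ?\<tau>"
        by (rule local_param_uminus[OF k(1)])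
      have fd: "frechet_derivative ?\<tau> (at y) = (\<lambda>v. - frechet_derivative \<sigma>' (at y) v)" if "y \<in> W'" for y
        using has_derivative_minus[OF smooth_on_has_derivative[OF local_paramD(2)[OF k(1)] that]]
          frechet_derivative_at by metis
      have un': "unit_normal W' ?\<tau> N'"
        using k(2) fd unfolding unit_normal_def by (auto simp: form_simps)
      obtain f1 f2 F1 F2 where "moving_frame W' \<sigma>' f1 f2 N' F1 F2"
        using maximal_moving_frame[OF maximal k(1,2)] by metis
      then interpret M': moving_frame W' \<sigma>' f1 f2 N' F1 F2 .
      note fr = M'.frame[OF k(3), unfolded M'.e1 M'.e2]
      have de: "deriv_along F ?\<tau> u' = - deriv_along F \<sigma>' u'" for F
        using fd[OF k(3)] by (simp add: deriv_along_def)
      have "orthoframe (?\<tau> u') (deriv_along F1 ?\<tau> u') (deriv_along F2 ?\<tau> u') (N' u')"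
        using fr unfolding orthoframe_def de by (simp add: form_simps)
      from shape_operator_eq(2)[OF lp' un' k(3) this, of v] shape_operator_eq(2)[OF k(1,2,3) fr, of v]
      have "shape_operator ?\<tau> N' u' *v v = - (shape_operator \<sigma>' N' u' *v v)"
        unfolding de by (simp add: form_simps)
      then have "(- k)\<^sup>2 = l\<^sup>2"
        using main[OF lp' un' neg, of "- k"] k(6) by simp
      then show ?thesis
        by simp
    qed
  qed
  have set: "principal_curvatures S (proj ?x) = {l, - l}"
  proof
    show "principal_curvatures S (proj ?x) \<subseteq> {l, - l}"
    proof
      fix k assume "k \<in> principal_curvatures S (proj ?x)"
      then have "k\<^sup>2 = l\<^sup>2"
        using all unfolding principal_curvatures_def by auto
      then show "k \<in> {l, - l}"
        by (simp add: power2_eq_iff)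
    qed
    have "k \<in> principal_curvatures S (proj ?x)" if kl: "k\<^sup>2 = l\<^sup>2" for k
    proof -
      obtain v where "v \<noteq> 0" "shape_operator \<sigma> N u *v v = k *\<^sub>R v"
        using M.shape_operator_eigenvalue[OF lp N c(2), of k] kl l(2) by auto
      then show ?thesis
        unfolding principal_curvatures_def using lp N c(2) by blast
    qed
    then show "{l, - l} \<subseteq> principal_curvatures S (proj ?x)"
      by auto
  qed
  have "lam ?x = l"
    unfolding lam_def principal_curvature_def set
  proof (rule the_equality)
    show "l \<ge> 0 \<and> {l, - l} = {l, - l}"
      using l by simp
    show "k = l" if "k \<ge> 0 \<and> {l, - l} = {k, - k}" for k
      using that l(1) by (auto simp: doubleton_eq_iff)
  qed
  then show "lam (\<sigma> u) \<ge> 0"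
    "(lam (\<sigma> u))\<^sup>2 = (form (deriv_along E1 N u) (e1 u))\<^sup>2 + (form (deriv_along E1 N u) (e2 u))\<^sup>2"
    using l by (simp_all add: M.\<alpha>_def M.\<beta>_def)
qed

lemma ex_frame:
  assumes "chart W \<sigma>"
  obtains e1 e2 N E1 E2 where "moving_frame W \<sigma> e1 e2 N E1 E2"
    "\<And>u. u \<in> W \<Longrightarrow> N u = nor (\<sigma> u)"
    "\<And>u. u \<in> W \<Longrightarrow> (lam (\<sigma> u))\<^sup>2 = (form (deriv_along E1 N u) (e1 u))\<^sup>2 + (form (deriv_along E1 N u) (e2 u))\<^sup>2"
proof -
  have lp: "local_param S W \<sigma>"
    using assms unfolding chart_def by auto
  obtain N where N: "unit_normal W \<sigma> N" "\<And>u. u \<in> W \<Longrightarrow> orient (\<sigma> u) (N u) > 0"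
    using ex_unit_normal[OF lp spacelike[OF lp]] by metis
  obtain e1 e2 E1 E2 where mf: "moving_frame W \<sigma> e1 e2 N E1 E2"
    using maximal_moving_frame[OF maximal lp N(1)] by metis
  show thesis
    by (rule that[OF mf]) (use nor_eq[OF assms N(1)] N(2) lam_chart(2)[OF assms _ N(1) mf] in auto)
qed

lemma lam_nonneg:
  assumes "x \<in> T"
  shows "lam x \<ge> 0"
proof -
  obtain W \<sigma> u where c: "chart W \<sigma>" "u \<in> W" "\<sigma> u = x"
    using ex_chart[OF assms] by metis
  have lp: "local_param S W \<sigma>"
    using c unfolding chart_def by auto
  obtain N where N: "unit_normal W \<sigma> N"
    using ex_unit_normal[OF lp spacelike[OF lp]] by metis
  obtain e1 e2 E1 E2 where mf: "moving_frame W \<sigma> e1 e2 N E1 E2"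
    using maximal_moving_frame[OF maximal lp N(1)] by metis
  show ?thesis
    using lam_chart(1)[OF c(1,2) N mf] c(3) by simp
qed

lemma continuous_on_nor: "continuous_on T nor"
proof (rule continuous_on_T)
  fix W \<sigma> assume "chart W \<sigma>"
  then obtain e1 e2 N E1 E2 where mf: "moving_frame W \<sigma> e1 e2 N E1 E2" "\<And>u. u \<in> W \<Longrightarrow> N u = nor (\<sigma> u)"
    using ex_frame by metis
  show "continuous_on W (\<lambda>u. nor (\<sigma> u))"
    by (rule continuous_on_eq[OF smooth_on_continuous[OF moving_frame.smooth_N[OF mf(1)]]]) (use mf(2) in auto)
qed

lemma continuous_on_lam: "continuous_on T lam"
proof (rule continuous_on_T)
  fix W \<sigma> assume c: "chart W \<sigma>"
  then obtain e1 e2 N E1 E2 where mf: "moving_frame W \<sigma> e1 e2 N E1 E2"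
    "\<And>u. u \<in> W \<Longrightarrow> (lam (\<sigma> u))\<^sup>2 = (form (deriv_along E1 N u) (e1 u))\<^sup>2 + (form (deriv_along E1 N u) (e2 u))\<^sup>2"
    using ex_frame by metis
  interpret M: moving_frame W \<sigma> e1 e2 N E1 E2
    by (rule mf(1))
  have "continuous_on W (\<lambda>u. sqrt ((M.\<alpha> u)\<^sup>2 + (M.\<beta> u)\<^sup>2))"
    by (intro continuous_intros smooth_on_continuous M.smooth_coeffs)
  then show "continuous_on W (\<lambda>u. lam (\<sigma> u))"
  proof (rule continuous_on_eq)
    fix u assume u: "u \<in> W"
    have "\<sigma> u \<in> T"
      using c u unfolding chart_def by auto
    from lam_nonneg[OF this] show "sqrt ((M.\<alpha> u)\<^sup>2 + (M.\<beta> u)\<^sup>2) = lam (\<sigma> u)"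
      using mf(2)[OF u] unfolding M.\<alpha>_def M.\<beta>_def by (metis abs_of_nonneg real_sqrt_abs)
  qed
qed

lemma nor_props:
  assumes "x \<in> T"
  shows "form (nor x) (nor x) = -1" "form x (nor x) = 0" "orient x (nor x) > 0"
proof -
  obtain W \<sigma> u where c: "chart W \<sigma>" "u \<in> W" "\<sigma> u = x"
    using ex_chart[OF assms] by metis
  have lp: "local_param S W \<sigma>"
    using c unfolding chart_def by auto
  obtain N where N: "unit_normal W \<sigma> N" "\<And>u. u \<in> W \<Longrightarrow> orient (\<sigma> u) (N u) > 0"
    using ex_unit_normal[OF lp spacelike[OF lp]] by metis
  have "N u = nor x"
    using nor_eq[OF c(1) N(1) c(2) N(2)[OF c(2)]] c(3) by simp
  then show "form (nor x) (nor x) = -1" "form x (nor x) = 0" "orient x (nor x) > 0"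
    using N(1) N(2)[OF c(2)] c(2,3) unfolding unit_normal_def by (auto simp: form_commute)
qed

end

subsection \<open>Second order conditions\<close>

lemma second_derivative_max:
  fixes \<phi> :: "real \<Rightarrow> real"
  assumes d: "d > 0" and D: "\<And>s. \<bar>s\<bar> < d \<Longrightarrow> (\<phi> has_real_derivative \<phi>' s) (at s)"
    and D2: "(\<phi>' has_real_derivative L) (at 0)" and max: "\<And>s. \<bar>s\<bar> < d \<Longrightarrow> \<phi> s \<le> \<phi> 0"
  shows "\<phi>' 0 = 0" "L \<le> 0"
proof -
  show z: "\<phi>' 0 = 0"
    by (rule DERIV_local_max[OF D[of 0] d]) (use d max in auto)
  show "L \<le> 0"
  proof (rule ccontr)
    assume "\<not> L \<le> 0"
    then obtain d' where d': "d' > 0" "\<And>h. h > 0 \<Longrightarrow> h < d' \<Longrightarrow> \<phi>' 0 < \<phi>' (0 + h)"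
      using DERIV_pos_inc_right[OF D2] by auto
    define s where "s = min d d' / 2"
    have s: "0 < s" "s < d" "s < d'"
      using d d' by (auto simp: s_def)
    obtain t where t: "0 < t" "t < s" "\<phi> s - \<phi> 0 = (s - 0) * \<phi>' t"
      using MVT2[of 0 s \<phi> \<phi>'] s D by (metis abs_of_nonneg less_le_trans le_less_trans)
    then have "\<phi> s - \<phi> 0 > 0"
      using d'(2)[of t] s z by simp
    then show False
      using max[of s] s by simp
  qed
qed

lemma smooth_on_line:
  assumes W: "open W" "u \<in> W" and f: "smooth_on f W"
  obtains d where "d > 0" "\<And>s. \<bar>s\<bar> < d \<Longrightarrow> u + s *\<^sub>R v \<in> W"
    "\<And>s. \<bar>s\<bar> < d \<Longrightarrow> ((\<lambda>s. f (u + s *\<^sub>R v)) has_vector_derivative frechet_derivative f (at (u + s *\<^sub>R v)) v) (at s)"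
    "((\<lambda>s. frechet_derivative f (at (u + s *\<^sub>R v)) v) has_vector_derivative
       frechet_derivative (\<lambda>y. frechet_derivative f (at y) v) (at u) v) (at 0)"
proof -
  obtain e where e: "e > 0" "ball u e \<subseteq> W"
    using W open_contains_ball by metis
  define d where "d = e / (norm v + 1)"
  have pos: "norm v + 1 > 0"
    using norm_ge_zero[of v] by linarith
  have inW: "u + s *\<^sub>R v \<in> W" if "\<bar>s\<bar> < d" for s
  proof -
    have "\<bar>s\<bar> * norm v \<le> \<bar>s\<bar> * (norm v + 1)"
      by (intro mult_left_mono) auto
    also have "\<dots> < e"
      using that pos unfolding d_def by (simp add: pos_less_divide_eq)
    finally have "u + s *\<^sub>R v \<in> ball u e"
      by (simp add: dist_norm)
    then show ?thesis
      using e(2) by auto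
  qed
  show thesis
  proof
    show "d > 0"
      using e pos by (simp add: d_def)
    show "((\<lambda>s. f (u + s *\<^sub>R v)) has_vector_derivative frechet_derivative f (at (u + s *\<^sub>R v)) v) (at s)"
      if "\<bar>s\<bar> < d" for s
      by (rule has_derivative_line[OF smooth_on_has_derivative[OF f inW[OF that]]])
    show "((\<lambda>s. frechet_derivative f (at (u + s *\<^sub>R v)) v) has_vector_derivative
       frechet_derivative (\<lambda>y. frechet_derivative f (at y) v) (at u) v) (at 0)"
      using has_derivative_line[of "\<lambda>y. frechet_derivative f (at y) v" _ u 0 v]
        smooth_on_has_derivative[OF smooth_on_frechet[OF f] W(2), of v] by simp
  qed (use inW in auto)
qed

lemma has_vector_derivative_form:
  assumes "(f has_vector_derivative f') (at s)" "(g has_vector_derivative g') (at s)"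
  shows "((\<lambda>s. form (f s) (g s)) has_real_derivative form (f s) g' + form f' (g s)) (at s)"
  using bounded_bilinear.has_vector_derivative[OF bounded_bilinear_form assms]
  by (simp add: has_real_derivative_iff_has_vector_derivative)

text \<open>Orthonormal rows of a 2 by 2 matrix give orthonormal columns; the trace computation in
  \<open>second_trace\<close> involves the columns.\<close>

lemma orthogonal_transpose:
  fixes p q r s :: real
  assumes "p\<^sup>2 + q\<^sup>2 = 1" "r\<^sup>2 + s\<^sup>2 = 1" "p * r + q * s = 0"
  shows "p\<^sup>2 + r\<^sup>2 = 1" "q\<^sup>2 + s\<^sup>2 = 1" "p * q + r * s = 0"
proof -
  have "r\<^sup>2 * (p\<^sup>2 + q\<^sup>2) = q\<^sup>2 * (r\<^sup>2 + s\<^sup>2) + (p * r + q * s) * (p * r - q * s)"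
    by algebra
  then have r: "r\<^sup>2 = q\<^sup>2"
    using assms by simp
  then show a: "p\<^sup>2 + r\<^sup>2 = 1" "q\<^sup>2 + s\<^sup>2 = 1"
    using assms by simp_all
  have "(p * q + r * s)\<^sup>2 = p\<^sup>2 * q\<^sup>2 + r\<^sup>2 * s\<^sup>2 + 2 * (q * s) * (p * r)"
    by algebra
  also have "p * r = - (q * s)"
    using assms(3) by linarith
  also have "p\<^sup>2 * q\<^sup>2 + r\<^sup>2 * s\<^sup>2 + 2 * (q * s) * (- (q * s)) = q\<^sup>2 * (p\<^sup>2 - s\<^sup>2) + s\<^sup>2 * (r\<^sup>2 - q\<^sup>2)"
    by algebra
  also have "\<dots> = 0"
    using a r assms by simp
  finally show "p * q + r * s = 0"
    by simp
qed

context moving_frame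
begin

lemma second_trace:
  assumes u: "u \<in> W" and o: "p\<^sup>2 + q\<^sup>2 = 1" "r\<^sup>2 + s\<^sup>2 = 1" "p * r + q * s = 0"
    and P: "form (e1 u) P = 0" "form (e2 u) P = 0"
  defines "w1 \<equiv> p *\<^sub>R E1 u + q *\<^sub>R E2 u" and "w2 \<equiv> r *\<^sub>R E1 u + s *\<^sub>R E2 u"
  shows "form (frechet_derivative (\<lambda>y. frechet_derivative \<sigma> (at y) w1) (at u) w1) P
    + form (frechet_derivative (\<lambda>y. frechet_derivative \<sigma> (at y) w2) (at u) w2) P = 2 * form (\<sigma> u) P"
proof -
  define Z where "Z w = frechet_derivative (\<lambda>y. frechet_derivative \<sigma> (at y) w) (at u) w" for w
  have orth: "form (frechet_derivative \<sigma> (at x) w) (\<sigma> x) = 0" "form (frechet_derivative \<sigma> (at x) w) (N x) = 0"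
    if x: "x \<in> W" for x w
  proof -
    obtain a b where w: "w = a *\<^sub>R E1 x + b *\<^sub>R E2 x"
      using basis_E[OF x] by blast
    show "form (frechet_derivative \<sigma> (at x) w) (\<sigma> x) = 0" "form (frechet_derivative \<sigma> (at x) w) (N x) = 0"
      unfolding w deriv_along_comb[OF smooth_\<sigma> x] e1[symmetric] e2[symmetric]
      using gram[OF x] by (simp_all add: form_simps)
  qed
  have Z1: "form (Z w) (\<sigma> u) = - form (frechet_derivative \<sigma> (at u) w) (frechet_derivative \<sigma> (at u) w)"
    and Z2: "form (Z w) (N u) = - form (frechet_derivative \<sigma> (at u) w) (frechet_derivative N (at u) w)" for w
    using deriv_form_const[OF smooth_on_frechet[OF smooth_\<sigma>, of w] smooth_\<sigma> u orth(1), of "\<lambda>_. w"]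
      deriv_form_const[OF smooth_on_frechet[OF smooth_\<sigma>, of w] smooth_N u orth(2), of "\<lambda>_. w"]
    by (simp_all add: deriv_along_def Z_def)
  note o' = orthogonal_transpose[OF o]
  have V1: "form (frechet_derivative \<sigma> (at u) (a *\<^sub>R E1 u + b *\<^sub>R E2 u)) (frechet_derivative \<sigma> (at u) (a *\<^sub>R E1 u + b *\<^sub>R E2 u))
      = a\<^sup>2 + b\<^sup>2"
    and V2: "form (frechet_derivative \<sigma> (at u) (a *\<^sub>R E1 u + b *\<^sub>R E2 u)) (frechet_derivative N (at u) (a *\<^sub>R E1 u + b *\<^sub>R E2 u))
      = \<alpha> u * (a\<^sup>2 - b\<^sup>2) + 2 * \<beta> u * (a * b)" for a b
    unfolding deriv_along_comb[OF smooth_\<sigma> u] deriv_along_comb[OF smooth_N u] e1[symmetric] e2[symmetric] frame_equations[OF u]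
    using gram[OF u] by (simp_all add: form_simps power2_eq_square algebra_simps)
  have A: "form (Z w1 + Z w2) (\<sigma> u) = - 2"
    using o by (simp add: form.add_left Z1 w1_def w2_def V1)
  have "form (Z w1 + Z w2) (N u) = - (\<alpha> u * ((p\<^sup>2 + r\<^sup>2) - (q\<^sup>2 + s\<^sup>2)) + 2 * \<beta> u * (p * q + r * s))"
    by (simp add: form.add_left Z2 w1_def w2_def V2 algebra_simps)
  then have B: "form (Z w1 + Z w2) (N u) = 0"
    using o' by simp
  have "form (Z w1 + Z w2) P = 2 * form P (\<sigma> u)"
    using orthoframe_form[OF frame[OF u], of "Z w1 + Z w2" P] A B P
    by (simp add: form_commute[of P "e1 u"] form_commute[of P "e2 u"])
  then show ?thesis
    by (simp add: form.add_left Z_def form_commute[of P])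
qed

text \<open>At a minimum of u the gradient vanishes and 0 \<le> \<Delta>u = 2u.\<close>

lemma linear_min:
  assumes u: "u \<in> W" and min: "\<And>x. x \<in> W \<Longrightarrow> form (\<sigma> u) p \<le> form (\<sigma> x) p"
  shows "form (e1 u) p = 0" "form (e2 u) p = 0" "form (\<sigma> u) p \<ge> 0"
proof -
  have key: "form (frechet_derivative \<sigma> (at u) w) p = 0 \<and>
      form (frechet_derivative (\<lambda>y. frechet_derivative \<sigma> (at y) w) (at u) w) p \<ge> 0" for w
  proof -
    obtain d where d: "d > 0" "\<And>s. \<bar>s\<bar> < d \<Longrightarrow> u + s *\<^sub>R w \<in> W"
      "\<And>s. \<bar>s\<bar> < d \<Longrightarrow> ((\<lambda>s. \<sigma> (u + s *\<^sub>R w)) has_vector_derivative frechet_derivative \<sigma> (at (u + s *\<^sub>R w)) w) (at s)"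
      "((\<lambda>s. frechet_derivative \<sigma> (at (u + s *\<^sub>R w)) w) has_vector_derivative
       frechet_derivative (\<lambda>y. frechet_derivative \<sigma> (at y) w) (at u) w) (at 0)"
      using smooth_on_line[OF open_W u smooth_\<sigma>, of w] by blast
    have A: "((\<lambda>s. - form (\<sigma> (u + s *\<^sub>R w)) p) has_real_derivative - form (frechet_derivative \<sigma> (at (u + s *\<^sub>R w)) w) p) (at s)"
      if "\<bar>s\<bar> < d" for s
      using DERIV_minus[OF has_vector_derivative_form[OF d(3)[OF that] has_vector_derivative_const[of p]]]
      by (simp add: form.zero_right)
    have B: "((\<lambda>s. - form (frechet_derivative \<sigma> (at (u + s *\<^sub>R w)) w) p) has_real_derivative
        - form (frechet_derivative (\<lambda>y. frechet_derivative \<sigma> (at y) w) (at u) w) p) (at 0)"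
      using DERIV_minus[OF has_vector_derivative_form[OF d(4) has_vector_derivative_const[of p]]]
      by (simp add: form.zero_right)
    have C: "- form (\<sigma> (u + s *\<^sub>R w)) p \<le> - form (\<sigma> (u + 0 *\<^sub>R w)) p" if "\<bar>s\<bar> < d" for s
      using min[OF d(2)[OF that]] by simp
    from second_derivative_max[OF d(1) A B C] show ?thesis
      by simp
  qed
  show z: "form (e1 u) p = 0" "form (e2 u) p = 0"
    using key by (simp_all add: e1 e2 deriv_along_def)
  show "form (\<sigma> u) p \<ge> 0"
    using second_trace[OF u _ _ _ z, of 1 0 0 1] key[of "E1 u"] key[of "E2 u"] by simp
qed

end

section \<open>Surfaces asymptotic to a curve at infinity: positivity, acausality and the normal
  bound\<close>

locale asymptotic_surface = lifted_surface S T for S T +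
  fixes \<Gamma> :: "(real ^ 4) set"
  assumes T_nonempty: "T \<noteq> {}"
    and \<Gamma>_compact: "compact \<Gamma>" and \<Gamma>_connected: "connected \<Gamma>"
    and \<Gamma>_null: "\<xi> \<in> \<Gamma> \<Longrightarrow> form \<xi> \<xi> = 0" and \<Gamma>_nonzero: "\<xi> \<in> \<Gamma> \<Longrightarrow> \<xi> \<noteq> 0"
    and \<Gamma>_neg: "\<xi> \<in> \<Gamma> \<Longrightarrow> \<eta> \<in> \<Gamma> \<Longrightarrow> \<xi> \<noteq> \<eta> \<Longrightarrow> form \<xi> \<eta> < 0"
    and \<Gamma>_two: "\<exists>\<xi>\<in>\<Gamma>. \<exists>\<eta>\<in>\<Gamma>. \<xi> \<noteq> \<eta>"
    and asymptotic: "(\<And>k. x k \<in> T) \<Longrightarrow> filterlim (\<lambda>k. norm (x k)) at_top sequentially \<Longrightarrow>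
      \<exists>r::nat \<Rightarrow> nat. strict_mono r \<and> (\<exists>\<xi>\<in>\<Gamma>. \<exists>c>0. (\<lambda>k. x (r k) /\<^sub>R norm (x (r k))) \<longlonglongrightarrow> c *\<^sub>R \<xi>)"
    and \<Gamma>_limit: "\<xi> \<in> \<Gamma> \<Longrightarrow> \<exists>x c. (\<forall>k::nat. x k \<in> T) \<and> (\<lambda>k. c k *\<^sub>R x k) \<longlonglongrightarrow> \<xi>"
begin

text \<open>The open cone dual to \<Gamma>: normals of planes that miss the curve, with the sign
  making all products positive. Its elements provide the test functions
  \<open>form x p\<close>.\<close>

definition "pos p \<longleftrightarrow> (\<forall>\<xi>\<in>\<Gamma>. form \<xi> p > 0)"

lemma \<Gamma>_le: "\<xi> \<in> \<Gamma> \<Longrightarrow> \<eta> \<in> \<Gamma> \<Longrightarrow> form \<xi> \<eta> \<le> 0"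
  using \<Gamma>_neg[of \<xi> \<eta>] \<Gamma>_null[of \<xi>] by (cases "\<xi> = \<eta>") auto

text \<open>Every point of \<Gamma> differs from \<open>\<xi>\<close> or from \<open>\<eta>\<close>,
  and distinct points have negative product, so minus the sum of two points works.\<close>

lemma ex_pos: "\<exists>p. pos p"
proof -
  obtain \<xi> \<eta> where *: "\<xi> \<in> \<Gamma>" "\<eta> \<in> \<Gamma>" "\<xi> \<noteq> \<eta>"
    using \<Gamma>_two by auto
  have "form \<zeta> (- (\<xi> + \<eta>)) > 0" if "\<zeta> \<in> \<Gamma>" for \<zeta>
  proof -
    have "\<zeta> \<noteq> \<xi> \<or> \<zeta> \<noteq> \<eta>"
      using * by auto
    then have "form \<zeta> \<xi> + form \<zeta> \<eta> < 0"
      using \<Gamma>_neg[OF that *(1)] \<Gamma>_neg[OF that *(2)] \<Gamma>_le[OF that *(1)] \<Gamma>_le[OF that *(2)]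
      by (elim disjE) linarith+
    then show ?thesis
      by (simp add: form_simps)
  qed
  then show ?thesis
    unfolding pos_def by blast
qed

text \<open>Compactness of \<Gamma> makes the cone \<open>pos\<close> open. Moving \<open>p\<close>
  both ways in a suitable direction is the device that turns weak inequalities into strict
  ones.\<close>

lemma pos_perturb:
  assumes "pos p"
  obtains d where "d > 0" "\<And>t. \<bar>t\<bar> \<le> d \<Longrightarrow> pos (p + t *\<^sub>R z)"
proof -
  have ne: "\<Gamma> \<noteq> {}"
    using \<Gamma>_two by auto
  have cont: "continuous_on \<Gamma> (\<lambda>\<xi>. form \<xi> p)" "continuous_on \<Gamma> (\<lambda>\<xi>. \<bar>form \<xi> z\<bar>)"
    by (intro continuous_intros)+
  obtain \<xi> where \<xi>: "\<xi> \<in> \<Gamma>" "\<And>\<eta>. \<eta> \<in> \<Gamma> \<Longrightarrow> form \<xi> p \<le> form \<eta> p"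
    using continuous_attains_inf[OF \<Gamma>_compact ne cont(1)] by auto
  obtain \<zeta> where \<zeta>: "\<zeta> \<in> \<Gamma>" "\<And>\<eta>. \<eta> \<in> \<Gamma> \<Longrightarrow> \<bar>form \<eta> z\<bar> \<le> \<bar>form \<zeta> z\<bar>"
    using continuous_attains_sup[OF \<Gamma>_compact ne cont(2)] by auto
  define d where "d = form \<xi> p / (2 * (\<bar>form \<zeta> z\<bar> + 1))"
  have p: "form \<xi> p > 0"
    using assms \<xi> unfolding pos_def by auto
  have "pos (p + t *\<^sub>R z)" if t: "\<bar>t\<bar> \<le> d" for t
    unfolding pos_def
  proof
    fix \<eta> assume \<eta>: "\<eta> \<in> \<Gamma>"
    have "\<bar>t * form \<eta> z\<bar> \<le> d * (\<bar>form \<zeta> z\<bar> + 1)"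
      unfolding abs_mult using t \<zeta>(2)[OF \<eta>] p by (intro mult_mono) (auto simp: d_def)
    also have "\<dots> = form \<xi> p / 2"
    proof -
      have "k / (2 * K) * K = k / 2" if "K > 0" for k K :: real
        using that by simp
      from this[of "\<bar>form \<zeta> z\<bar> + 1"] show ?thesis
        by (simp only: d_def add_nonneg_pos[OF abs_ge_zero zero_less_one])
    qed
    finally have "\<bar>t * form \<eta> z\<bar> \<le> form \<xi> p / 2" .
    then show "form \<eta> (p + t *\<^sub>R z) > 0"
      using \<xi>(2)[OF \<eta>] p by (simp add: form.add_right form.scaleR_right)
  qed
  moreover have "d > 0"
    using p by (simp add: d_def add_nonneg_pos)
  ultimately show thesis
    using that by blast
qed

text \<open>Along a sequence violating every such bound, a subsequence of the normalised points
  would converge to \<open>c *\<^sub>R \<xi>\<close> with \<open>c > 0\<close>, and their products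
  with \<open>p\<close> to a positive number and to at most 0.\<close>

lemma pos_growth:
  assumes "pos p"
  obtains c R where "c > 0" "\<And>x. x \<in> T \<Longrightarrow> norm x \<ge> R \<Longrightarrow> form x p \<ge> c * norm x"
proof (rule ccontr)
  assume "\<not> thesis"
  then have no: "\<exists>x. x \<in> T \<and> norm x \<ge> R \<and> form x p < c * norm x" if "c > 0" for c R
    using that assms \<open>\<And>c R. \<lbrakk>0 < c; \<And>x. x \<in> T \<Longrightarrow> R \<le> norm x \<Longrightarrow> c * norm x \<le> form x p\<rbrakk> \<Longrightarrow> thesis\<close>
    by (metis not_le)
  have "\<forall>k::nat. \<exists>x. x \<in> T \<and> norm x \<ge> real k \<and> form x p < inverse (real (Suc k)) * norm x"
  proof
    fix k :: nat
    show "\<exists>x. x \<in> T \<and> norm x \<ge> real k \<and> form x p < inverse (real (Suc k)) * norm x"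
      by (rule no) simp
  qed
  then obtain x where x: "\<And>k::nat. x k \<in> T" "\<And>k. norm (x k) \<ge> real k"
    "\<And>k. form (x k) p < inverse (real (Suc k)) * norm (x k)"
    by metis
  have "filterlim (\<lambda>k. norm (x k)) at_top sequentially"
    by (rule filterlim_at_top_mono[OF filterlim_real_sequentially]) (use x(2) in auto)
  from asymptotic[OF x(1) this] obtain r \<xi> c where r: "strict_mono (r :: nat \<Rightarrow> nat)" "\<xi> \<in> \<Gamma>" "c > 0"
    "(\<lambda>k. x (r k) /\<^sub>R norm (x (r k))) \<longlonglongrightarrow> c *\<^sub>R \<xi>"
    by auto
  have "(\<lambda>k. form (x (r k) /\<^sub>R norm (x (r k))) p) \<longlonglongrightarrow> form (c *\<^sub>R \<xi>) p"
    by (intro form.tendsto r(4) tendsto_const)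
  moreover have "(\<lambda>k. inverse (real (Suc (r k)))) \<longlonglongrightarrow> 0"
    using LIMSEQ_subseq_LIMSEQ[OF LIMSEQ_inverse_real_of_nat r(1)] by (simp add: o_def)
  moreover have "form (x (r k) /\<^sub>R norm (x (r k))) p \<le> inverse (real (Suc (r k)))" for k
  proof -
    have "norm (x (r k)) > 0"
      using T_nonzero[OF x(1)] by simp
    then show ?thesis
      using x(3)[of "r k"] by (simp add: form.scaleR_left field_simps)
  qed
  ultimately have "form (c *\<^sub>R \<xi>) p \<le> 0"
    using LIMSEQ_le by blast
  moreover have "form \<xi> p > 0"
    using assms r(2) unfolding pos_def by auto
  ultimately show False
    using r(3) by (simp add: form.scaleR_left mult_le_0_iff)
qed

text \<open>The substitute for compactness of \<open>T\<close>: the test functions are proper on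
  it.\<close>

lemma pos_sublevel_compact:
  assumes "pos p"
  shows "compact {x \<in> T. form x p \<le> M}"
proof -
  obtain c R where c: "c > 0" "\<And>x. x \<in> T \<Longrightarrow> norm x \<ge> R \<Longrightarrow> form x p \<ge> c * norm x"
    using pos_growth[OF assms] by metis
  have "norm x \<le> max R (M / c)" if "x \<in> T" "form x p \<le> M" for x
  proof (cases "norm x \<ge> R")
    case True
    then have "c * norm x \<le> M"
      using c(2)[OF that(1)] that(2) by auto
    then have "norm x \<le> M / c"
      using c(1) by (simp add: pos_le_divide_eq mult.commute)
    then show ?thesis
      by simp
  qed auto
  then have "bounded {x \<in> T. form x p \<le> M}"
    unfolding bounded_iff by blast
  moreover have "closed {x \<in> T. form x p \<le> M}"
  proof -
    have "closed {x. form x p \<le> M}"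
      by (intro closed_Collect_le continuous_intros)
    moreover have "{x \<in> T. form x p \<le> M} = T \<inter> {x. form x p \<le> M}"
      by auto
    ultimately show ?thesis
      using T_closed by (simp add: closed_Int)
  qed
  ultimately show ?thesis
    by (simp add: compact_eq_bounded_closed)
qed

lemma linear_min_T:
  assumes x: "x \<in> T" and min: "\<And>y. y \<in> T \<Longrightarrow> form x p \<le> form y p"
  shows "form x p \<ge> 0" "\<exists>e1 e2. orthoframe x e1 e2 (nor x) \<and> form e1 p = 0 \<and> form e2 p = 0"
proof -
  obtain W \<sigma> u where c: "chart W \<sigma>" "u \<in> W" "\<sigma> u = x"
    using ex_chart[OF x] by metis
  obtain e1 e2 N E1 E2 where mf: "moving_frame W \<sigma> e1 e2 N E1 E2" "\<And>u. u \<in> W \<Longrightarrow> N u = nor (\<sigma> u)"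
    using ex_frame[OF c(1)] by metis
  interpret M: moving_frame W \<sigma> e1 e2 N E1 E2
    by (rule mf(1))
  have "\<sigma> y \<in> T" if "y \<in> W" for y
    using c that unfolding chart_def by auto
  then have m: "form (\<sigma> u) p \<le> form (\<sigma> y) p" if "y \<in> W" for y
    using min c(3) that by auto
  show "form x p \<ge> 0"
    using M.linear_min(3)[OF c(2) m] c(3) by simp
  show "\<exists>e1 e2. orthoframe x e1 e2 (nor x) \<and> form e1 p = 0 \<and> form e2 p = 0"
    using M.linear_min(1,2)[OF c(2) m] M.frame[OF c(2)] mf(2)[OF c(2)] c(3) by auto
qed

lemma pos_nonneg:
  assumes "pos p" "x \<in> T"
  shows "form x p \<ge> 0"
proof -
  let ?K = "{y \<in> T. form y p \<le> form x p}"
  have "compact ?K" "?K \<noteq> {}"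
    using pos_sublevel_compact[OF assms(1)] assms(2) by auto
  moreover have "continuous_on ?K (\<lambda>y. form y p)"
    by (intro continuous_intros)
  ultimately obtain y where y: "y \<in> ?K" "\<And>z. z \<in> ?K \<Longrightarrow> form y p \<le> form z p"
    using continuous_attains_inf[of ?K "\<lambda>y. form y p"] by auto
  then have "form y p \<le> form z p" if "z \<in> T" for z
    using that by (cases "form z p \<le> form x p") auto
  then have "form y p \<ge> 0"
    using linear_min_T(1)[of y p] y(1) by auto
  then show ?thesis
    using y(2)[of x] assms(2) by auto
qed

text \<open>Strict positivity follows from the weak one for \<open>p\<close> moved both ways along a
  vector \<open>z\<close> not orthogonal to \<open>x\<close>.\<close>

lemma pos_T:
  assumes "pos p" "x \<in> T"
  shows "form x p > 0"
proof -
  obtain z where z: "form x z \<noteq> 0"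
    using form_nondegenerate T_nonzero[OF assms(2)] by auto
  obtain d where d: "d > 0" "\<And>t. \<bar>t\<bar> \<le> d \<Longrightarrow> pos (p + t *\<^sub>R z)"
    using pos_perturb[OF assms(1)] by metis
  have "form x (p + d *\<^sub>R z) \<ge> 0" "form x (p + (- d) *\<^sub>R z) \<ge> 0"
    by (intro pos_nonneg[OF d(2) assms(2)]; use d(1) in simp)+
  then have "form x p \<ge> \<bar>d * form x z\<bar>"
    by (simp add: form_simps)
  moreover have "\<bar>d * form x z\<bar> > 0"
    using d z by simp
  ultimately show ?thesis
    by linarith
qed

text \<open>\<open>- \<xi>\<close> itself is only on the boundary of the cone, since its product
  with \<open>\<xi>\<close> is zero; adding a positive multiple of \<open>p\<close> leads into the
  interior.\<close>

lemma pos_uminus_add: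
  assumes "pos p" "\<xi> \<in> \<Gamma>" "e > 0"
  shows "pos (- \<xi> + e *\<^sub>R p)"
  unfolding pos_def
proof
  fix \<eta> assume "\<eta> \<in> \<Gamma>"
  then have "form \<eta> \<xi> \<le> 0" "form \<eta> p > 0"
    using assms \<Gamma>_le unfolding pos_def by auto
  then show "form \<eta> (- \<xi> + e *\<^sub>R p) > 0"
    using mult_pos_pos[OF assms(3), of "form \<eta> p"] by (simp add: form_simps)
qed

text \<open>The weak inequality is the limit of positivity for
  \<open>- \<xi> + e *\<^sub>R p\<close>. Equality at \<open>x\<close> would make \<open>x\<close> a
  minimum, so \<open>\<xi>\<close> would be orthogonal to \<open>x\<close> and to the tangent plane,
  hence a multiple of the timelike vector \<open>nor x\<close>, which is impossible for a nonzero
  null vector.\<close>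

lemma \<Gamma>_T_neg:
  assumes \<xi>: "\<xi> \<in> \<Gamma>" and x: "x \<in> T"
  shows "form \<xi> x < 0"
proof -
  obtain p where p: "pos p"
    using ex_pos by auto
  have le: "form y (- \<xi>) \<ge> 0" if y: "y \<in> T" for y
  proof (rule field_le_epsilon)
    fix e :: real assume e: "e > 0"
    have py: "form y p > 0"
      using pos_T[OF p y] .
    have "form y (- \<xi> + (e / form y p) *\<^sub>R p) > 0"
      using pos_T[OF pos_uminus_add[OF p \<xi>] y] e py by auto
    then show "0 \<le> form y (- \<xi>) + e"
      using py by (simp add: form_simps)
  qed
  have "form x (- \<xi>) \<noteq> 0"
  proof
    assume z: "form x (- \<xi>) = 0"
    then have "form x (- \<xi>) \<le> form y (- \<xi>)" if "y \<in> T" for y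
      using le[OF that] by simp
    from linear_min_T(2)[OF x this] obtain e1 e2 where
      e: "orthoframe x e1 e2 (nor x)" "form e1 (- \<xi>) = 0" "form e2 (- \<xi>) = 0"
      by auto
    have "form \<xi> x = 0" "form \<xi> e1 = 0" "form \<xi> e2 = 0"
      using e z by (simp_all add: form_simps form_commute[of \<xi>])
    then have "\<xi> = - form \<xi> (nor x) *\<^sub>R nor x" "form \<xi> \<xi> = - (form \<xi> (nor x))\<^sup>2"
      using orthoframe_expand[OF e(1), of \<xi>] orthoframe_form[OF e(1), of \<xi> \<xi>]
      by (simp_all add: power2_eq_square)
    then show False
      using \<Gamma>_null[OF \<xi>] \<Gamma>_nonzero[OF \<xi>] by simp
  qed
  then show ?thesis
    using le[OF x] by (simp add: form_simps form_commute[of \<xi>])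
qed

lemma pos_uminus_T: "x \<in> T \<Longrightarrow> pos (- x)"
  using \<Gamma>_T_neg unfolding pos_def by (simp add: form_simps)

text \<open>The points \<open>(x/|x|, 1/|x|)\<close> compactify \<open>T\<close> by \<open>\<Gamma>\<close>.\<close>

definition "compactified = closure ((\<lambda>x. (x /\<^sub>R norm x, inverse (norm x))) ` T)"

lemma compact_compactified: "compact compactified"
proof -
  have "norm (x /\<^sub>R norm x, inverse (norm x)) \<le> 2" if "x \<in> T" for x
  proof -
    have n: "norm x \<ge> 1"
      using AdS_hat_norm_ge_1[OF T_AdS[OF that]] .
    have "norm (x /\<^sub>R norm x, inverse (norm x)) \<le> norm (x /\<^sub>R norm x) + norm (inverse (norm x))"
      by (rule norm_Pair_le)
    also have "\<dots> \<le> 1 + 1"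
      using n T_nonzero[OF that] by (intro add_mono) (auto simp: inverse_le_1_iff)
    finally show ?thesis
      by simp
  qed
  then have "bounded ((\<lambda>x. (x /\<^sub>R norm x, inverse (norm x))) ` T)"
    unfolding bounded_iff by blast
  then show ?thesis
    unfolding compactified_def by (simp add: compact_closure)
qed

text \<open>The last coordinate separates two strata: where it is positive, closedness of
  \<open>T\<close> recovers a point of \<open>T\<close>; where it is zero, the norms tend to
  infinity and the limit lies over \<Gamma>.\<close>

lemma compactified_cases:
  assumes "(z, t) \<in> compactified"
  shows "(t > 0 \<and> (\<exists>x\<in>T. z = t *\<^sub>R x)) \<or> (t = 0 \<and> (\<exists>\<xi>\<in>\<Gamma>. \<exists>c>0. z = c *\<^sub>R \<xi>))"
proof -
  obtain w where w: "\<And>k::nat. w k \<in> (\<lambda>x. (x /\<^sub>R norm x, inverse (norm x))) ` T" "w \<longlonglongrightarrow> (z, t)"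
    using assms unfolding compactified_def closure_sequential by auto
  then have "\<forall>k. \<exists>x. x \<in> T \<and> w k = (x /\<^sub>R norm x, inverse (norm x))"
    by (simp add: image_iff) blast
  then obtain x where x: "\<And>k. x k \<in> T" "\<And>k. w k = (x k /\<^sub>R norm (x k), inverse (norm (x k)))"
    by metis
  have lim: "(\<lambda>k. x k /\<^sub>R norm (x k)) \<longlonglongrightarrow> z" "(\<lambda>k. inverse (norm (x k))) \<longlonglongrightarrow> t"
    using tendsto_fst[OF w(2)] tendsto_snd[OF w(2)] by (simp_all add: x(2))
  have n: "norm (x k) > 0" for k
    using T_nonzero[OF x(1)] by simp
  have t0: "t \<ge> 0"
    by (rule LIMSEQ_le_const[OF lim(2)]) auto
  show ?thesis
  proof (cases "t = 0")
    case False
    have "(\<lambda>k. inverse (inverse (norm (x k))) *\<^sub>R (x k /\<^sub>R norm (x k))) \<longlonglongrightarrow> inverse t *\<^sub>R z"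
      using False by (intro tendsto_scaleR tendsto_inverse lim) auto
    moreover have "inverse (inverse (norm (x k))) *\<^sub>R (x k /\<^sub>R norm (x k)) = x k" for k
      using n[of k] by simp
    ultimately have "x \<longlonglongrightarrow> inverse t *\<^sub>R z"
      by simp
    then have "inverse t *\<^sub>R z \<in> T"
      using closed_sequentially[OF T_closed] x(1) by blast
    then show ?thesis
      using False t0 by (intro disjI1 conjI bexI[of _ "inverse t *\<^sub>R z"]) auto
  next
    case True
    have "filterlim (\<lambda>k. inverse (inverse (norm (x k)))) at_top sequentially"
      using lim(2) n True by (intro filterlim_inverse_at_top) auto
    then have "filterlim (\<lambda>k. norm (x k)) at_top sequentially"
      by simp
    from asymptotic[OF x(1) this] obtain r \<xi> c where r: "strict_mono (r :: nat \<Rightarrow> nat)" "\<xi> \<in> \<Gamma>" "c > 0"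
      "(\<lambda>k. x (r k) /\<^sub>R norm (x (r k))) \<longlonglongrightarrow> c *\<^sub>R \<xi>"
      by auto
    moreover have "(\<lambda>k. x (r k) /\<^sub>R norm (x (r k))) \<longlonglongrightarrow> z"
      using LIMSEQ_subseq_LIMSEQ[OF lim(1) r(1)] by (simp add: o_def)
    ultimately have "z = c *\<^sub>R \<xi>"
      using LIMSEQ_unique by blast
    then show ?thesis
      using True r by auto
  qed
qed

text \<open>If two points of \<open>T\<close> were causally related, \<open>(\<langle>x,y\<rangle> + 1) / (U x * U y)\<close> would have a
  positive maximum, at which moving both points simultaneously along matching orthonormal frames
  gives a positive second variation. The summand 1 of \<open>U\<close> makes the inequality strict.\<close>

lemma no_positive_maximum:
  assumes p: "pos p" and x: "x \<in> T" and y: "y \<in> T" and m: "m > 0"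
    and eq: "form x y + 1 = m * (1 + form x p) * (1 + form y p)"
    and max: "\<And>x' y'. x' \<in> T \<Longrightarrow> y' \<in> T \<Longrightarrow> form x' y' + 1 \<le> m * (1 + form x' p) * (1 + form y' p)"
  shows False
proof -
  obtain W \<sigma> u where c: "chart W \<sigma>" "u \<in> W" "\<sigma> u = x"
    using ex_chart[OF x] by metis
  obtain W' \<tau> v where c': "chart W' \<tau>" "v \<in> W'" "\<tau> v = y"
    using ex_chart[OF y] by metis
  obtain e1 e2 N E1 E2 where mf: "moving_frame W \<sigma> e1 e2 N E1 E2"
    using ex_frame[OF c(1)] by metis
  obtain f1 f2 N' F1 F2 where mf': "moving_frame W' \<tau> f1 f2 N' F1 F2"
    using ex_frame[OF c'(1)] by metis
  interpret M: moving_frame W \<sigma> e1 e2 N E1 E2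
    by (rule mf)
  interpret M': moving_frame W' \<tau> f1 f2 N' F1 F2
    by (rule mf')
  have inT: "\<sigma> y \<in> T" if "y \<in> W" for y
    using c that unfolding chart_def by auto
  have inT': "\<tau> y \<in> T" if "y \<in> W'" for y
    using c' that unfolding chart_def by auto
  define X Y where "X = 1 + form x p" and "Y = 1 + form y p"
  have XY: "X > 1" "Y > 1"
    using pos_T[OF p x] pos_T[OF p y] by (simp_all add: X_def Y_def)
  \<comment> \<open>Up to tangential projection, \<open>P\<close> and \<open>Q\<close> are the
    gradients, in the first and second point, of the difference of the two sides of
    \<open>max\<close>.\<close>
  define P Q where "P = y - (m * Y) *\<^sub>R p" and "Q = x - (m * X) *\<^sub>R p"
  have var: "form (frechet_derivative \<sigma> (at u) w) P + form (frechet_derivative \<tau> (at v) w') Q = 0 \<and>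
      form (frechet_derivative (\<lambda>y. frechet_derivative \<sigma> (at y) w) (at u) w) P
      + form (frechet_derivative (\<lambda>y. frechet_derivative \<tau> (at y) w') (at v) w') Q
      + 2 * (form (frechet_derivative \<sigma> (at u) w) (frechet_derivative \<tau> (at v) w')
        - m * form (frechet_derivative \<sigma> (at u) w) p * form (frechet_derivative \<tau> (at v) w') p) \<le> 0" for w w'
  proof -
    obtain d where d: "d > 0" "\<And>s. \<bar>s\<bar> < d \<Longrightarrow> u + s *\<^sub>R w \<in> W"
      "\<And>s. \<bar>s\<bar> < d \<Longrightarrow> ((\<lambda>s. \<sigma> (u + s *\<^sub>R w)) has_vector_derivative frechet_derivative \<sigma> (at (u + s *\<^sub>R w)) w) (at s)"
      "((\<lambda>s. frechet_derivative \<sigma> (at (u + s *\<^sub>R w)) w) has_vector_derivative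
       frechet_derivative (\<lambda>y. frechet_derivative \<sigma> (at y) w) (at u) w) (at 0)"
      using smooth_on_line[OF M.open_W c(2) M.smooth_\<sigma>, of w] by blast
    obtain d' where d': "d' > 0" "\<And>s. \<bar>s\<bar> < d' \<Longrightarrow> v + s *\<^sub>R w' \<in> W'"
      "\<And>s. \<bar>s\<bar> < d' \<Longrightarrow> ((\<lambda>s. \<tau> (v + s *\<^sub>R w')) has_vector_derivative frechet_derivative \<tau> (at (v + s *\<^sub>R w')) w') (at s)"
      "((\<lambda>s. frechet_derivative \<tau> (at (v + s *\<^sub>R w')) w') has_vector_derivative
       frechet_derivative (\<lambda>y. frechet_derivative \<tau> (at y) w') (at v) w') (at 0)"
      using smooth_on_line[OF M'.open_W c'(2) M'.smooth_\<sigma>, of w'] by blast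
    define a a' b b' where "a s = \<sigma> (u + s *\<^sub>R w)" and "a' s = frechet_derivative \<sigma> (at (u + s *\<^sub>R w)) w"
      and "b s = \<tau> (v + s *\<^sub>R w')" and "b' s = frechet_derivative \<tau> (at (v + s *\<^sub>R w')) w'" for s
    let ?a'' = "frechet_derivative (\<lambda>y. frechet_derivative \<sigma> (at y) w) (at u) w"
    let ?b'' = "frechet_derivative (\<lambda>y. frechet_derivative \<tau> (at y) w') (at v) w'"
    have D: "(a has_vector_derivative a' s) (at s)" "(b has_vector_derivative b' s) (at s)" if "\<bar>s\<bar> < min d d'" for s
      using d(3)[of s] d'(3)[of s] that unfolding a_def a'_def b_def b'_def by auto
    have D2: "(a' has_vector_derivative ?a'') (at 0)" "(b' has_vector_derivative ?b'') (at 0)"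
      using d(4) d'(4) unfolding a'_def b'_def by auto
    have Dp: "((\<lambda>s. form (f s) p) has_real_derivative form f' p) (at s)"
      if "(f has_vector_derivative f') (at s)" for f f' and s :: real
      using has_vector_derivative_form[OF that has_vector_derivative_const[of p]] by (simp add: form.zero_right)
    define \<phi> where "\<phi> s = form (a s) (b s) + 1 - m * ((1 + form (a s) p) * (1 + form (b s) p))" for s
    define \<phi>' where "\<phi>' s = form (a s) (b' s) + form (a' s) (b s)
        - m * ((1 + form (a s) p) * form (b' s) p + form (a' s) p * (1 + form (b s) p))" for s
    have "(\<phi> has_real_derivative \<phi>' s) (at s)" if "\<bar>s\<bar> < min d d'" for s
      unfolding \<phi>_def \<phi>'_def
      by (rule derivative_eq_intros has_vector_derivative_form[OF D[OF that]] Dp[OF D(1)[OF that]] Dp[OF D(2)[OF that]] refl | simp)+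
    moreover have "(\<phi>' has_real_derivative (form (a 0) ?b'' + form (a' 0) (b' 0) + (form (a' 0) (b' 0) + form ?a'' (b 0))
        - m * (((1 + form (a 0) p) * form ?b'' p + form (a' 0) p * form (b' 0) p)
          + (form (a' 0) p * form (b' 0) p + form ?a'' p * (1 + form (b 0) p))))) (at 0)"
    proof -
      have z: "\<bar>0 :: real\<bar> < min d d'"
        using d(1) d'(1) by simp
      show ?thesis
        unfolding \<phi>'_def
        by (rule derivative_eq_intros has_vector_derivative_form[OF D(1)[OF z] D2(2)] has_vector_derivative_form[OF D2(1) D(2)[OF z]]
            Dp[OF D(1)[OF z]] Dp[OF D(2)[OF z]] Dp[OF D2(1)] Dp[OF D2(2)] refl | simp)+
    qed
    moreover have "\<phi> s \<le> \<phi> 0" if "\<bar>s\<bar> < min d d'" for s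
    proof -
      have "\<phi> 0 = 0"
        using eq c(3) c'(3) by (simp add: \<phi>_def a_def b_def mult.assoc)
      moreover have "a s \<in> T" "b s \<in> T"
        using inT inT' d(2)[of s] d'(2)[of s] that by (auto simp: a_def b_def)
      ultimately show ?thesis
        using max[of "a s" "b s"] by (simp add: \<phi>_def mult.assoc)
    qed
    moreover have "min d d' > 0"
      using d(1) d'(1) by simp
    ultimately have *: "\<phi>' 0 = 0" "(form (a 0) ?b'' + form (a' 0) (b' 0) + (form (a' 0) (b' 0) + form ?a'' (b 0))
        - m * (((1 + form (a 0) p) * form ?b'' p + form (a' 0) p * form (b' 0) p)
          + (form (a' 0) p * form (b' 0) p + form ?a'' p * (1 + form (b 0) p)))) \<le> 0"
      using second_derivative_max[of "min d d'" \<phi> \<phi>'] by blast+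
    have 0: "a 0 = x" "b 0 = y" "a' 0 = frechet_derivative \<sigma> (at u) w" "b' 0 = frechet_derivative \<tau> (at v) w'"
      using c(3) c'(3) by (simp_all add: a_def b_def a'_def b'_def)
    show ?thesis
      using * unfolding \<phi>'_def 0 P_def Q_def X_def[symmetric] Y_def[symmetric]
      by (simp add: form_simps form_commute[of x] algebra_simps)
  qed
  have lin: "linear (frechet_derivative \<sigma> (at u))" "linear (frechet_derivative \<tau> (at v))"
    using smooth_on_has_derivative[OF M.smooth_\<sigma> c(2)] smooth_on_has_derivative[OF M'.smooth_\<sigma> c'(2)] has_derivative_linear by auto
  \<comment> \<open>Varying one point alone shows that \<open>P\<close> is orthogonal to the tangent
    plane at \<open>x\<close>, and likewise \<open>Q\<close> at \<open>y\<close>.\<close>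
  have tP: "form (frechet_derivative \<sigma> (at u) w) P = 0" for w
    using var[of w 0] by (simp add: linear_0[OF lin(2)] form.zero_left)
  have tQ: "form (frechet_derivative \<tau> (at v) w) Q = 0" for w
    using var[of 0 w] by (simp add: linear_0[OF lin(1)] form.zero_left)
  have a1: "1 + form x y = m * X * Y"
    using eq by (simp add: X_def Y_def)
  then have a1p: "1 + form x y > 0"
    using m XY by simp
  have F: "orthoframe x (e1 u) (e2 u) (N u)" "orthoframe y (f1 v) (f2 v) (N' v)"
    using M.frame[OF c(2)] M'.frame[OF c'(2)] c(3) c'(3) by simp_all
  define MM where "MM e f = form e f - form e y * form f x / (1 + form x y)" for e f
  obtain a b r s where o: "a\<^sup>2 + b\<^sup>2 = 1" "r\<^sup>2 + s\<^sup>2 = 1" "a * r + b * s = 0"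
    "MM (a *\<^sub>R e1 u + b *\<^sub>R e2 u) (f1 v) + MM (r *\<^sub>R e1 u + s *\<^sub>R e2 u) (f2 v) \<ge> 2"
    using two_frames[OF F] a1p unfolding MM_def by auto
  define w1 w2 where "w1 = a *\<^sub>R E1 u + b *\<^sub>R E2 u" and "w2 = r *\<^sub>R E1 u + s *\<^sub>R E2 u"
  have Dw: "frechet_derivative \<sigma> (at u) w1 = a *\<^sub>R e1 u + b *\<^sub>R e2 u" "frechet_derivative \<sigma> (at u) w2 = r *\<^sub>R e1 u + s *\<^sub>R e2 u"
    unfolding w1_def w2_def deriv_along_comb[OF M.smooth_\<sigma> c(2)] M.e1 M.e2 by auto
  have Df: "frechet_derivative \<tau> (at v) (F1 v) = f1 v" "frechet_derivative \<tau> (at v) (F2 v) = f2 v"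
    by (simp_all add: M'.e1 M'.e2 deriv_along_def)
  \<comment> \<open>Criticality expresses products with \<open>p\<close> by products with the
    opposite point, which turns the mixed second derivative into the pairing of
    \<open>two_frames\<close>.\<close>
  have eMM: "form e f - m * form e p * form f p = MM e f"
    if "e = frechet_derivative \<sigma> (at u) w" "f = frechet_derivative \<tau> (at v) w'" for e f w w'
  proof -
    have "form e y = m * Y * form e p" "form f x = m * X * form f p"
      using tP[of w] tQ[of w'] that by (simp_all add: P_def Q_def form_simps)
    then show ?thesis
      unfolding MM_def a1 using m XY by simp
  qed
  have S: "form (frechet_derivative (\<lambda>y. frechet_derivative \<sigma> (at y) w1) (at u) w1) P
      + form (frechet_derivative (\<lambda>y. frechet_derivative \<sigma> (at y) w2) (at u) w2) P = 2 * form x P"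
    using M.second_trace[OF c(2) o(1-3), of P] tP[of "E1 u"] tP[of "E2 u"] c(3)
    by (simp add: w1_def w2_def M.e1 M.e2 deriv_along_def)
  have S': "form (frechet_derivative (\<lambda>y. frechet_derivative \<tau> (at y) (F1 v)) (at v) (F1 v)) Q
      + form (frechet_derivative (\<lambda>y. frechet_derivative \<tau> (at y) (F2 v)) (at v) (F2 v)) Q = 2 * form y Q"
    using M'.second_trace[OF c'(2), of 1 0 0 1 Q] tQ[of "F1 v"] tQ[of "F2 v"] c'(3)
    by (simp add: M'.e1 M'.e2 deriv_along_def)
  have arith: "X' + Y' + (M1 + M2) \<le> 0"
    if "A + B + 2 * M1 \<le> 0" "C + D + 2 * M2 \<le> 0" "A + C = 2 * X'" "B + D = 2 * Y'"
    for A B C D M1 M2 X' Y' :: real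
    using that by linarith
  have "form x P + form y Q + (MM (a *\<^sub>R e1 u + b *\<^sub>R e2 u) (f1 v) + MM (r *\<^sub>R e1 u + s *\<^sub>R e2 u) (f2 v)) \<le> 0"
    by (rule arith[OF conjunct2[OF var[of w1 "F1 v"], unfolded Dw Df eMM[OF Dw(1)[symmetric] Df(1)[symmetric]]]
      conjunct2[OF var[of w2 "F2 v"], unfolded Dw Df eMM[OF Dw(2)[symmetric] Df(2)[symmetric]]] S S'])
  then have "form x P + form y Q \<le> - 2"
    using o(4) by linarith
  \<comment> \<open>With these values the inequality becomes \<open>m * X + m * Y \<le> 0\<close>,
    against the positivity of all factors.\<close>
  moreover have "form x P = m * Y - 1" "form y Q = m * X - 1"
    using a1 by (simp_all add: P_def Q_def form_simps form_commute[of y x] X_def Y_def algebra_simps)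
  ultimately show False
    using mult_pos_pos[OF m, of Y] mult_pos_pos[OF m, of X] XY by linarith
qed

text \<open>The quotient of \<open>no_positive_maximum\<close> is rescaled by the norms of both
  points so that it extends to the compactification. If one point is ideal, the numerator is
  nonpositive by \<open>\<Gamma>_T_neg\<close> and \<open>\<Gamma>_le\<close>, so a positive maximum
  would be attained at two points of \<open>T\<close>, which is excluded.\<close>

lemma acausal:
  assumes "x \<in> T" "y \<in> T"
  shows "form x y \<le> -1"
proof (rule ccontr)
  assume neg: "\<not> form x y \<le> -1"
  obtain p where p: "pos p"
    using ex_pos by auto
  let ?e = "\<lambda>x. (x /\<^sub>R norm x, inverse (norm x))"
  have den: "t + form z p > 0" if "(z, t) \<in> compactified" for z t
    using compactified_cases[OF that]
  proof
    assume "t > 0 \<and> (\<exists>x\<in>T. z = t *\<^sub>R x)"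
    then obtain x where "t > 0" "x \<in> T" "z = t *\<^sub>R x"
      by auto
    then show ?thesis
      using pos_T[OF p, of x] by (simp add: form_simps add_pos_pos)
  next
    assume "t = 0 \<and> (\<exists>\<xi>\<in>\<Gamma>. \<exists>c>0. z = c *\<^sub>R \<xi>)"
    then show ?thesis
      using p unfolding pos_def by (auto simp: form_simps)
  qed
  \<comment> \<open>Numerator and denominator are homogeneous of the same degree in each of the two
    pairs, so \<open>?e x\<close> may stand for \<open>(x, 1)\<close>; the last coordinates play the
    role of the summands 1.\<close>
  define H where "H q = (form (fst (fst q)) (fst (snd q)) + snd (fst q) * snd (snd q)) /
      ((snd (fst q) + form (fst (fst q)) p) * (snd (snd q) + form (fst (snd q)) p))" for q :: "((real ^ 4) \<times> real) \<times> ((real ^ 4) \<times> real)"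
  have "continuous_on (compactified \<times> compactified) H"
    unfolding H_def
    by (intro continuous_intros) (auto dest!: den)
  moreover have "compact (compactified \<times> compactified)"
    by (intro compact_Times compact_compactified)
  moreover have emb: "?e x \<in> compactified" if "x \<in> T" for x
    unfolding compactified_def by (rule subsetD[OF closure_subset], rule imageI[OF that])
  then have "compactified \<times> compactified \<noteq> {}"
    using assms by auto
  ultimately have "\<exists>q\<in>compactified \<times> compactified. \<forall>q'\<in>compactified \<times> compactified. H q' \<le> H q"
    by (intro continuous_attains_sup)
  then obtain q where q: "q \<in> compactified \<times> compactified" "\<forall>q'\<in>compactified \<times> compactified. H q' \<le> H q"
    by (elim bexE)
  have scale: "form (n *\<^sub>R a) (k *\<^sub>R b) + n * k = (n * k) * (form a b + 1)"
    "(n + form (n *\<^sub>R a) p) * (k + form (k *\<^sub>R b) p) = (n * k) * ((1 + form a p) * (1 + form b p))" for n k a b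
    by (simp_all add: form_simps algebra_simps)
  have HT: "H (?e a, ?e b) = (form a b + 1) / ((1 + form a p) * (1 + form b p))" if "a \<in> T" "b \<in> T" for a b
  proof -
    define n k where "n = inverse (norm a)" and "k = inverse (norm b)"
    have "n \<noteq> 0" "k \<noteq> 0"
      using T_nonzero that by (auto simp: n_def k_def)
    then have nk: "n * k \<noteq> 0"
      by simp
    have "H (?e a, ?e b) = ((n * k) * (form a b + 1)) / ((n * k) * ((1 + form a p) * (1 + form b p)))"
      by (simp only: H_def fst_conv snd_conv n_def[symmetric] k_def[symmetric] scale)
    then show ?thesis
      by (simp only: mult_divide_mult_cancel_left[OF nk])
  qed
  define m where "m = H q"
  have up: "1 + form a p > 0" if "a \<in> T" for a
    using pos_T[OF p that] by simp
  have "H (?e x, ?e y) > 0"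
    unfolding HT[OF assms] using neg up assms by simp
  then have m: "m > 0"
    using bspec[OF q(2), of "(?e x, ?e y)"] emb assms unfolding m_def by auto
  obtain z t z' t' where q': "q = ((z, t), (z', t'))"
    by (metis prod.exhaust)
  have zt: "(z, t) \<in> compactified" "(z', t') \<in> compactified"
    using q(1) q' by auto
  have num: "form z z' + t * t' > 0"
  proof -
    have "m * ((t + form z p) * (t' + form z' p)) = form z z' + t * t'"
      using den[OF zt(1)] den[OF zt(2)] unfolding m_def H_def q' by simp
    then show ?thesis
      using mult_pos_pos[OF m mult_pos_pos[OF den[OF zt(1)] den[OF zt(2)]]] by simp
  qed
  have "t > 0 \<and> t' > 0"
  proof (rule ccontr)
    assume *: "\<not> (t > 0 \<and> t' > 0)"
    have neg': "form (c *\<^sub>R \<xi>) w \<le> 0" if "\<xi> \<in> \<Gamma>" "c > 0" "(w, s) \<in> compactified" for c \<xi> w s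
      using compactified_cases[OF that(3)] less_imp_le[OF \<Gamma>_T_neg[OF that(1)]] \<Gamma>_le[OF that(1)] that(2)
      by (auto simp: form_simps mult_le_0_iff)
    have "t = 0 \<or> t' = 0"
      using compactified_cases[OF zt(1)] compactified_cases[OF zt(2)] * by linarith
    then have "form z z' \<le> 0 \<and> t * t' = 0"
    proof
      assume t: "t = 0"
      then obtain \<xi> c where "\<xi> \<in> \<Gamma>" "c > 0" "z = c *\<^sub>R \<xi>"
        using compactified_cases[OF zt(1)] by auto
      then show ?thesis
        using neg'[OF _ _ zt(2)] t by simp
    next
      assume t: "t' = 0"
      then obtain \<xi> c where "\<xi> \<in> \<Gamma>" "c > 0" "z' = c *\<^sub>R \<xi>"
        using compactified_cases[OF zt(2)] by auto
      then show ?thesis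
        using neg'[OF _ _ zt(1)] t unfolding form_commute[of z z'] by simp
    qed
    then have "form z z' \<le> 0" "t * t' = 0"
      by auto
    then show False
      using num by linarith
  qed
  then obtain a b where ab: "a \<in> T" "z = t *\<^sub>R a" "b \<in> T" "z' = t' *\<^sub>R b" and tp: "t > 0" "t' > 0"
    using compactified_cases[OF zt(1)] compactified_cases[OF zt(2)] by auto
  have "m = ((t * t') * (form a b + 1)) / ((t * t') * ((1 + form a p) * (1 + form b p)))"
    by (simp only: m_def H_def q' ab fst_conv snd_conv scale)
  moreover have tt: "t * t' \<noteq> 0"
    using tp by simp
  ultimately have "m = (form a b + 1) / ((1 + form a p) * (1 + form b p))"
    by (simp only: mult_divide_mult_cancel_left[OF tt])
  then have "form a b + 1 = m * ((1 + form a p) * (1 + form b p))"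
    using mult_pos_pos[OF up[OF ab(1)] up[OF ab(3)]] by (simp only: eq_divide_eq split: if_splits)
  then have "form a b + 1 = m * (1 + form a p) * (1 + form b p)"
    by (simp only: mult.assoc)
  moreover have "form a' b' + 1 \<le> m * (1 + form a' p) * (1 + form b' p)" if "a' \<in> T" "b' \<in> T" for a' b'
  proof -
    have "(form a' b' + 1) / ((1 + form a' p) * (1 + form b' p)) \<le> m"
      using bspec[OF q(2), of "(?e a', ?e b')"] emb that HT[OF that] unfolding m_def by auto
    then show ?thesis
      using up[OF that(1)] up[OF that(2)] by (simp add: pos_divide_le_eq mult.assoc)
  qed
  ultimately show False
    using no_positive_maximum[OF p ab(1,3) m] by blast
qed

text \<open>Fix \<open>y\<close> and maximise the squared ratio of \<open>form (nor z) y\<close> to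
  \<open>form z y\<close> over a compact sublevel set. If it exceeds L^2 there, moving along the
  gradient of \<open>form z y\<close> stays inside the set and increases the ratio further, because
  the derivative of the normal is bounded by \<lambda> \<le> L. No information on the normal at
  infinity enters.\<close>

lemma normal_bound:
  assumes L: "L \<ge> 0" "\<And>x. x \<in> T \<Longrightarrow> lam x \<le> L" and x: "x \<in> T" and y: "y \<in> T"
  shows "\<bar>form y (nor x)\<bar> \<le> - L * form y x"
proof (rule ccontr)
  assume neg: "\<not> \<bar>form y (nor x)\<bar> \<le> - L * form y x"
  define \<rho> where "\<rho> z = (form (nor z) y)\<^sup>2 / (form z y)\<^sup>2" for z
  let ?K = "{z \<in> T. form z (- y) \<le> form x (- y)}"
  have K: "compact ?K" "?K \<noteq> {}"
    using pos_sublevel_compact[OF pos_uminus_T[OF y]] x by auto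
  have a0: "form z y \<le> -1" if "z \<in> T" for z
    using acausal[OF that y] .
  have cont: "continuous_on ?K \<rho>"
    unfolding \<rho>_def using a0 continuous_on_subset[OF continuous_on_nor, of ?K]
    by (intro continuous_intros) fastforce+
  then obtain z where z: "z \<in> ?K" "\<And>w. w \<in> ?K \<Longrightarrow> \<rho> w \<le> \<rho> z"
    using continuous_attains_sup[OF K cont] by auto
  have zT: "z \<in> T"
    using z by auto
  obtain W \<sigma> u where c: "chart W \<sigma>" "u \<in> W" "\<sigma> u = z"
    using ex_chart[OF zT] by metis
  obtain e1 e2 N E1 E2 where mf: "moving_frame W \<sigma> e1 e2 N E1 E2" "\<And>u. u \<in> W \<Longrightarrow> N u = nor (\<sigma> u)"
    "\<And>u. u \<in> W \<Longrightarrow> (lam (\<sigma> u))\<^sup>2 = (form (deriv_along E1 N u) (e1 u))\<^sup>2 + (form (deriv_along E1 N u) (e2 u))\<^sup>2"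
    using ex_frame[OF c(1)] by metis
  interpret M: moving_frame W \<sigma> e1 e2 N E1 E2
    by (rule mf(1))
  define a n r where "a = form z y" and "n = form (nor z) y" and "r = sqrt (\<rho> z)"
  have a: "a \<le> -1"
    using a0[OF zT] by (simp add: a_def)
  have rho: "\<rho> z > L\<^sup>2"
  proof -
    have "form x y < 0"
      using a0[OF x] by simp
    moreover have "(L * form x y)\<^sup>2 < (form (nor x) y)\<^sup>2"
    proof -
      have "\<bar>L * form x y\<bar> < \<bar>form (nor x) y\<bar>"
        using neg L(1) \<open>form x y < 0\<close> by (simp add: form_commute[of y] abs_mult)
      then show ?thesis
        using abs_le_square_iff[of "form (nor x) y" "L * form x y"] by linarith
    qed
    ultimately have "L\<^sup>2 < \<rho> x"
      unfolding \<rho>_def by (simp add: pos_less_divide_eq power_mult_distrib)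
    then show ?thesis
      using z(2)[of x] x by auto
  qed
  then have r: "r > L" "r\<^sup>2 = \<rho> z"
    using L(1) unfolding r_def by (auto intro: real_less_rsqrt order_trans[OF zero_le_power2 less_imp_le])
  have n2: "n\<^sup>2 = r\<^sup>2 * a\<^sup>2"
    using a r(2) by (simp add: \<rho>_def a_def n_def)
  define c1 c2 where "c1 = form (e1 u) y" and "c2 = form (e2 u) y"
  have Nu: "N u = nor z"
    using mf(2)[OF c(2)] c(3) by simp
  have yy: "c1\<^sup>2 + c2\<^sup>2 - a\<^sup>2 - n\<^sup>2 = -1"
    using orthoframe_form[OF M.frame[OF c(2)], of y y] T_form[OF y] c(3) Nu
    by (simp add: c1_def c2_def a_def n_def form_commute[of y "e1 u"] form_commute[of y "e2 u"]
        form_commute[of y z] form_commute[of y "nor z"] power2_eq_square)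
  define q where "q = c1\<^sup>2 + c2\<^sup>2"
  \<comment> \<open>\<open>q\<close> is the squared gradient of \<open>form z y\<close>. If it
    vanished, a^2 + n^2 = 1 together with a^2 \<ge> 1 would make the ratio zero.\<close>
  have "q > 0"
  proof (rule ccontr)
    assume "\<not> q > 0"
    then have "a\<^sup>2 + n\<^sup>2 = 1"
      using yy by (smt (verit) q_def zero_le_power2)
    moreover have "a\<^sup>2 \<ge> 1"
      using a power_mono[of 1 "\<bar>a\<bar>" 2] by simp
    ultimately have "n\<^sup>2 = 0"
      by (smt (verit) zero_le_power2)
    then have "\<rho> z = 0"
      by (simp add: \<rho>_def n_def)
    then show False
      using rho by simp
  qed
  \<comment> \<open>The gradient direction: along it \<open>form z y\<close> has derivative
    \<open>q\<close>, and \<open>form (nor z) y\<close> has derivative \<open>h\<close> with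
    absolute value at most \<open>L * q\<close>.\<close>
  define v where "v = c1 *\<^sub>R E1 u + c2 *\<^sub>R E2 u"
  define h where "h = M.\<alpha> u * (c1\<^sup>2 - c2\<^sup>2) + 2 * M.\<beta> u * (c1 * c2)"
  have Dv: "form (frechet_derivative \<sigma> (at u) v) y = q" "form (frechet_derivative N (at u) v) y = h"
    unfolding v_def deriv_along_comb[OF M.smooth_\<sigma> c(2)] deriv_along_comb[OF M.smooth_N c(2)]
      M.frame_equations[OF c(2)] M.e1[symmetric] M.e2[symmetric]
    by (simp_all add: form_simps c1_def[symmetric] c2_def[symmetric] q_def h_def power2_eq_square algebra_simps)
  have hb: "\<bar>h\<bar> \<le> L * q"
  proof -
    have "h\<^sup>2 + (M.\<alpha> u * (2 * c1 * c2) - M.\<beta> u * (c1\<^sup>2 - c2\<^sup>2))\<^sup>2 = ((M.\<alpha> u)\<^sup>2 + (M.\<beta> u)\<^sup>2) * q\<^sup>2"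
      unfolding h_def q_def by algebra
    also have "\<dots> = (lam z * q)\<^sup>2"
      using mf(3)[OF c(2)] c(3) by (simp add: M.\<alpha>_def M.\<beta>_def power_mult_distrib)
    finally have "h\<^sup>2 \<le> (lam z * q)\<^sup>2"
      by (smt (verit) zero_le_power2)
    then have "\<bar>h\<bar> \<le> \<bar>lam z * q\<bar>"
      by (simp add: abs_le_square_iff)
    also have "\<dots> \<le> L * q"
      using lam_nonneg[OF zT] L(2)[OF zT] \<open>q > 0\<close> by (simp add: abs_mult mult_right_mono)
    finally show ?thesis .
  qed
  obtain d where d: "d > 0" "\<And>s. \<bar>s\<bar> < d \<Longrightarrow> u + s *\<^sub>R v \<in> W"
    "\<And>s. \<bar>s\<bar> < d \<Longrightarrow> ((\<lambda>s. \<sigma> (u + s *\<^sub>R v)) has_vector_derivative frechet_derivative \<sigma> (at (u + s *\<^sub>R v)) v) (at s)"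
    using smooth_on_line[OF M.open_W c(2) M.smooth_\<sigma>, of v] by metis
  obtain dn where dn: "dn > 0"
    "\<And>s. \<bar>s\<bar> < dn \<Longrightarrow> ((\<lambda>s. N (u + s *\<^sub>R v)) has_vector_derivative frechet_derivative N (at (u + s *\<^sub>R v)) v) (at s)"
    using smooth_on_line[OF M.open_W c(2) M.smooth_N, of v] by metis
  define as ns where "as s = form (\<sigma> (u + s *\<^sub>R v)) y" and "ns s = form (N (u + s *\<^sub>R v)) y" for s
  have Da: "(as has_real_derivative q) (at 0)" and Dn: "(ns has_real_derivative h) (at 0)"
    using has_vector_derivative_form[OF d(3)[of 0] has_vector_derivative_const[of y]]
      has_vector_derivative_form[OF dn(2)[of 0] has_vector_derivative_const[of y]] d(1) dn(1) Dv
    by (simp_all add: as_def[abs_def] ns_def[abs_def] form.zero_right)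
  have 0: "as 0 = a" "ns 0 = n"
    using c(3) Nu by (simp_all add: as_def ns_def a_def n_def)
  \<comment> \<open>The difference vanishes at 0 and is positive exactly where the squared ratio
    exceeds its maximal value r^2.\<close>
  have Dg: "((\<lambda>s. (ns s)\<^sup>2 - r\<^sup>2 * (as s)\<^sup>2) has_real_derivative 2 * (n * h) - 2 * (r\<^sup>2 * (a * q))) (at 0)"
    using Da Dn by (auto intro!: derivative_eq_intros simp: 0)
  have "n * h \<ge> - (r * (- a) * (L * q))"
  proof -
    have "\<bar>n\<bar> = r * (- a)"
    proof -
      have "n\<^sup>2 = (r * (- a))\<^sup>2"
        using n2 by (simp add: power_mult_distrib)
      moreover have "r * (- a) \<ge> 0"
        using r(1) L(1) a by (intro mult_nonneg_nonneg) auto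
      ultimately show ?thesis
        by (metis abs_of_nonneg power2_eq_iff abs_minus_cancel)
    qed
    then have "\<bar>n * h\<bar> \<le> r * (- a) * (L * q)"
      unfolding abs_mult using hb r(1) L(1) a by (metis abs_ge_zero mult_left_mono)
    then show ?thesis
      by linarith
  qed
  moreover have "r * (- a) * (L * q) < r * (- a) * (r * q)"
    using r(1) L(1) a \<open>q > 0\<close> by (intro mult_strict_left_mono mult_strict_right_mono mult_pos_pos) auto
  ultimately have "2 * (n * h) - 2 * (r\<^sup>2 * (a * q)) > 0"
    by (simp add: power2_eq_square algebra_simps)
  from DERIV_pos_inc_right[OF Dg this] obtain d2 where d2: "d2 > 0"
    "\<And>s. s > 0 \<Longrightarrow> s < d2 \<Longrightarrow> (ns 0)\<^sup>2 - r\<^sup>2 * (as 0)\<^sup>2 < (ns s)\<^sup>2 - r\<^sup>2 * (as s)\<^sup>2"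
    by auto
  from DERIV_pos_inc_right[OF Da \<open>q > 0\<close>] obtain d3 where d3: "d3 > 0"
    "\<And>s. s > 0 \<Longrightarrow> s < d3 \<Longrightarrow> as 0 < as s"
    by auto
  define s where "s = min d (min d2 d3) / 2"
  have s: "s > 0" "s < d" "s < d2" "s < d3"
    using d d2 d3 by (auto simp: s_def)
  let ?w = "\<sigma> (u + s *\<^sub>R v)"
  have uW: "u + s *\<^sub>R v \<in> W"
    using d(2)[of s] s by auto
  have wT: "?w \<in> T"
    using c(1) uW unfolding chart_def by auto
  have "as s > a"
    using d3(2)[OF s(1,4)] 0 by simp
  then have "?w \<in> ?K"
    using wT z(1) by (simp add: form_simps as_def a_def)
  then have "\<rho> ?w \<le> r\<^sup>2"
    using z(2) r(2) by simp
  moreover have "(ns s)\<^sup>2 > r\<^sup>2 * (as s)\<^sup>2"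
    using d2(2)[OF s(1,3)] n2 unfolding 0 by simp
  moreover have "as s \<noteq> 0"
    using a0[OF wT] by (auto simp: as_def)
  moreover have "\<rho> ?w = (ns s)\<^sup>2 / (as s)\<^sup>2"
    using mf(2)[OF uW] by (simp add: \<rho>_def as_def ns_def)
  ultimately show False
    by (simp add: pos_divide_le_eq)
qed

text \<open>Passage to the limit in \<open>normal_bound\<close>. The factors \<open>c k\<close> may
  have either sign, so the inequality is first put into a homogeneous form with absolute
  values.\<close>

lemma normal_bound_\<Gamma>:
  assumes L: "L \<ge> 0" "\<And>x. x \<in> T \<Longrightarrow> lam x \<le> L" and x: "x \<in> T" and \<xi>: "\<xi> \<in> \<Gamma>"
  shows "\<bar>form \<xi> (nor x)\<bar> \<le> - L * form \<xi> x"
proof -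
  obtain y c where y: "\<And>k::nat. y k \<in> T" "(\<lambda>k. c k *\<^sub>R y k) \<longlonglongrightarrow> \<xi>"
    using \<Gamma>_limit[OF \<xi>] by auto
  have "\<bar>form (c k *\<^sub>R y k) (nor x)\<bar> \<le> L * \<bar>form (c k *\<^sub>R y k) x\<bar>" for k
  proof -
    have "\<bar>form (y k) (nor x)\<bar> \<le> L * \<bar>form (y k) x\<bar>"
      using normal_bound[OF L x y(1)[of k]] acausal[OF y(1)[of k] x] by simp
    then show ?thesis
      by (simp add: form.scaleR_left abs_mult mult_left_mono mult.left_commute[of L])
  qed
  moreover have "(\<lambda>k. \<bar>form (c k *\<^sub>R y k) (nor x)\<bar>) \<longlonglongrightarrow> \<bar>form \<xi> (nor x)\<bar>"
    "(\<lambda>k. L * \<bar>form (c k *\<^sub>R y k) x\<bar>) \<longlonglongrightarrow> L * \<bar>form \<xi> x\<bar>"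
    by (intro tendsto_intros form.tendsto y(2))+
  ultimately have "\<bar>form \<xi> (nor x)\<bar> \<le> L * \<bar>form \<xi> x\<bar>"
    using LIMSEQ_le by blast
  then show ?thesis
    using \<Gamma>_T_neg[OF \<xi> x] by simp
qed

end

subsection \<open>Timelike geodesics\<close>

lemma has_vector_derivative_form_within:
  assumes "(f has_vector_derivative f') (at s within A)" "(g has_vector_derivative g') (at s within A)"
  shows "((\<lambda>s. form (f s) (g s)) has_vector_derivative form (f s) g' + form f' (g s)) (at s within A)"
  using bounded_bilinear.has_vector_derivative[OF bounded_bilinear_form assms] .

lemma vector_derivative_Icc_eq:
  fixes f :: "real \<Rightarrow> 'b::euclidean_space"
  assumes "a < b" "t \<in> {a..b}" "(f has_vector_derivative f') (at t within {a..b})"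
  shows "vector_derivative f (at t within {a..b}) = f'"
  using vector_derivative_within_cbox[OF assms(1)] assms(2,3) by (simp add: cbox_interval)

lemma vector_derivative_Icc_unique:
  fixes f :: "real \<Rightarrow> 'b::euclidean_space"
  assumes "a < b" "t \<in> {a..b}" "(f has_vector_derivative f') (at t within {a..b})"
    "(f has_vector_derivative f'') (at t within {a..b})"
  shows "f' = f''"
  using vector_derivative_Icc_eq[OF assms(1,2,3)] vector_derivative_Icc_eq[OF assms(1,2,4)] by simp

text \<open>The speed k is constant and the geodesic equation becomes \<gamma>'' = -k^2 \<gamma>.
  Instead of an appeal to uniqueness of solutions, a vector is exhibited that stays constant along
  the curve.\<close>

lemma timelike_geodesic_speed:
  assumes "timelike_geodesic \<gamma> a b"
  obtains k where "k > 0" "timelike_length \<gamma> a b = k * (b - a)"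
    "\<And>t. t \<in> {a..b} \<Longrightarrow> form (\<gamma> a) (\<gamma> t) = - cos (k * (t - a))"
    "continuous_on {a..b} \<gamma>" "a < b" "\<And>t. t \<in> {a..b} \<Longrightarrow> form (\<gamma> t) (\<gamma> t) = -1"
proof -
  have ab: "a < b"
    using assms unfolding timelike_geodesic_def by auto
  obtain \<gamma>' \<gamma>'' where g: "\<forall>t\<in>{a..b}. \<gamma> t \<in> AdS_hat \<and>
     (\<gamma> has_vector_derivative \<gamma>' t) (at t within {a..b}) \<and>
     (\<gamma>' has_vector_derivative \<gamma>'' t) (at t within {a..b}) \<and>
     form (\<gamma>' t) (\<gamma>' t) < 0 \<and> tangential (\<gamma> t) (\<gamma>'' t) = 0"
    using assms unfolding timelike_geodesic_def by (elim conjE exE)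
  then have n: "form (\<gamma> t) (\<gamma> t) = -1" and D: "(\<gamma> has_vector_derivative \<gamma>' t) (at t within {a..b})"
    and D2: "(\<gamma>' has_vector_derivative \<gamma>'' t) (at t within {a..b})" and neg: "form (\<gamma>' t) (\<gamma>' t) < 0"
    and geo: "tangential (\<gamma> t) (\<gamma>'' t) = 0" if "t \<in> {a..b}" for t
    using that by (auto simp: AdS_hat_def)
  have const: "f' = 0" if f: "(f has_vector_derivative f') (at t within {a..b})" "t \<in> {a..b}" "\<And>s. s \<in> {a..b} \<Longrightarrow> f s = c"
    for f :: "real \<Rightarrow> real" and f' t c
  proof -
    have "(f has_vector_derivative 0) (at t within {a..b})"
      by (rule has_vector_derivative_transform[OF f(2) _ has_vector_derivative_const[of c]]) (use f(3) in auto)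
    then show ?thesis
      using vector_derivative_Icc_unique[OF ab f(2,1)] by simp
  qed
  have o: "form (\<gamma>' t) (\<gamma> t) = 0" if "t \<in> {a..b}" for t
    using const[OF has_vector_derivative_form_within[OF D[OF that] D[OF that]] that n] form_commute[of "\<gamma> t" "\<gamma>' t"]
    by simp
  have acc: "\<gamma>'' t = form (\<gamma>' t) (\<gamma>' t) *\<^sub>R \<gamma> t" if "t \<in> {a..b}" for t
  proof -
    have "form (\<gamma>'' t) (\<gamma> t) = - form (\<gamma>' t) (\<gamma>' t)"
      using const[OF has_vector_derivative_form_within[OF D2[OF that] D[OF that]] that o] by simp
    then show ?thesis
      using geo[OF that] by (simp add: tangential_def)
  qed
  have "((\<lambda>t. form (\<gamma>' t) (\<gamma>' t)) has_vector_derivative 0) (at t within {a..b})" if "t \<in> {a..b}" for t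
    using has_vector_derivative_form_within[OF D2[OF that] D2[OF that]] o[OF that] form_commute[of "\<gamma>' t" "\<gamma> t"]
    by (simp add: acc[OF that] form.scaleR_left form.scaleR_right)
  from has_vector_derivative_zero_constant[OF convex_real_interval(5)[of a b] this]
  obtain c where c: "\<And>t. t \<in> {a..b} \<Longrightarrow> form (\<gamma>' t) (\<gamma>' t) = c"
    by auto
  have c0: "c < 0"
    using c[of a] neg[of a] ab by simp
  define k where "k = sqrt (- c)"
  have k: "k > 0" "k * k = - c"
    using c0 by (simp_all add: k_def)
  \<comment> \<open>For the expected solution cos(k(t - a)) \<gamma>(a) + sin(k(t - a))
    \<gamma>'(a)/k this combination is the initial point \<gamma>(a).\<close>
  have "((\<lambda>t. cos (k * (t - a)) *\<^sub>R \<gamma> t - (sin (k * (t - a)) / k) *\<^sub>R \<gamma>' t) has_vector_derivative 0) (at t within {a..b})"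
    if "t \<in> {a..b}" for t
  proof -
    have "((\<lambda>t. cos (k * (t - a))) has_real_derivative - sin (k * (t - a)) * k) (at t within {a..b})"
      "((\<lambda>t. sin (k * (t - a)) / k) has_real_derivative cos (k * (t - a))) (at t within {a..b})"
      using k(1) by (auto intro!: derivative_eq_intros)
    then have "((\<lambda>t. cos (k * (t - a)) *\<^sub>R \<gamma> t - (sin (k * (t - a)) / k) *\<^sub>R \<gamma>' t) has_vector_derivative
        (cos (k * (t - a)) *\<^sub>R \<gamma>' t + (- sin (k * (t - a)) * k) *\<^sub>R \<gamma> t)
        - ((sin (k * (t - a)) / k) *\<^sub>R \<gamma>'' t + cos (k * (t - a)) *\<^sub>R \<gamma>' t)) (at t within {a..b})"
      by (intro has_vector_derivative_diff has_vector_derivative_scaleR D D2 that)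
    moreover have "(sin (k * (t - a)) / k) *\<^sub>R \<gamma>'' t = (- sin (k * (t - a)) * k) *\<^sub>R \<gamma> t"
    proof -
      have "c = - (k * k)"
        using k(2) by simp
      then show ?thesis
        unfolding acc[OF that] c[OF that] using k(1) by simp
    qed
    ultimately show ?thesis
      by simp
  qed
  from has_vector_derivative_zero_constant[OF convex_real_interval(5)[of a b] this]
  obtain e where e: "\<And>t. t \<in> {a..b} \<Longrightarrow> cos (k * (t - a)) *\<^sub>R \<gamma> t - (sin (k * (t - a)) / k) *\<^sub>R \<gamma>' t = e"
    by auto
  have e0: "e = \<gamma> a"
    using e[of a] ab by simp
  have form: "form (\<gamma> a) (\<gamma> t) = - cos (k * (t - a))" if "t \<in> {a..b}" for t
    using e[OF that] n[OF that] o[OF that] unfolding e0 by (simp add: form_simps flip: e[OF that, unfolded e0])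
  have "timelike_length \<gamma> a b = integral {a..b} (\<lambda>t. k)"
    unfolding timelike_length_def
  proof (rule Henstock_Kurzweil_Integration.integral_cong)
    fix t assume "t \<in> {a..b}"
    then show "sqrt (- form (vector_derivative \<gamma> (at t within {a..b})) (vector_derivative \<gamma> (at t within {a..b}))) = k"
      using vector_derivative_Icc_eq[OF ab _ D] c by (simp add: k_def)
  qed
  then have len: "timelike_length \<gamma> a b = k * (b - a)"
    using ab by simp
  have "continuous_on {a..b} \<gamma>"
    unfolding continuous_on_eq_continuous_within by (intro ballI has_vector_derivative_continuous[OF D])
  then show thesis
    using that[OF k(1) len form _ ab n] by auto
qed

lemma timelike_geodesic_normal:
  assumes x: "form x x = -1" "form n n = -1" "form x n = 0" and \<theta>: "\<theta> > 0"
  defines "\<gamma> \<equiv> \<lambda>s. cos s *\<^sub>R x + sin s *\<^sub>R n"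
  shows "timelike_geodesic \<gamma> (- \<theta>) \<theta>" "timelike_length \<gamma> (- \<theta>) \<theta> = 2 * \<theta>"
proof -
  define \<gamma>' where "\<gamma>' s = - sin s *\<^sub>R x + cos s *\<^sub>R n" for s
  have D: "(\<gamma> has_vector_derivative \<gamma>' s) (at s within A)" and D2: "(\<gamma>' has_vector_derivative - \<gamma> s) (at s within A)" for s A
    unfolding \<gamma>_def \<gamma>'_def[abs_def] by (auto intro!: derivative_eq_intros)
  have f: "form (\<gamma> s) (\<gamma> s) = -1" "form (\<gamma>' s) (\<gamma>' s) = -1" for s
    using x form_commute[of n x]
    by (simp_all add: \<gamma>_def \<gamma>'_def form_simps) (use sin_cos_squared_add3[of s] in linarith)+
  show "timelike_geodesic \<gamma> (- \<theta>) \<theta>"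
    unfolding timelike_geodesic_def
  proof (intro conjI exI ballI)
    show "- \<theta> < \<theta>"
      using \<theta> by simp
    fix t
    show "\<gamma> t \<in> AdS_hat" "form (\<gamma>' t) (\<gamma>' t) < 0" "tangential (\<gamma> t) (- \<gamma> t) = 0"
      unfolding AdS_hat_def tangential_def form.minus_left mem_Collect_eq f by simp_all
  qed (rule D D2)+
  have "timelike_length \<gamma> (- \<theta>) \<theta> = integral {- \<theta>..\<theta>} (\<lambda>t. 1)"
    unfolding timelike_length_def
  proof (rule Henstock_Kurzweil_Integration.integral_cong)
    fix t assume "t \<in> {- \<theta>..\<theta>}"
    then have "vector_derivative \<gamma> (at t within {- \<theta>..\<theta>}) = \<gamma>' t"
      using vector_derivative_Icc_eq[OF _ _ D] \<theta> by simp
    then show "sqrt (- form (vector_derivative \<gamma> (at t within {- \<theta>..\<theta>})) (vector_derivative \<gamma> (at t within {- \<theta>..\<theta>}))) = 1"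
      by (simp add: f)
  qed
  then show "timelike_length \<gamma> (- \<theta>) \<theta> = 2 * \<theta>"
    using \<theta> by simp
qed

subsection \<open>The convex hull\<close>

context asymptotic_surface
begin

text \<open>The closed convex cone over \<Gamma>, described as a dual cone. Unlike its projective
  image it distinguishes the two lifts of a point, and its description involves no affine
  chart.\<close>

definition "hull_cone = {z. \<forall>p. pos p \<longrightarrow> form z p \<ge> 0}"

lemma hull_cone_pos:
  assumes "z \<in> hull_cone" "z \<noteq> 0" "pos p"
  shows "form z p > 0"
proof -
  obtain w where w: "form z w \<noteq> 0"
    using form_nondegenerate assms(2) by auto
  obtain d where d: "d > 0" "\<And>t. \<bar>t\<bar> \<le> d \<Longrightarrow> pos (p + t *\<^sub>R w)"
    using pos_perturb[OF assms(3)] by metis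
  have nn: "pos q \<Longrightarrow> form z q \<ge> 0" for q
    using assms(1) unfolding hull_cone_def by auto
  have "form z (p + d *\<^sub>R w) \<ge> 0" "form z (p + (- d) *\<^sub>R w) \<ge> 0"
    by (intro nn d(2); use d(1) in simp)+
  then have "form z p \<ge> \<bar>d * form z w\<bar>"
    by (simp add: form_simps)
  moreover have "\<bar>d * form z w\<bar> > 0"
    using d w by simp
  ultimately show ?thesis
    by linarith
qed

text \<open>The hull intersects half-spaces taken in varying charts. As \<Gamma> is connected,
  \<open>q\<close> has constant sign on it for every admissible half-space, and \<open>p\<close> has
  the same sign, so up to a common sign both belong to \<open>pos\<close>. The condition on
  \<open>p0\<close> selects the lift of \<open>proj z\<close> that can lie in the cone.\<close>

lemma proj_hull_iff:
  assumes z: "z \<noteq> 0" and p0: "pos p0" "form z p0 > 0"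
  shows "proj z \<in> convex_hull_AdS (proj ` \<Gamma>) \<longleftrightarrow> z \<in> hull_cone"
proof
  have half: "proj z \<in> half_space q p \<longleftrightarrow> form z q \<noteq> 0 \<and> form z p / form z q \<ge> 0" if z: "z \<noteq> 0" for z q p
  proof
    assume "proj z \<in> half_space q p"
    then obtain x where x: "proj z = proj x" "form x q \<noteq> 0" "form x p / form x q \<ge> 0"
      unfolding half_space_def by auto
    then have "x \<noteq> 0"
      by (auto simp: form.zero_left)
    then obtain c where "c \<noteq> 0" "x = c *\<^sub>R z"
      using proj_eq_iff[OF z, of x] x(1) by auto
    then show "form z q \<noteq> 0 \<and> form z p / form z q \<ge> 0"
      using x by (simp add: form_simps)
  next
    assume "form z q \<noteq> 0 \<and> form z p / form z q \<ge> 0"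
    then show "proj z \<in> half_space q p"
      unfolding half_space_def by auto
  qed
  show "z \<in> hull_cone" if hull: "proj z \<in> convex_hull_AdS (proj ` \<Gamma>)"
    unfolding hull_cone_def
  proof safe
    fix p assume p: "pos p"
    have "proj ` \<Gamma> \<subseteq> half_space p0 p"
    proof safe
      fix \<xi> assume "\<xi> \<in> \<Gamma>"
      then show "proj \<xi> \<in> half_space p0 p"
        using p p0 half[OF \<Gamma>_nonzero] unfolding pos_def by (simp add: less_imp_le less_imp_neq[THEN not_sym])
    qed
    moreover have "bdry_plane p \<inter> proj ` \<Gamma> = {}"
    proof (rule ccontr)
      assume "bdry_plane p \<inter> proj ` \<Gamma> \<noteq> {}"
      then obtain \<xi> x where x: "\<xi> \<in> \<Gamma>" "x \<noteq> 0" "form x p = 0" "proj \<xi> = proj x"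
        unfolding bdry_plane_def plane_def by auto
      then obtain c where "c \<noteq> 0" "x = c *\<^sub>R \<xi>"
        using proj_eq_iff[OF \<Gamma>_nonzero[OF x(1)] x(2)] by auto
      then show False
        using p x unfolding pos_def by (auto simp: form_simps)
    qed
    moreover have "p \<noteq> 0" "p0 \<noteq> 0"
      using p p0 \<Gamma>_two unfolding pos_def by (auto simp: form.zero_right)
    ultimately have "proj z \<in> half_space p0 p"
      using hull unfolding convex_hull_AdS_def by blast
    then show "form z p \<ge> 0"
      using half[OF z] p0(2) by (simp add: zero_le_divide_iff)
  qed
  show "proj z \<in> convex_hull_AdS (proj ` \<Gamma>)" if K: "z \<in> hull_cone"
    unfolding convex_hull_AdS_def
  proof safe
    fix q p assume qp: "q \<noteq> 0" "p \<noteq> 0" "bdry_plane p \<inter> proj ` \<Gamma> = {}" "proj ` \<Gamma> \<subseteq> half_space q p"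
    have s: "form \<xi> q \<noteq> 0 \<and> form \<xi> p / form \<xi> q > 0" if \<xi>: "\<xi> \<in> \<Gamma>" for \<xi>
    proof -
      have "form \<xi> p \<noteq> 0"
      proof
        assume "form \<xi> p = 0"
        then have "proj \<xi> \<in> bdry_plane p"
          using \<Gamma>_nonzero[OF \<xi>] \<Gamma>_null[OF \<xi>] unfolding bdry_plane_def plane_def bdry_AdS_def by blast
        then show False
          using qp(3) \<xi> by auto
      qed
      moreover have "form \<xi> q \<noteq> 0 \<and> form \<xi> p / form \<xi> q \<ge> 0"
        using half[OF \<Gamma>_nonzero[OF \<xi>]] qp(4) \<xi> by auto
      ultimately show ?thesis
        by (simp add: less_le)
    qed
    have "connected ((\<lambda>\<xi>. form \<xi> q) ` \<Gamma>)"
      by (intro connected_continuous_image \<Gamma>_connected continuous_intros)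
    then have iv: "is_interval ((\<lambda>\<xi>. form \<xi> q) ` \<Gamma>)"
      by (simp add: is_interval_connected_1)
    have "(\<forall>\<xi>\<in>\<Gamma>. form \<xi> q > 0) \<or> (\<forall>\<xi>\<in>\<Gamma>. form \<xi> q < 0)"
    proof (rule ccontr)
      assume "\<not> ?thesis"
      then obtain \<xi> \<eta> where "\<xi> \<in> \<Gamma>" "\<eta> \<in> \<Gamma>" "form \<xi> q \<le> 0" "form \<eta> q \<ge> 0"
        by (meson not_less)
      then have "0 \<in> (\<lambda>\<xi>. form \<xi> q) ` \<Gamma>"
        using iv unfolding is_interval_1 by blast
      then show False
        using s by auto
    qed
    then show "proj z \<in> half_space q p"
    proof
      assume a: "\<forall>\<xi>\<in>\<Gamma>. form \<xi> q > 0"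
      have "form \<xi> p > 0" if "\<xi> \<in> \<Gamma>" for \<xi>
      proof -
        have "form \<xi> q > 0"
          using a that by auto
        then show ?thesis
          using s[OF that] by (simp add: zero_less_divide_iff)
      qed
      with a have "pos q" "pos p"
        unfolding pos_def by auto
      then show ?thesis
        using hull_cone_pos[OF K z] half[OF z, of q p] by (simp add: less_imp_le less_imp_neq[THEN not_sym])
    next
      assume a: "\<forall>\<xi>\<in>\<Gamma>. form \<xi> q < 0"
      then have "form \<xi> p < 0" if "\<xi> \<in> \<Gamma>" for \<xi>
        using s[OF that] a that by (auto simp: zero_less_divide_iff)
      then have "pos (- q)" "pos (- p)"
        using a unfolding pos_def by (auto simp: form_simps)
      then have "form z q < 0" "form z p < 0"
        using hull_cone_pos[OF K z, of "- q"] hull_cone_pos[OF K z, of "- p"] by (simp_all add: form_simps)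
      then show ?thesis
        using half[OF z, of q p] by (simp add: divide_nonpos_neg)
    qed
  qed
qed

lemma T_hull_cone: "x \<in> T \<Longrightarrow> x \<in> hull_cone"
  using pos_T unfolding hull_cone_def by (auto intro: less_imp_le)

text \<open>With \<open>L'\<close> strictly above \<open>L\<close> the bound of
  \<open>normal_bound_\<Gamma>\<close> becomes strict, so \<open>nor x - L' *\<^sub>R x\<close> and
  \<open>- nor x - L' *\<^sub>R x\<close> belong to \<open>pos\<close> and can be tested against the
  cone.\<close>

lemma hull_cone_normal:
  assumes L: "L \<ge> 0" "\<And>x. x \<in> T \<Longrightarrow> lam x \<le> L" "L < L'" and x: "x \<in> T" and z: "z \<in> hull_cone"
  shows "\<bar>form z (nor x)\<bar> \<le> - L' * form z x"
proof -
  have "form \<xi> (nor x - L' *\<^sub>R x) > 0 \<and> form \<xi> (- nor x - L' *\<^sub>R x) > 0" if "\<xi> \<in> \<Gamma>" for \<xi>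
  proof -
    have "\<bar>form \<xi> (nor x)\<bar> \<le> - L * form \<xi> x"
      by (rule normal_bound_\<Gamma>[OF L(1,2) x that])
    moreover have "- L * form \<xi> x < - L' * form \<xi> x"
      using L(3) \<Gamma>_T_neg[OF that x] by simp
    ultimately show ?thesis
      by (simp add: form_simps) linarith
  qed
  then have "pos (nor x - L' *\<^sub>R x)" "pos (- nor x - L' *\<^sub>R x)"
    unfolding pos_def by auto
  then have "form z (nor x - L' *\<^sub>R x) \<ge> 0" "form z (- nor x - L' *\<^sub>R x) \<ge> 0"
    using z unfolding hull_cone_def by auto
  then show ?thesis
    by (simp add: form_simps)
qed

text \<open>At the point \<open>x0\<close> of \<open>T\<close> where the product with
  \<open>- z0\<close> is least, \<open>z0\<close> is a combination of \<open>x0\<close> and its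
  normal (after a small perturbation). The coefficients of \<open>z0\<close> and \<open>z1\<close>
  on these two vectors are compared by \<open>hull_cone_normal\<close>. The bound is -cos(2 arctan
  L'), so 2 arctan L' will bound timelike lengths.\<close>

lemma hull_cone_pairing:
  assumes L: "L \<ge> 0" "\<And>x. x \<in> T \<Longrightarrow> lam x \<le> L" "L < L'" "L' < 1"
    and z0: "z0 \<in> hull_cone" "form z0 z0 = -1" and z1: "z1 \<in> hull_cone" "form z1 z1 = -1"
  shows "form z0 z1 \<le> - ((1 - L'\<^sup>2) / (1 + L'\<^sup>2))"
proof -
  obtain x where x: "x \<in> T"
    using T_nonempty by auto
  obtain p where p: "pos p"
    using ex_pos by auto
  have K\<Gamma>: "form \<xi> z0 \<le> 0" if "\<xi> \<in> \<Gamma>" for \<xi>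
  proof (rule field_le_epsilon)
    fix e :: real assume e: "e > 0"
    have "z0 \<noteq> 0"
      using z0(2) by (auto simp: form.zero_left)
    then have pz: "form z0 p > 0"
      using hull_cone_pos[OF z0(1) _ p] by simp
    have "form z0 (- \<xi> + (e / form z0 p) *\<^sub>R p) \<ge> 0"
      using pos_uminus_add[OF p that, of "e / form z0 p"] e pz z0(1) unfolding hull_cone_def by auto
    then show "form \<xi> z0 \<le> 0 + e"
      using pz by (simp add: form_simps form_commute[of z0 \<xi>])
  qed
  have neg: "form z x \<le> 0" if "z \<in> hull_cone" for z
    using pos_uminus_T[OF x] that unfolding hull_cone_def by (auto simp: form_simps)
  have L'0: "L' > 0"
    using L by simp
  define \<kappa> where "\<kappa> = (1 - L'\<^sup>2) / (1 + L'\<^sup>2)"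
  \<comment> \<open>On \<Gamma> the products with \<open>- z0\<close> are only nonnegative, which
    does not guarantee a minimum on \<open>T\<close>; adding a multiple of a point of
    \<open>T\<close> to \<open>z0\<close> makes them positive.\<close>
  have key: "form (z0 + e *\<^sub>R x) z1 \<le> - \<kappa>" if e: "e > 0" for e
  proof -
    define z where "z = z0 + e *\<^sub>R x"
    have zK: "z \<in> hull_cone"
      using z0(1) T_hull_cone[OF x] e unfolding hull_cone_def z_def by (auto simp: form_simps)
    have "pos (- z)"
      unfolding pos_def
    proof
      fix \<xi> assume "\<xi> \<in> \<Gamma>"
      then show "form \<xi> (- z) > 0"
        using K\<Gamma> mult_pos_neg[OF e \<Gamma>_T_neg[OF _ x]] by (fastforce simp: z_def form_simps)
    qed
    let ?K = "{y \<in> T. form y (- z) \<le> form x (- z)}"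
    have "compact ?K" "?K \<noteq> {}" "continuous_on ?K (\<lambda>y. form y (- z))"
      using pos_sublevel_compact[OF \<open>pos (- z)\<close>] x by (auto intro!: continuous_intros)
    then have "\<exists>x0\<in>?K. \<forall>y\<in>?K. form x0 (- z) \<le> form y (- z)"
      by (rule continuous_attains_inf)
    then obtain x0 where x0: "x0 \<in> ?K" "\<forall>y\<in>?K. form x0 (- z) \<le> form y (- z)"
      by (elim bexE)
    have m: "form x0 (- z) \<le> form y (- z)" if "y \<in> T" for y
      using x0 that by (cases "form y (- z) \<le> form x (- z)") auto
    have x0T: "x0 \<in> T"
      using x0(1) by auto
    obtain e1 e2 where fr: "orthoframe x0 e1 e2 (nor x0)" "form e1 (- z) = 0" "form e2 (- z) = 0"
      using linear_min_T(2)[OF x0T m] by auto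
    then have ze: "form z e1 = 0" "form z e2 = 0"
      by (simp_all add: form_simps form_commute[of z])
    define A B A1 B1 where "A = - form z x0" and "B = form z (nor x0)" and "A1 = - form z1 x0" and "B1 = form z1 (nor x0)"
    have AB: "\<bar>B\<bar> \<le> L' * A" "\<bar>B1\<bar> \<le> L' * A1"
      using hull_cone_normal[OF L(1-3) x0T zK] hull_cone_normal[OF L(1-3) x0T z1(1)]
      by (simp_all add: A_def B_def A1_def B1_def)
    then have A0: "A \<ge> 0" "A1 \<ge> 0"
      using L'0 order_trans[OF abs_ge_zero AB(1)] order_trans[OF abs_ge_zero AB(2)]
      by (simp_all add: zero_le_mult_iff)
    have "form z z = - A * A - B * B" "form z z1 = - A * A1 - B * B1"
      using orthoframe_form[OF fr(1), of z z] orthoframe_form[OF fr(1), of z z1] ze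
      by (simp_all add: A_def B_def A1_def B1_def)
    moreover have "form z z \<le> -1"
    proof -
      have "e * form z0 x \<le> 0"
        using neg[OF z0(1)] e by (simp add: mult_le_0_iff)
      moreover have "form z z = form z0 z0 + 2 * (e * form z0 x) + (e * e) * form x x"
        by (simp add: z_def form.add_left form.add_right form.scaleR_left form.scaleR_right
            form_commute[of x z0] algebra_simps)
      ultimately show ?thesis
        unfolding z0(2) T_form[OF x] using zero_le_square[of e] by linarith
    qed
    moreover have "A1 * A1 + B1 * B1 \<ge> 1"
    proof -
      have "form z1 z1 = form z1 e1 * form z1 e1 + form z1 e2 * form z1 e2 - A1 * A1 - B1 * B1"
        using orthoframe_form[OF fr(1), of z1 z1] by (simp add: A1_def B1_def)
      then show ?thesis
        using z1(2) zero_le_square[of "form z1 e1"] zero_le_square[of "form z1 e2"] by linarith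
    qed
    moreover have sq: "B * B \<le> L'\<^sup>2 * (A * A)" "B1 * B1 \<le> L'\<^sup>2 * (A1 * A1)" "\<bar>B * B1\<bar> \<le> L'\<^sup>2 * (A * A1)"
    proof -
      have "\<bar>B\<bar> * \<bar>B\<bar> \<le> (L' * A) * (L' * A)" "\<bar>B1\<bar> * \<bar>B1\<bar> \<le> (L' * A1) * (L' * A1)" "\<bar>B\<bar> * \<bar>B1\<bar> \<le> (L' * A) * (L' * A1)"
        using AB A0 L'0 by (intro mult_mono; simp)+
      then show "B * B \<le> L'\<^sup>2 * (A * A)" "B1 * B1 \<le> L'\<^sup>2 * (A1 * A1)" "\<bar>B * B1\<bar> \<le> L'\<^sup>2 * (A * A1)"
        by (simp_all add: abs_mult power2_eq_square mult_ac)
    qed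
    ultimately have "(1 + L'\<^sup>2) * (A * A) \<ge> 1" "(1 + L'\<^sup>2) * (A1 * A1) \<ge> 1"
      by (simp_all add: algebra_simps)
    then have "((1 + L'\<^sup>2) * (A * A)) * ((1 + L'\<^sup>2) * (A1 * A1)) \<ge> 1 * 1"
      by (intro mult_mono) auto
    then have "1\<^sup>2 \<le> ((1 + L'\<^sup>2) * (A * A1))\<^sup>2"
      by (simp add: power2_eq_square mult_ac)
    then have AA: "1 \<le> (1 + L'\<^sup>2) * (A * A1)"
      by (rule power2_le_imp_le) (use A0 in \<open>auto intro!: mult_nonneg_nonneg\<close>)
    have pos1: "1 + L'\<^sup>2 > 0" "1 - L'\<^sup>2 > 0"
      using L(4) L'0 by (auto simp: add_pos_nonneg abs_square_less_1)
    have "\<kappa> * 1 \<le> \<kappa> * ((1 + L'\<^sup>2) * (A * A1))"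
      using AA pos1 by (intro mult_left_mono) (auto simp: \<kappa>_def)
    also have "\<dots> = (1 - L'\<^sup>2) * (A * A1)"
      using pos1(1) by (simp add: \<kappa>_def)
    finally have "\<kappa> \<le> A * A1 - L'\<^sup>2 * (A * A1)"
      by (simp add: algebra_simps)
    then have "form z z1 \<le> - \<kappa>"
      using sq(3) \<open>form z z1 = - A * A1 - B * B1\<close> by linarith
    then show ?thesis
      by (simp add: z_def)
  qed
  show ?thesis
    unfolding \<kappa>_def[symmetric]
  proof (rule field_le_epsilon)
    fix e :: real assume e: "e > 0"
    \<comment> \<open>Chosen so that the error \<open>- d * form z1 x\<close> of the perturbation
      equals \<open>e - d\<close>, which is below \<open>e\<close>.\<close>
    define d where "d = e / (1 - form z1 x)"
    have "1 - form z1 x > 0"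
      using neg[OF z1(1)] by simp
    then have d: "d > 0" "d * (1 - form z1 x) = e"
      using e by (simp_all add: d_def)
    have "form z0 z1 + d * form z1 x \<le> - \<kappa>"
      using key[OF d(1)] by (simp add: form_simps form_commute[of x z1])
    moreover have "d * form z1 x = d - e"
      using d(2) by (simp add: algebra_simps)
    ultimately show "form z0 z1 \<le> - \<kappa> + e"
      using d(1) by linarith
  qed
qed

text \<open>A longer segment would contain a point where the cosine falls below the bound of
  \<open>hull_cone_pairing\<close>. That lemma concerns the cone, so the lift of the geodesic is
  first shown to stay on one side of a plane with normal in \<open>pos\<close>, that is, in the cone
  or in its negative.\<close>

lemma hull_geodesic_length:
  assumes L: "L \<ge> 0" "\<And>x. x \<in> T \<Longrightarrow> lam x \<le> L" "L < L'" "L' < 1"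
    and \<gamma>: "timelike_geodesic \<gamma> a b" "\<And>t. t \<in> {a..b} \<Longrightarrow> proj (\<gamma> t) \<in> convex_hull_AdS (proj ` \<Gamma>)"
  shows "timelike_length \<gamma> a b \<le> arccos ((1 - L'\<^sup>2) / (1 + L'\<^sup>2))"
proof -
  obtain k where k: "k > 0" "timelike_length \<gamma> a b = k * (b - a)"
    "\<And>t. t \<in> {a..b} \<Longrightarrow> form (\<gamma> a) (\<gamma> t) = - cos (k * (t - a))"
    "continuous_on {a..b} \<gamma>" "a < b" "\<And>t. t \<in> {a..b} \<Longrightarrow> form (\<gamma> t) (\<gamma> t) = -1"
    using timelike_geodesic_speed[OF \<gamma>(1)] by metis
  obtain p where p: "pos p"
    using ex_pos by auto
  define \<kappa> where "\<kappa> = (1 - L'\<^sup>2) / (1 + L'\<^sup>2)"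
  have pos1: "1 + L'\<^sup>2 > 0" "1 - L'\<^sup>2 > 0"
    using L by (auto simp: add_pos_nonneg abs_square_less_1)
  have \<kappa>: "0 < \<kappa>" "\<kappa> \<le> 1"
    using pos1 by (auto simp: \<kappa>_def)
  have nz: "\<gamma> t \<noteq> 0" if "t \<in> {a..b}" for t
    using k(6)[OF that] by (auto simp: form.zero_left)
  have ne: "form (\<gamma> t) p \<noteq> 0" if t: "t \<in> {a..b}" for t
  proof -
    \<comment> \<open>\<open>half_space p p\<close> is the complement of \<open>plane p\<close> and
      is one of the half-spaces defining the hull; hence the hull misses that plane.\<close>
    have "bdry_plane p \<inter> proj ` \<Gamma> = {} \<and> proj ` \<Gamma> \<subseteq> half_space p p \<and> p \<noteq> 0"
    proof (intro conjI)
      show "p \<noteq> 0"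
        using p \<Gamma>_two unfolding pos_def by (auto simp: form.zero_right)
      show "proj ` \<Gamma> \<subseteq> half_space p p"
        using p unfolding pos_def half_space_def by force
      show "bdry_plane p \<inter> proj ` \<Gamma> = {}"
      proof (rule ccontr)
        assume "bdry_plane p \<inter> proj ` \<Gamma> \<noteq> {}"
        then obtain \<xi> x where x: "\<xi> \<in> \<Gamma>" "x \<noteq> 0" "form x p = 0" "proj \<xi> = proj x"
          unfolding bdry_plane_def plane_def by auto
        then obtain c where "c \<noteq> 0" "x = c *\<^sub>R \<xi>"
          using proj_eq_iff[OF \<Gamma>_nonzero[OF x(1)] x(2)] by auto
        then show False
          using p x unfolding pos_def by (auto simp: form_simps)
      qed
    qed
    then have "proj (\<gamma> t) \<in> half_space p p"
      using \<gamma>(2)[OF t] unfolding convex_hull_AdS_def by blast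
    then obtain x where x: "proj (\<gamma> t) = proj x" "form x p \<noteq> 0"
      unfolding half_space_def by auto
    then have "x \<noteq> 0"
      by (auto simp: form.zero_left)
    then obtain c where "c \<noteq> 0" "x = c *\<^sub>R \<gamma> t"
      using proj_eq_iff[OF nz[OF t], of x] x(1) by auto
    then show ?thesis
      using x(2) by (auto simp: form_simps)
  qed
  have "connected ((\<lambda>t. form (\<gamma> t) p) ` {a..b})"
    by (intro connected_continuous_image continuous_intros k(4)) auto
  then have iv: "is_interval ((\<lambda>t. form (\<gamma> t) p) ` {a..b})"
    by (simp add: is_interval_connected_1)
  have sgn: "(\<forall>t\<in>{a..b}. form (\<gamma> t) p > 0) \<or> (\<forall>t\<in>{a..b}. form (\<gamma> t) p < 0)"
  proof (rule ccontr)
    assume "\<not> ?thesis"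
    then obtain s t where "s \<in> {a..b}" "t \<in> {a..b}" "form (\<gamma> s) p \<le> 0" "form (\<gamma> t) p \<ge> 0"
      by (meson not_less)
    then have "0 \<in> (\<lambda>t. form (\<gamma> t) p) ` {a..b}"
      using iv unfolding is_interval_1 by blast
    then show False
      using ne by auto
  qed
  have le: "form (\<gamma> a) (\<gamma> t) \<le> - \<kappa>" if t: "t \<in> {a..b}" for t
    using sgn
  proof
    assume "\<forall>t\<in>{a..b}. form (\<gamma> t) p > 0"
    then have "\<gamma> s \<in> hull_cone" if "s \<in> {a..b}" for s
      using proj_hull_iff[OF nz[OF that] p] \<gamma>(2)[OF that] that by auto
    then show ?thesis
      unfolding \<kappa>_def using hull_cone_pairing[OF L] k(5,6) t by auto
  next
    assume neg: "\<forall>t\<in>{a..b}. form (\<gamma> t) p < 0"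
    have K: "- \<gamma> s \<in> hull_cone" if s: "s \<in> {a..b}" for s
      using proj_hull_iff[of "- \<gamma> s", OF _ p] \<gamma>(2)[OF s] nz[OF s] neg s by (auto simp: form_simps proj_minus)
    have "form (- \<gamma> a) (- \<gamma> t) \<le> - \<kappa>"
      unfolding \<kappa>_def by (rule hull_cone_pairing[OF L K _ K]) (use t k(5,6) in \<open>auto simp: form_simps\<close>)
    then show ?thesis
      by (simp add: form_simps)
  qed
  show ?thesis
    unfolding \<kappa>_def[symmetric] k(2)
  proof (rule ccontr)
    assume "\<not> k * (b - a) \<le> arccos \<kappa>"
    then have gt: "arccos \<kappa> < k * (b - a)"
      by simp
    have ac: "0 \<le> arccos \<kappa>" "arccos \<kappa> < pi"
      using arccos_lbound[of \<kappa>] \<kappa> arccos_le_pi2[OF less_imp_le[OF \<kappa>(1)] \<kappa>(2)] pi_gt_zero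
      by linarith+
    \<comment> \<open>The cosine is monotone only up to \<open>pi\<close>, so longer geodesics are
      cut off there.\<close>
    define \<tau> where "\<tau> = min pi (k * (b - a))"
    have \<tau>: "arccos \<kappa> < \<tau>" "\<tau> \<le> pi" "\<tau> \<le> k * (b - a)"
      using gt ac by (auto simp: \<tau>_def)
    have "cos \<tau> < cos (arccos \<kappa>)"
      by (rule cos_monotone_0_pi) (use \<tau> ac in auto)
    then have c: "cos \<tau> < \<kappa>"
      using \<kappa> by (simp add: cos_arccos)
    define t where "t = a + \<tau> / k"
    have "\<tau> / k \<le> b - a" "0 \<le> \<tau> / k"
      using \<tau> k(1) ac by (auto simp: pos_divide_le_eq mult.commute)
    then have "t \<in> {a..b}"
      by (simp add: t_def)
    from le[OF this] k(3)[OF this] have "cos (k * (t - a)) \<ge> \<kappa>"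
      by simp
    then show False
      using c k(1) by (simp add: t_def)
  qed
qed

text \<open>The supremum is taken in the reals, so it is an upper bound only if the lengths are
  bounded. Any \<open>L'\<close> between \<open>L\<close> and 1 provides a bound, and this bound is
  below \<open>pi / 2\<close> because its cosine is positive.\<close>

lemma width_bound:
  assumes L: "L \<ge> 0" "\<And>x. x \<in> T \<Longrightarrow> lam x \<le> L" "L < 1"
  shows "width (convex_hull_AdS (proj ` \<Gamma>)) < pi / 2"
    and "timelike_geodesic \<gamma> a b \<Longrightarrow> (\<And>t. t \<in> {a..b} \<Longrightarrow> proj (\<gamma> t) \<in> convex_hull_AdS (proj ` \<Gamma>)) \<Longrightarrow>
      timelike_length \<gamma> a b \<le> width (convex_hull_AdS (proj ` \<Gamma>))"
    and "width (convex_hull_AdS (proj ` \<Gamma>)) \<ge> 0"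
proof -
  obtain L' where L': "L < L'" "L' < 1"
    using dense[OF L(3)] by auto
  let ?X = "insert 0 {timelike_length \<gamma> a b | \<gamma> a b.
     timelike_geodesic \<gamma> a b \<and> (\<forall>t\<in>{a..b}. proj (\<gamma> t) \<in> convex_hull_AdS (proj ` \<Gamma>))}"
  define \<kappa> where "\<kappa> = (1 - L'\<^sup>2) / (1 + L'\<^sup>2)"
  have pos1: "1 + L'\<^sup>2 > 0" "1 - L'\<^sup>2 > 0"
    using L L' by (auto simp: add_pos_nonneg abs_square_less_1)
  have \<kappa>: "0 < \<kappa>" "\<kappa> \<le> 1"
    using pos1 by (auto simp: \<kappa>_def)
  have ub: "l \<le> arccos \<kappa>" if "l \<in> ?X" for l
    using that
  proof
    assume "l = 0"
    then show ?thesis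
      using arccos_lbound[of \<kappa>] \<kappa> by simp
  next
    assume "l \<in> {timelike_length \<gamma> a b | \<gamma> a b.
     timelike_geodesic \<gamma> a b \<and> (\<forall>t\<in>{a..b}. proj (\<gamma> t) \<in> convex_hull_AdS (proj ` \<Gamma>))}"
    then show ?thesis
      unfolding \<kappa>_def using hull_geodesic_length[OF L(1,2) L'] by auto
  qed
  have bdd: "bdd_above ?X"
    by (rule bdd_aboveI) (rule ub)
  have "width (convex_hull_AdS (proj ` \<Gamma>)) \<le> arccos \<kappa>"
    unfolding width_def by (rule cSup_least) (use ub in auto)
  also have "\<dots> < pi / 2"
  proof -
    have "cos (pi / 2) < cos (arccos \<kappa>)"
      using \<kappa> by (simp add: cos_arccos)
    then show ?thesis
      using cos_monotone_0_pi_le[of "pi / 2" "arccos \<kappa>"] \<kappa> arccos_bounded[of \<kappa>] by (cases "arccos \<kappa> < pi / 2") auto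
  qed
  finally show "width (convex_hull_AdS (proj ` \<Gamma>)) < pi / 2" .
  show "timelike_length \<gamma> a b \<le> width (convex_hull_AdS (proj ` \<Gamma>))"
    if "timelike_geodesic \<gamma> a b" "\<And>t. t \<in> {a..b} \<Longrightarrow> proj (\<gamma> t) \<in> convex_hull_AdS (proj ` \<Gamma>)"
    unfolding width_def
    by (rule cSup_upper[OF _ bdd], rule insertI2, rule CollectI, intro exI conjI refl ballI) (use that in auto)
  show "width (convex_hull_AdS (proj ` \<Gamma>)) \<ge> 0"
    unfolding width_def by (rule cSup_upper[OF _ bdd]) simp
qed

text \<open>Every point of the normal geodesic is a positive multiple of
  \<open>x + tan s *\<^sub>R nor x\<close>, which lies between the two given points of the cone. The
  segment has length 2 arctan t; the factor 2 is given up in the conclusion, where the width being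
  below \<open>pi / 2\<close> allows the tangent to be applied.\<close>

lemma tan_width_lower:
  assumes L: "L \<ge> 0" "\<And>x. x \<in> T \<Longrightarrow> lam x \<le> L" "L < 1" and x: "x \<in> T" and t: "t > 0"
    and K: "x + t *\<^sub>R nor x \<in> hull_cone" "x - t *\<^sub>R nor x \<in> hull_cone"
  shows "t \<le> tan (width (convex_hull_AdS (proj ` \<Gamma>)))"
proof -
  define \<theta> where "\<theta> = arctan t"
  have \<theta>: "0 < \<theta>" "\<theta> < pi / 2" "tan \<theta> = t"
    using t arctan_ubound[of t] by (simp_all add: \<theta>_def tan_arctan)
  define \<gamma> where "\<gamma> s = cos s *\<^sub>R x + sin s *\<^sub>R nor x" for s
  note g = timelike_geodesic_normal[OF T_form[OF x] nor_props(1,2)[OF x] \<theta>(1), folded \<gamma>_def]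
  have conv: "x + r *\<^sub>R nor x \<in> hull_cone" if "\<bar>r\<bar> \<le> t" for r
    unfolding hull_cone_def
  proof safe
    fix p assume "pos p"
    then have "form x p + t * form (nor x) p \<ge> 0" "form x p - t * form (nor x) p \<ge> 0"
      using K unfolding hull_cone_def by (auto simp: form_simps)
    then have "\<bar>t * form (nor x) p\<bar> \<le> form x p"
      by linarith
    moreover have "\<bar>r * form (nor x) p\<bar> \<le> \<bar>t * form (nor x) p\<bar>"
      unfolding abs_mult using that t by (intro mult_right_mono) auto
    ultimately show "form (x + r *\<^sub>R nor x) p \<ge> 0"
      by (simp add: form_simps)
  qed
  have "proj (\<gamma> s) \<in> convex_hull_AdS (proj ` \<Gamma>)" if s: "s \<in> {- \<theta>..\<theta>}" for s
  proof -
    have cs: "cos s > 0"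
      using s \<theta> by (intro cos_gt_zero_pi) auto
    have "\<bar>tan s\<bar> \<le> t"
    proof -
      have "tan s \<le> tan \<theta>" "tan (- \<theta>) \<le> tan s"
        using s \<theta>(1,2) by (intro tan_mono_le; simp)+
      then show ?thesis
        using \<theta>(3) by simp
    qed
    then have zK: "x + tan s *\<^sub>R nor x \<in> hull_cone"
      by (rule conv)
    have eq: "\<gamma> s = cos s *\<^sub>R (x + tan s *\<^sub>R nor x)"
      using cs by (simp add: \<gamma>_def tan_def scaleR_add_right)
    have "x + tan s *\<^sub>R nor x \<noteq> 0"
    proof
      assume "x + tan s *\<^sub>R nor x = 0"
      then have "form x (x + tan s *\<^sub>R nor x) = 0"
        by (simp add: form.zero_right)
      then show False
        using T_form[OF x] nor_props(2)[OF x] by (simp add: form_simps)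
    qed
    moreover obtain p where "pos p"
      using ex_pos by auto
    ultimately show ?thesis
      using proj_hull_iff[of "x + tan s *\<^sub>R nor x" p] hull_cone_pos[OF zK] zK cs
      unfolding eq by (simp add: proj_scaleR)
  qed
  then have "2 * \<theta> \<le> width (convex_hull_AdS (proj ` \<Gamma>))"
    using width_bound(2)[OF L g(1)] g(2) by simp
  then have "\<theta> \<le> width (convex_hull_AdS (proj ` \<Gamma>))"
    using \<theta>(1) by linarith
  then have "tan \<theta> \<le> tan (width (convex_hull_AdS (proj ` \<Gamma>)))"
    using width_bound(1)[OF L] \<theta> by (intro tan_mono_le) auto
  then show ?thesis
    using \<theta>(3) by simp
qed

end

subsection \<open>The Laplacian in a moving frame\<close>

lemma deriv_along_line:
  fixes f :: "real ^ 2 \<Rightarrow> real"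
  assumes "smooth_on f V" "u \<in> V"
  shows "((\<lambda>s. f (u + s *\<^sub>R E u)) has_real_derivative deriv_along E f u) (at 0)"
  using has_derivative_line[of f _ u 0 "E u"] smooth_on_has_derivative[OF assms]
  by (simp add: has_real_derivative_iff_has_vector_derivative deriv_along_def)

text \<open>Reduces the computation of a derivation to a derivative in one real variable, to which
  the rules \<open>derivative_eq_intros\<close> apply.\<close>

lemma deriv_along_eq_line:
  fixes f g :: "real ^ 2 \<Rightarrow> real"
  assumes V: "open V" "u \<in> V" and f: "smooth_on f V" and eq: "\<And>x. x \<in> V \<Longrightarrow> f x = g x"
    and g: "((\<lambda>s. g (u + s *\<^sub>R E u)) has_real_derivative L) (at 0)"
  shows "deriv_along E f u = L"
proof -
  have "open ((\<lambda>s::real. u + s *\<^sub>R E u) -` V)"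
    by (intro open_vimage V continuous_intros)
  then have "((\<lambda>s. f (u + s *\<^sub>R E u)) has_real_derivative L) (at 0)"
    by (rule has_field_derivative_transform_within_open[OF g]) (use V eq in auto)
  then show ?thesis
    using DERIV_unique[OF deriv_along_line[OF f V(2)]] by simp
qed

text \<open>At a critical point the derivative of the field \<open>E\<close> is multiplied by zero,
  so the iterated derivation equals the second derivative in the fixed direction
  \<open>E u\<close>.\<close>

lemma second_order_max:
  fixes \<Phi> :: "real ^ 2 \<Rightarrow> real"
  assumes V: "open V" "u \<in> V" and \<Phi>: "smooth_on \<Phi> V" and E: "smooth_on E V"
    and max: "\<And>x. x \<in> V \<Longrightarrow> \<Phi> x \<le> \<Phi> u"
  shows "deriv_along E \<Phi> u = 0" "deriv_along E (deriv_along E \<Phi>) u \<le> 0"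
proof -
  have key: "frechet_derivative \<Phi> (at u) v = 0 \<and> frechet_derivative (\<lambda>y. frechet_derivative \<Phi> (at y) v) (at u) v \<le> 0" for v
  proof -
    obtain d where d: "d > 0" "\<And>s. \<bar>s\<bar> < d \<Longrightarrow> u + s *\<^sub>R v \<in> V"
      "\<And>s. \<bar>s\<bar> < d \<Longrightarrow> ((\<lambda>s. \<Phi> (u + s *\<^sub>R v)) has_vector_derivative frechet_derivative \<Phi> (at (u + s *\<^sub>R v)) v) (at s)"
      "((\<lambda>s. frechet_derivative \<Phi> (at (u + s *\<^sub>R v)) v) has_vector_derivative
       frechet_derivative (\<lambda>y. frechet_derivative \<Phi> (at y) v) (at u) v) (at 0)"
      using smooth_on_line[OF V \<Phi>, of v] by blast
    have m: "\<Phi> (u + s *\<^sub>R v) \<le> \<Phi> (u + 0 *\<^sub>R v)" if "\<bar>s\<bar> < d" for s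
      using max[OF d(2)[OF that]] by simp
    from second_derivative_max[OF d(1) d(3)[unfolded has_real_derivative_iff_has_vector_derivative[symmetric]]
        d(4)[unfolded has_real_derivative_iff_has_vector_derivative[symmetric]] m]
    show ?thesis
      by simp
  qed
  then show "deriv_along E \<Phi> u = 0"
    by (simp add: deriv_along_def)
  define f1 f2 where "f1 x = frechet_derivative \<Phi> (at x) (axis 1 1)" and "f2 x = frechet_derivative \<Phi> (at x) (axis 2 1)" for x
  have sm: "smooth_on f1 V" "smooth_on f2 V"
    unfolding f1_def f2_def by (rule smooth_on_frechet[OF \<Phi>])+
  have f0: "f1 u = 0" "f2 u = 0"
    using key by (simp_all add: f1_def f2_def)
  have lin: "frechet_derivative \<Phi> (at x) w = w $ 1 * f1 x + w $ 2 * f2 x" if "x \<in> V" for x w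
    using deriv_along_coords[OF \<Phi> that, of "\<lambda>_. w"] by (simp add: deriv_along_def f1_def f2_def)
  note L = deriv_along_line[OF sm(1) V(2), of E] deriv_along_line[OF sm(2) V(2), of E]
  let ?v = "E u"
  have "deriv_along E (deriv_along E \<Phi>) u = ?v $ 1 * deriv_along E f1 u + ?v $ 2 * deriv_along E f2 u"
  proof (rule deriv_along_eq_line[OF V smooth_on_deriv_along[OF V(1) E \<Phi>]])
    show "deriv_along E \<Phi> x = E x $ 1 * f1 x + E x $ 2 * f2 x" if "x \<in> V" for x
      using lin[OF that] by (simp add: deriv_along_def)
    note Li = deriv_along_line[OF smooth_on_nth[OF V(1) E] V(2), of E]
    show "((\<lambda>s. E (u + s *\<^sub>R E u) $ 1 * f1 (u + s *\<^sub>R E u) + E (u + s *\<^sub>R E u) $ 2 * f2 (u + s *\<^sub>R E u))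
        has_real_derivative ?v $ 1 * deriv_along E f1 u + ?v $ 2 * deriv_along E f2 u) (at 0)"
      by (rule derivative_eq_intros Li L refl | simp add: f0)+
  qed
  moreover have "deriv_along E (\<lambda>y. frechet_derivative \<Phi> (at y) ?v) u = ?v $ 1 * deriv_along E f1 u + ?v $ 2 * deriv_along E f2 u"
  proof (rule deriv_along_eq_line[OF V smooth_on_frechet[OF \<Phi>]])
    show "frechet_derivative \<Phi> (at x) ?v = ?v $ 1 * f1 x + ?v $ 2 * f2 x" if "x \<in> V" for x
      using lin[OF that] by simp
    show "((\<lambda>s. ?v $ 1 * f1 (u + s *\<^sub>R E u) + ?v $ 2 * f2 (u + s *\<^sub>R E u))
        has_real_derivative ?v $ 1 * deriv_along E f1 u + ?v $ 2 * deriv_along E f2 u) (at 0)"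
      by (rule derivative_eq_intros L refl | simp)+
  qed
  ultimately show "deriv_along E (deriv_along E \<Phi>) u \<le> 0"
    using key[of ?v] by (simp add: deriv_along_def[of E "\<lambda>y. frechet_derivative \<Phi> (at y) ?v"])
qed

text \<open>The algebra behind \<Delta> ln \<lambda> = 2\<lambda>^2 - 2. The letters stand for
  derivatives: \<open>a1\<close> for \<open>D1 \<alpha>\<close>, \<open>A12\<close> for
  \<open>D1 (D2 \<alpha>)\<close>, \<open>w12\<close> for \<open>D1 \<omega>2\<close>, and so on.
  The hypotheses are the Codazzi, commutator and Gauss equations.\<close>

lemma simons_identity:
  fixes \<alpha> \<beta> :: real
  assumes l: "l = \<alpha>\<^sup>2 + \<beta>\<^sup>2" "l > 0" and cod: "a2 - b1 = 2 * (\<alpha> * w1 + \<beta> * w2)" "a1 + b2 = 2 * (\<beta> * w1 - \<alpha> * w2)"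
    and A: "A12 - A21 = - w1 * a1 - w2 * a2" and B: "B12 - B21 = - w1 * b1 - w2 * b2"
    and g: "w12 - w21 = 1 - l - w1\<^sup>2 - w2\<^sup>2"
  shows "(- ((a1 * b2 + \<alpha> * B12 - (b1 * a2 + \<beta> * A12)) * l - (\<alpha> * b2 - \<beta> * a2) * (2 * \<alpha> * a1 + 2 * \<beta> * b1)) / (l * l) - 2 * w12)
    + (((a2 * b1 + \<alpha> * B21 - (b2 * a1 + \<beta> * A21)) * l - (\<alpha> * b1 - \<beta> * a1) * (2 * \<alpha> * a2 + 2 * \<beta> * b2)) / (l * l) + 2 * w21)
    + w2 * ((\<alpha> * a1 + \<beta> * b1) / l) - w1 * ((\<alpha> * a2 + \<beta> * b2) / l) = 2 * l - 2"
proof -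
  have s: "a2 = b1 + 2 * (\<alpha> * w1 + \<beta> * w2)" "a1 = - b2 + 2 * (\<beta> * w1 - \<alpha> * w2)"
    "A12 = A21 - w1 * a1 - w2 * a2" "B12 = B21 - w1 * b1 - w2 * b2" "w12 = w21 + 1 - l - w1\<^sup>2 - w2\<^sup>2"
    using assms by linarith+
  have key: "- ((a1 * b2 + \<alpha> * B12 - (b1 * a2 + \<beta> * A12)) * l - (\<alpha> * b2 - \<beta> * a2) * (2 * \<alpha> * a1 + 2 * \<beta> * b1)) - 2 * w12 * (l * l)
    + (((a2 * b1 + \<alpha> * B21 - (b2 * a1 + \<beta> * A21)) * l - (\<alpha> * b1 - \<beta> * a1) * (2 * \<alpha> * a2 + 2 * \<beta> * b2)) + 2 * w21 * (l * l))
    + w2 * (\<alpha> * a1 + \<beta> * b1) * l - w1 * (\<alpha> * a2 + \<beta> * b2) * l = (2 * l - 2) * (l * l)"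
    unfolding s(3-5) unfolding s(1,2) unfolding l(1) by (simp add: power2_eq_square algebra_simps)
  have gen: "X / (l * l) - 2 * w12 + (Y / (l * l) + 2 * w21) + w2 * (P / l) - w1 * (Q / l)
      = (X - 2 * w12 * (l * l) + (Y + 2 * w21 * (l * l)) + w2 * P * l - w1 * Q * l) / (l * l)" for X Y P Q
    using l(2) by (simp add: field_simps)
  show ?thesis
    unfolding gen key using l(2) by simp
qed

locale frame_function = moving_frame W \<sigma> e1 e2 N E1 E2 for W \<sigma> e1 e2 N E1 E2 +
  fixes p :: "real ^ 4"
  assumes U_pos: "u \<in> W \<Longrightarrow> form (\<sigma> u) p > 0"
begin

text \<open>\<open>(P1, P2)\<close> is the gradient of \<open>ln U\<close>. In terms of \<open>P1\<close>, \<open>P2\<close> and \<open>m\<close> the structure equations are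
  polynomial.\<close>

definition "U x = form (\<sigma> x) p"
definition "P1 x = form (e1 x) p / U x"
definition "P2 x = form (e2 x) p / U x"
definition "m x = form (N x) p / U x"
definition "G x = P1 x * P1 x + P2 x * P2 x"
text \<open>The Laplace-Beltrami operator. The first-order terms subtract the derivatives of
  \<open>f\<close> along the tangential parts \<omega>1 e2 and -\<omega>2 e1 of \<open>D1 e1\<close>
  and \<open>D2 e2\<close>.\<close>

definition "lap f u = D1 (D1 f) u + D2 (D2 f) u + \<omega>2 u * D1 f u - \<omega>1 u * D2 f u"

lemma smooth_functions: "smooth_on U W" "smooth_on P1 W" "smooth_on P2 W" "smooth_on m W" "smooth_on G W"
proof -
  show U: "smooth_on U W"
    unfolding U_def[abs_def] by (intro smooth_on_form smooth_on_const open_W smooth_\<sigma>)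
  show P: "smooth_on P1 W" "smooth_on P2 W" "smooth_on m W"
    unfolding P1_def[abs_def] P2_def[abs_def] m_def[abs_def]
    by (intro smooth_on_divide smooth_on_form smooth_on_const open_W smooth_e1 smooth_e2 smooth_N U;
        use U_pos in \<open>simp add: U_def\<close>)+
  show "smooth_on G W"
    unfolding G_def[abs_def] by (intro smooth_on_add smooth_on_mult open_W P)
qed

lemma lap_add:
  assumes "open V" "V \<subseteq> W" "u \<in> V" "smooth_on f V" "smooth_on g V"
  shows "lap (\<lambda>x. f x + c * g x) u = lap f u + c * lap g u"
proof -
  have E: "smooth_on E1 V" "smooth_on E2 V"
    using smooth_on_subset[OF _ assms(2)] smooth_E1 smooth_E2 by auto
  have 1: "deriv_along E (\<lambda>x. f x + c * g x) x = deriv_along E f x + c * deriv_along E g x"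
    if "x \<in> V" "smooth_on f V" "smooth_on g V" for E f g x
  proof -
    have sm: "smooth_on (\<lambda>x. f x + c * g x) V"
      by (intro smooth_on_add smooth_on_mult smooth_on_const assms(1) that)
    show ?thesis
      by (rule deriv_along_eq_line[OF assms(1) that(1) sm refl])
        (rule derivative_eq_intros deriv_along_line[OF that(2,1)] deriv_along_line[OF that(3,1)] refl | simp)+
  qed
  have 2: "deriv_along E (deriv_along E (\<lambda>x. f x + c * g x)) u = deriv_along E (deriv_along E f) u + c * deriv_along E (deriv_along E g) u"
    if "smooth_on E V" for E
  proof -
    note sm = smooth_on_deriv_along[OF assms(1) that assms(4)] smooth_on_deriv_along[OF assms(1) that assms(5)]
    have "deriv_along E (deriv_along E (\<lambda>x. f x + c * g x)) u = deriv_along E (\<lambda>x. deriv_along E f x + c * deriv_along E g x) u"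
      by (rule deriv_along_cong[OF assms(1,3)])
        (use 1 assms(4,5) sm in \<open>auto intro!: smooth_on_add smooth_on_mult smooth_on_const assms(1)\<close>)
    then show ?thesis
      using 1[OF assms(3) sm] by simp
  qed
  show ?thesis
    unfolding lap_def 2[OF E(1)] 2[OF E(2)] 1[OF assms(3-5)] by (simp add: algebra_simps)
qed

lemma lap_max:
  assumes "open V" "V \<subseteq> W" "u \<in> V" "smooth_on \<Phi> V" "\<And>x. x \<in> V \<Longrightarrow> \<Phi> x \<le> \<Phi> u"
  shows "lap \<Phi> u \<le> 0"
proof -
  have E: "smooth_on E1 V" "smooth_on E2 V"
    using smooth_on_subset[OF _ assms(2)] smooth_E1 smooth_E2 by auto
  show ?thesis
    using second_order_max[OF assms(1,3,4) E(1) assms(5)] second_order_max[OF assms(1,3,4) E(2) assms(5)]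
    by (simp add: lap_def)
qed

lemma deriv_functions:
  assumes u: "u \<in> W"
  shows "D1 P1 u = 1 + \<omega>1 u * P2 u + \<alpha> u * m u - P1 u * P1 u"
    and "D1 P2 u = - \<omega>1 u * P1 u + \<beta> u * m u - P1 u * P2 u"
    and "D2 P1 u = \<omega>2 u * P2 u + \<beta> u * m u - P1 u * P2 u"
    and "D2 P2 u = 1 - \<omega>2 u * P1 u - \<alpha> u * m u - P2 u * P2 u"
    and "D1 m u = \<alpha> u * P1 u + \<beta> u * P2 u - m u * P1 u"
    and "D2 m u = \<beta> u * P1 u - \<alpha> u * P2 u - m u * P2 u"
    and "D1 U u = U u * P1 u" and "D2 U u = U u * P2 u"
proof -
  have U0: "U u > 0"
    using U_pos[OF u] by (simp add: U_def)
  have smf: "smooth_on (\<lambda>x. form (f x) p) W" if "smooth_on f W" for f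
    by (intro smooth_on_form open_W smooth_on_const that)
  have df: "deriv_along E (\<lambda>x. form (f x) p) u = form (deriv_along E f u) p" if "smooth_on f W" for f E
    using deriv_along_bilinear[OF bounded_bilinear_form that smooth_on_const u, of E p]
    by (simp add: deriv_along_const form.zero_right)
  have line: "((\<lambda>s. form (f (u + s *\<^sub>R E u)) p) has_real_derivative form (deriv_along E f u) p) (at 0)"
    if "smooth_on f W" for f E
    using deriv_along_line[OF smf[OF that] u, of E] df[OF that] by simp
  have quot: "deriv_along E h u = form (deriv_along E f u) p / U u - (form (f u) p / U u) * (form (deriv_along E \<sigma> u) p / U u)"
    if f: "smooth_on f W" and h: "smooth_on h W" "\<And>x. h x = form (f x) p / U x" for f h E
  proof (rule deriv_along_eq_line[OF open_W u h(1) h(2)])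
    have "((\<lambda>s. form (f (u + s *\<^sub>R E u)) p / form (\<sigma> (u + s *\<^sub>R E u)) p) has_real_derivative
        (form (deriv_along E f u) p * form (\<sigma> (u + 0 *\<^sub>R E u)) p - form (f (u + 0 *\<^sub>R E u)) p * form (deriv_along E \<sigma> u) p)
        / (form (\<sigma> (u + 0 *\<^sub>R E u)) p * form (\<sigma> (u + 0 *\<^sub>R E u)) p)) (at 0)"
      by (rule DERIV_divide[OF line[OF f] line[OF smooth_\<sigma>]]) (use U0 in \<open>simp add: U_def\<close>)
    moreover have "(A * form (\<sigma> u) p - B * C) / (form (\<sigma> u) p * form (\<sigma> u) p) = A / U u - B / U u * (C / U u)" for A B C
      using U0 by (simp add: U_def field_simps)
    ultimately show "((\<lambda>s. form (f (u + s *\<^sub>R E u)) p / U (u + s *\<^sub>R E u)) has_real_derivative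
        form (deriv_along E f u) p / U u - form (f u) p / U u * (form (deriv_along E \<sigma> u) p / U u)) (at 0)"
      by (simp add: U_def)
  qed
  have D\<sigma>: "D1 \<sigma> u = e1 u" "D2 \<sigma> u = e2 u"
    by (simp_all add: e1 e2)
  have UU: "U u / U u = 1"
    using U0 by simp
  note q = quot[OF smooth_e1 smooth_functions(2) P1_def] quot[OF smooth_e2 smooth_functions(3) P2_def]
    quot[OF smooth_N smooth_functions(4) m_def]
  note fold = P1_def[of u, symmetric] P2_def[of u, symmetric] m_def[of u, symmetric]
  have s: "form (\<sigma> u) p / U u = 1"
    using U0 by (simp add: U_def)
  show "D1 P1 u = 1 + \<omega>1 u * P2 u + \<alpha> u * m u - P1 u * P1 u"
    "D1 P2 u = - \<omega>1 u * P1 u + \<beta> u * m u - P1 u * P2 u"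
    "D2 P1 u = \<omega>2 u * P2 u + \<beta> u * m u - P1 u * P2 u"
    "D2 P2 u = 1 - \<omega>2 u * P1 u - \<alpha> u * m u - P2 u * P2 u"
    "D1 m u = \<alpha> u * P1 u + \<beta> u * P2 u - m u * P1 u"
    "D2 m u = \<beta> u * P1 u - \<alpha> u * P2 u - m u * P2 u"
    unfolding q frame_equations[OF u] D\<sigma>
    by (simp_all add: form_simps add_divide_distrib diff_divide_distrib s fold times_divide_eq_right[symmetric] del: times_divide_eq_right)
  show "D1 U u = U u * P1 u" "D2 U u = U u * P2 u"
    using df[OF smooth_\<sigma>, of E1] df[OF smooth_\<sigma>, of E2] U0 by (simp_all add: U_def[abs_def] D\<sigma> P1_def P2_def)
qed

text \<open>\<Delta> ln U = \<Delta>U / U - |grad ln U|^2, where \<Delta>U = 2U.\<close>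

lemma lap_ln_U:
  assumes u: "u \<in> W"
  shows "lap (\<lambda>x. ln (U x)) u = 2 - G u"
proof -
  have sm: "smooth_on (\<lambda>x. ln (U x)) W"
    by (intro smooth_on_ln open_W smooth_functions) (use U_pos in \<open>simp add: U_def\<close>)
  have d: "deriv_along E (\<lambda>x. ln (U x)) x = deriv_along E U x / U x" if x: "x \<in> W" for E x
  proof (rule deriv_along_eq_line[OF open_W x sm refl])
    show "((\<lambda>s. ln (U (x + s *\<^sub>R E x))) has_real_derivative deriv_along E U x / U x) (at 0)"
      using U_pos[OF x, folded U_def] by (auto intro!: derivative_eq_intros deriv_along_line[OF smooth_functions(1) x])
  qed
  have d1: "D1 (\<lambda>x. ln (U x)) x = P1 x" "D2 (\<lambda>x. ln (U x)) x = P2 x" if "x \<in> W" for x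
    using U_pos[OF that] d[OF that] deriv_functions(7,8)[OF that] by (simp_all add: U_def)
  have "D1 (D1 (\<lambda>x. ln (U x))) u = D1 P1 u" "D2 (D2 (\<lambda>x. ln (U x))) u = D2 P2 u"
    by (rule deriv_along_cong[OF open_W u]; use d1 smooth_functions in simp)+
  then show ?thesis
    unfolding lap_def d1[OF u] by (simp add: deriv_functions[OF u] G_def algebra_simps)
qed

text \<open>A Bochner formula. Derivatives of \<alpha> and \<beta> enter only in the two
  combinations given by the Codazzi equations, after which all connection coefficients
  cancel.\<close>

lemma lap_G:
  assumes u: "u \<in> W"
  shows "lap G u = 2 * ((\<alpha> u)\<^sup>2 + (\<beta> u)\<^sup>2) * G u + 4 * ((\<alpha> u)\<^sup>2 + (\<beta> u)\<^sup>2) * (m u)\<^sup>2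
    - 8 * m u * (\<alpha> u * (P1 u * P1 u - P2 u * P2 u) + 2 * \<beta> u * P1 u * P2 u) + (G u - 1) * (6 * G u - 4)"
proof -
  note sf = smooth_functions
  note sc = smooth_coeffs
  define R1 R2 where "R1 x = 2 * P1 x + 2 * m x * (\<alpha> x * P1 x + \<beta> x * P2 x) - 2 * P1 x * (P1 x * P1 x + P2 x * P2 x)"
    and "R2 x = 2 * P2 x + 2 * m x * (\<beta> x * P1 x - \<alpha> x * P2 x) - 2 * P2 x * (P1 x * P1 x + P2 x * P2 x)" for x
  have smR: "smooth_on R1 W" "smooth_on R2 W"
    unfolding R1_def[abs_def] R2_def[abs_def]
    by (intro smooth_on_add smooth_on_diff smooth_on_mult smooth_on_const open_W sf sc)+
  have d: "deriv_along E G x = 2 * P1 x * deriv_along E P1 x + 2 * P2 x * deriv_along E P2 x" if x: "x \<in> W" for E x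
    by (rule deriv_along_eq_line[OF open_W x sf(5) G_def])
      (rule derivative_eq_intros deriv_along_line[OF sf(2) x] deriv_along_line[OF sf(3) x] refl | simp)+
  have dG: "D1 G x = R1 x" "D2 G x = R2 x" if "x \<in> W" for x
    unfolding d[OF that] deriv_functions[OF that] by (simp_all add: R1_def R2_def algebra_simps)
  note L = deriv_along_line[OF sf(2) u] deriv_along_line[OF sf(3) u] deriv_along_line[OF sf(4) u]
    deriv_along_line[OF sc(3) u] deriv_along_line[OF sc(4) u]
  have DR: "deriv_along E R1 u = 2 * deriv_along E P1 u + (2 * deriv_along E m u * (\<alpha> u * P1 u + \<beta> u * P2 u)
      + 2 * m u * (deriv_along E \<alpha> u * P1 u + \<alpha> u * deriv_along E P1 u + deriv_along E \<beta> u * P2 u + \<beta> u * deriv_along E P2 u))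
      - (2 * deriv_along E P1 u * (P1 u * P1 u + P2 u * P2 u) + 2 * P1 u * (2 * P1 u * deriv_along E P1 u + 2 * P2 u * deriv_along E P2 u))" for E
    by (rule deriv_along_eq_line[OF open_W u smR(1) R1_def])
      (rule derivative_eq_intros L refl | simp add: algebra_simps)+
  have DR2: "deriv_along E R2 u = 2 * deriv_along E P2 u + (2 * deriv_along E m u * (\<beta> u * P1 u - \<alpha> u * P2 u)
      + 2 * m u * (deriv_along E \<beta> u * P1 u + \<beta> u * deriv_along E P1 u - deriv_along E \<alpha> u * P2 u - \<alpha> u * deriv_along E P2 u))
      - (2 * deriv_along E P2 u * (P1 u * P1 u + P2 u * P2 u) + 2 * P2 u * (2 * P1 u * deriv_along E P1 u + 2 * P2 u * deriv_along E P2 u))" for E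
    by (rule deriv_along_eq_line[OF open_W u smR(2) R2_def])
      (rule derivative_eq_intros L refl | simp add: algebra_simps)+
  have "D1 (D1 G) u = D1 R1 u" "D2 (D2 G) u = D2 R2 u"
    by (rule deriv_along_cong[OF open_W u]; use dG smR in simp)+
  moreover have "D1 \<alpha> u = 2 * (\<beta> u * \<omega>1 u - \<alpha> u * \<omega>2 u) - D2 \<beta> u" "D2 \<alpha> u = 2 * (\<alpha> u * \<omega>1 u + \<beta> u * \<omega>2 u) + D1 \<beta> u"
    using codazzi[OF u] by linarith+
  ultimately show ?thesis
    unfolding lap_def dG[OF u] DR DR2 deriv_functions[OF u] G_def R1_def R2_def
    by (simp add: power2_eq_square algebra_simps)
qed

text \<open>The Codazzi equations first rewrite the gradient of ln \<lambda> as a rotated gradient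
  of the argument of (\<alpha>, \<beta>) plus connection terms; these are \<open>X1\<close> and
  \<open>X2\<close>. In their divergence the second derivatives of \<alpha> and \<beta> occur only
  as commutators, and the derivatives of the connection only in the combination of the Gauss
  equation.\<close>

lemma lap_ln_lambda:
  assumes V: "open V" "V \<subseteq> W" "u \<in> V" and l: "\<And>x. x \<in> V \<Longrightarrow> \<alpha> x * \<alpha> x + \<beta> x * \<beta> x > 0"
  shows "lap (\<lambda>x. ln (\<alpha> x * \<alpha> x + \<beta> x * \<beta> x) / 2) u = 2 * ((\<alpha> u)\<^sup>2 + (\<beta> u)\<^sup>2) - 2"
proof -
  define lq where "lq x = \<alpha> x * \<alpha> x + \<beta> x * \<beta> x" for x
  have uW: "u \<in> W"
    using V by auto
  have sV: "smooth_on f V" if "smooth_on f W" for f :: "real ^ 2 \<Rightarrow> 'c::real_normed_vector"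
    using smooth_on_subset[OF that V(2)] .
  note sc = smooth_coeffs[THEN sV]
  have sE: "smooth_on E1 V" "smooth_on E2 V"
    using sV smooth_E1 smooth_E2 by auto
  have sl: "smooth_on lq V"
    unfolding lq_def[abs_def] by (intro smooth_on_add smooth_on_mult V sc)
  have lp: "lq x > 0" if "x \<in> V" for x
    using l[OF that] by (simp add: lq_def)
  have sd: "smooth_on (D1 \<alpha>) V" "smooth_on (D2 \<alpha>) V" "smooth_on (D1 \<beta>) V" "smooth_on (D2 \<beta>) V"
    by (intro smooth_on_deriv_along V sc sE)+
  let ?f = "\<lambda>x. ln (lq x) / 2"
  have sf: "smooth_on ?f V"
    using smooth_on_mult[OF V(1) smooth_on_ln[OF V(1) sl lp] smooth_on_const[of "1/2"]] by simp
  have dl: "deriv_along E ?f x = (\<alpha> x * deriv_along E \<alpha> x + \<beta> x * deriv_along E \<beta> x) / lq x" if x: "x \<in> V" for E x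
  proof (rule deriv_along_eq_line[OF V(1) x sf refl])
    have "((\<lambda>s. lq (x + s *\<^sub>R E x)) has_real_derivative 2 * \<alpha> x * deriv_along E \<alpha> x + 2 * \<beta> x * deriv_along E \<beta> x) (at 0)"
      unfolding lq_def by (rule derivative_eq_intros deriv_along_line[OF sc(3) x] deriv_along_line[OF sc(4) x] refl | simp)+
    then have "((\<lambda>s. ln (lq (x + s *\<^sub>R E x)) / 2) has_real_derivative
        1 / lq (x + 0 *\<^sub>R E x) * (2 * \<alpha> x * deriv_along E \<alpha> x + 2 * \<beta> x * deriv_along E \<beta> x) / 2) (at 0)"
      by (intro DERIV_cdivide DERIV_chain2[OF DERIV_ln_divide]) (use lp[OF x] in auto)
    then show "((\<lambda>s. ln (lq (x + s *\<^sub>R E x)) / 2) has_real_derivative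
        (\<alpha> x * deriv_along E \<alpha> x + \<beta> x * deriv_along E \<beta> x) / lq x) (at 0)"
      by (simp add: add_divide_distrib)
  qed
  define X1 X2 where "X1 x = - ((\<alpha> x * D2 \<beta> x - \<beta> x * D2 \<alpha> x) / lq x) - 2 * \<omega>2 x"
    and "X2 x = (\<alpha> x * D1 \<beta> x - \<beta> x * D1 \<alpha> x) / lq x + 2 * \<omega>1 x" for x
  have smX: "smooth_on X1 V" "smooth_on X2 V"
  proof -
    show "smooth_on X1 V"
      unfolding X1_def[abs_def]
      by (intro smooth_on_add smooth_on_diff smooth_on_minus smooth_on_mult smooth_on_divide smooth_on_const V sc sd sl lp)
    show "smooth_on X2 V"
      unfolding X2_def[abs_def]
      by (intro smooth_on_add smooth_on_diff smooth_on_minus smooth_on_mult smooth_on_divide smooth_on_const V sc sd sl lp)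
  qed
  have dX: "D1 ?f x = X1 x" "D2 ?f x = X2 x" if x: "x \<in> V" for x
  proof -
    have xW: "x \<in> W"
      using x V by auto
    have c: "D1 \<alpha> x = 2 * (\<beta> x * \<omega>1 x - \<alpha> x * \<omega>2 x) - D2 \<beta> x" "D2 \<alpha> x = 2 * (\<alpha> x * \<omega>1 x + \<beta> x * \<omega>2 x) + D1 \<beta> x"
      using codazzi[OF xW] by linarith+
    have "(\<alpha> x * D1 \<alpha> x + \<beta> x * D1 \<beta> x) = - (\<alpha> x * D2 \<beta> x - \<beta> x * D2 \<alpha> x) - 2 * \<omega>2 x * lq x"
      "(\<alpha> x * D2 \<alpha> x + \<beta> x * D2 \<beta> x) = (\<alpha> x * D1 \<beta> x - \<beta> x * D1 \<alpha> x) + 2 * \<omega>1 x * lq x"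
      unfolding c lq_def by (simp_all add: algebra_simps)
    then show "D1 ?f x = X1 x" "D2 ?f x = X2 x"
      unfolding dl[OF x] X1_def X2_def using lp[OF x] by (simp_all add: diff_divide_distrib add_divide_distrib)
  qed
  note L = deriv_along_line[OF sc(1) V(3)] deriv_along_line[OF sc(2) V(3)] deriv_along_line[OF sc(3) V(3)] deriv_along_line[OF sc(4) V(3)]
    deriv_along_line[OF sd(1) V(3)] deriv_along_line[OF sd(2) V(3)] deriv_along_line[OF sd(3) V(3)] deriv_along_line[OF sd(4) V(3)]
  have Ll: "((\<lambda>s. lq (u + s *\<^sub>R E u)) has_real_derivative 2 * \<alpha> u * deriv_along E \<alpha> u + 2 * \<beta> u * deriv_along E \<beta> u) (at 0)" for E
    unfolding lq_def by (rule derivative_eq_intros L refl | simp)+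
  have l0: "lq (u + 0 *\<^sub>R E u) \<noteq> 0" for E
    using lp[OF V(3)] by simp
  have E1X: "D1 X1 u = - ((D1 \<alpha> u * D2 \<beta> u + \<alpha> u * D1 (D2 \<beta>) u - (D1 \<beta> u * D2 \<alpha> u + \<beta> u * D1 (D2 \<alpha>) u)) * lq u
      - (\<alpha> u * D2 \<beta> u - \<beta> u * D2 \<alpha> u) * (2 * \<alpha> u * D1 \<alpha> u + 2 * \<beta> u * D1 \<beta> u)) / (lq u * lq u) - 2 * D1 \<omega>2 u"
    by (rule deriv_along_eq_line[OF V(1,3) smX(1) X1_def])
      (rule derivative_eq_intros L Ll l0 refl | simp add: algebra_simps minus_divide_left)+
  have E2X: "D2 X2 u = ((D2 \<alpha> u * D1 \<beta> u + \<alpha> u * D2 (D1 \<beta>) u - (D2 \<beta> u * D1 \<alpha> u + \<beta> u * D2 (D1 \<alpha>) u)) * lq u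
      - (\<alpha> u * D1 \<beta> u - \<beta> u * D1 \<alpha> u) * (2 * \<alpha> u * D2 \<alpha> u + 2 * \<beta> u * D2 \<beta> u)) / (lq u * lq u) + 2 * D2 \<omega>1 u"
    by (rule deriv_along_eq_line[OF V(1,3) smX(2) X2_def])
      (rule derivative_eq_intros L Ll l0 refl | simp add: algebra_simps)+
  have "D1 (D1 ?f) u = D1 X1 u" "D2 (D2 ?f) u = D2 X2 u"
    by (rule deriv_along_cong[OF V(1,3)]; use dX smX in simp)+
  then have "lap ?f u = D1 X1 u + D2 X2 u + \<omega>2 u * ((\<alpha> u * D1 \<alpha> u + \<beta> u * D1 \<beta> u) / lq u)
      - \<omega>1 u * ((\<alpha> u * D2 \<alpha> u + \<beta> u * D2 \<beta> u) / lq u)"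
    unfolding lap_def dl[OF V(3)] by simp
  also have "\<dots> = 2 * lq u - 2"
    unfolding E1X E2X
    by (rule simons_identity[OF _ lp[OF V(3)] codazzi[OF uW] commutator_real[OF uW smooth_coeffs(3)] commutator_real[OF uW smooth_coeffs(4)]])
      (use gauss[OF uW] in \<open>simp_all add: lq_def power2_eq_square\<close>)
  finally show ?thesis
    by (simp add: lq_def power2_eq_square)
qed

text \<open>Reflects \<Delta>n = 2\<lambda>^2 n and |grad n|^2 = \<lambda>^2 |grad u|^2, together
  with the formula for ln u. Half the logarithm of the square stands for ln |m|, so that no sign has
  to be chosen.\<close>

lemma lap_ln_m:
  assumes V: "open V" "V \<subseteq> W" "u \<in> V" and m0: "\<And>x. x \<in> V \<Longrightarrow> m x \<noteq> 0"
  shows "lap (\<lambda>x. ln (m x * m x) / 2) u =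
    2 * ((\<alpha> u)\<^sup>2 + (\<beta> u)\<^sup>2) - ((\<alpha> u)\<^sup>2 + (\<beta> u)\<^sup>2) * G u / (m u)\<^sup>2 - (2 - G u)"
proof -
  have uW: "u \<in> W"
    using V by auto
  have sV: "smooth_on f V" if "smooth_on f W" for f :: "real ^ 2 \<Rightarrow> 'c::real_normed_vector"
    using smooth_on_subset[OF that V(2)] .
  note sc = smooth_coeffs[THEN sV] and sf = smooth_functions[THEN sV]
  have mp: "m x * m x > 0" if "x \<in> V" for x
    using m0[OF that] by (simp add: zero_less_mult_iff linorder_neq_iff disj_commute)
  let ?f = "\<lambda>x. ln (m x * m x) / 2"
  have smf: "smooth_on ?f V"
    using smooth_on_mult[OF V(1) smooth_on_ln[OF V(1) smooth_on_mult[OF V(1) sf(4,4)] mp] smooth_on_const[of "1/2"]] by simp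
  have d: "deriv_along E ?f x = deriv_along E m x / m x" if x: "x \<in> V" for E x
  proof (rule deriv_along_eq_line[OF V(1) x smf refl])
    have "((\<lambda>s. m (x + s *\<^sub>R E x) * m (x + s *\<^sub>R E x)) has_real_derivative 2 * m x * deriv_along E m x) (at 0)"
      by (rule derivative_eq_intros deriv_along_line[OF sf(4) x] refl | simp)+
    then have "((\<lambda>s. ln (m (x + s *\<^sub>R E x) * m (x + s *\<^sub>R E x)) / 2) has_real_derivative
        1 / (m (x + 0 *\<^sub>R E x) * m (x + 0 *\<^sub>R E x)) * (2 * m x * deriv_along E m x) / 2) (at 0)"
      by (intro DERIV_cdivide DERIV_chain2[OF DERIV_ln_divide]) (use mp[OF x] in auto)
    then show "((\<lambda>s. ln (m (x + s *\<^sub>R E x) * m (x + s *\<^sub>R E x)) / 2) has_real_derivative deriv_along E m x / m x) (at 0)"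
      using m0[OF x] by simp
  qed
  \<comment> \<open>The denominator is written as \<open>m x * m x\<close>, which is positive as
    \<open>smooth_on_divide\<close> demands.\<close>
  define X1 X2 where "X1 x = (\<alpha> x * P1 x + \<beta> x * P2 x) * m x / (m x * m x) - P1 x"
    and "X2 x = (\<beta> x * P1 x - \<alpha> x * P2 x) * m x / (m x * m x) - P2 x" for x
  have smX: "smooth_on X1 V" "smooth_on X2 V"
  proof -
    have A: "smooth_on (\<lambda>x. \<alpha> x * P1 x + \<beta> x * P2 x) V" "smooth_on (\<lambda>x. \<beta> x * P1 x - \<alpha> x * P2 x) V"
      by (intro smooth_on_add smooth_on_diff smooth_on_mult V sc sf)+
    show "smooth_on X1 V" "smooth_on X2 V"
      unfolding X1_def[abs_def] X2_def[abs_def]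
      using smooth_on_diff[OF V(1) smooth_on_divide[OF V(1) smooth_on_mult[OF V(1) A(1) sf(4)] smooth_on_mult[OF V(1) sf(4,4)] mp] sf(2)]
        smooth_on_diff[OF V(1) smooth_on_divide[OF V(1) smooth_on_mult[OF V(1) A(2) sf(4)] smooth_on_mult[OF V(1) sf(4,4)] mp] sf(3)]
      by auto
  qed
  have dX: "D1 ?f x = X1 x" "D2 ?f x = X2 x" if x: "x \<in> V" for x
  proof -
    have xW: "x \<in> W"
      using x V by auto
    show "D1 ?f x = X1 x" "D2 ?f x = X2 x"
      unfolding d[OF x] deriv_functions[OF xW] X1_def X2_def using m0[OF x] by (simp_all add: field_simps)
  qed
  note L = deriv_along_line[OF sc(3) V(3)] deriv_along_line[OF sc(4) V(3)]
    deriv_along_line[OF sf(2) V(3)] deriv_along_line[OF sf(3) V(3)] deriv_along_line[OF sf(4) V(3)]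
  have X': "X1 x = (\<alpha> x * P1 x + \<beta> x * P2 x) / m x - P1 x" "X2 x = (\<beta> x * P1 x - \<alpha> x * P2 x) / m x - P2 x" if "x \<in> V" for x
    using m0[OF that] by (simp_all add: X1_def X2_def)
  have mu: "m (u + 0 *\<^sub>R E u) \<noteq> 0" for E
    using m0[OF V(3)] by simp
  have DX1: "deriv_along E X1 u = ((deriv_along E \<alpha> u * P1 u + \<alpha> u * deriv_along E P1 u + (deriv_along E \<beta> u * P2 u + \<beta> u * deriv_along E P2 u)) * m u
      - (\<alpha> u * P1 u + \<beta> u * P2 u) * deriv_along E m u) / (m u * m u) - deriv_along E P1 u" for E
    by (rule deriv_along_eq_line[OF V(1,3) smX(1) X'(1)])
      (rule derivative_eq_intros L mu refl | simp add: algebra_simps)+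
  have DX2: "deriv_along E X2 u = ((deriv_along E \<beta> u * P1 u + \<beta> u * deriv_along E P1 u - (deriv_along E \<alpha> u * P2 u + \<alpha> u * deriv_along E P2 u)) * m u
      - (\<beta> u * P1 u - \<alpha> u * P2 u) * deriv_along E m u) / (m u * m u) - deriv_along E P2 u" for E
    by (rule deriv_along_eq_line[OF V(1,3) smX(2) X'(2)])
      (rule derivative_eq_intros L mu refl | simp add: algebra_simps)+
  have "D1 (D1 ?f) u = D1 X1 u" "D2 (D2 ?f) u = D2 X2 u"
    by (rule deriv_along_cong[OF V(1,3)]; use dX smX in simp)+
  then have lap: "lap ?f u = D1 X1 u + D2 X2 u + \<omega>2 u * X1 u - \<omega>1 u * X2 u"
    unfolding lap_def dX[OF V(3)] by simp
  \<comment> \<open>With the reciprocal as a separate variable, the identity becomes polynomial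
    modulo \<open>m * i = 1\<close>.\<close>
  define i where "i = inverse (m u)"
  have im: "m u * i = 1"
    using m0[OF V(3)] by (simp add: i_def)
  have quo: "(A * m u - B) / (m u * m u) = A * i - B * (i * i)" "A / m u = A * i" "A / (m u)\<^sup>2 = A * (i * i)" for A B
    using m0[OF V(3)] by (simp_all add: i_def power2_eq_square field_simps)
  have c: "D1 \<alpha> u = 2 * (\<beta> u * \<omega>1 u - \<alpha> u * \<omega>2 u) - D2 \<beta> u" "D2 \<alpha> u = 2 * (\<alpha> u * \<omega>1 u + \<beta> u * \<omega>2 u) + D1 \<beta> u"
    using codazzi[OF uW] by linarith+
  have gen: "((2 * (b * w1 - a * w2) - b2) * p1 + a * (1 + w1 * p2 + a * m - p1 * p1) + (b1 * p2 + b * (- w1 * p1 + b * m - p1 * p2))) * i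
      - (a * p1 + b * p2) * (a * p1 + b * p2 - m * p1) * (i * i) - (1 + w1 * p2 + a * m - p1 * p1)
      + ((b2 * p1 + b * (w2 * p2 + b * m - p1 * p2) - ((2 * (a * w1 + b * w2) + b1) * p2 + a * (1 - w2 * p1 - a * m - p2 * p2))) * i
      - (b * p1 - a * p2) * (b * p1 - a * p2 - m * p2) * (i * i) - (1 - w2 * p1 - a * m - p2 * p2))
      + w2 * ((a * p1 + b * p2) * i - p1) - w1 * ((b * p1 - a * p2) * i - p2)
      = 2 * (a\<^sup>2 + b\<^sup>2) - (a\<^sup>2 + b\<^sup>2) * (p1 * p1 + p2 * p2) * (i * i) - (2 - (p1 * p1 + p2 * p2))"
    if "m * i = 1" for a b w1 w2 b1 b2 p1 p2 m i :: real
    using that by algebra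
  show ?thesis
    unfolding lap DX1 DX2 X'[OF V(3)] quo c deriv_functions[OF uW] G_def
    using gen[OF im, of "\<beta> u" "\<omega>1 u" "\<alpha> u" "\<omega>2 u" "D2 \<beta> u" "P1 u" "P2 u" "D1 \<beta> u"] by (simp only: mult_ac add_ac)
qed

end

subsection \<open>Estimates by the maximum principle\<close>

text \<open>Lets the penalty parameter tend to zero. Restricting it to \<open>e \<le> 1\<close>
  keeps its contribution below the slack in the estimates at the maximum.\<close>

lemma le_if_le_add_small:
  fixes a b k :: real
  assumes "\<And>e. 0 < e \<Longrightarrow> e \<le> 1 \<Longrightarrow> a \<le> b + e * k"
  shows "a \<le> b"
proof (rule field_le_epsilon)
  fix e :: real assume e: "e > 0"
  define d where "d = min 1 (e / (\<bar>k\<bar> + 1))"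
  have d: "0 < d" "d \<le> 1" "d \<le> e / (\<bar>k\<bar> + 1)"
    unfolding d_def using e by (auto simp: add_nonneg_pos)
  have "d * k \<le> d * (\<bar>k\<bar> + 1)"
    using d by (intro mult_left_mono) auto
  also have "\<dots> \<le> e"
    using d(3) by (simp add: pos_le_divide_eq add_nonneg_pos)
  finally show "a \<le> b + e"
    using assms[OF d(1,2)] by linarith
qed

text \<open>The cross term is the one to be controlled. With h^2 \<le> l g^2 it is at most 8 sqrt(l
  m^2) g, which consumes 7/2 of the 4 units of l m^2 and 11/2 of the 6 units of g^2; one half of
  each remains.\<close>

lemma laplacian_lower_bound:
  fixes a b p q m :: real
  defines "l \<equiv> a\<^sup>2 + b\<^sup>2" and "g \<equiv> p * p + q * q"
  shows "2 * l * g + 4 * l * m\<^sup>2 - 8 * m * (a * (p * p - q * q) + 2 * b * p * q) + (g - 1) * (6 * g - 4)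
    \<ge> (l * m\<^sup>2 + g\<^sup>2) / 2 - 10 * g + 4"
proof -
  define h where "h = a * (p * p - q * q) + 2 * b * p * q"
  have l: "l \<ge> 0" "g \<ge> 0"
    by (simp_all add: l_def g_def)
  have "h\<^sup>2 + (2 * a * p * q - b * (p * p - q * q))\<^sup>2 = l * g\<^sup>2"
    unfolding h_def l_def g_def by algebra
  then have "h\<^sup>2 \<le> l * g\<^sup>2"
    by (metis add.commute le_add_same_cancel2 zero_le_power2)
  then have "m\<^sup>2 * h\<^sup>2 \<le> m\<^sup>2 * (l * g\<^sup>2)"
    by (intro mult_left_mono) auto
  then have "64 * (m * h)\<^sup>2 \<le> 64 * (l * m\<^sup>2) * g\<^sup>2"
    by (simp add: power_mult_distrib mult_ac)
  also have "\<dots> \<le> (7 / 2 * (l * m\<^sup>2) + 11 / 2 * g\<^sup>2)\<^sup>2"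
  proof -
    \<comment> \<open>Possible since 4 (7/2) (11/2) = 77 exceeds 64 by 13.\<close>
    have "(7 / 2 * x + 11 / 2 * y)\<^sup>2 - 64 * x * y = (7 / 2 * x - 11 / 2 * y)\<^sup>2 + 13 * (x * y)" for x y :: real
      by (simp add: power2_eq_square algebra_simps)
    moreover have "(l * m\<^sup>2) * g\<^sup>2 \<ge> 0"
      using l by (intro mult_nonneg_nonneg) auto
    ultimately show ?thesis
      by (smt (verit) zero_le_power2)
  qed
  finally have "(8 * (m * h))\<^sup>2 \<le> (7 / 2 * (l * m\<^sup>2) + 11 / 2 * g\<^sup>2)\<^sup>2"
    by (simp add: power_mult_distrib)
  moreover have "7 / 2 * (l * m\<^sup>2) + 11 / 2 * g\<^sup>2 \<ge> 0"
    using l by (intro add_nonneg_nonneg mult_nonneg_nonneg) auto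
  ultimately have "8 * (m * h) \<le> 7 / 2 * (l * m\<^sup>2) + 11 / 2 * g\<^sup>2"
    using abs_le_square_iff[of "8 * (m * h)" "7 / 2 * (l * m\<^sup>2) + 11 / 2 * g\<^sup>2"] by linarith
  moreover have "2 * l * g \<ge> 0"
    using l by simp
  moreover have "(g - 1) * (6 * g - 4) = 6 * g\<^sup>2 - 10 * g + 4"
    by (simp add: power2_eq_square algebra_simps)
  ultimately show ?thesis
    unfolding h_def[symmetric] by (simp add: field_simps)
qed

context asymptotic_surface
begin

lemma ex_frame_function:
  assumes p: "pos p" and x: "x \<in> T"
  obtains W \<sigma> u e1 e2 N E1 E2 where "chart W \<sigma>" "u \<in> W" "\<sigma> u = x" "frame_function W \<sigma> e1 e2 N E1 E2 p"
    "\<And>u. u \<in> W \<Longrightarrow> N u = nor (\<sigma> u)"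
    "\<And>u. u \<in> W \<Longrightarrow> (lam (\<sigma> u))\<^sup>2 = (moving_frame.\<alpha> e1 N E1 u)\<^sup>2 + (moving_frame.\<beta> e2 N E1 u)\<^sup>2"
proof -
  obtain W \<sigma> u where c: "chart W \<sigma>" "u \<in> W" "\<sigma> u = x"
    using ex_chart[OF x] by metis
  obtain e1 e2 N E1 E2 where mf: "moving_frame W \<sigma> e1 e2 N E1 E2" "\<And>u. u \<in> W \<Longrightarrow> N u = nor (\<sigma> u)"
    "\<And>u. u \<in> W \<Longrightarrow> (lam (\<sigma> u))\<^sup>2 = (form (deriv_along E1 N u) (e1 u))\<^sup>2 + (form (deriv_along E1 N u) (e2 u))\<^sup>2"
    using ex_frame[OF c(1)] by metis
  interpret M: moving_frame W \<sigma> e1 e2 N E1 E2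
    by (rule mf(1))
  have ff: "frame_function W \<sigma> e1 e2 N E1 E2 p"
  proof
    fix y assume "y \<in> W"
    then have "\<sigma> y \<in> T"
      using c(1) unfolding chart_def by auto
    then show "form (\<sigma> y) p > 0"
      by (rule pos_T[OF p])
  qed
  have lamf: "(lam (\<sigma> y))\<^sup>2 = (M.\<alpha> y)\<^sup>2 + (M.\<beta> y)\<^sup>2" if "y \<in> W" for y
    using mf(3)[OF that] unfolding M.\<alpha>_def M.\<beta>_def .
  show thesis
    by (rule that[of W \<sigma> u e1 e2 N E1 E2]) (use c ff mf(2) lamf in auto)
qed

text \<open>If \<open>T\<close> spans the ambient space, the bound of \<open>\<langle>y, nor x\<rangle>\<close> by \<open>\<langle>y, x\<rangle>\<close> for \<open>y \<in> T\<close> extends to all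
  vectors; otherwise \<open>T\<close> is totally geodesic.\<close>

lemma normal_dominated:
  assumes L: "L \<ge> 0" "\<And>x. x \<in> T \<Longrightarrow> lam x \<le> L" and p: "pos p" and x0: "x0 \<in> T" "lam x0 > 0"
  obtains C where "C \<ge> 0" "\<And>x. x \<in> T \<Longrightarrow> \<bar>form (nor x) p\<bar> \<le> C * form x p"
proof -
  have up: "form x p > 0" if "x \<in> T" for x
    using pos_T[OF p that] .
  define A where "A = {q. \<exists>C\<ge>0. \<forall>x\<in>T. \<bar>form (nor x) q\<bar> \<le> C * form x p}"
  have "subspace A"
    unfolding subspace_def
  proof (intro conjI ballI allI)
    show "0 \<in> A"
      unfolding A_def by (auto simp: form.zero_right intro!: exI[of _ 0])
    fix q r assume "q \<in> A" "r \<in> A"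
    then obtain C D where "C \<ge> 0" "D \<ge> 0" "\<forall>x\<in>T. \<bar>form (nor x) q\<bar> \<le> C * form x p" "\<forall>x\<in>T. \<bar>form (nor x) r\<bar> \<le> D * form x p"
      unfolding A_def by auto
    then have "\<forall>x\<in>T. \<bar>form (nor x) (q + r)\<bar> \<le> (C + D) * form x p"
      by (fastforce simp: form.add_right algebra_simps)
    then show "q + r \<in> A"
      unfolding A_def using \<open>C \<ge> 0\<close> \<open>D \<ge> 0\<close> by (intro CollectI exI[of _ "C + D"]) auto
  next
    fix c q assume "q \<in> A"
    then obtain C where C: "C \<ge> 0" "\<forall>x\<in>T. \<bar>form (nor x) q\<bar> \<le> C * form x p"
      unfolding A_def by auto
    then have "\<forall>x\<in>T. \<bar>form (nor x) (c *\<^sub>R q)\<bar> \<le> (\<bar>c\<bar> * C) * form x p"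
      by (auto simp: form.scaleR_right abs_mult mult.assoc intro: mult_left_mono)
    then show "c *\<^sub>R q \<in> A"
      unfolding A_def using C(1) by (intro CollectI exI[of _ "\<bar>c\<bar> * C"]) auto
  qed
  moreover have "T \<subseteq> A"
  proof
    fix y assume y: "y \<in> T"
    obtain d where d: "d > 0" "\<And>t. \<bar>t\<bar> \<le> d \<Longrightarrow> pos (p + t *\<^sub>R y)"
      using pos_perturb[OF p] by metis
    have "\<bar>form (nor x) y\<bar> \<le> (L / d) * form x p" if x: "x \<in> T" for x
    proof -
      \<comment> \<open>Positivity for \<open>p\<close> perturbed in the direction \<open>y\<close>
        bounds \<open>- form x y\<close> by \<open>form x p / d\<close>, uniformly in
        \<open>x\<close>.\<close>
      have "form x (p + d *\<^sub>R y) > 0"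
        using pos_T[OF d(2) x] d(1) by simp
      then have "- form x y \<le> form x p / d"
        using d(1) by (simp add: form_simps pos_le_divide_eq mult.commute)
      then have "L * (- form x y) \<le> L * (form x p / d)"
        using L(1) by (rule mult_left_mono)
      then show ?thesis
        using normal_bound[OF L x y] by (simp add: form_commute[of "nor x"] form_commute[of y x])
    qed
    then show "y \<in> A"
      unfolding A_def using L(1) d(1) by (intro CollectI exI[of _ "L / d"]) auto
  qed
  ultimately have "span T \<subseteq> A"
    by (simp add: span_minimal)
  moreover have "span T = UNIV"
  proof (rule ccontr)
    assume "span T \<noteq> UNIV"
    then obtain a where a: "a \<noteq> 0" "\<And>x. x \<in> span T \<Longrightarrow> a \<bullet> x = 0"
      using span_not_UNIV_orthogonal[of T] by auto
    define w :: "real ^ 4" where "w = (\<chi> i. if i = 3 \<or> i = 4 then - a $ i else a $ i)"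
    have "form z w = a \<bullet> z" for z
      by (simp add: form_def inner_vec_def sum_4 w_def)
    then have w: "form y w = 0" if "y \<in> T" for y
      using a(2)[OF span_base[OF that]] by simp
    obtain W \<sigma> u where c: "chart W \<sigma>" "u \<in> W" "\<sigma> u = x0"
      using ex_chart[OF x0(1)] by metis
    obtain e1 e2 N E1 E2 where mf: "moving_frame W \<sigma> e1 e2 N E1 E2"
      "\<And>u. u \<in> W \<Longrightarrow> (lam (\<sigma> u))\<^sup>2 = (form (deriv_along E1 N u) (e1 u))\<^sup>2 + (form (deriv_along E1 N u) (e2 u))\<^sup>2"
      using ex_frame[OF c(1)] by metis
    interpret M: moving_frame W \<sigma> e1 e2 N E1 E2
      by (rule mf(1))
    have s0: "form (\<sigma> y) w = 0" if "y \<in> W" for y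
      using w c(1) that unfolding chart_def by auto
    have der0: "form (deriv_along E f y) w = 0" if "smooth_on f W" "\<And>y. y \<in> W \<Longrightarrow> form (f y) w = 0" "y \<in> W" for f E y
      using M.deriv_form_const[OF that(1) smooth_on_const that(3,2), of E] by (simp add: deriv_along_const form.zero_right)
    have e0: "form (e1 y) w = 0" "form (e2 y) w = 0" if "y \<in> W" for y
      using der0[OF M.smooth_\<sigma> s0 that] by (simp_all add: M.e1 M.e2)
    have "form (M.D1 e1 u) w = 0" "form (M.D1 e2 u) w = 0"
      using der0[OF M.smooth_e1 e0(1) c(2)] der0[OF M.smooth_e2 e0(2) c(2)] by auto
    then have "M.\<alpha> u * form (N u) w = 0" "M.\<beta> u * form (N u) w = 0"
      unfolding M.frame_equations[OF c(2)] using s0[OF c(2)] e0[OF c(2)] by (simp_all add: form_simps)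
    moreover have "form (N u) w \<noteq> 0"
    proof
      assume "form (N u) w = 0"
      then have "w = 0"
        using M.expand[OF c(2), of w] s0[OF c(2)] e0[OF c(2)] by (simp add: form_commute[of w])
      then show False
        using a(1) by (auto simp: w_def vec_eq_iff split: if_splits)
    qed
    ultimately have "(lam x0)\<^sup>2 = 0"
      using mf(2)[OF c(2)] c(3) by (simp add: M.\<alpha>_def M.\<beta>_def)
    then show False
      using x0(2) by simp
  qed
  ultimately show thesis
    using that unfolding A_def by blast
qed

lemma ex_min:
  assumes "pos p"
  obtains c where "c > 0" "\<And>x. x \<in> T \<Longrightarrow> c \<le> form x p"
proof -
  obtain x where x: "x \<in> T"
    using T_nonempty by auto
  let ?K = "{y \<in> T. form y p \<le> form x p}"
  have "compact ?K" "?K \<noteq> {}" "continuous_on ?K (\<lambda>y. form y p)"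
    using pos_sublevel_compact[OF assms] x by (auto intro!: continuous_intros)
  then have "\<exists>z\<in>?K. \<forall>y\<in>?K. form z p \<le> form y p"
    by (rule continuous_attains_inf)
  then obtain z where z: "z \<in> ?K" "\<forall>y\<in>?K. form z p \<le> form y p"
    by (elim bexE)
  have "form z p \<le> form y p" if "y \<in> T" for y
    using z that by (cases "form y p \<le> form x p") auto
  then show thesis
    using that[of "form z p"] pos_T[OF assms, of z] z(1) by auto
qed

text \<open>The weight u^(-e) tends to zero at the ends while \<open>h\<close> stays bounded, so the
  supremum of the product is attained on a compact sublevel set of u. Taking logarithms turns the
  weight into the penalty \<open>e * ln u\<close>.\<close>

lemma max_attained:
  assumes p: "pos p" and h: "continuous_on T h" "\<And>x. x \<in> T \<Longrightarrow> 0 \<le> h x" "\<And>x. x \<in> T \<Longrightarrow> h x \<le> B"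
    and x0: "x0 \<in> T" "h x0 > 0" and e: "e > (0::real)"
  obtains x where "x \<in> T" "h x > 0" "\<And>y. y \<in> T \<Longrightarrow> h y * exp (- e * ln (form y p)) \<le> h x * exp (- e * ln (form x p))"
proof -
  define f where "f y = h y * exp (- e * ln (form y p))" for y
  have up: "form y p > 0" if "y \<in> T" for y
    using pos_T[OF p that] .
  \<comment> \<open>The solution of B M^(-e) = f x0: where u exceeds \<open>M\<close>, the product
    cannot exceed its value at \<open>x0\<close>.\<close>
  define M where "M = exp ((ln B - ln (f x0)) / e)"
  have B: "B > 0"
    using h(3)[OF x0(1)] x0(2) by linarith
  have f0: "f x0 > 0"
    using x0(2) by (simp add: f_def)
  have far: "f y \<le> f x0" if y: "y \<in> T" "form y p > M" for y
  proof -
    have "ln M < ln (form y p)"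
      using y(2) by (subst ln_less_cancel_iff) (auto simp: M_def up[OF y(1)])
    then have "ln B - ln (f x0) < e * ln (form y p)"
      using e by (simp add: M_def pos_divide_less_eq mult.commute)
    then have "ln B + - e * ln (form y p) \<le> ln (f x0)"
      by simp
    then have "exp (ln B + - e * ln (form y p)) \<le> exp (ln (f x0))"
      by (simp only: exp_le_cancel_iff)
    then have "B * exp (- e * ln (form y p)) \<le> f x0"
      using B f0 by (simp only: exp_add exp_ln)
    moreover have "f y \<le> B * exp (- e * ln (form y p))"
      unfolding f_def using h(3)[OF y(1)] by (intro mult_right_mono) auto
    ultimately show ?thesis
      by linarith
  qed
  let ?K = "{y \<in> T. form y p \<le> max M (form x0 p)}"
  have sub: "?K \<subseteq> T"
    by auto
  have "compact ?K" "?K \<noteq> {}"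
    using pos_sublevel_compact[OF p] x0(1) by auto
  moreover have "continuous_on ?K f"
    unfolding f_def[abs_def]
    by (intro continuous_intros continuous_on_subset[OF h(1) sub]) (use up in force)
  ultimately have "\<exists>x\<in>?K. \<forall>y\<in>?K. f y \<le> f x"
    by (rule continuous_attains_sup)
  then obtain x where x: "x \<in> ?K" "\<forall>y\<in>?K. f y \<le> f x"
    by (elim bexE)
  have x0K: "x0 \<in> ?K"
    using x0(1) by auto
  have m: "f y \<le> f x" if y: "y \<in> T" for y
  proof (cases "y \<in> ?K")
    case True
    then show ?thesis
      using x(2) by auto
  next
    case False
    then have "form y p > M"
      using y by auto
    from far[OF y this] show ?thesis
      using bspec[OF x(2) x0K] by linarith
  qed
  have "f x > 0"
    using m[OF x0(1)] f0 by linarith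
  then have "h x > 0"
    unfolding f_def by (simp add: zero_less_mult_iff)
  then show thesis
    using that[of x] x(1) m unfolding f_def by auto
qed

text \<open>|grad ln u|^2 without reference to a frame: expanding \<open>form p p\<close> in an
  adapted frame gives |grad u|^2 = u^2 + n^2 + \<open>form p p\<close>.\<close>

definition "grad_sq p x = 1 + ((form (nor x) p)\<^sup>2 + form p p) / (form x p)\<^sup>2"

lemma grad_sq_frame:
  assumes "frame_function W \<sigma> e1 e2 N E1 E2 p" "u \<in> W" "N u = nor (\<sigma> u)"
  shows "frame_function.G \<sigma> e1 e2 p u = grad_sq p (\<sigma> u)"
proof -
  interpret F: frame_function W \<sigma> e1 e2 N E1 E2 p
    by (rule assms(1))
  have U: "form (\<sigma> u) p > 0"
    by (rule F.U_pos[OF assms(2)])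
  have "form p p = form p (e1 u) * form p (e1 u) + form p (e2 u) * form p (e2 u) - form p (\<sigma> u) * form p (\<sigma> u) - form p (N u) * form p (N u)"
    using orthoframe_form[OF F.frame[OF assms(2)]] .
  then have "form (e1 u) p * form (e1 u) p + form (e2 u) p * form (e2 u) p
      = (form (\<sigma> u) p)\<^sup>2 + ((form (nor (\<sigma> u)) p)\<^sup>2 + form p p)"
    using assms(3) by (simp add: power2_eq_square form_commute[of p "e1 u"] form_commute[of p "e2 u"]
        form_commute[of p "\<sigma> u"] form_commute[of p "nor (\<sigma> u)"])
  moreover have "F.G u = (form (e1 u) p * form (e1 u) p + form (e2 u) p * form (e2 u) p) / (form (\<sigma> u) p)\<^sup>2"
    by (simp add: F.G_def F.P1_def F.P2_def F.U_def power2_eq_square add_divide_distrib)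
  ultimately show ?thesis
    using U by (simp add: grad_sq_def add_divide_distrib)
qed

lemma grad_sq_nonneg:
  assumes "pos p" "x \<in> T"
  shows "grad_sq p x \<ge> 0"
proof -
  obtain W \<sigma> u e1 e2 N E1 E2 where c: "chart W \<sigma>" "u \<in> W" "\<sigma> u = x" "frame_function W \<sigma> e1 e2 N E1 E2 p"
    "\<And>u. u \<in> W \<Longrightarrow> N u = nor (\<sigma> u)"
    using ex_frame_function[OF assms] by metis
  interpret F: frame_function W \<sigma> e1 e2 N E1 E2 p
    by (rule c(4))
  have "F.G u \<ge> 0"
    by (simp add: F.G_def)
  then show ?thesis
    using grad_sq_frame[OF c(4,2) c(5)[OF c(2)]] c(3) by simp
qed

lemma continuous_on_grad_sq:
  assumes "pos p"
  shows "continuous_on T (grad_sq p)"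
  unfolding grad_sq_def[abs_def]
  by (intro continuous_intros continuous_on_nor) (use pos_T[OF assms] in fastforce)

text \<open>At a maximum of G - e ln u the Laplacian gives G^2/2 - 10 G + 4 - e (2 - G) \<le> 0,
  which fails for G > 20 when e \<le> 1. The point \<open>z\<close> with positive \<lambda> is what
  \<open>normal_dominated\<close> asks for.\<close>

lemma gradient_bound:
  assumes L: "L \<ge> 0" "\<And>x. x \<in> T \<Longrightarrow> lam x \<le> L" and p: "pos p" and z: "z \<in> T" "lam z > 0" and x0: "x0 \<in> T"
  shows "grad_sq p x0 \<le> 20"
proof -
  obtain C where C: "C \<ge> 0" "\<And>x. x \<in> T \<Longrightarrow> \<bar>form (nor x) p\<bar> \<le> C * form x p"
    using normal_dominated[OF L p z] by metis
  obtain c where c: "c > 0" "\<And>x. x \<in> T \<Longrightarrow> c \<le> form x p"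
    using ex_min[OF p] by metis
  have up: "form x p > 0" if "x \<in> T" for x
    using pos_T[OF p that] .
  \<comment> \<open>This a priori bound depends on \<open>p\<close>; it serves only for the
    existence of the maximum and does not enter the estimate there.\<close>
  define B where "B = 1 + (C\<^sup>2 + \<bar>form p p\<bar> / c\<^sup>2)"
  have B: "grad_sq p x \<le> B" if x: "x \<in> T" for x
  proof -
    have "(form (nor x) p)\<^sup>2 \<le> (C * form x p)\<^sup>2"
      using C(1) C(2)[OF x] up[OF x] by (metis abs_ge_zero power2_abs power_mono)
    then have "(form (nor x) p)\<^sup>2 / (form x p)\<^sup>2 \<le> C\<^sup>2"
      using up[OF x] by (simp add: pos_divide_le_eq power_mult_distrib)
    moreover have "form p p / (form x p)\<^sup>2 \<le> \<bar>form p p\<bar> / c\<^sup>2"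
      using c(1) c(2)[OF x] up[OF x] by (intro frac_le power_mono) auto
    ultimately show ?thesis
      by (simp add: grad_sq_def B_def add_divide_distrib)
  qed
  show ?thesis
  proof (rule le_if_le_add_small)
    fix e :: real assume e: "0 < e" "e \<le> 1"
    obtain x where x: "x \<in> T" "\<And>y. y \<in> T \<Longrightarrow> exp (grad_sq p y) * exp (- e * ln (form y p)) \<le> exp (grad_sq p x) * exp (- e * ln (form x p))"
    proof (rule max_attained[OF p, of "\<lambda>x. exp (grad_sq p x)" "exp B" x0 e])
      show "continuous_on T (\<lambda>x. exp (grad_sq p x))"
        by (intro continuous_intros continuous_on_grad_sq[OF p])
    qed (use B x0 e in auto)
    have mx: "grad_sq p y - e * ln (form y p) \<le> grad_sq p x - e * ln (form x p)" if "y \<in> T" for y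
      using x(2)[OF that] by (simp add: exp_add[symmetric])
    obtain W \<sigma> u e1 e2 N E1 E2 where ch: "chart W \<sigma>" "u \<in> W" "\<sigma> u = x" "frame_function W \<sigma> e1 e2 N E1 E2 p"
      "\<And>u. u \<in> W \<Longrightarrow> N u = nor (\<sigma> u)"
      using ex_frame_function[OF p x(1)] by metis
    interpret F: frame_function W \<sigma> e1 e2 N E1 E2 p
      by (rule ch(4))
    have Gu: "F.G y = grad_sq p (\<sigma> y)" if "y \<in> W" for y
      using grad_sq_frame[OF ch(4) that ch(5)[OF that]] .
    have smU: "smooth_on (\<lambda>x. ln (F.U x)) W"
      by (intro smooth_on_ln F.open_W F.smooth_functions) (use F.U_pos in \<open>simp add: F.U_def\<close>)
    have "F.lap (\<lambda>x. F.G x + (- e) * ln (F.U x)) u \<le> 0"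
    proof (rule F.lap_max[OF F.open_W order_refl ch(2)])
      show "smooth_on (\<lambda>x. F.G x + (- e) * ln (F.U x)) W"
        by (intro smooth_on_add smooth_on_mult smooth_on_const F.open_W F.smooth_functions smU)
      fix y assume y: "y \<in> W"
      then have "\<sigma> y \<in> T"
        using ch(1) unfolding chart_def by auto
      from mx[OF this] show "F.G y + (- e) * ln (F.U y) \<le> F.G u + (- e) * ln (F.U u)"
        using Gu[OF y] Gu[OF ch(2)] ch(3) by (simp add: F.U_def)
    qed
    then have "F.lap F.G u - e * (2 - F.G u) \<le> 0"
      using F.lap_add[OF F.open_W order_refl ch(2) F.smooth_functions(5) smU, of "- e"] F.lap_ln_U[OF ch(2)] by simp
    moreover have "F.lap F.G u \<ge> (((F.\<alpha> u)\<^sup>2 + (F.\<beta> u)\<^sup>2) * (F.m u)\<^sup>2 + (F.G u)\<^sup>2) / 2 - 10 * F.G u + 4"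
      using laplacian_lower_bound[where a = "F.\<alpha> u" and b = "F.\<beta> u" and p = "F.P1 u" and q = "F.P2 u" and m = "F.m u"]
      unfolding F.lap_G[OF ch(2)] F.G_def[symmetric] .
    moreover have "(F.G u)\<^sup>2 / 2 \<le> (((F.\<alpha> u)\<^sup>2 + (F.\<beta> u)\<^sup>2) * (F.m u)\<^sup>2 + (F.G u)\<^sup>2) / 2"
      by simp
    ultimately have ineq: "(F.G u)\<^sup>2 / 2 - 10 * F.G u + 4 - e * (2 - F.G u) \<le> 0"
      by linarith
    have G0: "F.G u \<ge> 0"
      by (simp add: F.G_def)
    have "F.G u \<le> 20"
    proof (rule ccontr)
      assume "\<not> F.G u \<le> 20"
      then have "F.G u * (F.G u - 20) > 0" "e * F.G u \<ge> 0"
        using e by auto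
      then show False
        using ineq e by (simp add: power2_eq_square algebra_simps)
    qed
    then have "grad_sq p x \<le> 20"
      using Gu[OF ch(2)] ch(3) by simp
    moreover have "e * ln c \<le> e * ln (form x p)"
      using e c(1) c(2)[OF x(1)] by (intro mult_left_mono) auto
    ultimately show "grad_sq p x0 \<le> 20 + e * (ln (form x0 p) - ln c)"
      using mx[OF x0] by (simp add: right_diff_distrib)
  qed
qed

text \<open>\<open>h\<close> is q exp G with q = \<lambda> |n| / u. If q > 11 at a maximum of ln h -
  e ln u, then q^2/2 > 60, the term \<lambda>^2 G / m^2 is absorbed by G, and G^2/2 - 10 G \<ge>
  -50, so the Laplacian would be positive. With G \<le> 20 this gives h \<le> 11 exp 20 at the
  maximum, and q \<le> h everywhere because G \<ge> 0.\<close>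

lemma curvature_bound:
  assumes L: "L \<ge> 0" "\<And>x. x \<in> T \<Longrightarrow> lam x \<le> L" "L \<le> 1" and p: "pos p" and x0: "x0 \<in> T"
  shows "lam x0 * \<bar>form (nor x0) p\<bar> \<le> 11 * exp 20 * form x0 p"
proof (cases "lam x0 * \<bar>form (nor x0) p\<bar> > 0")
  case False
  moreover have "form x0 p > 0"
    using pos_T[OF p x0] .
  ultimately show ?thesis
    by (simp add: not_less) (smt (verit) exp_gt_zero mult_pos_pos)
next
  case True
  then have lam0: "lam x0 > 0"
    using lam_nonneg[OF x0] by (auto simp: zero_less_mult_iff)
  obtain C where C: "C \<ge> 0" "\<And>x. x \<in> T \<Longrightarrow> \<bar>form (nor x) p\<bar> \<le> C * form x p"
    using normal_dominated[OF L(1,2) p x0 lam0] by metis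
  obtain c where c: "c > 0" "\<And>x. x \<in> T \<Longrightarrow> c \<le> form x p"
    using ex_min[OF p] by metis
  have up: "form x p > 0" if "x \<in> T" for x
    using pos_T[OF p that] .
  define q where "q x = lam x * \<bar>form (nor x) p\<bar> / form x p" for x
  define h where "h x = q x * exp (grad_sq p x)" for x
  have q0: "q x \<ge> 0" if "x \<in> T" for x
    unfolding q_def using lam_nonneg[OF that] up[OF that] by (intro divide_nonneg_pos mult_nonneg_nonneg) auto
  have qL: "q x \<le> L * C" if "x \<in> T" for x
  proof -
    have "lam x * \<bar>form (nor x) p\<bar> \<le> L * (C * form x p)"
      using L(1) L(2)[OF that] C(2)[OF that] lam_nonneg[OF that] by (intro mult_mono) auto
    then show ?thesis
      unfolding q_def using up[OF that] by (simp add: pos_divide_le_eq mult.assoc)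
  qed
  have gb: "grad_sq p x \<le> 20" if "x \<in> T" for x
    by (rule gradient_bound[OF L(1,2) p x0 lam0 that])
  have h0: "h x0 > 0"
    using True up[OF x0] by (simp add: h_def q_def)
  have "ln (h x0) \<le> ln (11 * exp 20)"
  proof (rule le_if_le_add_small)
    fix e :: real assume e: "0 < e" "e \<le> 1"
    obtain x where x: "x \<in> T" "h x > 0" "\<And>y. y \<in> T \<Longrightarrow> h y * exp (- e * ln (form y p)) \<le> h x * exp (- e * ln (form x p))"
    proof (rule max_attained[OF p, of h "L * C * exp 20" x0 e])
      show "continuous_on T h"
        unfolding h_def q_def using up
        by (intro continuous_intros continuous_on_grad_sq[OF p] continuous_on_lam continuous_on_nor) fastforce
      show "0 \<le> h x" if "x \<in> T" for x
        unfolding h_def using q0[OF that] by simp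
      show "h x \<le> L * C * exp 20" if "x \<in> T" for x
        unfolding h_def using q0[OF that] qL[OF that] gb[OF that] by (intro mult_mono) auto
    qed (use x0 h0 e in auto)
    have mx: "ln (h y) - e * ln (form y p) \<le> ln (h x) - e * ln (form x p)" if "y \<in> T" "h y > 0" for y
    proof -
      have "ln (h y * exp (- e * ln (form y p))) \<le> ln (h x * exp (- e * ln (form x p)))"
        using x(3)[OF that(1)] that(2) x(2) by (subst ln_le_cancel_iff) auto
      then show ?thesis
        using that(2) x(2) by (simp add: ln_mult)
    qed
    obtain W \<sigma> u e1 e2 N E1 E2 where ch: "chart W \<sigma>" "u \<in> W" "\<sigma> u = x" "frame_function W \<sigma> e1 e2 N E1 E2 p"
      "\<And>u. u \<in> W \<Longrightarrow> N u = nor (\<sigma> u)"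
      "\<And>u. u \<in> W \<Longrightarrow> (lam (\<sigma> u))\<^sup>2 = (moving_frame.\<alpha> e1 N E1 u)\<^sup>2 + (moving_frame.\<beta> e2 N E1 u)\<^sup>2"
      using ex_frame_function[OF p x(1)] by metis
    interpret F: frame_function W \<sigma> e1 e2 N E1 E2 p
      by (rule ch(4))
    have Gu: "F.G y = grad_sq p (\<sigma> y)" if "y \<in> W" for y
      using grad_sq_frame[OF ch(4) that ch(5)[OF that]] .
    have inT: "\<sigma> y \<in> T" if "y \<in> W" for y
      using ch(1) that unfolding chart_def by auto
    define l where "l y = F.\<alpha> y * F.\<alpha> y + F.\<beta> y * F.\<beta> y" for y
    have l: "l y = (lam (\<sigma> y))\<^sup>2" if "y \<in> W" for y
      using ch(6)[OF that] by (simp add: l_def power2_eq_square)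
    have qy: "q (\<sigma> y) = lam (\<sigma> y) * \<bar>F.m y\<bar>" if "y \<in> W" for y
      using ch(5)[OF that] up[OF inT[OF that]] by (simp add: q_def F.m_def F.U_def)
    \<comment> \<open>The logarithms exist only where \<lambda> and \<open>m\<close> are nonzero, an
      open set that contains the maximum because \<open>h x > 0\<close>.\<close>
    define V where "V = {y \<in> W. l y * (F.m y * F.m y) > 0}"
    have "continuous_on W (\<lambda>y. l y * (F.m y * F.m y))"
      unfolding l_def by (intro continuous_intros smooth_on_continuous F.smooth_coeffs F.smooth_functions)
    then have V: "open V" "V \<subseteq> W"
      using continuous_open_preimage[OF _ F.open_W, of "\<lambda>y. l y * (F.m y * F.m y)" "{0<..}"]
      by (auto simp: V_def vimage_def Int_def)
    have qsq: "l y * (F.m y * F.m y) = (q (\<sigma> y))\<^sup>2" if "y \<in> W" for y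
      using qy[OF that] l[OF that] by (simp add: power_mult_distrib) (simp add: power2_eq_square)
    have "q x > 0"
      using x(2) by (simp add: h_def zero_less_mult_iff)
    then have uV: "u \<in> V"
      using ch(2,3) qsq[OF ch(2)] by (simp add: V_def)
    have l0: "l y \<ge> 0" for y
      by (simp add: l_def)
    have lp: "l y > 0" and m0: "F.m y \<noteq> 0" if "y \<in> V" for y
      using that l0[of y] by (auto simp: V_def zero_less_mult_iff)
    have lm: "ln (h (\<sigma> y)) = ln (l y) / 2 + ln (F.m y * F.m y) / 2 + F.G y \<and> h (\<sigma> y) > 0" if y: "y \<in> V" for y
    proof -
      have yW: "y \<in> W"
        using y V by auto
      have pos2: "l y > 0" "F.m y * F.m y > 0"
        using lp[OF y] m0[OF y] by (auto simp: zero_less_mult_iff)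
      have qp: "q (\<sigma> y) > 0"
        using qsq[OF yW] q0[OF inT[OF yW]] mult_pos_pos[OF pos2] by (auto simp: less_le)
      have "ln ((q (\<sigma> y))\<^sup>2) = 2 * ln (q (\<sigma> y))"
        using qp by (simp add: ln_realpow)
      then have "2 * ln (q (\<sigma> y)) = ln (l y) + ln (F.m y * F.m y)"
        unfolding qsq[OF yW, symmetric] using ln_mult_pos[OF pos2] by linarith
      moreover have "ln (h (\<sigma> y)) = ln (q (\<sigma> y)) + F.G y"
        unfolding h_def using qp by (simp add: ln_mult Gu[OF yW])
      ultimately show ?thesis
        using qp by (simp add: h_def)
    qed
    have sub: "smooth_on f V" if "smooth_on f W" for f :: "real ^ 2 \<Rightarrow> real"
      using smooth_on_subset[OF that V(2)] .
    have smU: "smooth_on (\<lambda>x. ln (F.U x)) V"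
      by (rule sub, intro smooth_on_ln F.open_W F.smooth_functions) (use F.U_pos in \<open>simp add: F.U_def\<close>)
    have sml: "smooth_on (\<lambda>y. ln (l y) / 2) V"
    proof -
      have "smooth_on l V"
        unfolding l_def[abs_def] by (intro smooth_on_add smooth_on_mult V(1) F.smooth_coeffs[THEN sub])
      from smooth_on_mult[OF V(1) smooth_on_ln[OF V(1) this lp] smooth_on_const[of "1/2"]] show ?thesis
        by simp
    qed
    have smm: "smooth_on (\<lambda>y. ln (F.m y * F.m y) / 2) V"
    proof -
      have "F.m y * F.m y > 0" if "y \<in> V" for y
        using m0[OF that] by (auto simp: zero_less_mult_iff)
      from smooth_on_mult[OF V(1) smooth_on_ln[OF V(1) smooth_on_mult[OF V(1) F.smooth_functions(4,4)[THEN sub]] this] smooth_on_const[of "1/2"]]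
      show ?thesis
        by simp
    qed
    have smG: "smooth_on F.G V"
      by (rule sub[OF F.smooth_functions(5)])
    have sm1: "smooth_on (\<lambda>y. ln (l y) / 2 + 1 * (ln (F.m y * F.m y) / 2)) V"
      by (intro smooth_on_add smooth_on_mult smooth_on_const V(1) sml smm)
    have sm2: "smooth_on (\<lambda>y. ln (l y) / 2 + 1 * (ln (F.m y * F.m y) / 2) + 1 * F.G y) V"
      by (intro smooth_on_add[OF _ sm1] smooth_on_mult smooth_on_const V(1) smG)
    have "F.lap (\<lambda>y. ln (l y) / 2 + 1 * (ln (F.m y * F.m y) / 2) + 1 * F.G y + (- e) * ln (F.U y)) u \<le> 0"
    proof (rule F.lap_max[OF V uV])
      show "smooth_on (\<lambda>y. ln (l y) / 2 + 1 * (ln (F.m y * F.m y) / 2) + 1 * F.G y + (- e) * ln (F.U y)) V"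
        by (intro smooth_on_add[OF _ sm2] smooth_on_mult smooth_on_const V(1) smU)
      fix y assume y: "y \<in> V"
      then have yW: "y \<in> W"
        using V by auto
      show "ln (l y) / 2 + 1 * (ln (F.m y * F.m y) / 2) + 1 * F.G y + (- e) * ln (F.U y)
          \<le> ln (l u) / 2 + 1 * (ln (F.m u * F.m u) / 2) + 1 * F.G u + (- e) * ln (F.U u)"
        using mx[OF inT[OF yW]] lm[OF y] lm[OF uV] ch(3) by (simp add: F.U_def)
    qed
    then have "F.lap (\<lambda>y. ln (l y) / 2) u + F.lap (\<lambda>y. ln (F.m y * F.m y) / 2) u + F.lap F.G u - e * F.lap (\<lambda>y. ln (F.U y)) u \<le> 0"
      unfolding F.lap_add[OF V uV sm2 smU] F.lap_add[OF V uV sm1 smG] F.lap_add[OF V uV sml smm] by simp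
    moreover have "F.lap (\<lambda>y. ln (l y) / 2) u = 2 * l u - 2"
      using F.lap_ln_lambda[OF V uV] lp unfolding l_def by (simp add: power2_eq_square)
    moreover have "F.lap (\<lambda>y. ln (F.m y * F.m y) / 2) u = 2 * l u - l u * F.G u / (F.m u)\<^sup>2 - (2 - F.G u)"
      using F.lap_ln_m[OF V uV m0] unfolding l_def by (simp add: power2_eq_square)
    moreover have "F.lap (\<lambda>y. ln (F.U y)) u = 2 - F.G u"
      by (rule F.lap_ln_U[OF ch(2)])
    moreover have "F.lap F.G u \<ge> (l u * (F.m u)\<^sup>2 + (F.G u)\<^sup>2) / 2 - 10 * F.G u + 4"
      using laplacian_lower_bound[where a = "F.\<alpha> u" and b = "F.\<beta> u" and p = "F.P1 u" and q = "F.P2 u" and m = "F.m u"]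
      unfolding F.lap_G[OF ch(2)] F.G_def[symmetric] l_def power2_eq_square .
    moreover have lm2: "l u * (F.m u)\<^sup>2 = (q x)\<^sup>2"
      using qsq[OF ch(2)] ch(3) by (simp add: power2_eq_square)
    ultimately have ineq: "4 * l u - 4 + F.G u - l u * F.G u / (F.m u)\<^sup>2 + ((q x)\<^sup>2 + (F.G u)\<^sup>2) / 2 - 10 * F.G u + 4 - e * (2 - F.G u) \<le> 0"
      by simp
    have G0: "F.G u \<ge> 0"
      by (simp add: F.G_def)
    have "q x \<le> 11"
    proof (rule ccontr)
      assume "\<not> q x \<le> 11"
      then have "q x * q x > 11 * 11"
        by (intro mult_strict_mono) auto
      then have q2: "(q x)\<^sup>2 > 121"
        by (simp add: power2_eq_square)
      have "lam x \<le> 1"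
        using L(2)[OF x(1)] L(3) by simp
      then have l1: "l u \<le> 1"
        using l[OF ch(2)] ch(3) lam_nonneg[OF x(1)] by (simp add: power_le_one)
      have mp: "(F.m u)\<^sup>2 > 0"
        using m0[OF uV] by simp
      \<comment> \<open>Here \<lambda> \<le> 1 enters: from l m^2 = q^2 > 121 and l \<le> 1 it
        follows that m^2 \<ge> l, so the negative term l G / m^2 is at most G.\<close>
      have "l u * (F.m u)\<^sup>2 \<le> 1 * (F.m u)\<^sup>2"
        using l1 by (intro mult_right_mono) auto
      then have "l u \<le> (F.m u)\<^sup>2"
        using lm2 q2 l1 by linarith
      then have "l u * F.G u / (F.m u)\<^sup>2 \<le> F.G u"
        using mult_right_mono[OF _ G0] mp by (simp add: pos_divide_le_eq mult.commute[of "F.G u"])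
      moreover have "(F.G u)\<^sup>2 / 2 - 10 * F.G u \<ge> - 50"
        using zero_le_power2[of "F.G u - 10"] by (simp add: power2_diff)
      moreover have "e * F.G u \<ge> 0"
        using e G0 by simp
      moreover have "e * (2 - F.G u) = 2 * e - e * F.G u"
        by (simp add: algebra_simps)
      ultimately show False
        using ineq[unfolded add_divide_distrib] q2 e l0[of u] by linarith
    qed
    then have "h x \<le> 11 * exp 20"
      unfolding h_def using q0[OF x(1)] gb[OF x(1)] by (intro mult_mono) auto
    then have "ln (h x) \<le> ln (11 * exp 20)"
      using x(2) by (subst ln_le_cancel_iff) auto
    moreover have "e * ln c \<le> e * ln (form x p)"
      using e c(1) c(2)[OF x(1)] by (intro mult_left_mono) auto
    ultimately show "ln (h x0) \<le> ln (11 * exp 20) + e * (ln (form x0 p) - ln c)"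
      using mx[OF x0 h0] by (simp add: right_diff_distrib)
  qed
  then have "h x0 \<le> 11 * exp 20"
    using h0 by (subst (asm) ln_le_cancel_iff) auto
  moreover have "q x0 * 1 \<le> h x0"
    unfolding h_def using q0[OF x0] grad_sq_nonneg[OF p x0] by (intro mult_left_mono) auto
  ultimately have "q x0 \<le> 11 * exp 20"
    by simp
  then show ?thesis
    unfolding q_def using up[OF x0] by (simp add: pos_divide_le_eq)
qed

lemma lam_le_tan_width:
  assumes L: "L \<ge> 0" "\<And>x. x \<in> T \<Longrightarrow> lam x \<le> L" "L < 1" and x: "x \<in> T"
  shows "lam x \<le> 11 * exp 20 * tan (width (convex_hull_AdS (proj ` \<Gamma>)))"
proof (cases "lam x > 0")
  case True
  define t where "t = lam x / (11 * exp 20)"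
  have t: "t > 0"
    using True by (simp add: t_def)
  have "\<bar>t * form (nor x) p\<bar> \<le> form x p" if "pos p" for p
  proof -
    have "\<bar>t * form (nor x) p\<bar> = lam x * \<bar>form (nor x) p\<bar> / (11 * exp 20)"
      using True by (simp add: t_def abs_mult)
    also have "\<dots> \<le> form x p"
      using curvature_bound[OF L(1,2) less_imp_le[OF L(3)] that x] by (simp add: pos_divide_le_eq mult_ac)
    finally show ?thesis .
  qed
  then have le: "- (t * form (nor x) p) \<le> form x p" "t * form (nor x) p \<le> form x p" if "pos p" for p
    using that abs_le_D1 abs_le_D2 by blast+
  have "x + t *\<^sub>R nor x \<in> hull_cone" "x - t *\<^sub>R nor x \<in> hull_cone"
    unfolding hull_cone_def using le by (auto simp: form_simps) (smt (verit))
  from tan_width_lower[OF L x t this] show ?thesis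
    unfolding t_def by (simp add: pos_divide_le_eq mult_ac)
next
  case False
  have "tan (width (convex_hull_AdS (proj ` \<Gamma>))) \<ge> 0"
    using width_bound(1,3)[OF L] by (cases "width (convex_hull_AdS (proj ` \<Gamma>)) = 0") (auto intro!: less_imp_le tan_gt_zero)
  then have "11 * exp 20 * tan (width (convex_hull_AdS (proj ` \<Gamma>))) \<ge> 0"
    by simp
  then show ?thesis
    using False by linarith
qed

end

subsection \<open>The graph of a circle homeomorphism\<close>

lemma segre_nth:
  "segre u v $ 1 = (u $ 1 * v $ 1 - u $ 2 * v $ 2) / 2"
  "segre u v $ 2 = (u $ 1 * v $ 2 + u $ 2 * v $ 1) / 2"
  "segre u v $ 3 = (u $ 1 * v $ 1 + u $ 2 * v $ 2) / 2"
  "segre u v $ 4 = (u $ 1 * v $ 2 - u $ 2 * v $ 1) / 2"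
  unfolding segre_def vector_def by simp_all

text \<open>Polarisation of the determinant: on matrices of rank one it splits into the determinants
  of the two pairs of vectors.\<close>

lemma form_segre:
  "form (segre u v) (segre u' v') =
     - ((u $ 1 * u' $ 2 - u $ 2 * u' $ 1) * (v $ 1 * v' $ 2 - v $ 2 * v' $ 1)) / 2"
  unfolding form_def segre_nth by (simp add: field_simps)

lemma segre_scaleR: "segre (a *\<^sub>R u) (b *\<^sub>R v) = (a * b) *\<^sub>R segre u v"
  by (simp add: vec_eq_iff forall_4 segre_nth field_simps)

lemma segre_minor:
  "u $ 1 * v $ 1 = segre u v $ 3 + segre u v $ 1" "u $ 1 * v $ 2 = segre u v $ 2 + segre u v $ 4"
  "u $ 2 * v $ 1 = segre u v $ 2 - segre u v $ 4" "u $ 2 * v $ 2 = segre u v $ 3 - segre u v $ 1"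
  by (simp_all add: segre_nth field_simps)

lemma segre_entry:
  assumes "segre u' v' = k *\<^sub>R segre u v"
  shows "u' $ i * v' $ j = k * (u $ i * v $ j)"
  using exhaust_2[of i] exhaust_2[of j] assms
  by (elim disjE) (simp_all only: segre_minor vector_scaleR_component real_scaleR_def distrib_left right_diff_distrib)

lemma vec2_nonzero: "(u :: real ^ 2) \<noteq> 0 \<Longrightarrow> \<exists>i. u $ i \<noteq> 0"
  by (simp add: vec_eq_iff)

lemma segre_nonzero:
  assumes "u \<noteq> 0" "v \<noteq> 0"
  shows "segre u v \<noteq> 0"
proof
  assume "segre u v = 0"
  then have "u $ i * v $ j = 0" for i j
    using segre_entry[of u v 0 u v i j] by simp
  then show False
    using vec2_nonzero[OF assms(1)] vec2_nonzero[OF assms(2)] by auto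
qed

lemma segre_parallel:
  assumes "u \<noteq> 0" "v \<noteq> 0" "k \<noteq> 0" "segre u' v' = k *\<^sub>R segre u v"
  shows "\<exists>a. a \<noteq> 0 \<and> u' = a *\<^sub>R u" "\<exists>b. b \<noteq> 0 \<and> v' = b *\<^sub>R v"
proof -
  obtain i j where ij: "u $ i \<noteq> 0" "v $ j \<noteq> 0"
    using vec2_nonzero assms(1,2) by meson
  note e = segre_entry[OF assms(4)]
  have nz: "u' $ i \<noteq> 0" "v' $ j \<noteq> 0"
    using e[of i j] ij assms(3) by auto
  have "u' = (k * v $ j / v' $ j) *\<^sub>R u"
    using e[of _ j] nz by (simp add: vec_eq_iff field_simps)
  then show "\<exists>a. a \<noteq> 0 \<and> u' = a *\<^sub>R u"
    using nz ij assms(3) by (intro exI[of _ "k * v $ j / v' $ j"]) simp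
  have "v' = (k * u $ i / u' $ i) *\<^sub>R v"
    using e[of i] nz by (simp add: vec_eq_iff field_simps)
  then show "\<exists>b. b \<noteq> 0 \<and> v' = b *\<^sub>R v"
    using nz ij assms(3) by (intro exI[of _ "k * u $ i / u' $ i"]) simp
qed

lemma proj_segre_eq_iff:
  assumes "u \<noteq> 0" "v \<noteq> 0" "u' \<noteq> 0" "v' \<noteq> 0"
  shows "proj (segre u v) = proj (segre u' v') \<longleftrightarrow> proj u = proj u' \<and> proj v = proj v'"
proof
  assume "proj (segre u v) = proj (segre u' v')"
  then obtain k where "k \<noteq> 0" "segre u' v' = k *\<^sub>R segre u v"
    using proj_eq_iff[of "segre u v" "segre u' v'"] segre_nonzero[OF assms(1,2)] segre_nonzero[OF assms(3,4)] by auto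
  then show "proj u = proj u' \<and> proj v = proj v'"
    using segre_parallel[of u v k u' v'] proj_eq_iff[of u u'] proj_eq_iff[of v v'] assms by simp
next
  assume "proj u = proj u' \<and> proj v = proj v'"
  then obtain a b where ab: "a \<noteq> 0" "u' = a *\<^sub>R u" "b \<noteq> 0" "v' = b *\<^sub>R v"
    using proj_eq_iff[of u u'] proj_eq_iff[of v v'] assms by auto
  show "proj (segre u v) = proj (segre u' v')"
    unfolding ab(2,4) segre_scaleR
    using proj_scaleR[of "a * b" "segre u v"] ab(1,3) segre_nonzero[OF assms(1,2)] by simp
qed

text \<open>A nonzero singular 2 by 2 matrix has rank one; the factors are read off from its first
  row if that is nonzero, and otherwise from its second.\<close>

lemma null_segre:
  assumes "x \<noteq> 0" "form x x = 0"
  shows "\<exists>u v. u \<noteq> 0 \<and> v \<noteq> 0 \<and> x = segre u v"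
proof -
  have det: "(x $ 3 + x $ 1) * (x $ 3 - x $ 1) = (x $ 2 + x $ 4) * (x $ 2 - x $ 4)"
    using assms(2) by (simp add: form_def algebra_simps)
  have *: "?thesis" if "x = segre u v" for u v
  proof -
    have "u \<noteq> 0" "v \<noteq> 0"
      using that assms(1) by (auto simp: vec_eq_iff[of "segre _ _"] forall_4 segre_nth)
    then show ?thesis
      using that by blast
  qed
  consider "x $ 3 + x $ 1 \<noteq> 0" | "x $ 3 + x $ 1 = 0" "x $ 2 + x $ 4 \<noteq> 0"
    | "x $ 3 + x $ 1 = 0" "x $ 2 + x $ 4 = 0"
    by blast
  then show ?thesis
  proof cases
    case 1
    then have q: "(x $ 2 - x $ 4) / (x $ 3 + x $ 1) * (x $ 2 + x $ 4) = x $ 3 - x $ 1"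
      "(x $ 2 - x $ 4) / (x $ 3 + x $ 1) * (x $ 3 + x $ 1) = x $ 2 - x $ 4"
      using det by (simp_all add: divide_simps) (simp add: algebra_simps)
    show ?thesis
      by (rule *[of "vector [1, (x $ 2 - x $ 4) / (x $ 3 + x $ 1)]" "vector [x $ 3 + x $ 1, x $ 2 + x $ 4]"])
        (simp only: vec_eq_iff forall_4 segre_nth vector_2 q, simp)
  next
    case 2
    then have z: "x $ 2 - x $ 4 = 0"
      using det by simp
    have q: "(x $ 3 - x $ 1) / (x $ 2 + x $ 4) * (x $ 2 + x $ 4) = x $ 3 - x $ 1"
      using 2 by simp
    show ?thesis
      by (rule *[of "vector [1, (x $ 3 - x $ 1) / (x $ 2 + x $ 4)]" "vector [0, x $ 2 + x $ 4]"])
        (simp only: vec_eq_iff forall_4 segre_nth vector_2 q, use 2 z in simp)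
  next
    case 3
    show ?thesis
      by (rule *[of "vector [0, 1]" "vector [x $ 2 - x $ 4, x $ 3 - x $ 1]"])
        (simp only: vec_eq_iff forall_4 segre_nth vector_2, use 3 in simp)
  qed
qed

lemma conic_point_proj:
  assumes "u \<noteq> 0"
  shows "conic_point (proj u) = proj (segre u u)"
  unfolding conic_point_def
proof (rule the_equality)
  show "\<exists>ua. ua \<noteq> 0 \<and> proj ua = proj u \<and> proj (segre u u) = proj (segre ua ua)"
    using assms by blast
next
  fix \<xi> assume "\<exists>ua. ua \<noteq> 0 \<and> proj ua = proj u \<and> \<xi> = proj (segre ua ua)"
  then obtain w where w: "w \<noteq> 0" "proj w = proj u" "\<xi> = proj (segre w w)"
    by blast
  then show "\<xi> = proj (segre u u)"
    using proj_segre_eq_iff[of w w u u] assms by simp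
qed

text \<open>The fourth coordinate of \<open>segre u v\<close> is half the determinant of
  \<open>u\<close> and \<open>v\<close>, which vanishes iff they are parallel.\<close>

lemma segre_in_base_plane:
  assumes "u \<noteq> 0" "v \<noteq> 0"
  shows "proj (segre u v) \<in> bdry_plane base_point \<longleftrightarrow> proj u = proj v"
proof -
  have form4: "form x base_point = - x $ 4" for x
    by (simp add: form_def base_point_def axis_def)
  have "proj (segre u v) \<in> plane base_point \<longleftrightarrow> segre u v $ 4 = 0"
  proof
    assume "proj (segre u v) \<in> plane base_point"
    then obtain x where "proj (segre u v) = proj x" "x \<noteq> 0" "x $ 4 = 0"
      by (auto simp: plane_def form4)
    then show "segre u v $ 4 = 0"
      using proj_eq_iff[of "segre u v" x] segre_nonzero[OF assms] by auto
  next
    assume "segre u v $ 4 = 0"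
    then show "proj (segre u v) \<in> plane base_point"
      using segre_nonzero[OF assms] by (auto simp: plane_def form4)
  qed
  moreover have "proj (segre u v) \<in> bdry_AdS"
    using proj_in_bdry_iff[OF segre_nonzero[OF assms]] by (simp add: form_segre)
  moreover have "segre u v $ 4 = 0 \<longleftrightarrow> proj u = proj v"
  proof
    assume "segre u v $ 4 = 0"
    then have e: "u $ 1 * v $ 2 = u $ 2 * v $ 1"
      by (simp add: segre_nth)
    have "\<exists>c. v = c *\<^sub>R u"
    proof (cases "u $ 1 = 0")
      case True
      then have "u $ 2 \<noteq> 0"
        using assms(1) by (auto simp: vec_eq_iff forall_2)
      then show ?thesis
        using e True by (intro exI[of _ "v $ 2 / u $ 2"]) (auto simp: vec_eq_iff forall_2)
    next
      case False
      then show ?thesis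
        using e by (intro exI[of _ "v $ 1 / u $ 1"]) (auto simp: vec_eq_iff forall_2 field_simps)
    qed
    then show "proj u = proj v"
      using proj_eq_iff[OF assms] assms(2) by auto
  next
    assume "proj u = proj v"
    then obtain c where "v = c *\<^sub>R u"
      using proj_eq_iff[OF assms] by auto
    then show "segre u v $ 4 = 0"
      by (simp add: segre_nth)
  qed
  ultimately show ?thesis
    by (simp add: bdry_plane_def)
qed

lemma proj_left_segre:
  assumes "u \<noteq> 0" "v \<noteq> 0"
  shows "proj_left (proj (segre u v)) = proj (segre u u)"
  unfolding proj_left_def
proof (rule the_equality)
  have "{proj (segre u v) | v. v \<noteq> 0} \<in> left_ruling"
    using assms by (auto simp: left_ruling_def)
  then show "proj (segre u u) \<in> bdry_plane base_point \<and>
      (\<exists>l\<in>left_ruling. proj (segre u v) \<in> l \<and> proj (segre u u) \<in> l)"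
    using assms by (auto simp: segre_in_base_plane intro!: bexI[of _ "{proj (segre u v) | v. v \<noteq> 0}"])
next
  fix \<eta> assume *: "\<eta> \<in> bdry_plane base_point \<and> (\<exists>l\<in>left_ruling. proj (segre u v) \<in> l \<and> \<eta> \<in> l)"
  then obtain l where l: "l \<in> left_ruling" "proj (segre u v) \<in> l" "\<eta> \<in> l"
    by auto
  then obtain a where a: "a \<noteq> 0" "l = {proj (segre a v) | v. v \<noteq> 0}"
    by (auto simp: left_ruling_def)
  obtain b c where bc: "b \<noteq> 0" "proj (segre u v) = proj (segre a b)" "c \<noteq> 0" "\<eta> = proj (segre a c)"
    using l a(2) by auto
  have "proj u = proj a"
    using proj_segre_eq_iff[of u v a b] bc a assms by simp
  moreover have "proj a = proj c"
    using segre_in_base_plane[of a c] * bc a by simp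
  ultimately show "\<eta> = proj (segre u u)"
    using proj_segre_eq_iff[of u u a c] bc a assms by simp
qed

lemma proj_right_segre:
  assumes "u \<noteq> 0" "v \<noteq> 0"
  shows "proj_right (proj (segre u v)) = proj (segre v v)"
  unfolding proj_right_def
proof (rule the_equality)
  have "{proj (segre u v) | u. u \<noteq> 0} \<in> right_ruling"
    using assms by (auto simp: right_ruling_def)
  then show "proj (segre v v) \<in> bdry_plane base_point \<and>
      (\<exists>l\<in>right_ruling. proj (segre u v) \<in> l \<and> proj (segre v v) \<in> l)"
    using assms by (auto simp: segre_in_base_plane intro!: bexI[of _ "{proj (segre u v) | u. u \<noteq> 0}"])
next
  fix \<eta> assume *: "\<eta> \<in> bdry_plane base_point \<and> (\<exists>l\<in>right_ruling. proj (segre u v) \<in> l \<and> \<eta> \<in> l)"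
  then obtain l where l: "l \<in> right_ruling" "proj (segre u v) \<in> l" "\<eta> \<in> l"
    by auto
  then obtain a where a: "a \<noteq> 0" "l = {proj (segre u a) | u. u \<noteq> 0}"
    by (auto simp: right_ruling_def)
  obtain b c where bc: "b \<noteq> 0" "proj (segre u v) = proj (segre b a)" "c \<noteq> 0" "\<eta> = proj (segre c a)"
    using l a(2) by auto
  have "proj v = proj a"
    using proj_segre_eq_iff[of u v b a] bc a assms by simp
  moreover have "proj c = proj a"
    using segre_in_base_plane[of c a] * bc a by simp
  ultimately show "\<eta> = proj (segre v v)"
    using proj_segre_eq_iff[of v v c a] bc a assms by simp
qed

lemma segre_in_gr_iff:
  assumes "u \<noteq> 0" "v \<noteq> 0"
  shows "proj (segre u v) \<in> gr \<phi> \<longleftrightarrow> \<phi> (proj u) = proj v"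
proof -
  have bd: "proj (segre u v) \<in> bdry_AdS"
    using proj_in_bdry_iff[OF segre_nonzero[OF assms]] by (simp add: form_segre)
  have conic: "conic_point a = proj (segre w w) \<longleftrightarrow> a = proj w" if "w \<noteq> 0" for a w
  proof -
    obtain z where "z \<noteq> 0" "a = proj z"
      using ex_proj[of a] by auto
    then show ?thesis
      using conic_point_proj[of z] proj_segre_eq_iff[of z z w w] that by simp
  qed
  show ?thesis
    using bd by (simp add: gr_def proj_left_segre[OF assms] proj_right_segre[OF assms]
        conic[OF assms(1)] conic[OF assms(2)])
qed

section \<open>The covering of the projective line and the lifted graph\<close>

definition circle_vec :: "real \<Rightarrow> real ^ 2" where
  "circle_vec t = vector [cos t, sin t]"

lemma circle_vec_nth [simp]: "circle_vec t $ 1 = cos t" "circle_vec t $ 2 = sin t"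
  by (simp_all add: circle_vec_def)

lemma circle_vec_nonzero [simp]: "circle_vec t \<noteq> 0"
proof
  assume "circle_vec t = 0"
  then have "cos t = 0" "sin t = 0"
    by (simp_all add: vec_eq_iff forall_2)
  then show False
    using sin_cos_squared_add[of t] by simp
qed

lemma circle_cover_eq: "circle_cover t = proj (circle_vec t)"
  by (simp add: circle_cover_def circle_vec_def)

lemma circle_cover_eq_iff: "circle_cover a = circle_cover b \<longleftrightarrow> sin (a - b) = 0"
proof
  assume "circle_cover a = circle_cover b"
  then obtain c where "circle_vec b = c *\<^sub>R circle_vec a"
    using proj_eq_iff[of "circle_vec a" "circle_vec b"] by (auto simp: circle_cover_eq)
  then have "cos b = c * cos a" "sin b = c * sin a"
    by (simp_all add: vec_eq_iff forall_2)
  then show "sin (a - b) = 0"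
    by (simp add: sin_diff)
next
  assume s: "sin (a - b) = 0"
  have "cos b = cos (a - (a - b))" "sin b = sin (a - (a - b))"
    by simp_all
  then have "cos b = cos (a - b) * cos a" "sin b = cos (a - b) * sin a"
    using s by (simp_all only: cos_diff[of a "a - b"] sin_diff[of a "a - b"] mult_zero_right add_0_right diff_0_right mult.commute)
  then have "circle_vec b = cos (a - b) *\<^sub>R circle_vec a"
    by (simp add: vec_eq_iff forall_2)
  moreover have "cos (a - b) \<noteq> 0"
    using s sin_cos_squared_add[of "a - b"] by auto
  ultimately show "circle_cover a = circle_cover b"
    using proj_scaleR[of "cos (a - b)" "circle_vec a"] by (simp add: circle_cover_eq)
qed

text \<open>The covering has period \<open>pi\<close>, so the upper half circle suffices.\<close>

lemma circle_cover_surj: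
  assumes "u \<noteq> 0"
  shows "\<exists>t\<in>{0..pi}. proj u = circle_cover t"
proof -
  define w where "w = (if u $ 2 \<ge> 0 then 1 else -1) *\<^sub>R (u /\<^sub>R norm u)"
  have "proj w = proj u"
    unfolding w_def using assms proj_scaleR[of "inverse (norm u)" u] proj_minus[of "u /\<^sub>R norm u"] by auto
  moreover have "w $ 2 \<ge> 0"
    by (auto simp: w_def zero_le_divide_iff divide_inverse mult_nonneg_nonneg mult_nonneg_nonpos)
  moreover have "(w $ 1)\<^sup>2 + (w $ 2)\<^sup>2 = 1"
  proof -
    have "norm w = 1"
      using assms by (simp add: w_def)
    then show ?thesis
      by (simp add: norm_vec_def L2_set_def sum_2)
  qed
  ultimately obtain t where "0 \<le> t" "t \<le> pi" "w $ 1 = cos t" "w $ 2 = sin t"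
    using sincos_total_pi[of "w $ 2" "w $ 1"] by auto
  then have "w = circle_vec t"
    by (simp add: vec_eq_iff forall_2)
  then show ?thesis
    using \<open>proj w = proj u\<close> \<open>0 \<le> t\<close> \<open>t \<le> pi\<close> by (intro bexI[of _ t]) (simp_all add: circle_cover_eq)
qed

text \<open>The lift is \<open>segre\<close> of the covering vectors at \<open>t\<close> and
  \<open>F t\<close>. The product of two of its points is -sin(s - t) sin(F s - F t) / 2, and for 0
  < s - t < pi both sines are positive since F increases by less than \<open>pi\<close>. Here
  orientation matters: a decreasing lift would give the opposite sign.\<close>

lemma graph_lift:
  assumes \<phi>: "orientation_preserving_homeo \<phi>"
  shows "\<exists>\<Gamma>. compact \<Gamma> \<and> connected \<Gamma> \<and> (\<forall>\<xi>\<in>\<Gamma>. form \<xi> \<xi> = 0 \<and> \<xi> \<noteq> 0) \<and>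
    (\<forall>\<xi>\<in>\<Gamma>. \<forall>\<eta>\<in>\<Gamma>. \<xi> \<noteq> \<eta> \<longrightarrow> form \<xi> \<eta> < 0) \<and> (\<exists>\<xi>\<in>\<Gamma>. \<exists>\<eta>\<in>\<Gamma>. \<xi> \<noteq> \<eta>) \<and> proj ` \<Gamma> = gr \<phi>"
proof -
  obtain \<psi> where \<psi>: "homeomorphism UNIV UNIV \<phi> \<psi>"
    using \<phi> by (auto simp: orientation_preserving_homeo_def)
  obtain F :: "real \<Rightarrow> real" where F: "continuous_on UNIV F" "strict_mono F"
    "\<And>t. \<phi> (circle_cover t) = circle_cover (F t)"
    using \<phi> by (auto simp: orientation_preserving_homeo_def)
  have inj: "\<phi> a = \<phi> b \<Longrightarrow> a = b" for a b
    using \<psi> by (metis UNIV_I homeomorphism_apply1)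
  have Fcov: "sin (F s - F t) = 0 \<Longrightarrow> sin (s - t) = 0" for s t
    using inj[of "circle_cover s" "circle_cover t"] F(3) by (simp add: circle_cover_eq_iff)
  have Fcov': "sin (s - t) = 0 \<Longrightarrow> sin (F s - F t) = 0" for s t
    using F(3)[of s] F(3)[of t] circle_cover_eq_iff[of s t] circle_cover_eq_iff[of "F s" "F t"] by simp
  have no_pi: "F r \<noteq> F t + pi" if "t < r" "r < t + pi" for r t
  proof
    assume "F r = F t + pi"
    then have "sin (r - t) = 0"
      using Fcov[of r t] by simp
    moreover have "sin (r - t) > 0"
      using that by (intro sin_gt_zero) auto
    ultimately show False
      by simp
  qed
  \<comment> \<open>Otherwise the intermediate value theorem yields \<open>r\<close> strictly in
    between with \<open>F r = F t + pi\<close>, and two different points of the projective line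
    would have the same image.\<close>
  have le: "F s \<le> F t + pi" if st: "t < s" "s \<le> t + pi" for s t
  proof (rule ccontr)
    assume "\<not> F s \<le> F t + pi"
    then obtain r where r: "t \<le> r" "r \<le> s" "F r = F t + pi"
      using IVT'[of F t "F t + pi" s] st continuous_on_subset[OF F(1), of "{t..s}"] by auto
    moreover have "r \<noteq> t" "r \<noteq> s"
      using r(3) \<open>\<not> F s \<le> F t + pi\<close> pi_gt_zero by auto
    ultimately show False
      using no_pi[of t r] st by auto
  qed
  have less: "sin (F s - F t) > 0" if "t < s" "s < t + pi" for s t
    using le[of t s] no_pi[of t s] that strict_monoD[OF F(2), of t s] by (intro sin_gt_zero) auto
  have period: "F pi = F 0 + pi"
  proof (rule ccontr)
    assume "F pi \<noteq> F 0 + pi"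
    then have "sin (F pi - F 0) > 0"
      using le[of 0 pi] strict_monoD[OF F(2), of 0 pi] by (intro sin_gt_zero) auto
    then show False
      using Fcov'[of pi 0] by simp
  qed
  define G where "G t = segre (circle_vec t) (circle_vec (F t))" for t
  have form_G: "form (G s) (G t) = - (sin (s - t) * sin (F s - F t)) / 2" for s t
    unfolding G_def form_segre by (simp add: sin_diff algebra_simps)
  \<comment> \<open>Both covering vectors change sign over a period, so their product returns to the
    same vector and the lift closes up.\<close>
  have G_pi: "G pi = G 0"
    by (simp add: G_def vec_eq_iff forall_4 segre_nth period)
  have neg: "form (G s) (G t) < 0" if "0 \<le> t" "t < s" "s \<le> pi" "G s \<noteq> G t" for s t
  proof -
    have "s < t + pi"
      using that G_pi by (cases "t = 0 \<and> s = pi") auto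
    then show ?thesis
      using less[of t s] that sin_gt_zero[of "s - t"] by (simp add: form_G)
  qed
  have cont: "continuous_on {0..pi} G"
  proof -
    have "G = (\<lambda>t. ((cos t * cos (F t) - sin t * sin (F t)) / 2) *\<^sub>R axis 1 1
        + ((cos t * sin (F t) + sin t * cos (F t)) / 2) *\<^sub>R axis 2 1
        + ((cos t * cos (F t) + sin t * sin (F t)) / 2) *\<^sub>R axis 3 1
        + ((cos t * sin (F t) - sin t * cos (F t)) / 2) *\<^sub>R axis 4 1)"
      by (simp add: fun_eq_iff G_def vec_eq_iff forall_4 segre_nth axis_def)
    moreover have "continuous_on {0..pi} F"
      using F(1) by (rule continuous_on_subset) simp
    ultimately show ?thesis
      by (simp only:) (intro continuous_intros; simp)
  qed
  have "compact (G ` {0..pi})"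
    using cont by (intro compact_continuous_image) auto
  moreover have "connected (G ` {0..pi})"
    using cont by (intro connected_continuous_image) auto
  moreover have "\<forall>\<xi>\<in>G ` {0..pi}. form \<xi> \<xi> = 0 \<and> \<xi> \<noteq> 0"
    by (auto simp: form_G) (auto simp: G_def segre_nonzero)
  moreover have "\<forall>\<xi>\<in>G ` {0..pi}. \<forall>\<eta>\<in>G ` {0..pi}. \<xi> \<noteq> \<eta> \<longrightarrow> form \<xi> \<eta> < 0"
  proof (clarsimp)
    fix s t assume st: "0 \<le> s" "s \<le> pi" "0 \<le> t" "t \<le> pi" "G s \<noteq> G t"
    then have "s \<noteq> t"
      by auto
    then show "form (G s) (G t) < 0"
      using neg[of t s] neg[of s t] st form_commute[of "G s" "G t"] by (cases "s < t") auto
  qed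
  moreover have "\<exists>\<xi>\<in>G ` {0..pi}. \<exists>\<eta>\<in>G ` {0..pi}. \<xi> \<noteq> \<eta>"
  proof -
    have "form (G (pi / 2)) (G 0) \<noteq> form (G 0) (G 0)"
      using less[of 0 "pi / 2"] by (simp add: form_G)
    then have "G (pi / 2) \<noteq> G 0"
      by auto
    moreover have "G (pi / 2) \<in> G ` {0..pi}" "G 0 \<in> G ` {0..pi}"
      by auto
    ultimately show ?thesis
      by blast
  qed
  moreover have "proj ` G ` {0..pi} = gr \<phi>"
  proof (intro equalityI subsetI)
    fix \<xi> assume "\<xi> \<in> proj ` G ` {0..pi}"
    then obtain t where "\<xi> = proj (G t)"
      by auto
    then show "\<xi> \<in> gr \<phi>"
      using F(3)[of t] by (simp add: G_def segre_in_gr_iff circle_cover_eq)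
  next
    fix \<xi> assume \<xi>: "\<xi> \<in> gr \<phi>"
    then obtain x where "\<xi> = proj x" "x \<noteq> 0" "form x x = 0"
      by (auto simp: gr_def bdry_AdS_def)
    then obtain u v where uv: "u \<noteq> 0" "v \<noteq> 0" "\<xi> = proj (segre u v)"
      using null_segre[of x] by auto
    obtain t where t: "t \<in> {0..pi}" "proj u = circle_cover t"
      using circle_cover_surj[OF uv(1)] by auto
    have "proj v = circle_cover (F t)"
      using \<xi> uv segre_in_gr_iff[OF uv(1,2), of \<phi>] t(2) F(3)[of t] by simp
    then have "\<xi> = proj (G t)"
      using uv t by (simp add: G_def proj_segre_eq_iff circle_cover_eq)
    then show "\<xi> \<in> proj ` G ` {0..pi}"
      using t by auto
  qed
  ultimately show ?thesis
    by (intro exI[of _ "G ` {0..pi}"] conjI)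
qed

subsection \<open>Lifting the surface\<close>

lemma open_AdS: "open AdS"
proof -
  have "{x. x \<noteq> 0 \<and> proj x \<in> AdS} = {x. form x x < 0}"
    by (auto simp: proj_in_AdS_iff) (auto simp: AdS_def form.zero_left)
  moreover have "open {x. form x x < 0}"
    unfolding form_def by (intro open_Collect_less continuous_intros)
  ultimately show ?thesis
    unfolding open_projective_def by simp
qed

lemma continuous_on_projective:
  fixes h :: "real ^ 'n \<Rightarrow> 'b::topological_space"
  assumes U: "open U" and h: "continuous_on {x. x \<noteq> 0 \<and> proj x \<in> U} h"
    and Q: "\<And>x. x \<noteq> 0 \<Longrightarrow> proj x \<in> U \<Longrightarrow> Q (proj x) = h x"
  shows "continuous_on U Q"
proof -
  have "open (Q -` B \<inter> U)" if "open B" for B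
  proof -
    have "{x. x \<noteq> 0 \<and> proj x \<in> Q -` B \<inter> U} = h -` B \<inter> {x. x \<noteq> 0 \<and> proj x \<in> U}"
      using Q by auto
    moreover have "open {x. x \<noteq> 0 \<and> proj x \<in> U}"
      using U by (simp add: open_projective_def)
    ultimately show ?thesis
      unfolding open_projective_def using h that by (simp add: continuous_on_open_vimage)
  qed
  then show ?thesis
    using U by (simp add: continuous_on_open_vimage)
qed

text \<open>\<open>x $ i * x $ j / (- form x x)\<close> is homogeneous of degree 0, hence a function
  on \<open>AdS\<close>; on \<open>AdS_hat\<close> the denominator is 1.\<close>

lemma continuous_entries:
  "\<exists>Q. continuous_on AdS Q \<and> (\<forall>x\<in>AdS_hat. Q (proj x) = x $ i * x $ j)"
proof -
  define rep :: "4 projective \<Rightarrow> real ^ 4" where "rep p = (SOME x. x \<noteq> 0 \<and> p = proj x)" for p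
  have rep: "rep p \<noteq> 0 \<and> p = proj (rep p)" for p
    unfolding rep_def by (rule someI_ex) (rule ex_proj)
  define h where "h x = x $ i * x $ j / (- form x x)" for x
  have h_eq: "h (rep (proj x)) = h x" if x: "x \<noteq> 0" for x
  proof -
    obtain c where "c \<noteq> 0" "rep (proj x) = c *\<^sub>R x"
      using proj_eq_iff[of x "rep (proj x)"] rep[of "proj x"] x by auto
    then show ?thesis
      by (simp add: h_def form.scaleR_left form.scaleR_right)
  qed
  have "continuous_on AdS (\<lambda>p. h (rep p))"
  proof (rule continuous_on_projective[where h = h, OF open_AdS])
    show "continuous_on {x. x \<noteq> 0 \<and> proj x \<in> AdS} h"
      unfolding h_def
      by (intro continuous_intros form.continuous_on) (auto simp: proj_in_AdS_iff)
  qed (simp add: h_eq)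
  moreover have "h (rep (proj x)) = x $ i * x $ j" if "x \<in> AdS_hat" for x
    using h_eq[of x] AdS_hat_nonzero[OF that] that by (simp add: h_def AdS_hat_def)
  ultimately show ?thesis
    by (intro exI[of _ "\<lambda>p. h (rep p)"]) auto
qed

lemma AdS_ex_lift: "p \<in> AdS \<Longrightarrow> \<exists>x\<in>AdS_hat. proj x = p"
proof -
  assume "p \<in> AdS"
  then obtain x where x: "p = proj x" "form x x < 0"
    by (auto simp: AdS_def)
  define c where "c = inverse (sqrt (- form x x))"
  have "c \<noteq> 0" "c * c * form x x = -1"
    using x(2) by (auto simp: c_def field_simps)
  moreover have "x \<noteq> 0"
    using x(2) by (auto simp: form.zero_left)
  ultimately have "c *\<^sub>R x \<in> AdS_hat" "proj (c *\<^sub>R x) = p"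
    using x proj_scaleR[of c x] by (auto simp: AdS_hat_def form.scaleR_left form.scaleR_right)
  then show ?thesis
    by blast
qed

text \<open>The sign of the lift is a square root of \<open>(x\<^sub>3 + i x\<^sub>4)\<^sup>2\<close>, which is a nonzero function on \<open>AdS\<close>.\<close>

lemma lift_exists:
  fixes g :: "'a::real_normed_vector \<Rightarrow> 4 projective"
  assumes B: "contractible B" and g: "continuous_on B g" "g ` B \<subseteq> AdS"
  shows "\<exists>s. continuous_on B s \<and> (\<forall>b\<in>B. s b \<in> AdS_hat \<and> proj (s b) = g b)"
proof -
  obtain Q :: "4 \<Rightarrow> 4 \<Rightarrow> 4 projective \<Rightarrow> real" where
    Q: "\<And>i j. continuous_on AdS (Q i j)" "\<And>i j x. x \<in> AdS_hat \<Longrightarrow> Q i j (proj x) = x $ i * x $ j"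
    using continuous_entries by metis
  have Qg: "continuous_on B (\<lambda>b. Q i j (g b))" for i j
    using continuous_on_compose2[OF Q(1) g] by simp
  define h where "h b = Complex (Q 3 3 (g b) - Q 4 4 (g b)) (2 * Q 3 4 (g b))" for b
  have h: "h b = (Complex (x $ 3) (x $ 4))\<^sup>2" if "x \<in> AdS_hat" "proj x = g b" for b x
    using Q(2)[OF that(1)] by (simp add: h_def complex_eq_iff power2_eq_square flip: that(2))
  have nz: "Complex (x $ 3) (x $ 4) \<noteq> 0" if "x \<in> AdS_hat" for x
  proof
    assume "Complex (x $ 3) (x $ 4) = 0"
    then have "x $ 3 = 0" "x $ 4 = 0"
      by (simp_all add: complex_eq_iff)
    then have "(x $ 1)\<^sup>2 + (x $ 2)\<^sup>2 = -1"
      using that by (simp add: AdS_hat_def form_def power2_eq_square)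
    then show False
      using zero_le_power2[of "x $ 1"] zero_le_power2[of "x $ 2"] by linarith
  qed
  have lift: "\<exists>x\<in>AdS_hat. proj x = g b" if "b \<in> B" for b
    using AdS_ex_lift g(2) that by auto
  have "continuous_on B h"
    unfolding h_def by (intro continuous_intros Qg)
  moreover have "h b \<noteq> 0" if "b \<in> B" for b
    using lift[OF that] h nz by fastforce
  ultimately obtain w where w: "continuous_on B w" "\<And>b. b \<in> B \<Longrightarrow> h b = (w b)\<^sup>2"
    using continuous_sqrt_on_contractible[OF _ B, of h] by auto
  \<comment> \<open>For either lift \<open>x\<close> the numerator is \<open>x $ j\<close> times the
    complex number with parts \<open>x $ 3\<close> and \<open>x $ 4\<close>. As \<open>w\<close> is
    that number up to sign, the quotient is \<open>x $ j\<close> with a sign dictated by the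
    continuous function \<open>w\<close>.\<close>
  define s :: "'a \<Rightarrow> real ^ 4" where
    "s b = (\<chi> j. Re (Complex (Q 3 j (g b)) (Q 4 j (g b)) / w b))" for b
  have s: "s b = x \<or> s b = - x" if "b \<in> B" "x \<in> AdS_hat" "proj x = g b" for b x
  proof -
    let ?z = "Complex (x $ 3) (x $ 4)"
    have "(w b)\<^sup>2 = ?z\<^sup>2"
      using h[OF that(2,3)] w(2)[OF that(1)] by simp
    then have "w b = ?z \<or> w b = - ?z"
      by (simp add: power2_eq_iff)
    moreover have "Complex (Q 3 j (g b)) (Q 4 j (g b)) = of_real (x $ j) * ?z" for j
      using Q(2)[OF that(2)] by (simp add: complex_eq_iff flip: that(3))
    ultimately show ?thesis
      using nz[OF that(2)] by (auto simp: s_def vec_eq_iff)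
  qed
  have "w b \<noteq> 0" if "b \<in> B" for b
    using \<open>\<And>b. b \<in> B \<Longrightarrow> h b \<noteq> 0\<close>[OF that] w(2)[OF that] by auto
  then have "continuous_on B s"
    unfolding s_def by (intro continuous_intros Qg w) auto
  moreover have "s b \<in> AdS_hat \<and> proj (s b) = g b" if b: "b \<in> B" for b
  proof -
    obtain x where "x \<in> AdS_hat" "proj x = g b"
      using lift[OF b] by auto
    then show ?thesis
      using s[OF b, of x] by (auto simp: proj_minus AdS_hat_def form.minus_left form.minus_right)
  qed
  ultimately show ?thesis
    by (intro exI[of _ s]) auto
qed

lemma tendsto_proj:
  assumes "x \<longlonglongrightarrow> z" "z \<noteq> 0"
  shows "(\<lambda>k. proj (x k)) \<longlonglongrightarrow> proj z"
proof -
  have "isCont proj z"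
    using continuous_on_interior[OF continuous_on_proj, of z] assms(2) by (simp add: interior_open open_Compl)
  then show ?thesis
    using assms(1) by (rule isCont_tendsto_compose)
qed

lemma proj_limit_closure:
  assumes "x \<longlonglongrightarrow> z" "z \<noteq> 0" "\<And>k. proj (x k) \<in> S"
  shows "proj z \<in> closure S"
proof (rule Lim_in_closed_set[OF closed_closure _ _ tendsto_proj[OF assms(1,2)]])
  show "\<forall>\<^sub>F k in sequentially. proj (x k) \<in> closure S"
    using assms(3) closure_subset[of S] by (intro always_eventually allI) auto
qed simp

lemma open_proj_image:
  fixes U :: "(real ^ 'n) set"
  assumes "open U" "0 \<notin> U"
  shows "open (proj ` U)"
proof -
  have "{x. x \<noteq> 0 \<and> proj x \<in> proj ` U} = (\<Union>c\<in>-{0}. (*\<^sub>R) c ` U)"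
  proof (intro equalityI subsetI)
    fix x assume "x \<in> {x. x \<noteq> 0 \<and> proj x \<in> proj ` U}"
    then obtain u where u: "x \<noteq> 0" "u \<in> U" "proj u = proj x"
      by auto
    then have "u \<noteq> 0"
      using assms(2) by auto
    then show "x \<in> (\<Union>c\<in>-{0}. (*\<^sub>R) c ` U)"
      using proj_eq_iff[of u x] u by auto
  next
    fix x assume "x \<in> (\<Union>c\<in>-{0}. (*\<^sub>R) c ` U)"
    then obtain c u where cu: "c \<noteq> 0" "u \<in> U" "x = c *\<^sub>R u"
      by auto
    then have "u \<noteq> 0"
      using assms(2) by auto
    then show "x \<in> {x. x \<noteq> 0 \<and> proj x \<in> proj ` U}"
      using cu proj_scaleR[of c u] by auto
  qed
  then show ?thesis
    unfolding open_projective_def using assms(1) by (auto intro!: open_UN open_scaling)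
qed

lemma connected_annulus:
  assumes "2 \<le> DIM('a::euclidean_space)" "0 \<le> \<rho>"
  shows "connected {b :: 'a. \<rho> < norm b \<and> norm b < 1}"
proof -
  have "{b :: 'a. \<rho> < norm b \<and> norm b < 1} = (\<lambda>(r, u). r *\<^sub>R u) ` ({\<rho><..<1} \<times> sphere 0 1)"
  proof (intro equalityI subsetI)
    fix b :: 'a assume b: "b \<in> {b. \<rho> < norm b \<and> norm b < 1}"
    then have "b \<noteq> 0"
      using assms(2) by auto
    then have "b = norm b *\<^sub>R (b /\<^sub>R norm b)" "b /\<^sub>R norm b \<in> sphere 0 1"
      by simp_all
    then show "b \<in> (\<lambda>(r, u). r *\<^sub>R u) ` ({\<rho><..<1} \<times> sphere 0 1)"
      using b by (intro image_eqI[of _ _ "(norm b, b /\<^sub>R norm b)"]) auto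
  qed (use assms(2) in auto)
  moreover have "connected ((\<lambda>(r, u). r *\<^sub>R u) ` ({\<rho><..<1} \<times> sphere (0 :: 'a) 1))"
    using connected_sphere[OF assms(1)] unfolding case_prod_unfold
    by (intro connected_continuous_image connected_Times continuous_intros) auto
  ultimately show ?thesis
    by simp
qed

text \<open>Normalised points subconverge on the unit sphere. Their square is -1/|x|^2, so the limit
  is null and its class lies in the closure of \<open>S\<close> but not in \<open>S\<close>, hence
  on the curve. The sign of \<open>c\<close> stays open here; \<open>entire_lift\<close> determines
  it.\<close>

lemma asymptotic_limit:
  assumes S: "S \<subseteq> AdS" "bdry_infinity S = proj ` \<Gamma>" "bdry_infinity S \<subseteq> bdry_AdS"
    and nz: "0 \<notin> \<Gamma>" and x: "\<And>k. x k \<in> AdS_hat" "\<And>k. proj (x k) \<in> S"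
    and lim: "filterlim (\<lambda>k. norm (x k)) at_top sequentially"
  shows "\<exists>r::nat \<Rightarrow> nat. strict_mono r \<and>
    (\<exists>\<xi>\<in>\<Gamma>. \<exists>c. c \<noteq> 0 \<and> (\<lambda>k. x (r k) /\<^sub>R norm (x (r k))) \<longlonglongrightarrow> c *\<^sub>R \<xi>)"
proof -
  define y where "y k = x k /\<^sub>R norm (x k)" for k
  have x0: "x k \<noteq> 0" for k
    using AdS_hat_nonzero[OF x(1)] .
  have "y k \<in> sphere 0 1" for k
    using x0[of k] by (simp add: y_def)
  then obtain z r where z: "z \<in> sphere 0 1" "strict_mono (r :: nat \<Rightarrow> nat)" "(y \<circ> r) \<longlonglongrightarrow> z"
    using compact_sphere[of "0 :: real ^ 4" 1] unfolding compact_def by metis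
  have z0: "z \<noteq> 0"
    using z(1) by auto
  have "(\<lambda>k. form ((y \<circ> r) k) ((y \<circ> r) k)) \<longlonglongrightarrow> form z z"
    by (intro form.tendsto z(3))
  moreover have "form ((y \<circ> r) k) ((y \<circ> r) k) = - (inverse (norm ((x \<circ> r) k)) * inverse (norm ((x \<circ> r) k)))" for k
    using x(1)[of "r k"] by (simp add: y_def form.scaleR_left form.scaleR_right AdS_hat_def)
  moreover have "(\<lambda>k. - (inverse (norm ((x \<circ> r) k)) * inverse (norm ((x \<circ> r) k)))) \<longlonglongrightarrow> - (0 * 0)"
  proof (intro tendsto_intros)
    have "filterlim (\<lambda>k. norm (x (r k))) at_top sequentially"
      using filterlim_compose[OF lim filterlim_subseq[OF z(2)]] .
    then show "(\<lambda>k. inverse (norm ((x \<circ> r) k))) \<longlonglongrightarrow> 0"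
      unfolding o_def by (rule tendsto_inverse_0_at_top)
    then show "(\<lambda>k. inverse (norm ((x \<circ> r) k))) \<longlonglongrightarrow> 0" .
  qed
  ultimately have "form z z = 0"
    using LIMSEQ_unique[of "\<lambda>k. form ((y \<circ> r) k) ((y \<circ> r) k)" "form z z" 0] by simp
  then have "proj z \<notin> S"
    using S(1) proj_in_AdS_iff[OF z0] by auto
  moreover have "proj z \<in> closure S"
  proof (rule proj_limit_closure[OF z(3) z0])
    show "proj ((y \<circ> r) k) \<in> S" for k
      using x(2)[of "r k"] proj_scaleR[of "inverse (norm (x (r k)))" "x (r k)"] x0[of "r k"] by (simp add: y_def)
  qed
  ultimately have "proj z \<in> proj ` \<Gamma>"
    using S(2) by (auto simp: bdry_infinity_def)
  then obtain \<xi> where \<xi>: "\<xi> \<in> \<Gamma>" "proj \<xi> = proj z"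
    by auto
  then obtain c where "c \<noteq> 0" "z = c *\<^sub>R \<xi>"
    using proj_eq_iff[of \<xi> z] nz z0 by auto
  then show ?thesis
    using z(2,3) \<xi>(1) by (intro exI[of _ r] conjI bexI[of _ \<xi>] exI[of _ c]) (simp_all add: y_def o_def)
qed

lemma filterlim_norm_ge: "(\<And>n. norm (x n) \<ge> real n) \<Longrightarrow> filterlim (\<lambda>n. norm (x n)) at_top sequentially"
  by (rule filterlim_at_top_mono[OF filterlim_real_sequentially]) auto

text \<open>Properness of the lift. A bounded sequence of lifts over points tending to the boundary
  of the disc would subconverge in \<open>AdS_hat\<close>. The class of the limit belongs to
  \<open>S\<close>, because the frontier of \<open>S\<close> is at infinity, and by continuity
  \<open>f\<close> would send it to a point of norm 1.\<close>

lemma lift_proper: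
  fixes s :: "'a::euclidean_space \<Rightarrow> real ^ 4"
  assumes hom: "homeomorphism S (ball 0 1) f g" and S: "bdry_infinity S \<subseteq> bdry_AdS"
    and s: "\<And>b. b \<in> ball 0 1 \<Longrightarrow> s b \<in> AdS_hat \<and> proj (s b) = g b"
  shows "\<exists>\<rho>\<ge>0. \<rho> < 1 \<and> (\<forall>b\<in>ball 0 1. norm (s b) \<le> R \<longrightarrow> norm b \<le> \<rho>)"
proof (rule ccontr)
  assume neg: "\<not> ?thesis"
  have "\<exists>b\<in>ball 0 1. norm (s b) \<le> R \<and> norm b > 1 - inverse (real (Suc n))" for n
  proof -
    have "1 - inverse (real (Suc n)) \<ge> 0" "1 - inverse (real (Suc n)) < 1"
      by (simp_all add: field_simps)
    then show ?thesis
      using neg by (meson not_le)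
  qed
  then obtain b where b: "\<And>n. b n \<in> ball 0 1" "\<And>n. norm (s (b n)) \<le> R"
    "\<And>n. norm (b n) > 1 - inverse (real (Suc n))"
    by metis
  have "s (b n) \<in> cball 0 R" for n
    using b(2) by simp
  then obtain x r where x: "strict_mono (r :: nat \<Rightarrow> nat)" "((\<lambda>n. s (b n)) \<circ> r) \<longlonglongrightarrow> x"
    using compact_cball[of "0 :: real ^ 4" R] unfolding compact_def by metis
  have "closed AdS_hat"
    unfolding AdS_hat_def form_def by (intro closed_Collect_eq continuous_intros)
  then have xA: "x \<in> AdS_hat"
    using closed_sequentially[of AdS_hat "(\<lambda>n. s (b n)) \<circ> r" x] x(2) s b(1) by auto
  have x0: "x \<noteq> 0"
    using AdS_hat_nonzero[OF xA] .
  have gS: "g c \<in> S" if "c \<in> ball 0 1" for c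
    using hom that by (auto simp: homeomorphism_def)
  have "proj x \<in> closure S"
    using proj_limit_closure[OF x(2) x0, of S] s b(1) gS by simp
  moreover have "proj x \<notin> bdry_AdS"
    using proj_in_bdry_iff[OF x0] xA by (simp add: AdS_hat_def)
  ultimately have xS: "proj x \<in> S"
    using S by (auto simp: bdry_infinity_def)
  have "(\<lambda>n. f (proj (((\<lambda>n. s (b n)) \<circ> r) n))) \<longlonglongrightarrow> f (proj x)"
  proof (rule continuous_on_tendsto_compose[OF _ tendsto_proj[OF x(2) x0] xS])
    show "continuous_on S f"
      using hom by (simp add: homeomorphism_def)
    show "\<forall>\<^sub>F n in sequentially. proj (((\<lambda>n. s (b n)) \<circ> r) n) \<in> S"
      using s b(1) gS by simp
  qed
  moreover have "f (proj (((\<lambda>n. s (b n)) \<circ> r) n)) = b (r n)" for n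
    using hom s b(1) by (simp add: homeomorphism_def)
  ultimately have "(\<lambda>n. norm (b (r n))) \<longlonglongrightarrow> norm (f (proj x))"
    using tendsto_norm by simp
  moreover have "(\<lambda>n. norm (b (r n))) \<longlonglongrightarrow> 1"
  proof (rule tendsto_sandwich)
    show "\<forall>\<^sub>F n in sequentially. 1 - inverse (real (Suc (r n))) \<le> norm (b (r n))"
      using b(3) less_imp_le by (intro always_eventually allI) blast
    show "\<forall>\<^sub>F n in sequentially. norm (b (r n)) \<le> 1"
      using b(1) by (intro always_eventually allI) (simp add: less_imp_le)
    have "(\<lambda>n. 1 - inverse (real (Suc n))) \<longlonglongrightarrow> 1 - 0"
      by (intro tendsto_intros LIMSEQ_inverse_real_of_nat)
    then show "(\<lambda>n. 1 - inverse (real (Suc (r n)))) \<longlonglongrightarrow> 1"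
      using LIMSEQ_subseq_LIMSEQ[OF _ x(1)] by (fastforce simp: o_def)
  qed simp
  ultimately have "norm (f (proj x)) = 1"
    using LIMSEQ_unique by blast
  moreover have "f (proj x) \<in> ball 0 1"
    using hom xS by (auto simp: homeomorphism_def)
  ultimately show False
    by simp
qed

text \<open>Zeros of \<open>form x p\<close> tending to infinity would have a limiting direction
  orthogonal to \<open>p\<close>, but every such direction is a nonzero multiple of a point of
  \<Gamma>.\<close>

lemma eventually_sign:
  assumes S: "S \<subseteq> AdS" "bdry_infinity S = proj ` \<Gamma>" "bdry_infinity S \<subseteq> bdry_AdS"
    and nz: "0 \<notin> \<Gamma>" and p: "\<And>\<xi>. \<xi> \<in> \<Gamma> \<Longrightarrow> form \<xi> p > 0"
  shows "\<exists>R. \<forall>x\<in>AdS_hat. proj x \<in> S \<longrightarrow> norm x \<ge> R \<longrightarrow> form x p \<noteq> 0"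
proof (rule ccontr)
  assume "\<not> ?thesis"
  then have "\<exists>x\<in>AdS_hat. proj x \<in> S \<and> norm x \<ge> real n \<and> form x p = 0" for n
    by blast
  then obtain x where x: "\<And>n. x n \<in> AdS_hat" "\<And>n. proj (x n) \<in> S" "\<And>n. norm (x n) \<ge> real n"
    "\<And>n. form (x n) p = 0"
    by metis
  obtain r \<xi> c where r: "\<xi> \<in> \<Gamma>" "c \<noteq> 0" "(\<lambda>k. x (r k) /\<^sub>R norm (x (r k))) \<longlonglongrightarrow> c *\<^sub>R \<xi>"
    using asymptotic_limit[OF S nz x(1,2) filterlim_norm_ge[of x, OF x(3)]] by auto
  have "(\<lambda>k. form (x (r k) /\<^sub>R norm (x (r k))) p) \<longlonglongrightarrow> form (c *\<^sub>R \<xi>) p"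
    by (intro form.tendsto r(3) tendsto_const)
  then have "(\<lambda>k. 0 :: real) \<longlonglongrightarrow> c * form \<xi> p"
    by (simp add: form.scaleR_left x(4))
  then show False
    using LIMSEQ_unique[OF _ tendsto_const] r(2) p[OF r(1)] by fastforce
qed

text \<open>The lift of the disc is determined up to a global sign, and an asymptotic surface has to
  converge to positive multiples of points of \<Gamma>. Near the boundary of the disc the product
  with \<open>p\<close> has no zeros, and an annulus is connected, so the product has one sign there
  and a global choice works.\<close>

lemma entire_lift:
  assumes max: "maximal_surface S" and ent: "entire_surface S" and bd: "bdry_infinity S = proj ` \<Gamma>"
    and \<Gamma>: "compact \<Gamma>" "connected \<Gamma>" "\<And>\<xi>. \<xi> \<in> \<Gamma> \<Longrightarrow> form \<xi> \<xi> = 0" "\<And>\<xi>. \<xi> \<in> \<Gamma> \<Longrightarrow> \<xi> \<noteq> 0"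
      "\<And>\<xi> \<eta>. \<xi> \<in> \<Gamma> \<Longrightarrow> \<eta> \<in> \<Gamma> \<Longrightarrow> \<xi> \<noteq> \<eta> \<Longrightarrow> form \<xi> \<eta> < 0" "\<exists>\<xi>\<in>\<Gamma>. \<exists>\<eta>\<in>\<Gamma>. \<xi> \<noteq> \<eta>"
  shows "\<exists>T. asymptotic_surface S T \<Gamma> \<and> proj ` T = S"
proof -
  let ?B = "ball 0 1 :: (real ^ 2) set"
  have SA: "S \<subseteq> AdS"
    using max by (auto simp: maximal_surface_def spacelike_surface_def embedded_surface_def)
  have S: "S \<subseteq> AdS" "bdry_infinity S = proj ` \<Gamma>" "bdry_infinity S \<subseteq> bdry_AdS" "0 \<notin> \<Gamma>"
    using SA bd ent \<Gamma>(4) by (auto simp: entire_surface_def)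
  obtain f g where hom: "homeomorphism S ?B f g"
    using ent by (auto simp: entire_surface_def homeomorphic_def)
  have gS: "g ` ?B = S" and fS: "f ` S = ?B" and cont: "continuous_on S f" "continuous_on ?B g"
    and fg: "\<And>b. b \<in> ?B \<Longrightarrow> f (g b) = b" and gf: "\<And>p. p \<in> S \<Longrightarrow> g (f p) = p"
    using hom by (auto simp: homeomorphism_def)
  have "contractible ?B"
    by (intro convex_imp_contractible) simp
  then obtain s0 where s0: "continuous_on ?B s0" "\<And>b. b \<in> ?B \<Longrightarrow> s0 b \<in> AdS_hat \<and> proj (s0 b) = g b"
    using lift_exists[of ?B g] cont(2) gS SA by auto
  obtain \<xi>1 \<eta>1 where two: "\<xi>1 \<in> \<Gamma>" "\<eta>1 \<in> \<Gamma>" "\<xi>1 \<noteq> \<eta>1"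
    using \<Gamma>(6) by auto
  define p where "p = - (\<xi>1 + \<eta>1)"
  have p: "form \<zeta> p > 0" if "\<zeta> \<in> \<Gamma>" for \<zeta>
  proof -
    have "form \<zeta> \<eta> \<le> 0" if "\<eta> \<in> \<Gamma>" for \<eta>
      using \<Gamma>(5)[OF \<open>\<zeta> \<in> \<Gamma>\<close> that] \<Gamma>(3)[OF that] by (cases "\<zeta> = \<eta>") auto
    then have "form \<zeta> \<xi>1 \<le> 0" "form \<zeta> \<eta>1 \<le> 0"
      using two by auto
    moreover have "form \<zeta> \<xi>1 < 0 \<or> form \<zeta> \<eta>1 < 0"
      using \<Gamma>(5)[OF \<open>\<zeta> \<in> \<Gamma>\<close> two(1)] \<Gamma>(5)[OF \<open>\<zeta> \<in> \<Gamma>\<close> two(2)] two(3) by blast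
    ultimately show ?thesis
      by (auto simp: p_def form.minus_right form.add_right form.diff_right)
  qed
  obtain R where R: "\<And>x. x \<in> AdS_hat \<Longrightarrow> proj x \<in> S \<Longrightarrow> norm x \<ge> R \<Longrightarrow> form x p \<noteq> 0"
    using eventually_sign[OF S p] by auto
  obtain \<rho> where \<rho>: "\<rho> \<ge> 0" "\<rho> < 1" "\<And>b. b \<in> ?B \<Longrightarrow> norm (s0 b) \<le> R \<Longrightarrow> norm b \<le> \<rho>"
    using lift_proper[OF hom S(3) s0(2), of R] by auto
  have cball: "cball 0 \<rho>' \<subseteq> ?B" if "\<rho>' < 1" for \<rho>'
    using that by auto
  let ?A = "{b :: real ^ 2. \<rho> < norm b \<and> norm b < 1}"
  have AB: "?A \<subseteq> ?B"
    by auto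
  have nz: "form (s0 b) p \<noteq> 0" if "b \<in> ?A" for b
  proof -
    have "b \<in> ?B" "norm (s0 b) \<ge> R"
      using that \<rho>(3)[of b] by (auto simp: not_le intro: less_imp_le linorder_class.le_cases)
    then show ?thesis
      using R[of "s0 b"] s0(2)[of b] gS by auto
  qed
  have "connected ((\<lambda>b. form (s0 b) p) ` ?A)"
  proof (intro connected_continuous_image)
    show "continuous_on ?A (\<lambda>b. form (s0 b) p)"
      by (intro form.continuous_on continuous_on_subset[OF s0(1) AB] continuous_intros)
    show "connected ?A"
      using \<rho>(1) by (intro connected_annulus) simp_all
  qed
  then have "(\<forall>b\<in>?A. form (s0 b) p > 0) \<or> (\<forall>b\<in>?A. form (s0 b) p < 0)"
    using nz unfolding connected_iff_interval by (smt (verit) imageE imageI)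
  then obtain \<epsilon> :: real where \<epsilon>: "\<epsilon> = 1 \<or> \<epsilon> = -1" "\<And>b. b \<in> ?A \<Longrightarrow> \<epsilon> * form (s0 b) p > 0"
    by (elim disjE) (auto intro: that[of 1] that[of "-1"])
  define s where "s b = \<epsilon> *\<^sub>R s0 b" for b
  have s_cont: "continuous_on ?B s"
    unfolding s_def by (intro continuous_intros s0(1))
  have s: "s b \<in> AdS_hat \<and> proj (s b) = g b" if "b \<in> ?B" for b
    using \<epsilon>(1) s0(2)[OF that]
    by (auto simp: s_def AdS_hat_def form.minus_left form.minus_right proj_minus)
  have s_pos: "form (s b) p > 0" if "b \<in> ?A" for b
    using \<epsilon>(2)[OF that] by (simp add: s_def form.scaleR_left)
  have "compact (s ` cball 0 \<rho>)"
    using continuous_on_subset[OF s_cont cball[OF \<rho>(2)]] by (intro compact_continuous_image) auto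
  then have "\<exists>R'. \<forall>x\<in>s ` cball 0 \<rho>. norm x \<le> R'"
    using compact_imp_bounded bounded_iff[of "s ` cball 0 \<rho>"] by auto
  then obtain R' where R': "\<And>b. b \<in> cball 0 \<rho> \<Longrightarrow> norm (s b) \<le> R'"
    by (elim exE) blast
  define P where "P = {x \<in> AdS_hat. proj x \<in> S}"
  define T where "T = s ` ?B"
  have T_far: "form x p > 0" if x: "x \<in> T" "norm x > R'" for x
  proof -
    obtain b where b: "b \<in> ?B" "x = s b"
      using x(1) by (auto simp: T_def)
    then have "b \<in> ?A"
      using R'[of b] x(2) by force
    then show ?thesis
      using s_pos b by simp
  qed
  have T_sub: "T \<subseteq> P"
    using s gS by (auto simp: T_def P_def)
  have proj_T: "proj ` T = S"
    using s gS by (force simp: T_def image_image)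
  have sign: "s (f (proj x)) = x \<or> s (f (proj x)) = - x" if "x \<in> P" for x
  proof -
    have "f (proj x) \<in> ?B"
      using that fS by (auto simp: P_def)
    then show ?thesis
      using AdS_hat_proj_eq[of x "s (f (proj x))"] s[of "f (proj x)"] that gf[of "proj x"]
      by (auto simp: P_def)
  qed
  have T_fix: "x \<in> T \<longleftrightarrow> x \<in> P \<and> s (f (proj x)) = x" for x
  proof
    assume "x \<in> T"
    then obtain b where "b \<in> ?B" "x = s b"
      by (auto simp: T_def)
    then show "x \<in> P \<and> s (f (proj x)) = x"
      using T_sub \<open>x \<in> T\<close> s[of b] fg[of b] by auto
  next
    assume x: "x \<in> P \<and> s (f (proj x)) = x"
    then have "f (proj x) \<in> ?B"
      using fS by (auto simp: P_def)
    then show "x \<in> T"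
      unfolding T_def using x by (metis imageI)
  qed
  have nzP: "x \<noteq> 0" if "x \<in> P" for x
    using that AdS_hat_nonzero by (auto simp: P_def)
  have T_anti: "- x \<notin> T" if "x \<in> T" for x
  proof
    assume "- x \<in> T"
    then have "s (f (proj x)) = - x" "s (f (proj x)) = x"
      using that T_fix[of x] T_fix[of "- x"] by (auto simp: proj_minus)
    then have "x = - x"
      by simp
    then have "x = 0"
      by (simp only: vec_eq_iff vector_uminus_component) simp
    then show False
      using nzP[of x] that T_sub by auto
  qed
  \<comment> \<open>The section over the class of \<open>x\<close> is \<open>x\<close> itself on
    \<open>T\<close> and \<open>- x\<close> on the opposite sheet, so \<open>T\<close> is the set
    where the Euclidean product of the two is positive.\<close>
  have T_open: "openin (top_of_set P) T"
  proof -
    have "continuous_on P (\<lambda>x. f (proj x))"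
      using nzP by (intro continuous_on_compose2[OF cont(1)] continuous_on_subset[OF continuous_on_proj])
        (auto simp: P_def)
    then have "continuous_on P (\<lambda>x. inner x (s (f (proj x))))"
      using fS by (intro continuous_intros continuous_on_compose2[OF s_cont]) (auto simp: P_def)
    then have "openin (top_of_set P) (P \<inter> (\<lambda>x. inner x (s (f (proj x)))) -` {0<..})"
      by (rule continuous_openin_preimage_gen) simp
    moreover have "P \<inter> (\<lambda>x. inner x (s (f (proj x)))) -` {0<..} = T"
    proof (intro equalityI subsetI)
      fix x assume x: "x \<in> P \<inter> (\<lambda>x. inner x (s (f (proj x)))) -` {0<..}"
      then have "s (f (proj x)) \<noteq> - x"
        using leD[OF inner_ge_zero[of x]] by auto
      then show "x \<in> T"
        using T_fix[of x] sign[of x] x by auto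
    next
      fix x assume "x \<in> T"
      then show "x \<in> P \<inter> (\<lambda>x. inner x (s (f (proj x)))) -` {0<..}"
        using T_fix[of x] nzP[of x] by auto
    qed
    ultimately show ?thesis
      by simp
  qed
  \<comment> \<open>By properness the parameters of a convergent sequence in \<open>T\<close> stay
    in a smaller closed disc, where they subconverge.\<close>
  have T_closed: "closed T"
    unfolding closed_sequential_limits
  proof (intro allI impI, elim conjE)
    fix x l assume x: "\<forall>n. x n \<in> T" "x \<longlonglongrightarrow> l"
    obtain K where K: "\<And>n. norm (x n) \<le> K"
      using convergent_imp_bounded[OF x(2)] by (auto simp: bounded_iff)
    obtain \<rho>' where \<rho>': "\<rho>' < 1" "\<And>b. b \<in> ?B \<Longrightarrow> norm (s b) \<le> K \<Longrightarrow> norm b \<le> \<rho>'"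
      using lift_proper[OF hom S(3) s, of K] by auto
    have "\<forall>n. \<exists>c. c \<in> ?B \<and> x n = s c"
      using x(1) unfolding T_def by blast
    from choice[OF this] obtain b where b: "\<And>n. b n \<in> ?B" "\<And>n. x n = s (b n)"
      by blast
    have "b n \<in> cball 0 \<rho>'" for n
      using \<rho>'(2)[of "b n"] K[of n] b by simp
    then obtain c r where c: "c \<in> cball 0 \<rho>'" "strict_mono (r :: nat \<Rightarrow> nat)" "(b \<circ> r) \<longlonglongrightarrow> c"
      using compact_cball[of "0 :: real ^ 2" \<rho>'] unfolding compact_def by metis
    then have cB: "c \<in> ?B"
      using cball[OF \<rho>'(1)] by auto
    have "(\<lambda>n. s ((b \<circ> r) n)) \<longlonglongrightarrow> s c"
      using b(1) by (intro continuous_on_tendsto_compose[OF s_cont c(3) cB]) auto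
    moreover have "(\<lambda>n. s ((b \<circ> r) n)) \<longlonglongrightarrow> l"
      using LIMSEQ_subseq_LIMSEQ[OF x(2) c(2)] b(2) by (simp add: o_def)
    ultimately show "l \<in> T"
      using LIMSEQ_unique[of "\<lambda>n. s ((b \<circ> r) n)" "s c" l] imageI[OF cB, of s] by (simp only: T_def)
  qed
  have asym: "\<exists>r::nat \<Rightarrow> nat. strict_mono r \<and> (\<exists>\<xi>\<in>\<Gamma>. \<exists>c>0. (\<lambda>k. x (r k) /\<^sub>R norm (x (r k))) \<longlonglongrightarrow> c *\<^sub>R \<xi>)"
    if x: "\<And>k. x k \<in> T" "filterlim (\<lambda>k. norm (x k)) at_top sequentially" for x :: "nat \<Rightarrow> real ^ 4"
  proof -
    have "x k \<in> AdS_hat" "proj (x k) \<in> S" for k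
      using x(1)[of k] T_sub by (auto simp: P_def)
    then obtain r \<xi> c where r: "strict_mono r" "\<xi> \<in> \<Gamma>" "c \<noteq> 0"
      "(\<lambda>k. x (r k) /\<^sub>R norm (x (r k))) \<longlonglongrightarrow> c *\<^sub>R \<xi>"
      using asymptotic_limit[OF S, of x] x(2) by auto
    have "(\<lambda>k. form (x (r k) /\<^sub>R norm (x (r k))) p) \<longlonglongrightarrow> form (c *\<^sub>R \<xi>) p"
      by (intro form.tendsto r(4) tendsto_const)
    moreover have "\<forall>\<^sub>F k in sequentially. form (x (r k) /\<^sub>R norm (x (r k))) p \<ge> 0"
    proof -
      have "\<forall>\<^sub>F k in sequentially. norm (x (r k)) > R'"
        using filterlim_compose[OF x(2) filterlim_subseq[OF r(1)]]
        by (auto simp: filterlim_at_top_dense)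
      then show ?thesis
        by eventually_elim (use T_far[OF x(1)] in \<open>simp add: form.scaleR_left less_imp_le\<close>)
    qed
    \<comment> \<open>Far points of \<open>T\<close> have positive product with \<open>p\<close>,
      which excludes \<open>c < 0\<close>.\<close>
    ultimately have "c * form \<xi> p \<ge> 0"
      using tendsto_lowerbound by (fastforce simp: form.scaleR_left)
    then have "c > 0"
      using p[OF r(2)] r(3) by (simp add: zero_le_mult_iff)
    then show ?thesis
      using r by blast
  qed
  have lim: "\<exists>x c. (\<forall>k::nat. x k \<in> T) \<and> (\<lambda>k. c k *\<^sub>R x k) \<longlonglongrightarrow> \<xi>" if \<xi>: "\<xi> \<in> \<Gamma>" for \<xi>
  proof -
    have cl: "proj \<xi> \<in> closure S"
      using bd \<xi> by (auto simp: bdry_infinity_def)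
    have "\<exists>y\<in>T. \<exists>c. dist (c *\<^sub>R y) \<xi> < inverse (real (Suc k))" for k
    proof -
      define U where "U = ball \<xi> (inverse (real (Suc k))) - {0}"
      have "open (proj ` U)"
        by (rule open_proj_image) (auto simp: U_def intro!: open_Diff)
      moreover have "\<xi> \<in> U"
        using \<Gamma>(4)[OF \<xi>] by (simp add: U_def)
      ultimately have "proj ` U \<inter> S \<noteq> {}"
        using cl open_Int_closure_eq_empty[of "proj ` U" S] by auto
      then obtain u where u: "u \<in> U" "proj u \<in> S"
        by auto
      then obtain y where y: "y \<in> T" "proj u = proj y"
        using proj_T by auto
      have "u \<noteq> 0" "y \<noteq> 0"
        using u nzP[of y] y T_sub by (auto simp: U_def)
      then obtain c where "u = c *\<^sub>R y"
        using proj_eq_iff[of y u] y(2) by auto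
      then show ?thesis
        using u(1) y(1) by (auto simp: U_def dist_commute)
    qed
    then obtain x c where x: "\<And>k. x k \<in> T" "\<And>k. dist (c k *\<^sub>R x k) \<xi> < inverse (real (Suc k))"
      by metis
    have "(\<lambda>k. dist (c k *\<^sub>R x k) \<xi>) \<longlonglongrightarrow> 0"
      by (rule tendsto_sandwich[OF _ _ tendsto_const LIMSEQ_inverse_real_of_nat])
        (use x(2) less_imp_le in \<open>auto intro!: always_eventually\<close>)
    then show ?thesis
      using x(1) tendsto_dist_iff by blast
  qed
  have "asymptotic_surface S T \<Gamma>"
    using max T_sub T_open T_closed T_anti \<Gamma> asym lim
    unfolding P_def
    by unfold_locales (auto simp: T_def)
  then show ?thesis
    using proj_T by blast
qed

theorem theorem1:
  shows "\<exists>C1 :: real. \<forall>(S :: 4 projective set) \<phi>.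
    maximal_surface S \<and> entire_surface S \<and>
    orientation_preserving_homeo \<phi> \<and> bdry_infinity S = gr \<phi> \<and>
    curvature_norm S < 1 \<longrightarrow>
    curvature_norm S \<le> ereal (C1 * tan (width (convex_hull_AdS (bdry_infinity S))))"
proof (intro exI allI impI, elim conjE)
  fix S :: "4 projective set" and \<phi>
  assume S: "maximal_surface S" "entire_surface S" and \<phi>: "orientation_preserving_homeo \<phi>"
    and bd: "bdry_infinity S = gr \<phi>" and less: "curvature_norm S < 1"
  obtain \<Gamma> where \<Gamma>: "compact \<Gamma>" "connected \<Gamma>" "\<forall>\<xi>\<in>\<Gamma>. form \<xi> \<xi> = 0 \<and> \<xi> \<noteq> 0"
    "\<forall>\<xi>\<in>\<Gamma>. \<forall>\<eta>\<in>\<Gamma>. \<xi> \<noteq> \<eta> \<longrightarrow> form \<xi> \<eta> < 0" "\<exists>\<xi>\<in>\<Gamma>. \<exists>\<eta>\<in>\<Gamma>. \<xi> \<noteq> \<eta>" "proj ` \<Gamma> = gr \<phi>"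
    using graph_lift[OF \<phi>] by (elim exE conjE)
  have b\<Gamma>: "bdry_infinity S = proj ` \<Gamma>"
    using bd \<Gamma>(6) by simp
  obtain T where T: "asymptotic_surface S T \<Gamma>" "proj ` T = S"
    using entire_lift[OF S b\<Gamma> \<Gamma>(1,2) _ _ _ \<Gamma>(5)] \<Gamma>(3,4) by auto
  interpret asymptotic_surface S T \<Gamma>
    by (rule T(1))
  \<comment> \<open>A real \<open>L\<close> between the extended supremum and 1 bounds every
    \<lambda> and leaves room for the strict inequalities of the width bound.\<close>
  obtain L where L: "curvature_norm S < ereal L" "ereal L < 1"
    using ereal_dense2[OF less] by auto
  have lam_le: "lam x \<le> L" if "x \<in> T" for x
  proof -
    have "ereal (principal_curvature S (proj x)) \<le> curvature_norm S"
      unfolding curvature_norm_def using T(2) that by (intro SUP_upper) auto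
    then show ?thesis
      using L(1) by (simp add: lam_def order.strict_trans2 flip: ereal_less_eq(3))
  qed
  have L0: "L \<ge> 0"
  proof -
    obtain x where "x \<in> T"
      using T_nonempty by auto
    then show ?thesis
      using lam_le[of x] lam_nonneg[of x] by auto
  qed
  show "curvature_norm S \<le> ereal (11 * exp 20 * tan (width (convex_hull_AdS (bdry_infinity S))))"
    unfolding curvature_norm_def
  proof (rule SUP_least)
    fix q assume "q \<in> S"
    then obtain x where x: "x \<in> T" "q = proj x"
      using T(2) by auto
    have "lam x \<le> 11 * exp 20 * tan (width (convex_hull_AdS (proj ` \<Gamma>)))"
      using L(2) by (intro lam_le_tan_width[OF L0 lam_le _ x(1)]) auto
    then show "ereal (principal_curvature S q) \<le>
        ereal (11 * exp 20 * tan (width (convex_hull_AdS (bdry_infinity S))))"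
      by (simp add: b\<Gamma> x(2) lam_def)
  qed
qed

end
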